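(* There is an absolute constant $\gamma>0$ such that the following holds. Let $p\in(1,\infty)$, $\alpha>0$ with $1/2-1/p<\alpha<1-1/p$, and $\beta\in\mathbb{R}$. Let $\sigma_j=j^{-\alpha}(\log(j+1))^{-\beta}$ for $1\le j\le N$, with associated $p$-ellipsoid $\mathcal{E}_p\subset\mathbb{R}^N$. If $p\ge2$, then for all $1\le n<N$ one has $$\mathcal{R}_n(\mathcal{E}_p)\approx\min\left\{1,\ n^{-1/2}N^{1-1/p-\alpha}(\log(N+1))^{-\beta}\right\}$$ with probability at least $1-e^{-\gamma n}-2e^{-\gamma pn^{2/p}}$. If $p<2$, then for all $1\le n<N$ $$n^{1/2-1/p-\alpha}(\log(n+1))^{-\beta}\lesssim\mathcal{R}_n(\mathcal{E}_p)\lesssim\min\left\{1,\ n^{-1/2}N^{1-1/p-\alpha}(\log(N+1))^{-\beta}\right\}$$ with probability at least $1-3e^{-\gamma n}$; and there is $c>0$ depending only on $p,\alpha,\beta$ such that for all $1\le n<N$ with $n\le cN^{2/p'}$ one has $$\mathcal{R}_n(\mathcal{E}_p)\approx\min\left\{1,\ n^{-1/2}N^{1-1/p-\alpha}(\log(N+1))^{-\beta}\right\}$$ with probability at least $1-3e^{-\gamma n}$. Moreover, for every $p\in(1,\infty)$ there is $c>0$ depending only on $p,\alpha,\beta$ such that for all $1\le n<N$ with $n\le c\,N^{2(1-1/p-\alpha)}(\log(N+1))^{-2\beta}$, $$\mathbb{P}\left(\mathcal{R}_n(\mathcal{E}_p)\approx1\right)\ge1-2e^{-2n}.$$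
   Context: $p'$ is the conjugate exponent, $1/p+1/p'=1$. $\mathcal{E}_p=\{x\in\mathbb{R}^N:\sum_{i=1}^N(|x_i|/\sigma_i)^p\le1\}$. The $n$-th random radius is $\mathcal{R}_n(\mathcal{E}_p)=\max_{y\in E_n\cap\mathcal{E}_p}|y|$, where $|\cdot|$ is the Euclidean norm and $E_n$ is a random $n$-codimensional linear subspace of $\mathbb{R}^N$ distributed according to the normalized Haar measure on the Grassmannian. $a\lesssim b$ means $a\le Cb$ for a constant $C>0$ depending only on $p,\alpha,\beta$ (in particular independent of $n$ and $N$); $a\approx b$ means $a\lesssim b$ and $b\lesssim a$. The paper's ranges "$n\lesssim X$" are expressed as $n\le cX$. *)

theory Defs
  imports "HOL-Probability.Probability" "HOL-Analysis.Finite_Function_Topology"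
begin

text \<open>
  The dimension \<open>N\<close> is quantified inside the statement, so \<open>\<real>\<^sup>N\<close> is a carrier set and not a type:
  it consists of the finitely supported sequences with support in \<open>{1..N}\<close>. Linear algebra
  (\<open>subspace\<close>, \<open>dim\<close>, \<open>linear\<close>) is the library's, for the real vector space of finitely supported
  sequences. The library norm on that type is the \<open>\<ell>\<^sub>1\<close> norm and is not used; the Euclidean
  norm and inner product are defined below.
\<close>

type_synonym fseq = "(nat, real) poly_mapping"

definition Rn :: "nat \<Rightarrow> fseq set" where
  "Rn N = {x. Poly_Mapping.keys x \<subseteq> {1..N}}"

definition inner2 :: "nat \<Rightarrow> fseq \<Rightarrow> fseq \<Rightarrow> real" where
  "inner2 N x y = (\<Sum>i=1..N. Poly_Mapping.lookup x i * Poly_Mapping.lookup y i)"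

definition norm2 :: "nat \<Rightarrow> fseq \<Rightarrow> real" where
  "norm2 N x = L2_set (Poly_Mapping.lookup x) {1..N}"

text \<open>
  An element of the orthogonal group \<open>O(N)\<close> is given by a linear map on the ambient sequence
  space that restricts to an isometry of \<open>\<real>\<^sup>N\<close>; its values outside \<open>\<real>\<^sup>N\<close> are irrelevant.
\<close>

definition orthogonal_on :: "nat \<Rightarrow> (fseq \<Rightarrow> fseq) \<Rightarrow> bool" where
  "orthogonal_on N U \<longleftrightarrow> linear U \<and> (\<forall>x\<in>Rn N. U x \<in> Rn N \<and> norm2 N (U x) = norm2 N x)"

definition grassmannian :: "nat \<Rightarrow> nat \<Rightarrow> fseq set set" where
  "grassmannian N n = {E. subspace E \<and> E \<subseteq> Rn N \<and> dim E + n = N}"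

definition orth_proj :: "nat \<Rightarrow> fseq set \<Rightarrow> fseq \<Rightarrow> fseq" where
  "orth_proj N E x = (THE y. y \<in> E \<and> (\<forall>z\<in>E. inner2 N (x - y) z = 0))"

text \<open>
  The topology of the Grassmannian is the usual one, induced by the operator norm
  \<open>\<parallel>P\<^sub>E - P\<^sub>F\<parallel>\<close> of the difference of the orthogonal projections.
  The locale \<open>Metric_space\<close> requires symmetry and nonnegativity on the whole type, hence the
  default value \<open>0\<close> off the subspaces of \<open>\<real>\<^sup>N\<close>, where \<open>orth_proj\<close> is unspecified.
\<close>

definition grassmann_dist :: "nat \<Rightarrow> fseq set \<Rightarrow> fseq set \<Rightarrow> real" where
  "grassmann_dist N E F =
     (if subspace E \<and> E \<subseteq> Rn N \<and> subspace F \<and> F \<subseteq> Rn N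
      then SUP x\<in>{x \<in> Rn N. norm2 N x \<le> 1}. norm2 N (orth_proj N E x - orth_proj N F x)
      else 0)"

definition grassmann_borel :: "nat \<Rightarrow> nat \<Rightarrow> fseq set measure" where
  "grassmann_borel N n = sigma (grassmannian N n)
     {A. openin (Metric_space.mtopology (grassmannian N n) (grassmann_dist N)) A}"

text \<open>
  The normalized Haar measure on the Grassmannian is the (unique) Borel probability measure
  invariant under the action \<open>E \<mapsto> U(E)\<close> of the orthogonal group.
\<close>

definition normalized_haar :: "nat \<Rightarrow> nat \<Rightarrow> fseq set measure \<Rightarrow> bool" where
  "normalized_haar N n \<mu> \<longleftrightarrow>
     prob_space \<mu> \<and> sets \<mu> = sets (grassmann_borel N n) \<and>
     (\<forall>U. orthogonal_on N U \<longrightarrow>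
        (\<forall>A\<in>sets \<mu>. emeasure \<mu> ((\<lambda>E. U ` E) ` A) = emeasure \<mu> A))"

definition p_ellipsoid :: "nat \<Rightarrow> real \<Rightarrow> (nat \<Rightarrow> real) \<Rightarrow> fseq set" where
  "p_ellipsoid N p \<sigma> =
     {x \<in> Rn N. (\<Sum>i=1..N. (\<bar>Poly_Mapping.lookup x i\<bar> / \<sigma> i) powr p) \<le> 1}"

text \<open>
  The radius of the section \<open>E \<inter> K\<close>. For a subspace \<open>E\<close> and a \<open>p\<close>-ellipsoid \<open>K\<close> this set is compact
  and nonempty, so the supremum is a maximum.
\<close>

definition section_radius :: "nat \<Rightarrow> fseq set \<Rightarrow> fseq set \<Rightarrow> real" where
  "section_radius N K E = (SUP y\<in>E \<inter> K. norm2 N y)"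

definition sigma_seq :: "real \<Rightarrow> real \<Rightarrow> nat \<Rightarrow> real" where
  "sigma_seq \<alpha> \<beta> j = real j powr (- \<alpha>) * ln (real j + 1) powr (- \<beta>)"

definition rate :: "real \<Rightarrow> real \<Rightarrow> real \<Rightarrow> nat \<Rightarrow> nat \<Rightarrow> real" where
  "rate p \<alpha> \<beta> N n =
     min 1 (real n powr (- 1 / 2) * real N powr (1 - 1 / p - \<alpha>) * ln (real N + 1) powr (- \<beta>))"

definition approx_by :: "real \<Rightarrow> real \<Rightarrow> real \<Rightarrow> bool" where
  "approx_by C a b \<longleftrightarrow> a \<le> C * b \<and> b \<le> C * a"

end

(*
  Let Q be the orthogonal projection onto the orthogonal complement of E. By rotation invariance the
  law of |Q x| / |x| is that of |Q g| / |g| for a standard Gaussian vector g and a fixed subspace, so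
  single vectors satisfy |Q x|^2 of order (n / N) |x|^2 with chi-square tails.

  Upper bound: nets turn the single-vector estimates into bounds for all s-sparse vectors, with a
  lower bound |Q x| >= c sqrt(n / N) |x| as long as s log (N / s) is small compared with n, and an upper
  bound for larger s. Splitting x in E by decreasing size of its coordinates into a sparse head and
  dyadic tail blocks, Q x = 0 forces the head to be controlled by the tail, and membership in the
  ellipsoid makes the tail small.

  Lower bound: for n at most a small multiple of N, Q contracts sparse vectors, so Q e_1 is the image
  of a vector z whose coordinates are at most of order sqrt n / N and whose first coordinate vanishes;
  then e_1 - z lies in E.
  For p > 2 and n comparable to N, the projection of e_1 onto E has a controlled l_p norm off the
  first coordinate, its marginals being Gaussian-like. For p <= 2, E meets the span of the first
  n + 1 coordinate vectors by dimension counting.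
*)
theory Submission
  imports Defs
begin

section \<open>Orthogonal projections in \<open>\<real>\<^sup>N\<close>\<close>

text \<open>The strict inequality \<alpha> < 1 - 1/p leaves room for a small \<delta>. Net entropies
  \<open>s * ln (N / s)\<close> are replaced by multiples of
  \<open>s powr (1 - \<delta>) * N powr \<delta>\<close>, and the logarithms in the semiaxes by
  powers, so that all dyadic sums become geometric. If \<open>n\<close> is too small for any
  sparsity level at this price, the rate is bounded below by a constant and boundedness of the
  ellipsoids suffices; the latter rests on \<alpha> > 1/2 - 1/p. Invariance of the measure is
  applied to Householder reflections only, which act transitively on spheres, and Gaussian sums of
  squares are treated by linearising the square in the exponent instead of rotating the Gaussian
  measure. For p > 2 and \<open>n\<close> close to \<open>N\<close> the obstacle is that the
  projection of \<open>e_1\<close> may be very short, and not just with exponentially small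
  probability; the marginal estimates are therefore relative to its norm, which cancels in the end.
  The failure probabilities are first proved at rate \<open>2 * n\<close>; the final \<gamma> = 1/2
  pays for their number.\<close>

abbreviation lk :: "fseq \<Rightarrow> nat \<Rightarrow> real" where "lk \<equiv> Poly_Mapping.lookup"

lemma lookup_scaleR [simp]: "lk (c *\<^sub>R x) i = c * lk x i"
proof -
  have "finite {i. c *\<^sub>R lk x i \<noteq> 0}"
    by (rule finite_subset[OF _ finite_lookup[of x]]) auto
  then show ?thesis
    by (simp add: scaleR_poly_mapping_def)
qed

text \<open>Truncation to \<open>{1..N}\<close> makes the support finite, so every function has an
  image. This turns samples of a Gaussian measure indexed by \<open>{1..N}\<close> into vectors of
  \<open>Rn N\<close>.\<close>

definition vec_of :: "nat \<Rightarrow> (nat \<Rightarrow> real) \<Rightarrow> fseq" where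
  "vec_of N g = Abs_poly_mapping (\<lambda>i. if i \<in> {1..N} then g i else 0)"

lemma lookup_vec_of [simp]: "lk (vec_of N g) i = (if i \<in> {1..N} then g i else 0)"
proof -
  have "finite {i. (if i \<in> {1..N} then g i else 0) \<noteq> 0}"
    by (rule finite_subset[of _ "{1..N}"]) auto
  then show ?thesis
    by (simp add: vec_of_def)
qed

lemma Rn_iff: "x \<in> Rn N \<longleftrightarrow> (\<forall>i. i \<notin> {1..N} \<longrightarrow> lk x i = 0)"
  by (auto simp: Rn_def in_keys_iff)

lemma Rn_lookup_outside: "x \<in> Rn N \<Longrightarrow> i \<notin> {1..N} \<Longrightarrow> lk x i = 0"
  by (simp add: Rn_iff)

lemma Rn_eqI: "x \<in> Rn N \<Longrightarrow> y \<in> Rn N \<Longrightarrow> (\<And>i. i \<in> {1..N} \<Longrightarrow> lk x i = lk y i) \<Longrightarrow> x = y"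
  by (rule poly_mapping_eqI) (metis Rn_iff)

lemma vec_of_in_Rn [simp]: "vec_of N g \<in> Rn N"
  by (simp add: Rn_iff)

lemma subspace_Rn: "subspace (Rn N)"
  by (auto simp: subspace_def Rn_iff lookup_add)

lemma zero_in_Rn [simp]: "0 \<in> Rn N"
  by (simp add: Rn_iff)

lemma Rn_add [intro]: "x \<in> Rn N \<Longrightarrow> y \<in> Rn N \<Longrightarrow> x + y \<in> Rn N"
  using subspace_Rn by (rule subspace_add)

lemma Rn_diff [intro]: "x \<in> Rn N \<Longrightarrow> y \<in> Rn N \<Longrightarrow> x - y \<in> Rn N"
  using subspace_Rn by (rule subspace_diff)

lemma Rn_scale [intro]: "x \<in> Rn N \<Longrightarrow> c *\<^sub>R x \<in> Rn N"
  using subspace_Rn by (rule subspace_scale)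

lemma Rn_sum [intro]: "(\<And>a. a \<in> A \<Longrightarrow> f a \<in> Rn N) \<Longrightarrow> (\<Sum>a\<in>A. f a) \<in> Rn N"
  using subspace_Rn by (rule subspace_sum)

lemma inner2_commute: "inner2 N x y = inner2 N y x"
  by (simp add: inner2_def mult.commute)

lemma inner2_add_left: "inner2 N (x + y) z = inner2 N x z + inner2 N y z"
  by (simp add: inner2_def lookup_add algebra_simps sum.distrib)

lemma inner2_diff_left: "inner2 N (x - y) z = inner2 N x z - inner2 N y z"
  by (simp add: inner2_def lookup_minus algebra_simps sum_subtractf)

lemma inner2_scale_left [simp]: "inner2 N (c *\<^sub>R x) z = c * inner2 N x z"
  by (simp add: inner2_def sum_distrib_left mult.assoc)

lemma inner2_zero_left [simp]: "inner2 N 0 z = 0"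
  by (simp add: inner2_def)

lemma inner2_sum_left: "inner2 N (\<Sum>a\<in>A. f a) z = (\<Sum>a\<in>A. inner2 N (f a) z)"
  by (induction A rule: infinite_finite_induct) (auto simp: inner2_add_left)

lemma inner2_add_right: "inner2 N z (x + y) = inner2 N z x + inner2 N z y"
  by (simp add: inner2_commute[of N z] inner2_add_left)

lemma inner2_diff_right: "inner2 N z (x - y) = inner2 N z x - inner2 N z y"
  by (simp add: inner2_commute[of N z] inner2_diff_left)

lemma inner2_scale_right [simp]: "inner2 N z (c *\<^sub>R x) = c * inner2 N z x"
  by (simp add: inner2_commute[of N z])

lemma inner2_zero_right [simp]: "inner2 N z 0 = 0"
  by (simp add: inner2_def)

lemma inner2_sum_right: "inner2 N z (\<Sum>a\<in>A. f a) = (\<Sum>a\<in>A. inner2 N z (f a))"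
  by (simp add: inner2_commute[of N z] inner2_sum_left)

lemma norm2_nonneg [simp]: "0 \<le> norm2 N x"
  by (simp add: norm2_def)

lemma norm2_sq: "(norm2 N x)\<^sup>2 = inner2 N x x"
  by (simp add: norm2_def L2_set_def inner2_def power2_eq_square sum_nonneg)

lemma norm2_sq_sum: "(norm2 N x)\<^sup>2 = (\<Sum>i=1..N. (lk x i)\<^sup>2)"
  unfolding norm2_sq by (simp add: inner2_def power2_eq_square)

lemma norm2_zero [simp]: "norm2 N 0 = 0"
  by (simp add: norm2_def L2_set_def)

lemma norm2_triangle: "norm2 N (x + y) \<le> norm2 N x + norm2 N y"
  unfolding norm2_def lookup_add by (rule L2_set_triangle_ineq)

lemma norm2_scale [simp]: "norm2 N (c *\<^sub>R x) = \<bar>c\<bar> * norm2 N x"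
  unfolding norm2_def by (simp add: L2_set_def power_mult_distrib sum_distrib_left[symmetric] real_sqrt_mult)

lemma norm2_minus_commute: "norm2 N (x - y) = norm2 N (y - x)"
  unfolding norm2_def L2_set_def by (simp add: lookup_minus power2_commute)

lemma norm2_triangle_sub: "norm2 N x \<le> norm2 N y + norm2 N (x - y)"
  using norm2_triangle[of N y "x - y"] by simp

lemma norm2_diff_triangle: "norm2 N (x - y) \<le> norm2 N x + norm2 N y"
  using norm2_triangle[of N x "(-1) *\<^sub>R y"] norm2_scale[of N "-1" y] by simp

lemma norm2_eq_0_iff: "x \<in> Rn N \<Longrightarrow> norm2 N x = 0 \<longleftrightarrow> x = 0"
proof
  assume x: "x \<in> Rn N" and "norm2 N x = 0"
  then have "\<forall>i\<in>{1..N}. lk x i = 0"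
    unfolding norm2_def by (simp add: L2_set_eq_0_iff)
  then show "x = 0"
    using x by (intro Rn_eqI[of x N 0]) auto
qed auto

lemma norm2_pos: "x \<in> Rn N \<Longrightarrow> x \<noteq> 0 \<Longrightarrow> 0 < norm2 N x"
  using norm2_eq_0_iff[of x N] norm2_nonneg[of N x] by linarith

lemma inner2_Cauchy_Schwarz: "\<bar>inner2 N x y\<bar> \<le> norm2 N x * norm2 N y"
proof -
  have "\<bar>inner2 N x y\<bar> \<le> (\<Sum>i=1..N. \<bar>lk x i\<bar> * \<bar>lk y i\<bar>)"
    unfolding inner2_def abs_mult[symmetric] by (rule sum_abs)
  also have "\<dots> \<le> norm2 N x * norm2 N y"
    unfolding norm2_def by (rule L2_set_mult_ineq)
  finally show ?thesis .
qed

lemma abs_lookup_le_norm2: "i \<in> {1..N} \<Longrightarrow> \<bar>lk x i\<bar> \<le> norm2 N x"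
proof -
  assume i: "i \<in> {1..N}"
  have "(lk x i)\<^sup>2 \<le> (norm2 N x)\<^sup>2"
    unfolding norm2_sq_sum using i by (intro member_le_sum) auto
  then show ?thesis
    using abs_le_square_iff[of "lk x i" "norm2 N x"] by simp
qed

definition unit_vec :: "nat \<Rightarrow> fseq" where "unit_vec i = Poly_Mapping.single i 1"

lemma lookup_unit_vec [simp]: "lk (unit_vec i) j = (if i = j then 1 else 0)"
  by (simp add: unit_vec_def lookup_single when_def)

lemma unit_vec_in_Rn: "i \<in> {1..N} \<Longrightarrow> unit_vec i \<in> Rn N"
  by (auto simp: Rn_iff)

lemma inner2_unit_vec_right [simp]: "inner2 N x (unit_vec i) = (if i \<in> {1..N} then lk x i else 0)"
  by (simp add: inner2_def if_distrib cong: if_cong)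

lemma inner2_unit_vec_left [simp]: "inner2 N (unit_vec i) x = (if i \<in> {1..N} then lk x i else 0)"
  by (simp add: inner2_commute[of N "unit_vec i"])

lemma norm2_unit_vec [simp]: "i \<in> {1..N} \<Longrightarrow> norm2 N (unit_vec i) = 1"
proof -
  assume i: "i \<in> {1..N}"
  have "(norm2 N (unit_vec i))\<^sup>2 = 1"
    unfolding norm2_sq using i by simp
  then show ?thesis
    using norm2_nonneg[of N "unit_vec i"] by (simp add: power2_eq_1_iff)
qed

lemma Rn_unit_vec_expand: "x \<in> Rn N \<Longrightarrow> x = (\<Sum>i=1..N. lk x i *\<^sub>R unit_vec i)"
  by (rule Rn_eqI[of _ N])
    (auto simp: lookup_sum if_distrib intro!: Rn_sum Rn_scale unit_vec_in_Rn cong: if_cong)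

section \<open>Orthonormal systems and bases\<close>

definition orthonormal :: "nat \<Rightarrow> fseq set \<Rightarrow> bool" where
  "orthonormal N B \<longleftrightarrow> finite B \<and> B \<subseteq> Rn N \<and>
     (\<forall>a\<in>B. \<forall>b\<in>B. inner2 N a b = (if a = b then 1 else 0))"

lemma orthonormalD:
  assumes "orthonormal N B"
  shows "finite B" "B \<subseteq> Rn N" "a \<in> B \<Longrightarrow> b \<in> B \<Longrightarrow> inner2 N a b = (if a = b then 1 else 0)"
  using assms by (auto simp: orthonormal_def)

lemma orthonormal_subset: "orthonormal N B \<Longrightarrow> A \<subseteq> B \<Longrightarrow> orthonormal N A"
  unfolding orthonormal_def by (meson finite_subset subset_eq)

lemma span_orthonormal_subset_Rn: "orthonormal N B \<Longrightarrow> span B \<subseteq> Rn N"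
  by (rule span_minimal) (auto simp: subspace_Rn orthonormal_def)

lemma orthonormal_inner2_sum:
  assumes B: "orthonormal N B" and b: "b \<in> B"
  shows "inner2 N (\<Sum>a\<in>B. c a *\<^sub>R a) b = c b"
proof -
  have "inner2 N (\<Sum>a\<in>B. c a *\<^sub>R a) b = (\<Sum>a\<in>B. if a = b then c a else 0)"
    unfolding inner2_sum_left by (rule sum.cong) (auto simp: orthonormalD(3)[OF B _ b])
  also have "\<dots> = c b"
    using b orthonormalD(1)[OF B] by simp
  finally show ?thesis .
qed

lemma orthonormal_expand:
  assumes B: "orthonormal N B" and x: "x \<in> span B"
  shows "x = (\<Sum>b\<in>B. inner2 N x b *\<^sub>R b)"
proof -
  obtain u where u: "x = (\<Sum>b\<in>B. u b *\<^sub>R b)"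
    using x orthonormalD(1)[OF B] by (auto simp: span_finite)
  have "u b = inner2 N x b" if "b \<in> B" for b
    unfolding u using orthonormal_inner2_sum[OF B that] by simp
  then have "(\<Sum>b\<in>B. u b *\<^sub>R b) = (\<Sum>b\<in>B. inner2 N x b *\<^sub>R b)"
    by (intro sum.cong) auto
  then show ?thesis
    using u by simp
qed

lemma orthonormal_independent:
  assumes B: "orthonormal N B"
  shows "independent B"
proof
  assume "dependent B"
  then obtain u b where ub: "b \<in> B" "u b \<noteq> 0" "(\<Sum>a\<in>B. u a *\<^sub>R a) = 0"
    using dependent_finite[OF orthonormalD(1)[OF B]] by auto
  have "u b = inner2 N (\<Sum>a\<in>B. u a *\<^sub>R a) b"
    using orthonormal_inner2_sum[OF B ub(1)] by simp
  with ub show False by simp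
qed

lemma orthonormal_inner2_expand:
  assumes B: "orthonormal N B" and x: "x \<in> span B"
  shows "inner2 N x y = (\<Sum>b\<in>B. inner2 N x b * inner2 N y b)"
proof -
  have "inner2 N x y = inner2 N (\<Sum>b\<in>B. inner2 N x b *\<^sub>R b) y"
    using orthonormal_expand[OF B x] by simp
  also have "\<dots> = (\<Sum>b\<in>B. inner2 N x b * inner2 N y b)"
    by (simp add: inner2_sum_left inner2_commute[of N y])
  finally show ?thesis .
qed

text \<open>Gram-Schmidt, one vector of \<open>A\<close> at a time. \<open>B0\<close> stays inside
  the result, so that an orthonormal basis of a subspace can be completed to one of
  \<open>Rn N\<close>.\<close>

lemma orthonormal_extend:
  assumes B0: "orthonormal N B0" and A: "finite A" "A \<subseteq> Rn N"
  shows "\<exists>B. B0 \<subseteq> B \<and> orthonormal N B \<and> span B = span (B0 \<union> A)"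
  using A
proof (induction A)
  case empty
  then show ?case using B0 by auto
next
  case (insert a A)
  then obtain B where B: "B0 \<subseteq> B" "orthonormal N B" "span B = span (B0 \<union> A)"
    by auto
  define a' where "a' = a - (\<Sum>b\<in>B. inner2 N a b *\<^sub>R b)"
  have s: "(\<Sum>b\<in>B. inner2 N a b *\<^sub>R b) \<in> span B"
    by (intro span_sum span_scale span_base)
  have aR: "a' \<in> Rn N"
    unfolding a'_def
  proof (rule Rn_diff)
    show "a \<in> Rn N" using insert.prems by simp
    show "(\<Sum>b\<in>B. inner2 N a b *\<^sub>R b) \<in> Rn N"
      using span_orthonormal_subset_Rn[OF B(2)] s by (rule subsetD)
  qed
  have orth: "inner2 N a' b = 0" if "b \<in> B" for b
    unfolding a'_def inner2_diff_left orthonormal_inner2_sum[OF B(2) that] by simp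
  have orth': "inner2 N b a' = 0" if "b \<in> B" for b
    using orth[OF that] by (simp only: inner2_commute)
  have span1: "span (insert a B) = span (B0 \<union> insert a A)"
  proof -
    have "span (insert a B) = span (insert a (B0 \<union> A))"
      unfolding span_insert B(3) ..
    then show ?thesis by simp
  qed
  show ?case
  proof (cases "a' = 0")
    case True
    then have "a \<in> span B" using s by (simp add: a'_def)
    then have "span (insert a B) = span B"
      by (rule span_redundant)
    then show ?thesis using B span1 by (intro exI[of _ B]) auto
  next
    case False
    define c where "c = inverse (norm2 N a')"
    have np: "norm2 N a' > 0" using norm2_pos[OF aR False] .
    then have c0: "c \<noteq> 0" by (simp add: c_def)
    have un: "inner2 N (c *\<^sub>R a') (c *\<^sub>R a') = 1"
      unfolding inner2_scale_left inner2_scale_right norm2_sq[symmetric]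
      using np by (simp add: c_def power2_eq_square)
    have on: "orthonormal N (insert (c *\<^sub>R a') B)"
      unfolding orthonormal_def
    proof (intro conjI ballI)
      show "finite (insert (c *\<^sub>R a') B)" using orthonormalD(1)[OF B(2)] by simp
      show "insert (c *\<^sub>R a') B \<subseteq> Rn N" using orthonormalD(2)[OF B(2)] aR by auto
      fix x y assume xy: "x \<in> insert (c *\<^sub>R a') B" "y \<in> insert (c *\<^sub>R a') B"
      have nB: "c *\<^sub>R a' \<notin> B" using un orth[of "c *\<^sub>R a'"] by auto
      show "inner2 N x y = (if x = y then 1 else 0)"
        using xy un orth orth' orthonormalD(3)[OF B(2)] nB by auto
    qed
    have "span (insert (c *\<^sub>R a') B) = span (insert a B)"
    proof -
      have "span (insert a' B) = span (insert a B)"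
      proof (rule span_eq[THEN iffD2], intro conjI subsetI)
        fix x assume "x \<in> insert a' B"
        then show "x \<in> span (insert a B)"
          using subsetD[OF span_mono[OF subset_insertI] s, of a]
          by (auto simp: a'_def intro: span_diff span_base)
      next
        fix x assume x: "x \<in> insert a B"
        have "a = a' + (\<Sum>b\<in>B. inner2 N a b *\<^sub>R b)" by (simp add: a'_def)
        moreover have "a' + (\<Sum>b\<in>B. inner2 N a b *\<^sub>R b) \<in> span (insert a' B)"
          using s span_mono[of B "insert a' B"] by (intro span_add) (auto intro: span_base)
        ultimately show "x \<in> span (insert a' B)"
          using x by (auto intro: span_base)
      qed
      moreover have "span (insert (c *\<^sub>R a') B) = span (insert a' B)"
      proof (rule span_eq[THEN iffD2], intro conjI subsetI)
        fix x assume "x \<in> insert (c *\<^sub>R a') B"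
        then show "x \<in> span (insert a' B)"
          by (auto intro!: span_scale intro: span_base)
      next
        fix x assume x: "x \<in> insert a' B"
        have "a' = inverse c *\<^sub>R (c *\<^sub>R a')" using c0 by simp
        moreover have "inverse c *\<^sub>R (c *\<^sub>R a') \<in> span (insert (c *\<^sub>R a') B)"
          by (intro span_scale[of "c *\<^sub>R a'"] span_base) auto
        ultimately show "x \<in> span (insert (c *\<^sub>R a') B)"
          using x by (metis insert_iff span_base)
      qed
      ultimately show ?thesis by simp
    qed
    then show ?thesis
      using on B(1) span1 by (intro exI[of _ "insert (c *\<^sub>R a') B"]) auto
  qed
qed

lemma inj_unit_vec: "inj unit_vec"
  by (rule injI) (metis lookup_unit_vec zero_neq_one)

lemma orthonormal_unit_vecs: "I \<subseteq> {1..N} \<Longrightarrow> orthonormal N (unit_vec ` I)"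
  unfolding orthonormal_def
  using finite_subset[of I "{1..N}"]
  by (auto simp: unit_vec_in_Rn subset_iff dest: injD[OF inj_unit_vec])

lemma span_unit_vecs: "span (unit_vec ` {1..N}) = Rn N"
proof
  show "span (unit_vec ` {1..N}) \<subseteq> Rn N"
    using orthonormal_unit_vecs span_orthonormal_subset_Rn by blast
  show "Rn N \<subseteq> span (unit_vec ` {1..N})"
  proof
    fix x assume "x \<in> Rn N"
    then have "x = (\<Sum>i=1..N. lk x i *\<^sub>R unit_vec i)" by (rule Rn_unit_vec_expand)
    also have "\<dots> \<in> span (unit_vec ` {1..N})"
      by (intro span_sum span_scale span_base) auto
    finally show "x \<in> span (unit_vec ` {1..N})" .
  qed
qed

lemma card_unit_vecs: "card (unit_vec ` I) = card I"
  by (rule card_image) (rule inj_on_subset[OF inj_unit_vec], simp)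

lemma card_orthonormal_le:
  assumes "orthonormal N B" shows "card B \<le> N"
proof -
  have "card B \<le> card (unit_vec ` {1..N})"
    using independent_span_bound[OF _ orthonormal_independent[OF assms], of "unit_vec ` {1..N}"]
      orthonormalD(2)[OF assms] span_unit_vecs by auto
  then show ?thesis by (simp add: card_unit_vecs)
qed

lemma card_orthonormal_basis:
  assumes B: "orthonormal N B" and sp: "span B = Rn N" shows "card B = N"
proof -
  have "card (unit_vec ` {1..N}) \<le> card B"
    using independent_span_bound[OF orthonormalD(1)[OF B] orthonormal_independent[OF orthonormal_unit_vecs[of "{1..N}" N]]]
      orthonormalD(2)[OF orthonormal_unit_vecs[of "{1..N}" N]] sp by auto
  then show ?thesis
    using card_orthonormal_le[OF B] by (simp add: card_unit_vecs)
qed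

text \<open>\<open>B'\<close> spans the orthogonal complement. Having it as an explicit set of
  \<open>N - dim E\<close> vectors later turns residual norms into sums of that many
  squares.\<close>

lemma subspace_orthonormal_basis:
  assumes E: "subspace E" "E \<subseteq> Rn N"
  obtains B B' where "orthonormal N (B \<union> B')" "B \<inter> B' = {}" "span B = E" "card B = dim E"
    "card B' + dim E = N" "span (B \<union> B') = Rn N"
proof -
  obtain A where A: "A \<subseteq> E" "independent A" "E \<subseteq> span A"
    using basis_exists[of E] by metis
  have "finite A"
    using independent_span_bound[of "unit_vec ` {1..N}" A] A E span_unit_vecs by auto
  then obtain B where B: "orthonormal N B" "span B = span A"
    using orthonormal_extend[of N "{}" A] A(1) E by (auto simp: orthonormal_def[of N "{}"])
  have spA: "span A = E"
    using A E by (simp add: span_subspace)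
  obtain C where C: "B \<subseteq> C" "orthonormal N C" "span C = span (B \<union> unit_vec ` {1..N})"
    using orthonormal_extend[OF B(1), of "unit_vec ` {1..N}"]
      orthonormalD(2)[OF orthonormal_unit_vecs[of "{1..N}" N]] by auto
  have spC: "span C = Rn N"
  proof
    show "span C \<subseteq> Rn N" by (rule span_orthonormal_subset_Rn[OF C(2)])
    show "Rn N \<subseteq> span C"
      unfolding C(3) span_unit_vecs[symmetric] by (rule span_mono) auto
  qed
  have dB: "card B = dim E"
    using dim_span_eq_card_independent[OF orthonormal_independent[OF B(1)]] B(2) spA by simp
  have cC: "card C = N" by (rule card_orthonormal_basis[OF C(2) spC])
  have "card (C - B) + card B = card C"
    using card_Diff_subset[OF orthonormalD(1)[OF B(1)] C(1)] card_mono[OF orthonormalD(1)[OF C(2)] C(1)]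
    by simp
  then have "card (C - B) + dim E = N"
    using dB cC by linarith
  moreover have "B \<union> (C - B) = C" using C(1) by blast
  moreover have "span B = E" using B(2) spA by (rule trans)
  ultimately show ?thesis
    by (intro that[of B "C - B", OF _ Diff_disjoint _ dB]) (simp_all add: C(2) spC)
qed

section \<open>The orthogonal projection onto a subspace and its residual\<close>

lemma orth_proj_unique:
  assumes E: "subspace E" "E \<subseteq> Rn N" and y: "y \<in> E" "\<And>z. z \<in> E \<Longrightarrow> inner2 N (x - y) z = 0"
  shows "orth_proj N E x = y"
  unfolding orth_proj_def
proof (rule the_equality)
  show "y \<in> E \<and> (\<forall>z\<in>E. inner2 N (x - y) z = 0)" using y by auto
  fix w assume w: "w \<in> E \<and> (\<forall>z\<in>E. inner2 N (x - w) z = 0)"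
  have d: "w - y \<in> E" using w y E(1) by (auto intro: subspace_diff)
  have "inner2 N (w - y) (w - y) = inner2 N (x - y) (w - y) - inner2 N (x - w) (w - y)"
    by (simp add: inner2_diff_left)
  also have "\<dots> = 0" using w y(2)[OF d] d by simp
  finally have "norm2 N (w - y) = 0"
    using norm2_sq[of N "w - y"] by simp
  then show "w = y" using norm2_eq_0_iff[of "w - y" N] d E by auto
qed

lemma orth_proj_eq_sum:
  assumes B: "orthonormal N B"
  shows "orth_proj N (span B) x = (\<Sum>b\<in>B. inner2 N x b *\<^sub>R b)"
proof (rule orth_proj_unique)
  show "span B \<subseteq> Rn N" by (rule span_orthonormal_subset_Rn[OF B])
  show "(\<Sum>b\<in>B. inner2 N x b *\<^sub>R b) \<in> span B" by (intro span_sum span_scale span_base)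
  fix z assume z: "z \<in> span B"
  have "inner2 N (x - (\<Sum>b\<in>B. inner2 N x b *\<^sub>R b)) z =
      inner2 N (x - (\<Sum>b\<in>B. inner2 N x b *\<^sub>R b)) (\<Sum>b\<in>B. inner2 N z b *\<^sub>R b)"
    using orthonormal_expand[OF B z] by simp
  also have "\<dots> = (\<Sum>b\<in>B. inner2 N z b * inner2 N (x - (\<Sum>b\<in>B. inner2 N x b *\<^sub>R b)) b)"
    by (simp add: inner2_sum_right)
  also have "\<dots> = 0"
    by (rule sum.neutral) (auto simp: inner2_diff_left orthonormal_inner2_sum[OF B])
  finally show "inner2 N (x - (\<Sum>b\<in>B. inner2 N x b *\<^sub>R b)) z = 0" .
qed simp

context
  fixes N :: nat and E :: "fseq set"
  assumes E: "subspace E" "E \<subseteq> Rn N"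
begin

lemma orth_proj_in: "orth_proj N E x \<in> E"
  and orth_proj_orth: "z \<in> E \<Longrightarrow> inner2 N (x - orth_proj N E x) z = 0"
  and linear_orth_proj: "linear (orth_proj N E)"
  and orth_proj_symmetric: "inner2 N (orth_proj N E x) y = inner2 N x (orth_proj N E y)"
proof -
  obtain B B' where B: "orthonormal N (B \<union> B')" "span B = E"
    using subspace_orthonormal_basis[OF E] by metis
  have oB: "orthonormal N B" using orthonormal_subset[OF B(1)] by auto
  have P: "orth_proj N E x = (\<Sum>b\<in>B. inner2 N x b *\<^sub>R b)" for x
    using orth_proj_eq_sum[OF oB] B(2) by simp
  show in': "orth_proj N E x \<in> E" for x
    unfolding P using B(2) by (auto intro!: span_sum span_scale intro: span_base)
  show "inner2 N (x - orth_proj N E x) z = 0" if z: "z \<in> E" for x z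
  proof -
    have "inner2 N (orth_proj N E x) z = (\<Sum>b\<in>B. inner2 N x b * inner2 N z b)"
      unfolding P by (simp add: inner2_sum_left inner2_commute[of N z])
    also have "\<dots> = inner2 N z x"
      using orthonormal_inner2_expand[OF oB, of z x] z B(2) by (simp add: mult.commute)
    finally show ?thesis by (simp add: inner2_diff_left inner2_commute[of N z])
  qed
  show "linear (orth_proj N E)"
    unfolding P by (rule linearI)
      (auto simp: inner2_add_left scaleR_add_left sum.distrib scaleR_sum_right)
  show "inner2 N (orth_proj N E x) y = inner2 N x (orth_proj N E y)"
    unfolding P by (simp add: inner2_sum_left inner2_sum_right inner2_commute mult.commute)
qed

lemma orth_proj_in_Rn: "orth_proj N E x \<in> Rn N"
  using orth_proj_in E by auto

lemma orth_proj_id: "x \<in> E \<Longrightarrow> orth_proj N E x = x"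
  by (rule orth_proj_unique[OF E]) auto

lemma orth_proj_inner_self: "inner2 N (orth_proj N E x) x = (norm2 N (orth_proj N E x))\<^sup>2"
  using orth_proj_orth[OF orth_proj_in, of x x]
  by (simp add: norm2_sq inner2_diff_left inner2_commute[of N _ x])

lemma orth_proj_pythagoras:
  "(norm2 N x)\<^sup>2 = (norm2 N (orth_proj N E x))\<^sup>2 + (norm2 N (x - orth_proj N E x))\<^sup>2"
proof -
  have "(norm2 N (x - orth_proj N E x))\<^sup>2 = inner2 N (x - orth_proj N E x) x"
    using orth_proj_orth[OF orth_proj_in, of x x] by (simp add: norm2_sq inner2_diff_right)
  then show ?thesis
    using orth_proj_inner_self[of x] by (simp add: norm2_sq inner2_diff_left)
qed

lemma norm2_orth_proj_le: "norm2 N (orth_proj N E x) \<le> norm2 N x"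
  using orth_proj_pythagoras[of x] by (simp add: power2_le_imp_le)

lemma norm2_resid_le: "norm2 N (x - orth_proj N E x) \<le> norm2 N x"
  using orth_proj_pythagoras[of x] by (simp add: power2_le_imp_le)

end

lemmas orth_proj_add = linear_add[OF linear_orth_proj]
  and orth_proj_diff = linear_diff[OF linear_orth_proj]
  and orth_proj_scale = linear_scale[OF linear_orth_proj]
  and orth_proj_sum = linear_sum[OF linear_orth_proj]

lemma grassmannianD:
  assumes "E \<in> grassmannian N n"
  shows "subspace E" "E \<subseteq> Rn N" "dim E + n = N"
  using assms by (auto simp: grassmannian_def)

text \<open>Parseval over \<open>B \<union> F\<close> minus Parseval over \<open>B\<close> writes
  the squared residual as a sum of \<open>n\<close> squares, which for Gaussian input is a
  chi-square variable.\<close>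

lemma grassmannian_bases:
  assumes E: "E \<in> grassmannian N n"
  obtains B F where "orthonormal N (B \<union> F)" "B \<inter> F = {}" "span B = E" "card B + n = N" "card F = n"
    "span (B \<union> F) = Rn N"
    "\<And>x. x \<in> Rn N \<Longrightarrow> (norm2 N (x - orth_proj N E x))\<^sup>2 = (\<Sum>f\<in>F. (inner2 N x f)\<^sup>2)"
    "\<And>x. (norm2 N (orth_proj N E x))\<^sup>2 = (\<Sum>f\<in>B. (inner2 N x f)\<^sup>2)"
proof -
  note E' = grassmannianD[OF E]
  obtain B F where B: "orthonormal N (B \<union> F)" "B \<inter> F = {}" "span B = E" "card B = dim E"
    "card F + dim E = N" "span (B \<union> F) = Rn N"
    using subspace_orthonormal_basis[OF E'(1,2)] by metis
  have oB: "orthonormal N B" using orthonormal_subset[OF B(1)] by auto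
  have fin: "finite B" "finite F" using orthonormalD(1)[OF B(1)] by auto
  have P: "(norm2 N (orth_proj N E x))\<^sup>2 = (\<Sum>f\<in>B. (inner2 N x f)\<^sup>2)" for x
  proof -
    have "(norm2 N (orth_proj N E x))\<^sup>2 = inner2 N (orth_proj N E x) x"
      by (simp add: orth_proj_inner_self E')
    also have "\<dots> = (\<Sum>f\<in>B. (inner2 N x f)\<^sup>2)"
      using orth_proj_eq_sum[OF oB, of x] B(3)
      by (simp add: inner2_sum_left power2_eq_square inner2_commute[of N _ x])
    finally show ?thesis .
  qed
  have Q: "(norm2 N (x - orth_proj N E x))\<^sup>2 = (\<Sum>f\<in>F. (inner2 N x f)\<^sup>2)" if x: "x \<in> Rn N" for x
  proof -
    have "(norm2 N x)\<^sup>2 = (\<Sum>f\<in>B \<union> F. (inner2 N x f)\<^sup>2)"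
      unfolding norm2_sq
      using orthonormal_inner2_expand[OF B(1), of x x] x B(6) by (simp add: power2_eq_square)
    also have "\<dots> = (\<Sum>f\<in>B. (inner2 N x f)\<^sup>2) + (\<Sum>f\<in>F. (inner2 N x f)\<^sup>2)"
      using fin B(2) by (rule sum.union_disjoint)
    finally show ?thesis
      using P[of x] orth_proj_pythagoras[OF E'(1,2), of x] by simp
  qed
  show ?thesis
    using that[of B F] B E'(3) P Q by auto
qed

section \<open>Householder reflections acting on the Grassmannian\<close>

definition reflect :: "nat \<Rightarrow> fseq \<Rightarrow> fseq \<Rightarrow> fseq" where
  "reflect N v y = y - (2 * inner2 N v y / inner2 N v v) *\<^sub>R v"

lemma linear_reflect: "linear (reflect N v)"
  by (rule linearI) (auto simp: reflect_def inner2_add_right algebra_simps add_divide_distrib)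

lemma reflect_in_Rn: "v \<in> Rn N \<Longrightarrow> y \<in> Rn N \<Longrightarrow> reflect N v y \<in> Rn N"
  by (auto simp: reflect_def)

text \<open>If \<open>inner2 N v v = 0\<close>, division by zero turns \<open>reflect N v\<close>
  into the identity, so no hypothesis on \<open>v\<close> is required.\<close>

lemma inner2_reflect:
  "inner2 N (reflect N v x) (reflect N v y) = inner2 N x y"
proof (cases "inner2 N v v = 0")
  case False
  then show ?thesis
    by (simp add: reflect_def inner2_diff_left inner2_diff_right inner2_commute[of N x v] field_simps)
qed (simp add: reflect_def)

lemma norm2_reflect: "norm2 N (reflect N v x) = norm2 N x"
  using inner2_reflect[of N v x x] norm2_sq by (metis norm2_nonneg power2_eq_imp_eq)

lemma reflect_reflect [simp]: "reflect N v (reflect N v y) = y"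
proof (cases "inner2 N v v = 0")
  case False
  have "inner2 N v (reflect N v y) = - inner2 N v y"
    using False by (simp add: reflect_def inner2_diff_right)
  then have "reflect N v (reflect N v y) =
      reflect N v y - (2 * (- inner2 N v y) / inner2 N v v) *\<^sub>R v"
    unfolding reflect_def[of N v "reflect N v y"] by simp
  then show ?thesis by (simp add: reflect_def)
qed (simp add: reflect_def)

lemma orthogonal_reflect: "v \<in> Rn N \<Longrightarrow> orthogonal_on N (reflect N v)"
  by (simp add: orthogonal_on_def linear_reflect reflect_in_Rn norm2_reflect)

text \<open>Equal norms give \<open>2 * inner2 N (x - y) x = inner2 N (x - y) (x - y)\<close>, so
  the reflection along \<open>x - y\<close> subtracts exactly \<open>x - y\<close> from
  \<open>x\<close>.\<close>

lemma reflect_maps: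
  assumes x: "x \<in> Rn N" "y \<in> Rn N" "norm2 N x = norm2 N y"
  shows "reflect N (x - y) x = y"
proof (cases "x = y")
  case False
  have xy: "inner2 N x x = inner2 N y y"
    using x(3) by (simp add: norm2_sq[symmetric])
  have "inner2 N (x - y) (x - y) \<noteq> 0"
    using norm2_pos[OF Rn_diff[OF x(1,2)]] False by (auto simp: norm2_sq[symmetric])
  moreover have "2 * inner2 N (x - y) x = inner2 N (x - y) (x - y)"
    using xy by (simp add: inner2_diff_left inner2_diff_right inner2_commute)
  ultimately show ?thesis by (simp add: reflect_def)
qed (simp add: reflect_def)

lemma reflect_fixes: "inner2 N v y = 0 \<Longrightarrow> reflect N v y = y"
  by (simp add: reflect_def)

lemma reflect_image_reflect_image [simp]: "reflect N v ` reflect N v ` A = A"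
  by (auto simp: image_image)

lemma grassmannian_reflect:
  assumes E: "E \<in> grassmannian N n" and v: "v \<in> Rn N"
  shows "reflect N v ` E \<in> grassmannian N n"
proof -
  obtain B F where B: "orthonormal N (B \<union> F)" "span B = E" "card B + n = N"
    using grassmannian_bases[OF E] by metis
  have oB: "orthonormal N B" using orthonormal_subset[OF B(1)] by auto
  have inj: "inj (reflect N v)"
    by (rule inj_on_inverseI[of _ "reflect N v"]) simp
  have "orthonormal N (reflect N v ` B)"
    using oB v inj unfolding orthonormal_def
    by (auto simp: inner2_reflect reflect_in_Rn subset_iff dest: injD)
  moreover have "span (reflect N v ` B) = reflect N v ` E"
    using linear_span_image[OF linear_reflect] B(2) by blast
  moreover have "card (reflect N v ` B) = card B"
    using inj by (intro card_image) (auto simp: inj_on_def)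
  ultimately have "dim (reflect N v ` E) = card B"
    using dim_span_eq_card_independent orthonormal_independent by metis
  then show ?thesis
    using B(3) grassmannianD[OF E] reflect_in_Rn[OF v]
    by (auto simp: grassmannian_def linear_subspace_image linear_reflect)
qed

text \<open>A reflection preserves inner products, so it carries the orthogonality that
  characterises the projection onto \<open>E\<close> to the one for the image of
  \<open>E\<close>.\<close>

lemma orth_proj_reflect:
  assumes E: "E \<in> grassmannian N n" and v: "v \<in> Rn N"
  shows "orth_proj N (reflect N v ` E) (reflect N v x) = reflect N v (orth_proj N E x)"
proof (rule orth_proj_unique)
  note E' = grassmannianD[OF E]
  show "subspace (reflect N v ` E)" "reflect N v ` E \<subseteq> Rn N"
    using grassmannianD[OF grassmannian_reflect[OF E v]] by auto
  show "reflect N v (orth_proj N E x) \<in> reflect N v ` E"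
    using orth_proj_in[OF E'(1,2)] by auto
  fix z assume "z \<in> reflect N v ` E"
  then obtain y where y: "y \<in> E" "z = reflect N v y" by auto
  show "inner2 N (reflect N v x - reflect N v (orth_proj N E x)) z = 0"
    unfolding y(2) linear_diff[OF linear_reflect, symmetric] inner2_reflect
    by (rule orth_proj_orth[OF E'(1,2) y(1)])
qed

section \<open>Measurability on the Grassmannian\<close>

text \<open>\<open>grassmann_dist\<close> is a supremum of reals and carries information only
  because of this bound.\<close>

lemma grassmann_dist_bdd:
  assumes E: "subspace E" "E \<subseteq> Rn N" and F: "subspace F" "F \<subseteq> Rn N"
  shows "bdd_above ((\<lambda>x. norm2 N (orth_proj N E x - orth_proj N F x)) ` {x \<in> Rn N. norm2 N x \<le> 1})"
proof (rule bdd_aboveI2)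
  fix x assume x: "x \<in> {x \<in> Rn N. norm2 N x \<le> 1}"
  show "norm2 N (orth_proj N E x - orth_proj N F x) \<le> 2"
    using norm2_diff_triangle[of N "orth_proj N E x" "orth_proj N F x"]
      norm2_orth_proj_le[OF E, of x] norm2_orth_proj_le[OF F, of x] x by auto
qed

lemma grassmann_dist_upper:
  assumes E: "subspace E" "E \<subseteq> Rn N" and F: "subspace F" "F \<subseteq> Rn N"
    and x: "x \<in> Rn N" "norm2 N x \<le> 1"
  shows "norm2 N (orth_proj N E x - orth_proj N F x) \<le> grassmann_dist N E F"
  unfolding grassmann_dist_def using E F x
  by (auto intro!: cSUP_upper grassmann_dist_bdd)

lemma grassmann_dist_nonneg: "0 \<le> grassmann_dist N E F"
proof (cases "subspace E \<and> E \<subseteq> Rn N \<and> subspace F \<and> F \<subseteq> Rn N")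
  case True
  then have "norm2 N (orth_proj N E 0 - orth_proj N F 0) \<le> grassmann_dist N E F"
    by (intro grassmann_dist_upper) auto
  then show ?thesis using norm2_nonneg order_trans by blast
qed (auto simp: grassmann_dist_def)

lemma norm2_proj_diff_le:
  assumes E: "subspace E" "E \<subseteq> Rn N" and F: "subspace F" "F \<subseteq> Rn N" and x: "x \<in> Rn N"
  shows "norm2 N (orth_proj N E x - orth_proj N F x) \<le> grassmann_dist N E F * norm2 N x"
proof (cases "x = 0")
  case True
  then show ?thesis
    using linear_0[OF linear_orth_proj[OF E]] linear_0[OF linear_orth_proj[OF F]] by simp
next
  case False
  define c where "c = inverse (norm2 N x)"
  have np: "norm2 N x > 0" using norm2_pos[OF x False] .
  have "norm2 N (orth_proj N E (c *\<^sub>R x) - orth_proj N F (c *\<^sub>R x)) \<le> grassmann_dist N E F"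
    using x np by (intro grassmann_dist_upper E F) (auto simp: c_def)
  also have "orth_proj N E (c *\<^sub>R x) - orth_proj N F (c *\<^sub>R x) = c *\<^sub>R (orth_proj N E x - orth_proj N F x)"
    by (simp add: orth_proj_scale[OF E] orth_proj_scale[OF F] scaleR_diff_right)
  finally show ?thesis
    using np unfolding norm2_scale by (simp add: c_def field_simps)
qed

lemma grassmann_dist_commute: "grassmann_dist N E F = grassmann_dist N F E"
  unfolding grassmann_dist_def by (subst norm2_minus_commute) auto

lemma Metric_space_grassmann: "Metric_space (grassmannian N n) (grassmann_dist N)"
proof
  show "0 \<le> grassmann_dist N E F" for E F by (rule grassmann_dist_nonneg)
  show "grassmann_dist N E F = grassmann_dist N F E" for E F by (rule grassmann_dist_commute)
  fix E F assume E: "E \<in> grassmannian N n" and F: "F \<in> grassmannian N n"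
  note E' = grassmannianD(1,2)[OF E] and F' = grassmannianD(1,2)[OF F]
  show "grassmann_dist N E F = 0 \<longleftrightarrow> E = F"
  proof
    assume d: "grassmann_dist N E F = 0"
    have *: "orth_proj N E x = orth_proj N F x" if x: "x \<in> Rn N" for x
    proof -
      have "norm2 N (orth_proj N E x - orth_proj N F x) = 0"
        using norm2_proj_diff_le[OF E' F' x] d norm2_nonneg by (simp add: order_antisym)
      then show ?thesis
        using norm2_eq_0_iff[OF Rn_diff[OF orth_proj_in_Rn[OF E'] orth_proj_in_Rn[OF F']]] by simp
    qed
    have "E \<subseteq> F"
      using *  E'(2) orth_proj_id[OF E'] orth_proj_in[OF F'] by (metis subset_eq)
    moreover have "F \<subseteq> E"
      using *  F'(2) orth_proj_id[OF F'] orth_proj_in[OF E'] by (metis subset_eq)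
    ultimately show "E = F" by blast
  next
    assume "E = F"
    have "(SUP x\<in>{x \<in> Rn N. norm2 N x \<le> 1}. (0::real)) = 0"
      by (rule cSUP_const) (auto intro!: exI[of _ 0])
    then show "grassmann_dist N E F = 0"
      using E' unfolding \<open>E = F\<close> grassmann_dist_def by simp
  qed
  fix G assume G: "G \<in> grassmannian N n"
  note G' = grassmannianD(1,2)[OF G]
  show "grassmann_dist N E G \<le> grassmann_dist N E F + grassmann_dist N F G"
  proof -
    have "(SUP x\<in>{x \<in> Rn N. norm2 N x \<le> 1}. norm2 N (orth_proj N E x - orth_proj N G x))
        \<le> grassmann_dist N E F + grassmann_dist N F G"
    proof (rule cSUP_least)
      show "{x \<in> Rn N. norm2 N x \<le> 1} \<noteq> {}" by (auto intro!: exI[of _ 0])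
      fix x assume "x \<in> {x \<in> Rn N. norm2 N x \<le> 1}"
      then have x: "x \<in> Rn N" "norm2 N x \<le> 1" by auto
      have "orth_proj N E x - orth_proj N G x =
        (orth_proj N E x - orth_proj N F x) + (orth_proj N F x - orth_proj N G x)" by simp
      then show "norm2 N (orth_proj N E x - orth_proj N G x) \<le> grassmann_dist N E F + grassmann_dist N F G"
        using norm2_triangle[of N "orth_proj N E x - orth_proj N F x" "orth_proj N F x - orth_proj N G x"]
          grassmann_dist_upper[OF E' F' x] grassmann_dist_upper[OF F' G' x] by simp
    qed
    then show ?thesis using E' G' by (simp add: grassmann_dist_def[of N E G])
  qed
qed

lemma space_grassmann_borel [simp]: "space (grassmann_borel N n) = grassmannian N n"
  by (simp add: grassmann_borel_def space_measure_of_conv)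

lemma open_in_sets_grassmann_borel:
  assumes A: "A \<subseteq> grassmannian N n"
    and "\<And>E. E \<in> A \<Longrightarrow> \<exists>r>0. \<forall>F\<in>grassmannian N n. grassmann_dist N E F < r \<longrightarrow> F \<in> A"
  shows "A \<in> sets (grassmann_borel N n)"
proof -
  interpret Metric_space "grassmannian N n" "grassmann_dist N"
    by (rule Metric_space_grassmann)
  have "openin mtopology A"
    unfolding openin_mtopology
  proof (intro conjI allI impI)
    fix E assume "E \<in> A"
    then obtain r where "r > 0" "\<forall>F\<in>grassmannian N n. grassmann_dist N E F < r \<longrightarrow> F \<in> A"
      using assms(2) by blast
    then show "\<exists>r>0. mball E r \<subseteq> A" by (intro exI[of _ r]) auto
  qed (rule A)
  moreover have "{A. openin mtopology A} \<subseteq> Pow (grassmannian N n)"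
    using openin_subset[of mtopology] by auto
  ultimately show ?thesis
    unfolding grassmann_borel_def by (subst sets_measure_of) auto
qed

text \<open>Superlevel sets are open: a Lipschitz function needs a definite distance to drop from
  \<open>f E\<close> to \<open>a\<close>.\<close>

lemma measurable_grassmann_Lipschitz:
  fixes f :: "fseq set \<Rightarrow> real"
  assumes L: "\<And>E F. E \<in> grassmannian N n \<Longrightarrow> F \<in> grassmannian N n \<Longrightarrow> \<bar>f E - f F\<bar> \<le> L * grassmann_dist N E F"
  shows "f \<in> borel_measurable (grassmann_borel N n)"
  unfolding borel_measurable_iff_greater space_grassmann_borel
proof (intro allI open_in_sets_grassmann_borel)
  fix a E assume "E \<in> {E \<in> grassmannian N n. a < f E}"
  then have E: "E \<in> grassmannian N n" "a < f E" by auto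
  \<comment> \<open>\<open>\<bar>L\<bar> + 1\<close> is positive whatever the sign of
    \<open>L\<close>.\<close>
  define r where "r = (f E - a) / (\<bar>L\<bar> + 1)"
  have "r > 0" using E by (simp add: r_def)
  moreover have "F \<in> {E \<in> grassmannian N n. a < f E}"
    if F: "F \<in> grassmannian N n" "grassmann_dist N E F < r" for F
  proof -
    have "f E - f F \<le> L * grassmann_dist N E F" using L[OF E(1) F(1)] by linarith
    also have "\<dots> \<le> (\<bar>L\<bar> + 1) * grassmann_dist N E F"
      by (intro mult_right_mono grassmann_dist_nonneg) auto
    also have "\<dots> < (\<bar>L\<bar> + 1) * r"
      using F(2) by (intro mult_strict_left_mono) auto
    also have "\<dots> = f E - a" by (simp add: r_def)
    finally show ?thesis using F by simp
  qed
  ultimately show "\<exists>r>0. \<forall>F\<in>grassmannian N n. grassmann_dist N E F < r \<longrightarrow> F \<in> {E \<in> grassmannian N n. a < f E}"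
    by blast
qed auto

text \<open>Lipschitz with constant \<open>norm2 N x * norm2 N y\<close>, by Cauchy-Schwarz and the
  operator norm. Coordinates and norms of projections follow from this one.\<close>

lemma measurable_inner_orth_proj:
  assumes x: "x \<in> Rn N"
  shows "(\<lambda>E. inner2 N (orth_proj N E x) y) \<in> borel_measurable (grassmann_borel N n)"
proof (rule measurable_grassmann_Lipschitz)
  fix E F assume E: "E \<in> grassmannian N n" and F: "F \<in> grassmannian N n"
  note E' = grassmannianD(1,2)[OF E] and F' = grassmannianD(1,2)[OF F]
  have "\<bar>inner2 N (orth_proj N E x) y - inner2 N (orth_proj N F x) y\<bar>
      \<le> norm2 N (orth_proj N E x - orth_proj N F x) * norm2 N y"
    using inner2_Cauchy_Schwarz[of N "orth_proj N E x - orth_proj N F x" y]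
    by (simp add: inner2_diff_left)
  also have "\<dots> \<le> grassmann_dist N E F * norm2 N x * norm2 N y"
    by (intro mult_right_mono norm2_proj_diff_le E' F' x) auto
  finally show "\<bar>inner2 N (orth_proj N E x) y - inner2 N (orth_proj N F x) y\<bar>
      \<le> (norm2 N x * norm2 N y) * grassmann_dist N E F"
    by (simp add: mult_ac)
qed

lemma measurable_lookup_orth_proj:
  assumes x: "x \<in> Rn N" and i: "i \<in> {1..N}"
  shows "(\<lambda>E. lk (orth_proj N E x) i) \<in> borel_measurable (grassmann_borel N n)"
  using measurable_inner_orth_proj[OF x, of "unit_vec i" n] i by simp

lemma measurable_norm2_orth_proj:
  assumes x: "x \<in> Rn N"
  shows "(\<lambda>E. norm2 N (orth_proj N E x)) \<in> borel_measurable (grassmann_borel N n)"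
  unfolding norm2_def L2_set_def
  using measurable_lookup_orth_proj[OF x, of _ n, measurable] by measurable

lemma measurable_norm2_resid:
  assumes x: "x \<in> Rn N"
  shows "(\<lambda>E. norm2 N (x - orth_proj N E x)) \<in> borel_measurable (grassmann_borel N n)"
  unfolding norm2_def L2_set_def lookup_minus
  using measurable_lookup_orth_proj[OF x, of _ n, measurable] by measurable

section \<open>Measurability of the section radius\<close>

lemma p_ellipsoid_lookup_le:
  assumes x: "x \<in> p_ellipsoid N p \<sigma>" and i: "i \<in> {1..N}" and p: "p > 0" and \<sigma>: "\<sigma> i > 0"
  shows "\<bar>lk x i\<bar> \<le> \<sigma> i"
proof -
  have "(\<bar>lk x i\<bar> / \<sigma> i) powr p \<le> (\<Sum>i=1..N. (\<bar>lk x i\<bar> / \<sigma> i) powr p)"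
    using i by (intro member_le_sum) auto
  also have "\<dots> \<le> 1 powr p" using x by (simp add: p_ellipsoid_def)
  finally have "\<bar>lk x i\<bar> / \<sigma> i \<le> 1"
    using p \<sigma> powr_less_mono2[of p 1 "\<bar>lk x i\<bar> / \<sigma> i"] by (meson not_less zero_le_one)
  then show ?thesis using \<sigma> by simp
qed

lemma bdd_above_section:
  assumes p: "p > 0" and \<sigma>: "\<And>i. i \<in> {1..N} \<Longrightarrow> \<sigma> i > 0"
  shows "bdd_above (norm2 N ` (E \<inter> p_ellipsoid N p \<sigma>))"
proof (rule bdd_aboveI2)
  fix x assume "x \<in> E \<inter> p_ellipsoid N p \<sigma>"
  then have "\<bar>lk x i\<bar> \<le> \<sigma> i" if "i \<in> {1..N}" for i
    using that p \<sigma> by (auto intro!: p_ellipsoid_lookup_le)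
  then show "norm2 N x \<le> L2_set \<sigma> {1..N}"
    unfolding norm2_def L2_set_def
    by (intro real_sqrt_le_mono sum_mono) (metis abs_le_square_iff abs_of_pos \<sigma>)
qed

lemma zero_in_p_ellipsoid [simp]: "0 \<in> p_ellipsoid N p \<sigma>"
  by (simp add: p_ellipsoid_def)

lemma section_radius_upper:
  assumes "p > 0" "\<And>i. i \<in> {1..N} \<Longrightarrow> \<sigma> i > 0" "y \<in> E" "y \<in> p_ellipsoid N p \<sigma>"
  shows "norm2 N y \<le> section_radius N (p_ellipsoid N p \<sigma>) E"
  unfolding section_radius_def using assms by (intro cSUP_upper bdd_above_section) auto

lemma section_radius_least:
  assumes "0 \<in> E" "\<And>y. y \<in> E \<Longrightarrow> y \<in> p_ellipsoid N p \<sigma> \<Longrightarrow> norm2 N y \<le> c"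
  shows "section_radius N (p_ellipsoid N p \<sigma>) E \<le> c"
  unfolding section_radius_def using assms by (intro cSUP_least) (auto intro: exI[of _ 0])

lemma rational_sequence:
  obtains r :: "nat \<Rightarrow> real" where "\<And>k. r k \<in> \<rat>" "r \<longlonglongrightarrow> a"
proof -
  have "\<exists>q\<in>\<rat>. a < q \<and> q < a + inverse (real (Suc k))" for k
    by (rule Rats_dense_in_real) simp
  then obtain r where r: "\<And>k. r k \<in> \<rat>" "\<And>k. a < r k" "\<And>k. r k < a + inverse (real (Suc k))"
    by metis
  have "(\<lambda>k. a + inverse (real (Suc k))) \<longlonglongrightarrow> a + 0"
    by (intro tendsto_intros LIMSEQ_inverse_real_of_nat)
  then have lim: "(\<lambda>k. a + inverse (real (Suc k))) \<longlonglongrightarrow> a" by simp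
  have "r \<longlonglongrightarrow> a"
  proof (rule tendsto_sandwich[OF _ _ tendsto_const[of a] lim])
    show "eventually (\<lambda>k. a \<le> r k) sequentially"
      using less_imp_le[OF r(2)] by simp
    show "eventually (\<lambda>k. r k \<le> a + inverse (real (Suc k))) sequentially"
      using less_imp_le[OF r(3)] by (intro always_eventually) blast
  qed
  with r(1) show ?thesis by (rule that)
qed

text \<open>A subspace may contain no rational vector except zero, so rational vectors of
  \<open>Rn N\<close> are projected onto \<open>E\<close>, where their images are dense. The strict
  constraint \<open>G < 1\<close> makes the condition open, so this countable family detects
  it.\<close>

lemma section_radius_gt_iff:
  fixes \<sigma> :: "nat \<Rightarrow> real" and p :: real and N :: nat
  defines "G \<equiv> \<lambda>x::fseq. \<Sum>i=1..N. (\<bar>lk x i\<bar> / \<sigma> i) powr p"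
  assumes p: "p > 0" and \<sigma>: "\<And>i. i \<in> {1..N} \<Longrightarrow> \<sigma> i > 0" and E: "E \<in> grassmannian N n"
  shows "t < section_radius N (p_ellipsoid N p \<sigma>) E \<longleftrightarrow>
    (\<exists>g\<in>PiE {1..N} (\<lambda>_. \<rat>). G (orth_proj N E (vec_of N g)) < 1 \<and> t < norm2 N (orth_proj N E (vec_of N g)))"
proof -
  note E' = grassmannianD(1,2)[OF E]
  have z: "0 \<in> E" using E'(1) by (rule subspace_0)
  have "t < section_radius N (p_ellipsoid N p \<sigma>) E \<longleftrightarrow> (\<exists>y\<in>E \<inter> p_ellipsoid N p \<sigma>. t < norm2 N y)"
    unfolding section_radius_def using z
    by (intro less_cSUP_iff bdd_above_section p \<sigma>) (auto intro: exI[of _ 0])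
  also have "\<dots> \<longleftrightarrow> (\<exists>g\<in>PiE {1..N} (\<lambda>_. \<rat>). G (orth_proj N E (vec_of N g)) < 1 \<and> t < norm2 N (orth_proj N E (vec_of N g)))"
  proof
    assume "\<exists>y\<in>E \<inter> p_ellipsoid N p \<sigma>. t < norm2 N y"
    then obtain y where y: "y \<in> E" "y \<in> p_ellipsoid N p \<sigma>" "t < norm2 N y" by auto
    have yR: "y \<in> Rn N" using y E' by auto
    \<comment> \<open>A factor \<theta> slightly below 1 moves \<open>y\<close> to the interior
      \<open>G < 1\<close> while its norm stays above \<open>t\<close>. The index
      \<open>Suc (Suc k)\<close> keeps \<theta> positive.\<close>
    have "(\<lambda>k. (1 - inverse (real (Suc (Suc k)))) * norm2 N y) \<longlonglongrightarrow> (1 - 0) * norm2 N y"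
      by (intro tendsto_intros LIMSEQ_Suc[OF LIMSEQ_inverse_real_of_nat])
    then have "eventually (\<lambda>k. t < (1 - inverse (real (Suc (Suc k)))) * norm2 N y) sequentially"
      using y(3) by (intro order_tendstoD) auto
    then obtain k where k: "t < (1 - inverse (real (Suc (Suc k)))) * norm2 N y"
      by (auto dest: eventually_happens)
    define \<theta> where "\<theta> = 1 - inverse (real (Suc (Suc k)))"
    have \<theta>: "0 < \<theta>" "\<theta> < 1" by (auto simp: \<theta>_def field_simps)
    define w where "w = \<theta> *\<^sub>R y"
    have w: "w \<in> E" "w \<in> Rn N" using y yR E'(1) by (auto simp: w_def subspace_scale)
    have tw: "t < norm2 N w" using k \<theta> by (simp add: w_def \<theta>_def)
    have "G w = \<theta> powr p * G y"
      unfolding G_def w_def sum_distrib_left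
    proof (rule sum.cong[OF refl])
      fix i assume i: "i \<in> {1..N}"
      have "\<bar>lk (\<theta> *\<^sub>R y) i\<bar> / \<sigma> i = \<theta> * (\<bar>lk y i\<bar> / \<sigma> i)"
        using \<theta> by (simp add: abs_mult)
      moreover have "0 \<le> \<bar>lk y i\<bar> / \<sigma> i" using \<sigma>[OF i] by simp
      ultimately show "(\<bar>lk (\<theta> *\<^sub>R y) i\<bar> / \<sigma> i) powr p = \<theta> powr p * (\<bar>lk y i\<bar> / \<sigma> i) powr p"
        using \<theta> by (simp only: powr_mult less_imp_le)
    qed
    also have "\<dots> \<le> \<theta> powr p * 1"
      using y(2) by (intro mult_left_mono) (auto simp: G_def p_ellipsoid_def)
    also have "\<dots> < 1" using powr_less_mono2[of p \<theta> 1] p \<theta> by simp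
    finally have Gw: "G w < 1" .
    have "\<exists>r. (\<forall>k. r k \<in> \<rat>) \<and> r \<longlonglongrightarrow> lk w i" for i
      using rational_sequence by metis
    then obtain r where r: "\<And>i k. r i k \<in> \<rat>" "\<And>i. r i \<longlonglongrightarrow> lk w i" by metis
    define q where "q k = vec_of N (restrict (\<lambda>i. r i k) {1..N})" for k
    have lim: "(\<lambda>k. lk (orth_proj N E (q k)) i) \<longlonglongrightarrow> lk w i" if i: "i \<in> {1..N}" for i
    proof -
      have e: "lk (orth_proj N E x) i = (\<Sum>j=1..N. lk x j * lk (orth_proj N E (unit_vec i)) j)" for x
        using orth_proj_symmetric[OF E', of x "unit_vec i"] i by (simp add: inner2_def[of N x])
      have "(\<lambda>k. \<Sum>j=1..N. lk (q k) j * lk (orth_proj N E (unit_vec i)) j)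
          \<longlonglongrightarrow> (\<Sum>j=1..N. lk w j * lk (orth_proj N E (unit_vec i)) j)"
        by (intro tendsto_intros) (auto simp: q_def r)
      then show ?thesis unfolding e[symmetric] orth_proj_id[OF E' w(1)] .
    qed
    have "(\<lambda>k. G (orth_proj N E (q k))) \<longlonglongrightarrow> G w"
      unfolding G_def
    proof (rule tendsto_sum)
      fix i assume i: "i \<in> {1..N}"
      have "\<sigma> i \<noteq> 0" and nn: "0 \<le> \<bar>lk (orth_proj N E (q k)) i\<bar> / \<sigma> i" for k
        using \<sigma>[OF i] by auto
      then have "(\<lambda>k. \<bar>lk (orth_proj N E (q k)) i\<bar> / \<sigma> i) \<longlonglongrightarrow> \<bar>lk w i\<bar> / \<sigma> i"
        by (intro tendsto_divide tendsto_rabs lim i tendsto_const)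
      then show "(\<lambda>k. (\<bar>lk (orth_proj N E (q k)) i\<bar> / \<sigma> i) powr p) \<longlonglongrightarrow> (\<bar>lk w i\<bar> / \<sigma> i) powr p"
        using nn p by (intro tendsto_powr' tendsto_const) (auto intro!: always_eventually)
    qed
    then have ev1: "eventually (\<lambda>k. G (orth_proj N E (q k)) < 1) sequentially"
      using Gw by (rule order_tendstoD)
    have "(\<lambda>k. norm2 N (orth_proj N E (q k))) \<longlonglongrightarrow> norm2 N w"
      unfolding norm2_def L2_set_def using lim by (intro tendsto_intros) auto
    then have "eventually (\<lambda>k. t < norm2 N (orth_proj N E (q k))) sequentially"
      using tw by (rule order_tendstoD)
    with ev1 have "eventually (\<lambda>k. G (orth_proj N E (q k)) < 1 \<and> t < norm2 N (orth_proj N E (q k))) sequentially"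
      by eventually_elim auto
    then obtain k where "G (orth_proj N E (q k)) < 1 \<and> t < norm2 N (orth_proj N E (q k))"
      by (auto dest: eventually_happens)
    then show "\<exists>g\<in>PiE {1..N} (\<lambda>_. \<rat>). G (orth_proj N E (vec_of N g)) < 1 \<and> t < norm2 N (orth_proj N E (vec_of N g))"
      unfolding q_def using r(1) by (intro bexI[of _ "restrict (\<lambda>i. r i k) {1..N}"]) auto
  next
    assume "\<exists>g\<in>PiE {1..N} (\<lambda>_. \<rat>). G (orth_proj N E (vec_of N g)) < 1 \<and> t < norm2 N (orth_proj N E (vec_of N g))"
    then obtain g where g: "G (orth_proj N E (vec_of N g)) < 1" "t < norm2 N (orth_proj N E (vec_of N g))"
      by blast
    have "orth_proj N E (vec_of N g) \<in> E \<inter> p_ellipsoid N p \<sigma>"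
      using g(1) orth_proj_in[OF E', of "vec_of N g"] orth_proj_in_Rn[OF E', of "vec_of N g"]
      unfolding p_ellipsoid_def G_def by simp
    with g(2) show "\<exists>y\<in>E \<inter> p_ellipsoid N p \<sigma>. t < norm2 N y" ..
  qed
  finally show ?thesis .
qed

lemma measurable_section_radius:
  assumes p: "p > 0" and \<sigma>: "\<And>i. i \<in> {1..N} \<Longrightarrow> \<sigma> i > 0"
  shows "section_radius N (p_ellipsoid N p \<sigma>) \<in> borel_measurable (grassmann_borel N n)"
  unfolding borel_measurable_iff_greater space_grassmann_borel
proof
  fix t :: real
  let ?D = "PiE {1..N} (\<lambda>_. \<rat>) :: (nat \<Rightarrow> real) set"
  let ?A = "\<lambda>g. {E \<in> space (grassmann_borel N n).
     (\<Sum>i=1..N. (\<bar>lk (orth_proj N E (vec_of N g)) i\<bar> / \<sigma> i) powr p) < 1 \<and> t < norm2 N (orth_proj N E (vec_of N g))}"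
  have "{E \<in> grassmannian N n. t < section_radius N (p_ellipsoid N p \<sigma>) E} = (\<Union>g\<in>?D. ?A g)"
  proof (rule set_eqI)
    fix E
    show "E \<in> {E \<in> grassmannian N n. t < section_radius N (p_ellipsoid N p \<sigma>) E} \<longleftrightarrow> E \<in> (\<Union>g\<in>?D. ?A g)"
    proof (cases "E \<in> grassmannian N n")
      case True
      show ?thesis
        using section_radius_gt_iff[where t = t, OF p \<sigma> True] True
        unfolding UN_iff mem_Collect_eq space_grassmann_borel by (simp only: True simp_thms)
    qed simp
  qed
  also have "\<dots> \<in> sets (grassmann_borel N n)"
  proof (rule sets.countable_UN'')
    show "countable ?D" by (intro countable_PiE) (auto simp: countable_rat)
    fix g
    note [measurable] = measurable_lookup_orth_proj[OF vec_of_in_Rn, of _ N g n]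
      measurable_norm2_orth_proj[OF vec_of_in_Rn, of N g n]
    show "?A g \<in> sets (grassmann_borel N n)"
      by measurable
  qed
  finally show "{E \<in> grassmannian N n. t < section_radius N (p_ellipsoid N p \<sigma>) E} \<in> sets (grassmann_borel N n)" .
qed

section \<open>Invariant probability measures on the Grassmannian\<close>

locale haar =
  fixes N n :: nat and \<mu> :: "fseq set measure"
  assumes haar: "normalized_haar N n \<mu>"
begin

sublocale prob_space \<mu>
  using haar by (simp add: normalized_haar_def)

lemma sets_haar [measurable_cong]: "sets \<mu> = sets (grassmann_borel N n)"
  using haar by (simp add: normalized_haar_def)

lemma space_haar: "space \<mu> = grassmannian N n"
  using sets_eq_imp_space_eq[OF sets_haar] by simp

text \<open>Invariance is stated for images of events. A reflection is its own inverse on subspaces,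
  so the image of the event of \<open>\<phi>\<close> is again given by a predicate, namely
  \<open>\<psi>\<close>.\<close>

lemma reflect_event:
  assumes v: "v \<in> Rn N" and m: "{E \<in> space \<mu>. \<phi> E} \<in> sets \<mu>"
    and inv: "\<And>E. E \<in> grassmannian N n \<Longrightarrow> \<psi> (reflect N v ` E) \<longleftrightarrow> \<phi> E"
  shows "measure \<mu> {E \<in> space \<mu>. \<psi> E} = measure \<mu> {E \<in> space \<mu>. \<phi> E}"
proof -
  have "(\<lambda>E. reflect N v ` E) ` {E \<in> space \<mu>. \<phi> E} = {E \<in> space \<mu>. \<psi> E}"
  proof (intro equalityI subsetI)
    fix F assume "F \<in> (\<lambda>E. reflect N v ` E) ` {E \<in> space \<mu>. \<phi> E}"
    then show "F \<in> {E \<in> space \<mu>. \<psi> E}"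
      using inv grassmannian_reflect[OF _ v] by (auto simp: space_haar)
  next
    fix F assume F: "F \<in> {E \<in> space \<mu>. \<psi> E}"
    then have G: "reflect N v ` F \<in> grassmannian N n"
      using grassmannian_reflect[OF _ v] by (auto simp: space_haar)
    have "\<phi> (reflect N v ` F)"
      using inv[OF G] F by (simp only: reflect_image_reflect_image) simp
    then show "F \<in> (\<lambda>E. reflect N v ` E) ` {E \<in> space \<mu>. \<phi> E}"
      using G by (intro image_eqI[of _ _ "reflect N v ` F"]) (simp_all add: space_haar)
  qed
  moreover have "emeasure \<mu> ((\<lambda>E. reflect N v ` E) ` {E \<in> space \<mu>. \<phi> E}) = emeasure \<mu> {E \<in> space \<mu>. \<phi> E}"
    using haar orthogonal_reflect[OF v] m unfolding normalized_haar_def by blast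
  ultimately show ?thesis by (simp add: measure_def)
qed

end

section \<open>Gaussian vectors\<close>

abbreviation gauss :: "'i set \<Rightarrow> ('i \<Rightarrow> real) measure" where
  "gauss I \<equiv> PiM I (\<lambda>_. std_normal_distribution)"

lemma prob_space_std_normal: "prob_space std_normal_distribution"
  by (rule prob_space_normal_density) simp

lemma prob_space_gauss: "prob_space (gauss I)"
  by (rule prob_space_PiM) (rule prob_space_std_normal)

lemma product_sigma_finite_gauss: "product_sigma_finite (\<lambda>_. std_normal_distribution)"
  by (simp add: product_sigma_finite_def prob_space_imp_sigma_finite prob_space_std_normal)

lemma pair_sigma_finite_gauss: "pair_sigma_finite (gauss I) (gauss J)"
  by (simp add: pair_sigma_finite_def prob_space_imp_sigma_finite prob_space_gauss)

section \<open>Gaussian exponential moments and characteristic functions\<close>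

lemma nn_integral_normal_density:
  "\<sigma> > 0 \<Longrightarrow> (\<integral>\<^sup>+x. ennreal (normal_density m \<sigma> x) \<partial>lborel) = 1"
  by (subst nn_integral_eq_integral) auto

text \<open>Completing the square: the tilted density is \<open>exp (t\<^sup>2 / 2)\<close> times
  the normal density with mean \<open>t\<close>.\<close>

lemma nn_integral_std_normal_exp:
  "(\<integral>\<^sup>+x. ennreal (exp (t * x)) \<partial>std_normal_distribution) = ennreal (exp (t\<^sup>2 / 2))"
proof -
  have eq: "std_normal_density x * exp (t * x) = exp (t\<^sup>2 / 2) * normal_density t 1 x" for x
  proof -
    have "exp (- x\<^sup>2 / 2) * exp (t * x) = exp (t\<^sup>2 / 2) * exp (- (x - t)\<^sup>2 / 2)"
      unfolding exp_add[symmetric] by (rule arg_cong[of _ _ exp]) (simp add: power2_eq_square field_simps)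
    then show ?thesis by (simp add: normal_density_def)
  qed
  have "(\<integral>\<^sup>+x. ennreal (exp (t * x)) \<partial>std_normal_distribution) =
      (\<integral>\<^sup>+x. ennreal (exp (t\<^sup>2 / 2)) * ennreal (normal_density t 1 x) \<partial>lborel)"
    by (subst nn_integral_density)
      (auto intro!: nn_integral_cong simp: ennreal_mult[symmetric] eq)
  also have "\<dots> = ennreal (exp (t\<^sup>2 / 2))"
    by (subst nn_integral_cmult) (auto simp: nn_integral_normal_density)
  finally show ?thesis .
qed

text \<open>For \<open>l < 1\<close> the tilted density is a centred normal density of standard
  deviation \<open>s = 1 / sqrt (1 - l)\<close>, multiplied by \<open>s\<close>.\<close>

lemma nn_integral_std_normal_exp_sq:
  assumes l: "l < 1"
  shows "(\<integral>\<^sup>+x. ennreal (exp (l * x\<^sup>2 / 2)) \<partial>std_normal_distribution) = ennreal (1 / sqrt (1 - l))"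
proof -
  define s where "s = 1 / sqrt (1 - l)"
  have s: "s > 0" "s\<^sup>2 = 1 / (1 - l)" using l by (auto simp: s_def power_divide)
  have eq: "std_normal_density x * exp (l * x\<^sup>2 / 2) = s * normal_density 0 s x" for x
  proof -
    have "exp (- x\<^sup>2 / 2) * exp (l * x\<^sup>2 / 2) = exp (- x\<^sup>2 / (2 * s\<^sup>2))"
      unfolding exp_add[symmetric] s(2) using l by (intro arg_cong[of _ _ exp]) (simp add: field_simps)
    moreover have "sqrt (2 * pi * s\<^sup>2) = sqrt (2 * pi) * s"
      using s(1) by (simp add: real_sqrt_mult)
    ultimately show ?thesis using s(1) by (simp add: normal_density_def)
  qed
  have "(\<integral>\<^sup>+x. ennreal (exp (l * x\<^sup>2 / 2)) \<partial>std_normal_distribution) =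
      (\<integral>\<^sup>+x. ennreal s * ennreal (normal_density 0 s x) \<partial>lborel)"
    using s(1) by (subst nn_integral_density)
      (auto intro!: nn_integral_cong simp: ennreal_mult[symmetric] eq)
  also have "\<dots> = ennreal s"
    using s(1) by (subst nn_integral_cmult) (auto simp: nn_integral_normal_density)
  finally show ?thesis by (simp add: s_def)
qed

lemma nn_integral_gauss_prod:
  assumes I: "finite I" and f: "\<And>i. i \<in> I \<Longrightarrow> f i \<in> borel_measurable borel"
    and nn: "\<And>i x. i \<in> I \<Longrightarrow> 0 \<le> f i x"
    and c: "\<And>i. i \<in> I \<Longrightarrow> (\<integral>\<^sup>+x. ennreal (f i x) \<partial>std_normal_distribution) = ennreal (c i)"
    and c0: "\<And>i. i \<in> I \<Longrightarrow> 0 \<le> c i"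
  shows "(\<integral>\<^sup>+g. ennreal (\<Prod>i\<in>I. f i (g i)) \<partial>gauss I) = ennreal (\<Prod>i\<in>I. c i)"
proof -
  interpret product_sigma_finite "\<lambda>_. std_normal_distribution"
    by (rule product_sigma_finite_gauss)
  have "(\<integral>\<^sup>+g. ennreal (\<Prod>i\<in>I. f i (g i)) \<partial>gauss I) = (\<integral>\<^sup>+g. (\<Prod>i\<in>I. ennreal (f i (g i))) \<partial>gauss I)"
    by (intro nn_integral_cong) (simp add: prod_ennreal nn)
  also have "\<dots> = (\<Prod>i\<in>I. \<integral>\<^sup>+x. ennreal (f i x) \<partial>std_normal_distribution)"
    using I f by (intro product_nn_integral_prod) auto
  also have "\<dots> = ennreal (\<Prod>i\<in>I. c i)"
    using c c0 by (simp add: prod_ennreal)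
  finally show ?thesis .
qed

lemma nn_integral_gauss_exp_linear:
  assumes I: "finite I"
  shows "(\<integral>\<^sup>+g. ennreal (exp (\<Sum>i\<in>I. a i * g i)) \<partial>gauss I) = ennreal (exp ((\<Sum>i\<in>I. (a i)\<^sup>2) / 2))"
proof -
  have "(\<integral>\<^sup>+g. ennreal (\<Prod>i\<in>I. exp (a i * g i)) \<partial>gauss I) = ennreal (\<Prod>i\<in>I. exp ((a i)\<^sup>2 / 2))"
    using I by (intro nn_integral_gauss_prod nn_integral_std_normal_exp) auto
  then show ?thesis
    using I by (simp add: exp_sum[symmetric] sum_divide_distrib)
qed

lemma nn_integral_gauss_exp_sq:
  assumes I: "finite I" and l: "l < 1"
  shows "(\<integral>\<^sup>+g. ennreal (exp (l * (\<Sum>i\<in>I. (g i)\<^sup>2) / 2)) \<partial>gauss I) = ennreal ((1 / sqrt (1 - l)) ^ card I)"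
proof -
  have "(\<integral>\<^sup>+g. ennreal (\<Prod>i\<in>I. exp (l * (g i)\<^sup>2 / 2)) \<partial>gauss I) = ennreal (\<Prod>i\<in>I. 1 / sqrt (1 - l))"
    using I l by (intro nn_integral_gauss_prod nn_integral_std_normal_exp_sq) auto
  then show ?thesis
    using I by (simp add: exp_sum[symmetric] sum_divide_distrib sum_distrib_left)
qed

lemma integral_gauss_iexp_linear:
  assumes I: "finite I"
  shows "(CLINT g|gauss I. iexp (\<Sum>i\<in>I. a i * g i)) = complex_of_real (exp (- (\<Sum>i\<in>I. (a i)\<^sup>2) / 2))"
proof -
  interpret product_sigma_finite "\<lambda>_. std_normal_distribution"
    by (rule product_sigma_finite_gauss)
  interpret s: prob_space std_normal_distribution by (rule prob_space_std_normal)
  have "(CLINT g|gauss I. iexp (\<Sum>i\<in>I. a i * g i)) = (CLINT g|gauss I. (\<Prod>i\<in>I. iexp (a i * g i)))"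
    using I by (simp add: exp_sum[symmetric] sum_distrib_left)
  also have "\<dots> = (\<Prod>i\<in>I. CLINT x|std_normal_distribution. iexp (a i * x))"
    using I by (intro product_integral_prod s.integrable_const_bound[where B = 1]) auto
  also have "\<dots> = (\<Prod>i\<in>I. complex_of_real (exp (- (a i)\<^sup>2 / 2)))"
    using char_std_normal_distribution by (simp add: char_def fun_eq_iff)
  also have "\<dots> = complex_of_real (exp (- (\<Sum>i\<in>I. (a i)\<^sup>2) / 2))"
    using I by (simp add: exp_sum[symmetric] sum_divide_distrib sum_negf of_real_prod[symmetric] del: of_real_prod)
  finally show ?thesis .
qed

lemma (in prob_space) exp_Markov:
  assumes X [measurable]: "X \<in> borel_measurable M"
    and c: "(\<integral>\<^sup>+x. ennreal (exp (X x)) \<partial>M) \<le> ennreal c" "0 \<le> c"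
  shows "measure M {x \<in> space M. u \<le> X x} \<le> c * exp (- u)"
proof -
  have "emeasure M {x \<in> space M. u \<le> X x} = (\<integral>\<^sup>+x. indicator {x \<in> space M. u \<le> X x} x \<partial>M)"
    by simp
  also have "\<dots> \<le> (\<integral>\<^sup>+x. ennreal (exp (- u)) * ennreal (exp (X x)) \<partial>M)"
  proof (rule nn_integral_mono)
    fix x
    have "1 \<le> exp (- u) * exp (X x)" if "u \<le> X x"
      unfolding exp_add[symmetric] using that by simp
    then show "indicator {x \<in> space M. u \<le> X x} x \<le> ennreal (exp (- u)) * ennreal (exp (X x))"
      unfolding ennreal_mult[OF exp_ge_zero exp_ge_zero, symmetric]
      by (auto simp: indicator_def simp flip: ennreal_1)
  qed
  also have "\<dots> = ennreal (exp (- u)) * (\<integral>\<^sup>+x. ennreal (exp (X x)) \<partial>M)"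
    by (rule nn_integral_cmult) measurable
  also have "\<dots> \<le> ennreal (exp (- u)) * ennreal c"
    using c by (intro mult_left_mono) auto
  also have "\<dots> = ennreal (c * exp (- u))"
    using c by (simp add: ennreal_mult[symmetric] mult.commute)
  finally show ?thesis
    using c by (simp add: emeasure_eq_measure)
qed

section \<open>Sums of squares of Gaussian coordinates in an orthonormal system\<close>

lemma orthonormal_norm2_sum:
  assumes F: "orthonormal N F"
  shows "(\<Sum>i=1..N. (\<Sum>f\<in>F. c f * lk f i)\<^sup>2) = (\<Sum>f\<in>F. (c f)\<^sup>2)"
proof -
  let ?y = "\<Sum>f\<in>F. c f *\<^sub>R f"
  have "(\<Sum>i=1..N. (\<Sum>f\<in>F. c f * lk f i)\<^sup>2) = inner2 N ?y ?y"
    unfolding norm2_sq[symmetric] norm2_sq_sum by (simp add: lookup_sum)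
  also have "\<dots> = (\<Sum>f\<in>F. c f * inner2 N ?y f)"
    by (simp add: inner2_sum_right[of N ?y])
  also have "\<dots> = (\<Sum>f\<in>F. (c f)\<^sup>2)"
    using orthonormal_inner2_sum[OF F] by (intro sum.cong) (auto simp: power2_eq_square)
  finally show ?thesis .
qed

lemma inner2_vec_of: "inner2 N (vec_of N g) f = (\<Sum>i=1..N. g i * lk f i)"
  by (simp add: inner2_def)

lemma sum_inner2_vec_of:
  assumes "finite F"
  shows "(\<Sum>f\<in>F. c f * inner2 N (vec_of N g) f) = (\<Sum>i=1..N. (\<Sum>f\<in>F. c f * lk f i) * g i)"
  unfolding inner2_vec_of sum_distrib_left sum_distrib_right
  by (subst sum.swap) (simp add: mult_ac)

lemma measurable_inner2_vec_of [measurable]: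
  "(\<lambda>g. inner2 N (vec_of N g) f) \<in> borel_measurable (gauss {1..N})"
  unfolding inner2_vec_of by measurable

lemmas measurable_inner2_vec_of_Suc [measurable] = measurable_inner2_vec_of[unfolded One_nat_def]

text \<open>The square is linearised: \<open>exp (l * c\<^sup>2 / 2)\<close> is the mean of
  \<open>exp (sqrt l * h * c)\<close> over an independent standard normal \<open>h\<close>, one for
  each \<open>f\<close>. After Fubini the integral over \<open>g\<close> is that of the exponential
  of a linear form, and orthonormality reduces its variance to a sum of the
  \<open>(h f)\<^sup>2\<close>. This takes the place of rotation invariance of the Gaussian
  measure.\<close>

lemma gauss_exp_sq_upper:
  assumes F: "orthonormal N F" and l: "0 \<le> l" "l < 1"
  shows "(\<integral>\<^sup>+g. ennreal (exp (l * (\<Sum>f\<in>F. (inner2 N (vec_of N g) f)\<^sup>2) / 2)) \<partial>gauss {1..N}) =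
    ennreal ((1 / sqrt (1 - l)) ^ card F)"
proof -
  interpret pair_sigma_finite "gauss {1..N}" "gauss F" by (rule pair_sigma_finite_gauss)
  have finF: "finite F" using F by (rule orthonormalD)
  let ?c = "\<lambda>g f. inner2 N (vec_of N g) f"
  have inner: "ennreal (exp (l * (\<Sum>f\<in>F. (?c g f)\<^sup>2) / 2)) =
      (\<integral>\<^sup>+h. ennreal (exp (\<Sum>f\<in>F. sqrt l * h f * ?c g f)) \<partial>gauss F)" for g
    using nn_integral_gauss_exp_linear[OF finF, of "\<lambda>f. sqrt l * ?c g f"] l
    by (simp add: power_mult_distrib sum_distrib_left mult_ac)
  have outer: "(\<integral>\<^sup>+g. ennreal (exp (\<Sum>f\<in>F. sqrt l * h f * ?c g f)) \<partial>gauss {1..N}) =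
      ennreal (exp (l * (\<Sum>f\<in>F. (h f)\<^sup>2) / 2))" for h
  proof -
    have "(\<Sum>f\<in>F. sqrt l * h f * ?c g f) = (\<Sum>i=1..N. (\<Sum>f\<in>F. sqrt l * h f * lk f i) * g i)" for g
      by (rule sum_inner2_vec_of[OF finF])
    then have "(\<integral>\<^sup>+g. ennreal (exp (\<Sum>f\<in>F. sqrt l * h f * ?c g f)) \<partial>gauss {1..N}) =
       ennreal (exp ((\<Sum>i=1..N. (\<Sum>f\<in>F. sqrt l * h f * lk f i)\<^sup>2) / 2))"
      using nn_integral_gauss_exp_linear[of "{1..N}" "\<lambda>i. \<Sum>f\<in>F. sqrt l * h f * lk f i"] by simp
    then show ?thesis
      unfolding orthonormal_norm2_sum[OF F, of "\<lambda>f. sqrt l * h f"]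
      using l by (simp add: power_mult_distrib sum_distrib_left)
  qed
  have "(\<integral>\<^sup>+g. ennreal (exp (l * (\<Sum>f\<in>F. (?c g f)\<^sup>2) / 2)) \<partial>gauss {1..N}) =
      (\<integral>\<^sup>+g. (\<integral>\<^sup>+h. ennreal (exp (\<Sum>f\<in>F. sqrt l * h f * ?c g f)) \<partial>gauss F) \<partial>gauss {1..N})"
    unfolding inner ..
  also have "\<dots> = (\<integral>\<^sup>+h. (\<integral>\<^sup>+g. ennreal (exp (\<Sum>f\<in>F. sqrt l * h f * ?c g f)) \<partial>gauss {1..N}) \<partial>gauss F)"
    by (rule Fubini'[symmetric]) (simp add: inner2_vec_of split_def)
  also have "\<dots> = ennreal ((1 / sqrt (1 - l)) ^ card F)"
    unfolding outer by (rule nn_integral_gauss_exp_sq[OF finF l(2)])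
  finally show ?thesis .
qed

text \<open>With a negative exponent the linearisation needs an imaginary factor, so characteristic
  functions replace moment generating functions. The integrand has modulus one, which settles
  integrability for Fubini.\<close>

lemma gauss_exp_sq_lower:
  assumes F: "orthonormal N F" and s: "0 \<le> s"
  shows "(\<integral>\<^sup>+g. ennreal (exp (- s * (\<Sum>f\<in>F. (inner2 N (vec_of N g) f)\<^sup>2) / 2)) \<partial>gauss {1..N}) =
    ennreal ((1 / sqrt (1 + s)) ^ card F)"
proof -
  interpret pair_sigma_finite "gauss {1..N}" "gauss F" by (rule pair_sigma_finite_gauss)
  interpret P1: prob_space "gauss {1..N}" by (rule prob_space_gauss)
  interpret P2: prob_space "gauss F" by (rule prob_space_gauss)
  interpret P: pair_prob_space "gauss {1..N}" "gauss F" ..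
  have finF: "finite F" using F by (rule orthonormalD)
  let ?c = "\<lambda>g f. inner2 N (vec_of N g) f"
  have inner: "complex_of_real (exp (- s * (\<Sum>f\<in>F. (?c g f)\<^sup>2) / 2)) =
      (CLINT h|gauss F. iexp (\<Sum>f\<in>F. sqrt s * h f * ?c g f))" for g
  proof -
    have "(\<Sum>f\<in>F. (sqrt s * ?c g f)\<^sup>2) = s * (\<Sum>f\<in>F. (?c g f)\<^sup>2)"
      using s by (simp add: power_mult_distrib sum_distrib_left)
    then show ?thesis
      using integral_gauss_iexp_linear[OF finF, of "\<lambda>f. sqrt s * ?c g f"]
      by (simp only: mult_ac minus_mult_left)
  qed
  have outer: "(CLINT g|gauss {1..N}. iexp (\<Sum>f\<in>F. sqrt s * h f * ?c g f)) =
      complex_of_real (exp (- s * (\<Sum>f\<in>F. (h f)\<^sup>2) / 2))" for h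
  proof -
    have "(\<Sum>f\<in>F. sqrt s * h f * ?c g f) = (\<Sum>i=1..N. (\<Sum>f\<in>F. sqrt s * h f * lk f i) * g i)" for g
      by (rule sum_inner2_vec_of[OF finF])
    then have "(CLINT g|gauss {1..N}. iexp (\<Sum>f\<in>F. sqrt s * h f * ?c g f)) =
       complex_of_real (exp (- (\<Sum>i=1..N. (\<Sum>f\<in>F. sqrt s * h f * lk f i)\<^sup>2) / 2))"
      using integral_gauss_iexp_linear[of "{1..N}" "\<lambda>i. \<Sum>f\<in>F. sqrt s * h f * lk f i"] by simp
    then show ?thesis
      unfolding orthonormal_norm2_sum[OF F, of "\<lambda>f. sqrt s * h f"]
      using s by (simp add: power_mult_distrib sum_distrib_left sum_negf)
  qed
  have [measurable]: "(\<lambda>x. iexp (\<Sum>f\<in>F. sqrt s * snd x f * ?c (fst x) f)) \<in> borel_measurable (gauss {1..N} \<Otimes>\<^sub>M gauss F)"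
    by (simp add: inner2_vec_of)
  have int: "integrable (gauss {1..N} \<Otimes>\<^sub>M gauss F) (\<lambda>(g, h). iexp (\<Sum>f\<in>F. sqrt s * h f * ?c g f))"
    unfolding split_def by (rule P.integrable_const_bound[where B = 1]) auto
  have "complex_of_real (LINT g|gauss {1..N}. exp (- s * (\<Sum>f\<in>F. (?c g f)\<^sup>2) / 2)) =
      (CLINT g|gauss {1..N}. complex_of_real (exp (- s * (\<Sum>f\<in>F. (?c g f)\<^sup>2) / 2)))"
    by (rule integral_complex_of_real[symmetric])
  also have "\<dots> = (CLINT h|gauss F. CLINT g|gauss {1..N}. iexp (\<Sum>f\<in>F. sqrt s * h f * ?c g f))"
    unfolding inner by (rule Fubini_integral[symmetric]) (rule int)
  also have "\<dots> = complex_of_real (LINT h|gauss F. exp (- s * (\<Sum>f\<in>F. (h f)\<^sup>2) / 2))"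
    unfolding outer by (rule integral_complex_of_real)
  finally have eq: "(LINT g|gauss {1..N}. exp (- s * (\<Sum>f\<in>F. (?c g f)\<^sup>2) / 2)) =
      (LINT h|gauss F. exp (- s * (\<Sum>f\<in>F. (h f)\<^sup>2) / 2))"
    by (simp only: of_real_eq_iff)
  have le1: "exp (- s * (\<Sum>f\<in>F. (k f)\<^sup>2) / 2) \<le> 1" for k :: "fseq \<Rightarrow> real"
    using s by (simp add: sum_nonneg)
  have "(\<integral>\<^sup>+g. ennreal (exp (- s * (\<Sum>f\<in>F. (?c g f)\<^sup>2) / 2)) \<partial>gauss {1..N}) =
      ennreal (LINT g|gauss {1..N}. exp (- s * (\<Sum>f\<in>F. (?c g f)\<^sup>2) / 2))"
  proof (rule nn_integral_eq_integral)
    show "integrable (gauss {1..N}) (\<lambda>g. exp (- s * (\<Sum>f\<in>F. (?c g f)\<^sup>2) / 2))"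
      by (rule P1.integrable_const_bound[where B = 1]) (use le1 in \<open>auto intro!: AE_I2\<close>)
  qed simp
  also have "\<dots> = (\<integral>\<^sup>+h. ennreal (exp (- s * (\<Sum>f\<in>F. (h f)\<^sup>2) / 2)) \<partial>gauss F)"
    unfolding eq
  proof (rule nn_integral_eq_integral[symmetric])
    show "integrable (gauss F) (\<lambda>h. exp (- s * (\<Sum>f\<in>F. (h f)\<^sup>2) / 2))"
      by (rule P2.integrable_const_bound[where B = 1]) (use le1 in \<open>auto intro!: AE_I2\<close>)
  qed simp
  also have "\<dots> = ennreal ((1 / sqrt (1 + s)) ^ card F)"
    using nn_integral_gauss_exp_sq[OF finF, of "- s"] s by simp
  finally show ?thesis .
qed

text \<open>Chernoff at \<open>l = 1/2\<close>, where each degree of freedom contributes the factor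
  \<open>sqrt 2\<close>.\<close>

lemma gauss_sq_upper:
  assumes F: "orthonormal N F"
  shows "measure (gauss {1..N}) {g \<in> space (gauss {1..N}). u \<le> (\<Sum>f\<in>F. (inner2 N (vec_of N g) f)\<^sup>2)}
    \<le> sqrt 2 ^ card F * exp (- u / 4)"
proof -
  interpret prob_space "gauss {1..N}" by (rule prob_space_gauss)
  have "measure (gauss {1..N}) {g \<in> space (gauss {1..N}). u / 4 \<le> (1/2) * (\<Sum>f\<in>F. (inner2 N (vec_of N g) f)\<^sup>2) / 2}
    \<le> (1 / sqrt (1 - 1/2)) ^ card F * exp (- (u / 4))"
    by (rule exp_Markov) (simp_all add: gauss_exp_sq_upper[OF F, of "1/2", simplified])
  then show ?thesis by (simp add: real_sqrt_divide)
qed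

text \<open>\<open>s\<close> stays free: a large \<open>s\<close> reaches any prescribed exponential
  rate at the price of a small threshold \<open>u\<close>.\<close>

lemma gauss_sq_lower:
  assumes F: "orthonormal N F" and s: "0 < s"
  shows "measure (gauss {1..N}) {g \<in> space (gauss {1..N}). (\<Sum>f\<in>F. (inner2 N (vec_of N g) f)\<^sup>2) \<le> u}
    \<le> (1 / sqrt (1 + s)) ^ card F * exp (s * u / 2)"
proof -
  interpret prob_space "gauss {1..N}" by (rule prob_space_gauss)
  have "measure (gauss {1..N}) {g \<in> space (gauss {1..N}). - s * u / 2 \<le> - s * (\<Sum>f\<in>F. (inner2 N (vec_of N g) f)\<^sup>2) / 2}
    \<le> (1 / sqrt (1 + s)) ^ card F * exp (- (- s * u / 2))"
  proof (rule exp_Markov)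
    show "(\<integral>\<^sup>+g. ennreal (exp (- s * (\<Sum>f\<in>F. (inner2 N (vec_of N g) f)\<^sup>2) / 2)) \<partial>gauss {1..N})
        \<le> ennreal ((1 / sqrt (1 + s)) ^ card F)"
      using gauss_exp_sq_lower[OF F, of s] s by simp
  qed (use s in auto)
  then show ?thesis using s by simp
qed

lemma gauss_linear_upper:
  assumes a: "norm2 N a \<le> 1" and t: "0 \<le> t"
  shows "measure (gauss {1..N}) {g \<in> space (gauss {1..N}). t \<le> inner2 N (vec_of N g) a} \<le> exp (- t\<^sup>2 / 2)"
proof (cases "t = 0")
  case True
  then show ?thesis using prob_space.prob_le_1[OF prob_space_gauss] by simp
next
  case False
  interpret prob_space "gauss {1..N}" by (rule prob_space_gauss)
  have "(\<integral>\<^sup>+g. ennreal (exp (t * inner2 N (vec_of N g) a)) \<partial>gauss {1..N}) =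
      ennreal (exp (t\<^sup>2 * (norm2 N a)\<^sup>2 / 2))"
    using nn_integral_gauss_exp_linear[of "{1..N}" "\<lambda>i. t * lk a i"]
    by (simp add: inner2_vec_of norm2_sq_sum power_mult_distrib sum_distrib_left mult_ac)
  also have "\<dots> \<le> ennreal (exp (t\<^sup>2 / 2))"
    using a by (intro ennreal_leI) (simp add: power_le_one mult_left_le)
  finally have "measure (gauss {1..N}) {g \<in> space (gauss {1..N}). t\<^sup>2 \<le> t * inner2 N (vec_of N g) a} \<le>
      exp (t\<^sup>2 / 2) * exp (- t\<^sup>2)"
    by (intro exp_Markov) auto
  then show ?thesis
    using t False by (simp add: power2_eq_square exp_add[symmetric])
qed

section \<open>The residual of a single vector\<close>

declare One_nat_def [simp del]

lemma vec_of_expand: "vec_of N g = (\<Sum>i=1..N. g i *\<^sub>R unit_vec i)"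
  by (rule Rn_eqI[of _ N])
    (auto simp: lookup_sum if_distrib intro!: Rn_sum Rn_scale unit_vec_in_Rn cong: if_cong)

text \<open>
  Chosen so that \<open>1 / (22 * resid_const) = exp 11\<close>: this makes the lower tail of a \<open>\<chi>\<^sup>2\<close> variable
  with \<open>n\<close> degrees of freedom at most \<open>exp (- 5 * n)\<close>.
\<close>

definition resid_const :: real where "resid_const = exp (- 11) / 22"

context haar
begin

lemma measurable_inner_orth_proj_haar [measurable]:
  assumes "x \<in> Rn N"
  shows "(\<lambda>E. inner2 N (orth_proj N E x) y) \<in> borel_measurable \<mu>"
  using measurable_inner_orth_proj[OF assms, of y n] by (simp cong: measurable_cong_sets add: sets_haar)

lemma measurable_norm2_orth_proj_haar [measurable]:
  assumes "x \<in> Rn N"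
  shows "(\<lambda>E. norm2 N (orth_proj N E x)) \<in> borel_measurable \<mu>"
  using measurable_norm2_orth_proj[OF assms, of n] by (simp cong: measurable_cong_sets add: sets_haar)

lemma measurable_norm2_resid_haar [measurable]:
  assumes "x \<in> Rn N"
  shows "(\<lambda>E. norm2 N (x - orth_proj N E x)) \<in> borel_measurable \<mu>"
  using measurable_norm2_resid[OF assms, of n] by (simp cong: measurable_cong_sets add: sets_haar)

text \<open>For joint measurability in \<open>E\<close> and \<open>g\<close>: the squared residual
  is a polynomial in \<open>g\<close> whose coefficients are measurable functions of
  \<open>E\<close> alone.\<close>

lemma norm2_resid_vec_of:
  assumes E: "E \<in> grassmannian N n"
  shows "(norm2 N (vec_of N g - orth_proj N E (vec_of N g)))\<^sup>2 = (\<Sum>i=1..N. (g i)\<^sup>2) -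
    (\<Sum>i=1..N. \<Sum>j=1..N. g i * g j * inner2 N (orth_proj N E (unit_vec i)) (unit_vec j))"
proof -
  note E' = grassmannianD(1,2)[OF E]
  have "inner2 N (orth_proj N E (vec_of N g)) (vec_of N g) =
      (\<Sum>i=1..N. \<Sum>j=1..N. g i * g j * inner2 N (orth_proj N E (unit_vec i)) (unit_vec j))"
    unfolding vec_of_expand orth_proj_sum[OF E'] orth_proj_scale[OF E'] inner2_sum_left inner2_sum_right
      inner2_scale_left inner2_scale_right
    by (subst sum.swap) (simp add: sum_distrib_left mult_ac del: inner2_unit_vec_right)
  moreover have "(norm2 N (vec_of N g))\<^sup>2 = (\<Sum>i=1..N. (g i)\<^sup>2)"
    by (simp add: norm2_sq_sum)
  ultimately show ?thesis
    using orth_proj_pythagoras[OF E', of "vec_of N g"] orth_proj_inner_self[OF E', of "vec_of N g"]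
    by simp
qed

lemma measurable_resid_pair [measurable]:
  "(\<lambda>x. (norm2 N (vec_of N (snd x) - orth_proj N (fst x) (vec_of N (snd x))))\<^sup>2)
    \<in> borel_measurable (\<mu> \<Otimes>\<^sub>M gauss {1..N})"
proof -
  have [measurable]: "(\<lambda>E. inner2 N (orth_proj N E (unit_vec i)) (unit_vec j)) \<in> borel_measurable \<mu>"
    if "i \<in> {1..N}" for i j
    using that unit_vec_in_Rn by (intro measurable_inner_orth_proj_haar) blast
  have "(\<lambda>x. (\<Sum>i=1..N. (snd x i)\<^sup>2) -
    (\<Sum>i=1..N. \<Sum>j=1..N. snd x i * snd x j * inner2 N (orth_proj N (fst x) (unit_vec i)) (unit_vec j)))
    \<in> borel_measurable (\<mu> \<Otimes>\<^sub>M gauss {1..N})"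
    by measurable
  then show ?thesis
    by (rule measurable_cong[THEN iffD1, rotated])
      (auto simp: space_pair_measure space_haar norm2_resid_vec_of simp del: inner2_unit_vec_right)
qed

text \<open>
  A deterministic vector has the same residual law as a Gaussian one of the same norm, while for a
  fixed subspace the Gaussian residual is a \<open>\<chi>\<^sup>2\<close> variable. An event on the product space whose
  sections are bounded below in \<open>g\<close> and above in \<open>E\<close> therefore transfers Gaussian tail bounds to \<open>\<mu>\<close>.
\<close>

lemma haar_gauss_exchange:
  assumes m: "{x \<in> space (\<mu> \<Otimes>\<^sub>M gauss {1..N}). \<Phi> (fst x) (snd x)} \<in> sets (\<mu> \<Otimes>\<^sub>M gauss {1..N})"
    and up: "\<And>E. E \<in> space \<mu> \<Longrightarrow> measure (gauss {1..N}) {g \<in> space (gauss {1..N}). \<Phi> E g} \<le> B"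
    and lo: "\<And>g. g \<in> space (gauss {1..N}) \<Longrightarrow> c \<le> measure \<mu> {E \<in> space \<mu>. \<Phi> E g}"
  shows "c \<le> B"
proof -
  let ?\<gamma> = "gauss {1..N} :: (nat \<Rightarrow> real) measure"
  let ?A = "{x \<in> space (\<mu> \<Otimes>\<^sub>M ?\<gamma>). \<Phi> (fst x) (snd x)}"
  interpret G: prob_space ?\<gamma> by (rule prob_space_gauss)
  interpret P: pair_prob_space \<mu> ?\<gamma> ..
  have B0: "0 \<le> B"
    using up not_empty by (meson all_not_in_conv measure_nonneg order_trans)
  have "ennreal c = (\<integral>\<^sup>+g. ennreal c \<partial>?\<gamma>)"
    by (simp only: nn_integral_const G.emeasure_space_1 mult_1_right)
  also have "\<dots> \<le> (\<integral>\<^sup>+g. emeasure \<mu> ((\<lambda>x. (x, g)) -` ?A) \<partial>?\<gamma>)"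
  proof (rule nn_integral_mono)
    fix g assume g: "g \<in> space ?\<gamma>"
    then have "(\<lambda>x. (x, g)) -` ?A = {E \<in> space \<mu>. \<Phi> E g}"
      by (auto simp: space_pair_measure)
    then show "ennreal c \<le> emeasure \<mu> ((\<lambda>x. (x, g)) -` ?A)"
      using lo[OF g] by (simp add: emeasure_eq_measure ennreal_leI)
  qed
  also have "\<dots> = emeasure (\<mu> \<Otimes>\<^sub>M ?\<gamma>) ?A"
    by (rule P.emeasure_pair_measure_alt2[symmetric, OF m])
  also have "\<dots> = (\<integral>\<^sup>+E. emeasure ?\<gamma> (Pair E -` ?A) \<partial>\<mu>)"
    by (rule G.emeasure_pair_measure_alt[OF m])
  also have "\<dots> \<le> (\<integral>\<^sup>+E. ennreal B \<partial>\<mu>)"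
  proof (rule nn_integral_mono)
    fix E assume E: "E \<in> space \<mu>"
    then have "Pair E -` ?A = {g \<in> space ?\<gamma>. \<Phi> E g}"
      by (auto simp: space_pair_measure)
    then show "emeasure ?\<gamma> (Pair E -` ?A) \<le> ennreal B"
      using up[OF E] by (simp add: G.emeasure_eq_measure ennreal_leI)
  qed
  also have "\<dots> = ennreal B" by (simp add: emeasure_space_1)
  finally show ?thesis using B0 by simp
qed

text \<open>The reflection along \<open>x - y\<close> moves \<open>x\<close> to \<open>y\<close>
  and, by equivariance of the projection, the residual of \<open>x\<close> to that of
  \<open>y\<close>, while \<open>\<mu>\<close> is preserved.\<close>

lemma resid_law:
  assumes x: "x \<in> Rn N" and y: "y \<in> Rn N" and xy: "norm2 N x = norm2 N y"
    and m: "{E \<in> space \<mu>. P (norm2 N (x - orth_proj N E x))} \<in> sets \<mu>"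
  shows "measure \<mu> {E \<in> space \<mu>. P (norm2 N (y - orth_proj N E y))} =
    measure \<mu> {E \<in> space \<mu>. P (norm2 N (x - orth_proj N E x))}"
proof (rule reflect_event[OF Rn_diff[OF x y] m])
  fix E assume E: "E \<in> grassmannian N n"
  let ?U = "reflect N (x - y)"
  have "y - orth_proj N (?U ` E) y = ?U x - orth_proj N (?U ` E) (?U x)"
    by (simp add: reflect_maps[OF x y xy])
  also have "\<dots> = ?U (x - orth_proj N E x)"
    by (simp add: orth_proj_reflect[OF E Rn_diff[OF x y]] linear_diff[OF linear_reflect])
  finally show "P (norm2 N (y - orth_proj N (?U ` E) y)) \<longleftrightarrow> P (norm2 N (x - orth_proj N E x))"
    by (simp add: norm2_reflect)
qed

lemma norm2_resid_scale:
  assumes "E \<in> space \<mu>"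
  shows "norm2 N (c *\<^sub>R x - orth_proj N E (c *\<^sub>R x)) = \<bar>c\<bar> * norm2 N (x - orth_proj N E x)"
  using orth_proj_scale[OF grassmannianD(1,2)] assms
  by (simp add: space_haar scaleR_diff_right[symmetric])

lemma resid_law_normalized:
  assumes x: "x \<in> Rn N" "norm2 N x = 1" and y: "y \<in> Rn N" "y \<noteq> 0"
    and m: "{E \<in> space \<mu>. P (norm2 N (x - orth_proj N E x))} \<in> sets \<mu>"
  shows "measure \<mu> {E \<in> space \<mu>. P (norm2 N (y - orth_proj N E y) / norm2 N y)} =
    measure \<mu> {E \<in> space \<mu>. P (norm2 N (x - orth_proj N E x))}"
proof -
  define z where "z = inverse (norm2 N y) *\<^sub>R y"
  have np: "norm2 N y > 0" using norm2_pos y by blast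
  have z: "z \<in> Rn N" "norm2 N x = norm2 N z"
    using x y np by (auto simp: z_def)
  have "{E \<in> space \<mu>. P (norm2 N (y - orth_proj N E y) / norm2 N y)} =
      {E \<in> space \<mu>. P (norm2 N (z - orth_proj N E z))}"
    unfolding z_def using np by (auto simp: norm2_resid_scale divide_inverse mult.commute)
  then show ?thesis using resid_law[OF x(1) z m] by simp
qed

text \<open>\<open>gauss_sq_lower\<close> with \<open>s = 1\<close> has exponent
  \<open>1/4 - ln 2 / 2\<close> per coordinate, which is at most \<open>-1/12\<close> because
  \<open>ln 2 \<ge> 2/3\<close>.\<close>

lemma gauss_norm_small:
  assumes I: "I \<subseteq> {1..N}"
  shows "measure (gauss {1..N}) {g \<in> space (gauss {1..N}). (\<Sum>i\<in>I. (g i)\<^sup>2) \<le> real (card I) / 2}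
    \<le> exp (- real (card I) / 12)"
proof -
  have inj: "inj_on unit_vec I" by (rule inj_on_subset[OF inj_unit_vec]) simp
  have "(\<Sum>f\<in>unit_vec ` I. (inner2 N (vec_of N g) f)\<^sup>2) = (\<Sum>i\<in>I. (g i)\<^sup>2)" for g
    unfolding sum.reindex[OF inj] using I by (intro sum.cong) auto
  then have "measure (gauss {1..N}) {g \<in> space (gauss {1..N}). (\<Sum>i\<in>I. (g i)\<^sup>2) \<le> real (card I) / 2}
      \<le> (1 / sqrt 2) ^ card I * exp (real (card I) / 4)"
    using gauss_sq_lower[OF orthonormal_unit_vecs[OF I], of 1 "real (card I) / 2"]
    by (simp add: card_unit_vecs)
  also have "(1 / sqrt 2) ^ card I = exp (real (card I) * (- ln 2 / 2))"
  proof -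
    have "1 / sqrt 2 = exp (- ln 2 / 2)"
      by (simp add: exp_minus ln_sqrt[symmetric] inverse_eq_divide flip: exp_ln)
    then show ?thesis by (simp only: exp_of_nat_mult)
  qed
  also have "exp (real (card I) * (- ln 2 / 2)) * exp (real (card I) / 4) \<le> exp (- real (card I) / 12)"
  proof -
    have "real (card I) * (- ln 2 / 2) + real (card I) / 4 = real (card I) * (1 / 4 - ln 2 / 2)"
      by (simp add: algebra_simps)
    also have "\<dots> \<le> real (card I) * (- 1 / 12)"
      using ln2_ge_two_thirds by (intro mult_left_mono) auto
    finally show ?thesis unfolding exp_add[symmetric] by simp
  qed
  finally show ?thesis by simp
qed

lemma exp_half_ge_sqrt2: "sqrt 2 \<le> exp (1 / 2 :: real)"
proof -
  have "(2::real) \<le> (exp (1 / 2))\<^sup>2"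
    using exp_ge_add_one_self[of "1::real"] by (simp add: exp_double[symmetric])
  then show ?thesis by (rule real_le_lsqrt[rotated 1]) auto
qed

text \<open>With \<open>g / |g|\<close> in place of \<open>x\<close>, a squared residual above
  \<open>a\<close> forces \<open>|Q g|^2 \<ge> a N / 2\<close> or \<open>|g|^2 \<le> N / 2\<close>.
  Each has probability at most \<open>exp (- a N / 24)\<close>; the hypothesis
  \<open>8 n \<le> a N\<close> absorbs the factor \<open>sqrt 2 ^ n\<close>.\<close>

lemma resid_upper_unit:
  assumes x: "x \<in> Rn N" "norm2 N x = 1" and a: "8 * real n \<le> a * real N" and N: "0 < N"
  shows "measure \<mu> {E \<in> space \<mu>. a < (norm2 N (x - orth_proj N E x))\<^sup>2} \<le> 2 * exp (- a * real N / 24)"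
proof (cases "a \<le> 1")
  \<comment> \<open>The residual map is a contraction, so above level 1 the event is empty. In the
    other case \<open>a \<le> 1\<close> allows \<open>exp (- N / 12)\<close> to be compared with
    \<open>exp (- a N / 24)\<close>.\<close>
  case False
  have "norm2 N (x - orth_proj N E x) \<le> 1" if "E \<in> space \<mu>" for E
    using norm2_resid_le[OF grassmannianD(1)[of E N n] grassmannianD(2)[of E N n], of x] that x
    by (simp add: space_haar)
  then have "(norm2 N (x - orth_proj N E x))\<^sup>2 \<le> 1" if "E \<in> space \<mu>" for E
    using that by (simp add: power_le_one)
  then have empty: "{E \<in> space \<mu>. a < (norm2 N (x - orth_proj N E x))\<^sup>2} = {}"
    using False by fastforce
  show ?thesis unfolding empty by simp
next
  case True
  have a0: "0 \<le> a" using a N by (metis mult_nonneg_nonneg of_nat_0_le_iff of_nat_0_less_iff order_trans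
    zero_le_mult_iff zero_le_numeral less_le_not_le)
  let ?Q = "\<lambda>E g. (norm2 N (vec_of N g - orth_proj N E (vec_of N g)))\<^sup>2"
  let ?\<Phi> = "\<lambda>E g. a * real N / 2 \<le> ?Q E g \<or> (\<Sum>i\<in>{1..N}. (g i)\<^sup>2) \<le> real N / 2"
  show ?thesis
  proof (rule haar_gauss_exchange[of ?\<Phi>])
    show "{x \<in> space (\<mu> \<Otimes>\<^sub>M gauss {1..N}). ?\<Phi> (fst x) (snd x)} \<in> sets (\<mu> \<Otimes>\<^sub>M gauss {1..N})"
      by measurable
  next
    fix E assume "E \<in> space \<mu>"
    then have E: "E \<in> grassmannian N n" by (simp add: space_haar)
    interpret G: prob_space "gauss {1..N} :: (nat \<Rightarrow> real) measure" by (rule prob_space_gauss)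
    obtain B F where F: "orthonormal N (B \<union> F)" "card F = n"
        "\<And>x. x \<in> Rn N \<Longrightarrow> (norm2 N (x - orth_proj N E x))\<^sup>2 = (\<Sum>f\<in>F. (inner2 N x f)\<^sup>2)"
      using grassmannian_bases[OF E] by metis
    have oF: "orthonormal N F" using orthonormal_subset[OF F(1)] by auto
    have Q: "?Q E g = (\<Sum>f\<in>F. (inner2 N (vec_of N g) f)\<^sup>2)" for g by (rule F(3)) simp
    have "measure (gauss {1..N}) {g \<in> space (gauss {1..N}). ?\<Phi> E g} =
       measure (gauss {1..N}) ({g \<in> space (gauss {1..N}). a * real N / 2 \<le> (\<Sum>f\<in>F. (inner2 N (vec_of N g) f)\<^sup>2)} \<union>
         {g \<in> space (gauss {1..N}). (\<Sum>i\<in>{1..N}. (g i)\<^sup>2) \<le> real N / 2})"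
      unfolding Q by (rule arg_cong[of _ _ "measure (gauss {1..N})"]) auto
    also have "\<dots> \<le> measure (gauss {1..N}) {g \<in> space (gauss {1..N}). a * real N / 2 \<le> (\<Sum>f\<in>F. (inner2 N (vec_of N g) f)\<^sup>2)} +
       measure (gauss {1..N}) {g \<in> space (gauss {1..N}). (\<Sum>i\<in>{1..N}. (g i)\<^sup>2) \<le> real N / 2}"
      by (rule measure_Un_le) measurable
    also have "\<dots> \<le> sqrt 2 ^ n * exp (- (a * real N / 2) / 4) + exp (- real N / 12)"
      using gauss_sq_upper[OF oF, of "a * real N / 2"] gauss_norm_small[of "{1..N}"] F(2) by simp
    also have "\<dots> \<le> exp (- a * real N / 24) + exp (- a * real N / 24)"
    proof (rule add_mono)
      have "sqrt 2 ^ n \<le> exp (1/2) ^ n" by (intro power_mono exp_half_ge_sqrt2) auto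
      also have "\<dots> = exp (real n / 2)" by (simp add: exp_of_nat_mult[symmetric])
      finally have "sqrt 2 ^ n * exp (- (a * real N / 2) / 4) \<le> exp (real n / 2) * exp (- (a * real N / 2) / 4)"
        by (rule mult_right_mono) simp
      also have "\<dots> \<le> exp (- a * real N / 24)"
        unfolding exp_add[symmetric] using a by simp
      finally show "sqrt 2 ^ n * exp (- (a * real N / 2) / 4) \<le> exp (- a * real N / 24)" .
      have "a * real N \<le> 1 * real N" using True by (intro mult_right_mono) auto
      then show "exp (- real N / 12) \<le> exp (- a * real N / 24)" by simp
    qed
    finally show "measure (gauss {1..N}) {g \<in> space (gauss {1..N}). ?\<Phi> E g} \<le> 2 * exp (- a * real N / 24)"
      by simp
  next
    fix g :: "nat \<Rightarrow> real"
    show "measure \<mu> {E \<in> space \<mu>. a < (norm2 N (x - orth_proj N E x))\<^sup>2} \<le> measure \<mu> {E \<in> space \<mu>. ?\<Phi> E g}"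
    proof (cases "(\<Sum>i\<in>{1..N}. (g i)\<^sup>2) \<le> real N / 2")
      case True
      then show ?thesis by (simp add: prob_space)
    next
      case False
      let ?y = "vec_of N g"
      have ny: "(norm2 N ?y)\<^sup>2 > real N / 2" using False by (simp add: norm2_sq_sum)
      then have y0: "?y \<noteq> 0" using N by auto
      have np: "norm2 N ?y > 0" using norm2_pos[OF vec_of_in_Rn y0] .
      have "measure \<mu> {E \<in> space \<mu>. a < (norm2 N (x - orth_proj N E x))\<^sup>2} =
          measure \<mu> {E \<in> space \<mu>. a < (norm2 N (?y - orth_proj N E ?y) / norm2 N ?y)\<^sup>2}"
        by (rule resid_law_normalized[OF x vec_of_in_Rn y0, symmetric]) (use x in measurable)
      also have "\<dots> \<le> measure \<mu> {E \<in> space \<mu>. ?\<Phi> E g}"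
      proof (rule finite_measure_mono)
        show "{E \<in> space \<mu>. a < (norm2 N (?y - orth_proj N E ?y) / norm2 N ?y)\<^sup>2} \<subseteq> {E \<in> space \<mu>. ?\<Phi> E g}"
        proof (rule Collect_mono, intro impI, elim conjE, intro conjI)
          fix E assume "a < (norm2 N (?y - orth_proj N E ?y) / norm2 N ?y)\<^sup>2"
          then have "a * (norm2 N ?y)\<^sup>2 < ?Q E g" using np by (simp add: field_simps)
          moreover have "a * (real N / 2) \<le> a * (norm2 N ?y)\<^sup>2" using ny a0 by (intro mult_left_mono) auto
          ultimately show "?\<Phi> E g" by simp
        qed
        show "{E \<in> space \<mu>. ?\<Phi> E g} \<in> sets \<mu>" by measurable
      qed
      finally show ?thesis .
    qed
  qed
qed

text \<open>The cutoff \<open>22 N\<close> for \<open>|g|^2\<close> costs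
  \<open>exp (N / 2 - 22 N / 4) = exp (- 5 N)\<close>, and \<open>n \<le> N\<close> brings this to
  the rate \<open>5 n\<close> that \<open>resid_const\<close> is chosen for.\<close>

lemma resid_lower_unit:
  assumes x: "x \<in> Rn N" "norm2 N x = 1" and n: "1 \<le> n" "n \<le> N"
  shows "measure \<mu> {E \<in> space \<mu>. (norm2 N (x - orth_proj N E x))\<^sup>2 \<le> resid_const * real n / real N} \<le> 2 * exp (- 5 * real n)"
proof -
  let ?b = resid_const
  have b: "?b > 0" by (simp add: resid_const_def)
  let ?Q = "\<lambda>E g. (norm2 N (vec_of N g - orth_proj N E (vec_of N g)))\<^sup>2"
  let ?\<Phi> = "\<lambda>E g. ?Q E g \<le> 22 * ?b * real n \<or> 22 * real N \<le> (\<Sum>i\<in>{1..N}. (g i)\<^sup>2)"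
  show ?thesis
  proof (rule haar_gauss_exchange[of ?\<Phi>])
    show "{x \<in> space (\<mu> \<Otimes>\<^sub>M gauss {1..N}). ?\<Phi> (fst x) (snd x)} \<in> sets (\<mu> \<Otimes>\<^sub>M gauss {1..N})"
      by measurable
  next
    fix E assume "E \<in> space \<mu>"
    then have E: "E \<in> grassmannian N n" by (simp add: space_haar)
    interpret G: prob_space "gauss {1..N} :: (nat \<Rightarrow> real) measure" by (rule prob_space_gauss)
    obtain B F where F: "orthonormal N (B \<union> F)" "card F = n"
        "\<And>x. x \<in> Rn N \<Longrightarrow> (norm2 N (x - orth_proj N E x))\<^sup>2 = (\<Sum>f\<in>F. (inner2 N x f)\<^sup>2)"
      using grassmannian_bases[OF E] by metis
    have oF: "orthonormal N F" using orthonormal_subset[OF F(1)] by auto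
    have Q: "?Q E g = (\<Sum>f\<in>F. (inner2 N (vec_of N g) f)\<^sup>2)" for g by (rule F(3)) simp
    have inj: "inj_on unit_vec {1..N}" by (rule inj_on_subset[OF inj_unit_vec]) simp
    have nrm: "(\<Sum>f\<in>unit_vec ` {1..N}. (inner2 N (vec_of N g) f)\<^sup>2) = (\<Sum>i\<in>{1..N}. (g i)\<^sup>2)" for g
      unfolding sum.reindex[OF inj] by (intro sum.cong) auto
    have 1: "measure (gauss {1..N}) {g \<in> space (gauss {1..N}). (\<Sum>f\<in>F. (inner2 N (vec_of N g) f)\<^sup>2) \<le> 22 * ?b * real n} \<le> exp (- 5 * real n)"
    proof -
      let ?s = "1 / (22 * ?b)"
      have s: "?s > 0" using b by simp
      have "1 / sqrt (1 + ?s) \<le> exp (- 11 / 2)"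
      proof -
        have "?s = exp 11" by (simp add: resid_const_def exp_minus field_simps)
        then have "sqrt (1 + ?s) \<ge> sqrt (exp 11)" by simp
        also have "sqrt (exp 11) = exp (11 / 2 :: real)"
          by (rule real_sqrt_unique) (simp_all add: exp_double[symmetric])
        finally have "1 / sqrt (1 + ?s) \<le> 1 / exp (11 / 2)"
          using s by (intro divide_left_mono mult_pos_pos) (auto intro: add_pos_pos)
        then show ?thesis by (simp add: exp_minus inverse_eq_divide)
      qed
      then have "(1 / sqrt (1 + ?s)) ^ n \<le> exp (- 11 / 2) ^ n"
        using s by (intro power_mono) auto
      also have "\<dots> = exp (- 11 / 2 * real n)" by (simp add: exp_of_nat_mult[symmetric] mult.commute)
      finally have "(1 / sqrt (1 + ?s)) ^ n * exp (?s * (22 * ?b * real n) / 2) \<le>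
          exp (- 11 / 2 * real n) * exp (?s * (22 * ?b * real n) / 2)"
        by (rule mult_right_mono) simp
      also have "?s * (22 * ?b * real n) / 2 = real n / 2" using b by simp
      also have "exp (- 11 / 2 * real n) * exp (real n / 2) = exp (- 5 * real n)"
        unfolding exp_add[symmetric] by simp
      finally show ?thesis
        using gauss_sq_lower[OF oF s, of "22 * ?b * real n"] F(2) b by simp
    qed
    have 2: "measure (gauss {1..N}) {g \<in> space (gauss {1..N}). 22 * real N \<le> (\<Sum>i\<in>{1..N}. (g i)\<^sup>2)} \<le> exp (- 5 * real n)"
    proof -
      have "measure (gauss {1..N}) {g \<in> space (gauss {1..N}). 22 * real N \<le> (\<Sum>i\<in>{1..N}. (g i)\<^sup>2)}
          \<le> sqrt 2 ^ N * exp (- (22 * real N) / 4)"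
        using gauss_sq_upper[OF orthonormal_unit_vecs[of "{1..N}" N], of "22 * real N"]
        unfolding nrm by (simp add: card_unit_vecs)
      also have "\<dots> \<le> exp (1/2) ^ N * exp (- (22 * real N) / 4)"
        by (intro mult_right_mono power_mono exp_half_ge_sqrt2) auto
      also have "\<dots> = exp (real N / 2) * exp (- (22 * real N) / 4)" by (simp add: exp_of_nat_mult[symmetric])
      also have "\<dots> \<le> exp (- 5 * real n)"
        unfolding exp_add[symmetric] using n by simp
      finally show ?thesis .
    qed
    have "measure (gauss {1..N}) {g \<in> space (gauss {1..N}). ?\<Phi> E g} =
       measure (gauss {1..N}) ({g \<in> space (gauss {1..N}). (\<Sum>f\<in>F. (inner2 N (vec_of N g) f)\<^sup>2) \<le> 22 * ?b * real n} \<union>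
         {g \<in> space (gauss {1..N}). 22 * real N \<le> (\<Sum>i\<in>{1..N}. (g i)\<^sup>2)})"
      unfolding Q by (rule arg_cong[of _ _ "measure (gauss {1..N})"]) auto
    also have "\<dots> \<le> measure (gauss {1..N}) {g \<in> space (gauss {1..N}). (\<Sum>f\<in>F. (inner2 N (vec_of N g) f)\<^sup>2) \<le> 22 * ?b * real n} +
       measure (gauss {1..N}) {g \<in> space (gauss {1..N}). 22 * real N \<le> (\<Sum>i\<in>{1..N}. (g i)\<^sup>2)}"
      by (rule measure_Un_le) measurable
    finally show "measure (gauss {1..N}) {g \<in> space (gauss {1..N}). ?\<Phi> E g} \<le> 2 * exp (- 5 * real n)"
      using 1 2 by linarith
  next
    fix g :: "nat \<Rightarrow> real"
    let ?y = "vec_of N g"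
    show "measure \<mu> {E \<in> space \<mu>. (norm2 N (x - orth_proj N E x))\<^sup>2 \<le> ?b * real n / real N} \<le> measure \<mu> {E \<in> space \<mu>. ?\<Phi> E g}"
    proof (cases "22 * real N \<le> (\<Sum>i\<in>{1..N}. (g i)\<^sup>2) \<or> ?y = 0")
      case True
      have "?\<Phi> E g" if "E \<in> space \<mu>" for E
      proof (cases "?y = 0")
        case y0: True
        have "norm2 N (?y - orth_proj N E ?y) = 0"
          using norm2_resid_scale[OF that, of 0 0] y0 by simp
        then show ?thesis using b by simp
      qed (use True in auto)
      then have "{E \<in> space \<mu>. ?\<Phi> E g} = space \<mu>" by blast
      then show ?thesis by (simp add: prob_space)
    next
      case False
      then have ny: "(norm2 N ?y)\<^sup>2 \<le> 22 * real N" and y0: "?y \<noteq> 0" by (auto simp: norm2_sq_sum)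
      have np: "norm2 N ?y > 0" using norm2_pos[OF vec_of_in_Rn y0] .
      have "measure \<mu> {E \<in> space \<mu>. (norm2 N (x - orth_proj N E x))\<^sup>2 \<le> ?b * real n / real N} =
          measure \<mu> {E \<in> space \<mu>. (norm2 N (?y - orth_proj N E ?y) / norm2 N ?y)\<^sup>2 \<le> ?b * real n / real N}"
        by (rule resid_law_normalized[OF x vec_of_in_Rn y0, symmetric]) (use x in measurable)
      also have "\<dots> \<le> measure \<mu> {E \<in> space \<mu>. ?\<Phi> E g}"
      proof (rule finite_measure_mono)
        show "{E \<in> space \<mu>. (norm2 N (?y - orth_proj N E ?y) / norm2 N ?y)\<^sup>2 \<le> ?b * real n / real N} \<subseteq> {E \<in> space \<mu>. ?\<Phi> E g}"
        proof (rule Collect_mono, intro impI, elim conjE, intro conjI)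
          fix E assume "(norm2 N (?y - orth_proj N E ?y) / norm2 N ?y)\<^sup>2 \<le> ?b * real n / real N"
          then have "?Q E g \<le> ?b * real n / real N * (norm2 N ?y)\<^sup>2" using np by (simp add: power_divide pos_divide_le_eq)
          also have "\<dots> \<le> ?b * real n / real N * (22 * real N)" using ny b by (intro mult_left_mono) auto
          also have "\<dots> = 22 * ?b * real n" using n by simp
          finally show "?\<Phi> E g" by simp
        qed
        show "{E \<in> space \<mu>. ?\<Phi> E g} \<in> sets \<mu>" by measurable
      qed
      finally show ?thesis .
    qed
  qed
qed

text \<open>For a unit vector, residual norm 1 means vanishing projection. For the Gaussian vector
  all \<open>card B \<ge> 1\<close> squares then vanish, and \<open>gauss_sq_lower\<close> at
  \<open>u = 0\<close> gives a bound that tends to zero as \<open>s\<close> grows.\<close>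

lemma proj_nonzero_unit:
  assumes x: "x \<in> Rn N" "norm2 N x = 1" and n: "n < N"
  shows "measure \<mu> {E \<in> space \<mu>. 1 \<le> norm2 N (x - orth_proj N E x)} = 0"
proof -
  let ?c = "measure \<mu> {E \<in> space \<mu>. 1 \<le> norm2 N (x - orth_proj N E x)}"
  let ?Q = "\<lambda>E g. (norm2 N (vec_of N g - orth_proj N E (vec_of N g)))\<^sup>2"
  let ?\<Phi> = "\<lambda>E g. (\<Sum>i\<in>{1..N}. (g i)\<^sup>2) \<le> ?Q E g"
  have bound: "?c \<le> 1 / sqrt (1 + s)" if s: "s > 0" for s
  proof (rule haar_gauss_exchange[of ?\<Phi>])
    show "{x \<in> space (\<mu> \<Otimes>\<^sub>M gauss {1..N}). ?\<Phi> (fst x) (snd x)} \<in> sets (\<mu> \<Otimes>\<^sub>M gauss {1..N})"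
      by measurable
  next
    fix E assume "E \<in> space \<mu>"
    then have E: "E \<in> grassmannian N n" by (simp add: space_haar)
    interpret G: prob_space "gauss {1..N} :: (nat \<Rightarrow> real) measure" by (rule prob_space_gauss)
    obtain B F where B: "orthonormal N (B \<union> F)" "card B + n = N"
        "\<And>x. (norm2 N (orth_proj N E x))\<^sup>2 = (\<Sum>f\<in>B. (inner2 N x f)\<^sup>2)"
      using grassmannian_bases[OF E] by metis
    have oB: "orthonormal N B" using orthonormal_subset[OF B(1)] by auto
    have eq: "?\<Phi> E g \<longleftrightarrow> (\<Sum>f\<in>B. (inner2 N (vec_of N g) f)\<^sup>2) \<le> 0" for g
      using orth_proj_pythagoras[OF grassmannianD(1,2)[OF E], of "vec_of N g"] B(3)[of "vec_of N g"]
      by (simp add: norm2_sq_sum[of N "vec_of N g"])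
    have "measure (gauss {1..N}) {g \<in> space (gauss {1..N}). ?\<Phi> E g} \<le> (1 / sqrt (1 + s)) ^ card B"
      unfolding eq using gauss_sq_lower[OF oB s, of 0] by simp
    also have "\<dots> \<le> (1 / sqrt (1 + s)) ^ 1"
      using s B(2) n by (intro power_decreasing) auto
    finally show "measure (gauss {1..N}) {g \<in> space (gauss {1..N}). ?\<Phi> E g} \<le> 1 / sqrt (1 + s)" by simp
  next
    fix g :: "nat \<Rightarrow> real"
    let ?y = "vec_of N g"
    show "?c \<le> measure \<mu> {E \<in> space \<mu>. ?\<Phi> E g}"
    proof (cases "?y = 0")
      case True
      then have "(\<Sum>i\<in>{1..N}. (g i)\<^sup>2) = 0"
        using lookup_vec_of[of N g] by (intro sum.neutral ballI) (metis lookup_zero zero_power2)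
      then have "{E \<in> space \<mu>. ?\<Phi> E g} = space \<mu>" by simp
      then show ?thesis by (simp add: prob_space)
    next
      case y0: False
      have np: "norm2 N ?y > 0" using norm2_pos[OF vec_of_in_Rn y0] .
      have "?c = measure \<mu> {E \<in> space \<mu>. 1 \<le> norm2 N (?y - orth_proj N E ?y) / norm2 N ?y}"
        by (rule resid_law_normalized[OF x vec_of_in_Rn y0, symmetric]) (use x in measurable)
      also have "\<dots> \<le> measure \<mu> {E \<in> space \<mu>. ?\<Phi> E g}"
      proof (rule finite_measure_mono)
        show "{E \<in> space \<mu>. 1 \<le> norm2 N (?y - orth_proj N E ?y) / norm2 N ?y} \<subseteq> {E \<in> space \<mu>. ?\<Phi> E g}"
        proof (rule Collect_mono, intro impI, elim conjE, intro conjI)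
          fix E assume "1 \<le> norm2 N (?y - orth_proj N E ?y) / norm2 N ?y"
          then have "norm2 N ?y \<le> norm2 N (?y - orth_proj N E ?y)" using np by simp
          then have "(norm2 N ?y)\<^sup>2 \<le> ?Q E g" by (intro power_mono) auto
          then show "?\<Phi> E g" by (simp add: norm2_sq_sum[of N ?y])
        qed
        show "{E \<in> space \<mu>. ?\<Phi> E g} \<in> sets \<mu>" by measurable
      qed
      finally show ?thesis .
    qed
  qed
  have "\<not> 0 < ?c"
  proof
    assume c: "0 < ?c"
    \<comment> \<open>\<open>s = 1 / ?c\<^sup>2\<close> makes the bound strictly smaller than
      \<open>?c\<close>.\<close>
    have "?c \<le> 1 / sqrt (1 + 1 / ?c\<^sup>2)" using c by (intro bound) simp
    also have "\<dots> < 1 / sqrt (1 / ?c\<^sup>2)"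
      using c by (intro divide_strict_left_mono mult_pos_pos) (auto intro!: add_pos_pos)
    also have "\<dots> = ?c" using c by (simp add: real_sqrt_divide)
    finally show False by simp
  qed
  then show ?thesis using measure_nonneg[of \<mu>] by (meson linorder_neqE_linordered_idom not_less)
qed

text \<open>Reflections along vectors orthogonal to \<open>e_1\<close> fix \<open>e_1\<close> and
  move \<open>y\<close> over the unit sphere of its complement. So \<open>y\<close> can be exchanged
  for a normalised Gaussian vector without first coordinate, and for fixed \<open>E\<close> the
  inner product is normal. The estimate is relative to the norm of the projection, which may be tiny
  when \<open>n\<close> is close to \<open>N\<close>.\<close>

lemma marginal_unit:
  assumes N: "2 \<le> N" and y: "y \<in> Rn N" "norm2 N y = 1" "lk y 1 = 0" and \<tau>: "0 \<le> \<tau>"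
  shows "measure \<mu> {E \<in> space \<mu>. \<tau> * norm2 N (orth_proj N E (unit_vec 1)) < inner2 N (orth_proj N E (unit_vec 1)) y}
    \<le> 2 * exp (- \<tau>\<^sup>2 * real N / 24)"
proof -
  let ?x = "\<lambda>E. orth_proj N E (unit_vec 1)"
  have e1: "unit_vec 1 \<in> Rn N" using N by (intro unit_vec_in_Rn) auto
  note [measurable] = measurable_norm2_orth_proj_haar[OF e1]
  have lkm: "(\<lambda>E. lk (?x E) i) \<in> borel_measurable \<mu>" if "i \<in> {1..N}" for i
    using measurable_inner_orth_proj_haar[OF e1, of "unit_vec i"] that by simp
  have [measurable]: "(\<lambda>E. inner2 N (?x E) z) \<in> borel_measurable \<mu>" for z
    by (rule measurable_inner_orth_proj_haar[OF e1])
  show ?thesis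
  proof (cases "\<tau> \<le> 1")
    case False
    have "\<not> \<tau> * norm2 N (?x E) < inner2 N (?x E) y" for E
    proof -
      have "inner2 N (?x E) y \<le> 1 * norm2 N (?x E)"
        using inner2_Cauchy_Schwarz[of N "?x E" y] y by simp
      also have "\<dots> \<le> \<tau> * norm2 N (?x E)" using False by (intro mult_right_mono) auto
      finally show ?thesis by simp
    qed
    then show ?thesis by simp
  next
    case \<tau>1: True
    let ?M = "real (N - 1) / 2"
    let ?z = "\<lambda>g. vec_of N (\<lambda>i. if i = 1 then 0 else g i)"
    \<comment> \<open>If the projection vanishes, the first inequality reads
      \<open>0 \<le> 0\<close> for every \<open>g\<close>, so that case is excluded explicitly; for
      \<open>\<mu>\<close> the strict inequality of the claim excludes it.\<close>
    let ?\<Phi> = "\<lambda>E g. (\<tau> * sqrt ?M * norm2 N (?x E) \<le> (\<Sum>i\<in>{2..N}. g i * lk (?x E) i) \<and> norm2 N (?x E) \<noteq> 0) \<or>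
      (\<Sum>i\<in>{2..N}. (g i)\<^sup>2) \<le> ?M"
    have split: "(\<Sum>i=1..N. f i) = f 1 + (\<Sum>i\<in>{2..N}. f i)" for f :: "nat \<Rightarrow> real"
      using N by (simp add: sum.atLeast_Suc_atMost numeral_2_eq_2)
    show ?thesis
    proof (rule haar_gauss_exchange[of ?\<Phi>])
      have [measurable]: "(\<lambda>x. lk (?x (fst x)) i) \<in> borel_measurable (\<mu> \<Otimes>\<^sub>M gauss {1..N})" if "i \<in> {2..N}" for i
      proof -
        have [measurable]: "(\<lambda>E. lk (?x E) i) \<in> borel_measurable \<mu>" using that by (intro lkm) auto
        show ?thesis by measurable
      qed
      have [measurable]: "(\<lambda>x. snd x i) \<in> borel_measurable (\<mu> \<Otimes>\<^sub>M gauss {1..N})" if "i \<in> {2..N}" for i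
      proof -
        have [measurable]: "(\<lambda>g. g i) \<in> borel_measurable (gauss {1..N})"
          by measurable (use that in auto)
        show ?thesis by measurable
      qed
      show "{x \<in> space (\<mu> \<Otimes>\<^sub>M gauss {1..N}). ?\<Phi> (fst x) (snd x)} \<in> sets (\<mu> \<Otimes>\<^sub>M gauss {1..N})"
        by measurable
    next
      fix E assume "E \<in> space \<mu>"
      then have E: "E \<in> grassmannian N n" by (simp add: space_haar)
      interpret G: prob_space "gauss {1..N} :: (nat \<Rightarrow> real) measure" by (rule prob_space_gauss)
      have [measurable]: "(\<lambda>g. g i) \<in> borel_measurable (gauss {1..N})" if "i \<in> {2..N}" for i
        by measurable (use that in auto)
      have 1: "measure (gauss {1..N}) {g \<in> space (gauss {1..N}).
          \<tau> * sqrt ?M * norm2 N (?x E) \<le> (\<Sum>i\<in>{2..N}. g i * lk (?x E) i) \<and> norm2 N (?x E) \<noteq> 0} \<le> exp (- \<tau>\<^sup>2 * real N / 24)"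
      proof (cases "norm2 N (?x E) = 0")
        case False
        then have np: "norm2 N (?x E) > 0" by (simp add: less_le)
        let ?w = "vec_of N (\<lambda>i. if i = 1 then 0 else lk (?x E) i)"
        let ?a = "inverse (norm2 N (?x E)) *\<^sub>R ?w"
        have "(norm2 N ?w)\<^sup>2 \<le> (norm2 N (?x E))\<^sup>2"
          unfolding norm2_sq_sum by (intro sum_mono) auto
        then have "norm2 N ?w \<le> norm2 N (?x E)" by (rule power2_le_imp_le) simp
        then have a: "norm2 N ?a \<le> 1" using np by (simp add: field_simps)
        have ip: "inner2 N (vec_of N g) ?a = (\<Sum>i\<in>{2..N}. g i * lk (?x E) i) / norm2 N (?x E)" for g
        proof -
          have "inner2 N (vec_of N g) ?w = (\<Sum>i\<in>{2..N}. g i * lk (?x E) i)"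
            unfolding inner2_vec_of split using N by simp
          then show ?thesis by (simp add: divide_inverse)
        qed
        have "measure (gauss {1..N}) {g \<in> space (gauss {1..N}). \<tau> * sqrt ?M \<le> inner2 N (vec_of N g) ?a} \<le> exp (- (\<tau> * sqrt ?M)\<^sup>2 / 2)"
          by (rule gauss_linear_upper[OF a]) (use \<tau> in auto)
        also have "\<dots> \<le> exp (- \<tau>\<^sup>2 * real N / 24)"
        proof -
          have "\<tau>\<^sup>2 * (real N / 2) \<le> \<tau>\<^sup>2 * real (N - 1)" using N by (intro mult_left_mono) auto
          moreover have "0 \<le> \<tau>\<^sup>2 * real (N - 1)" by simp
          ultimately have "\<tau>\<^sup>2 * real N \<le> 6 * (\<tau>\<^sup>2 * real (N - 1))" by linarith
          then show ?thesis by (simp add: power_mult_distrib mult_ac)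
        qed
        finally show ?thesis
          unfolding ip using np by (simp add: pos_le_divide_eq)
      qed simp
      have 2: "measure (gauss {1..N}) {g \<in> space (gauss {1..N}). (\<Sum>i\<in>{2..N}. (g i)\<^sup>2) \<le> ?M} \<le> exp (- \<tau>\<^sup>2 * real N / 24)"
      proof -
        have "measure (gauss {1..N}) {g \<in> space (gauss {1..N}). (\<Sum>i\<in>{2..N}. (g i)\<^sup>2) \<le> ?M} \<le> exp (- real (N - 1) / 12)"
          using gauss_norm_small[of "{2..N}"] by simp
        also have "\<dots> \<le> exp (- \<tau>\<^sup>2 * real N / 24)"
        proof -
          have "\<tau>\<^sup>2 * real N \<le> 1 * real N" using \<tau> \<tau>1 by (intro mult_right_mono) (auto simp: power_le_one)
          also have "\<dots> \<le> 2 * real (N - 1)" using N by simp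
          finally show ?thesis by (simp add: mult_ac)
        qed
        finally show ?thesis .
      qed
      have "measure (gauss {1..N}) {g \<in> space (gauss {1..N}). ?\<Phi> E g} =
         measure (gauss {1..N}) ({g \<in> space (gauss {1..N}).
          \<tau> * sqrt ?M * norm2 N (?x E) \<le> (\<Sum>i\<in>{2..N}. g i * lk (?x E) i) \<and> norm2 N (?x E) \<noteq> 0} \<union>
          {g \<in> space (gauss {1..N}). (\<Sum>i\<in>{2..N}. (g i)\<^sup>2) \<le> ?M})"
        by (rule arg_cong[of _ _ "measure (gauss {1..N})"]) auto
      also have "\<dots> \<le> measure (gauss {1..N}) {g \<in> space (gauss {1..N}).
          \<tau> * sqrt ?M * norm2 N (?x E) \<le> (\<Sum>i\<in>{2..N}. g i * lk (?x E) i) \<and> norm2 N (?x E) \<noteq> 0} +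
         measure (gauss {1..N}) {g \<in> space (gauss {1..N}). (\<Sum>i\<in>{2..N}. (g i)\<^sup>2) \<le> ?M}"
        by (rule measure_Un_le) measurable
      finally show "measure (gauss {1..N}) {g \<in> space (gauss {1..N}). ?\<Phi> E g} \<le> 2 * exp (- \<tau>\<^sup>2 * real N / 24)"
        using 1 2 by linarith
    next
      fix g :: "nat \<Rightarrow> real"
      show "measure \<mu> {E \<in> space \<mu>. \<tau> * norm2 N (?x E) < inner2 N (?x E) y} \<le> measure \<mu> {E \<in> space \<mu>. ?\<Phi> E g}"
      proof (cases "(\<Sum>i\<in>{2..N}. (g i)\<^sup>2) \<le> ?M")
        case True
        then show ?thesis by (simp add: prob_space)
      next
        case False
        have nz: "(norm2 N (?z g))\<^sup>2 = (\<Sum>i\<in>{2..N}. (g i)\<^sup>2)"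
          unfolding norm2_sq_sum split using N by simp
        have big: "(norm2 N (?z g))\<^sup>2 > ?M" using False nz by simp
        have np: "norm2 N (?z g) > 0"
          using big by (smt (verit) norm2_nonneg of_nat_0_le_iff power2_less_0 zero_eq_power2 divide_nonneg_nonneg)
        have sq: "sqrt ?M \<le> norm2 N (?z g)" using big by (intro real_le_lsqrt) auto
        define w where "w = inverse (norm2 N (?z g)) *\<^sub>R ?z g"
        have w: "w \<in> Rn N" "norm2 N w = 1" "lk w 1 = 0"
          using np N by (auto simp: w_def)
        let ?v = "y - w"
        have v: "?v \<in> Rn N" using y w by auto
        \<comment> \<open>Both \<open>y\<close> and \<open>w\<close> have vanishing first
          coordinate, so their difference is orthogonal to \<open>e_1\<close>.\<close>
        have e1v: "reflect N ?v (unit_vec 1) = unit_vec 1"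
          by (rule reflect_fixes) (use y w N in \<open>simp add: lookup_minus\<close>)
        have yw: "reflect N ?v y = w" by (rule reflect_maps) (use y w in auto)
        have "measure \<mu> {E \<in> space \<mu>. \<tau> * norm2 N (?x E) < inner2 N (?x E) w} =
            measure \<mu> {E \<in> space \<mu>. \<tau> * norm2 N (?x E) < inner2 N (?x E) y}"
        proof (rule reflect_event[OF v])
          show "{E \<in> space \<mu>. \<tau> * norm2 N (?x E) < inner2 N (?x E) y} \<in> sets \<mu>" by measurable
          fix E assume E: "E \<in> grassmannian N n"
          have "?x (reflect N ?v ` E) = reflect N ?v (?x E)"
            using orth_proj_reflect[OF E v, of "unit_vec 1"] unfolding e1v .
          then show "\<tau> * norm2 N (?x (reflect N ?v ` E)) < inner2 N (?x (reflect N ?v ` E)) w \<longleftrightarrow>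
              \<tau> * norm2 N (?x E) < inner2 N (?x E) y"
            using inner2_reflect[of N ?v "?x E" y] unfolding yw by (simp add: norm2_reflect)
        qed
        moreover have "measure \<mu> {E \<in> space \<mu>. \<tau> * norm2 N (?x E) < inner2 N (?x E) w} \<le> measure \<mu> {E \<in> space \<mu>. ?\<Phi> E g}"
        proof (rule finite_measure_mono)
          show "{E \<in> space \<mu>. \<tau> * norm2 N (?x E) < inner2 N (?x E) w} \<subseteq> {E \<in> space \<mu>. ?\<Phi> E g}"
          proof (rule Collect_mono, intro impI, elim conjE, intro conjI)
            fix E assume lt: "\<tau> * norm2 N (?x E) < inner2 N (?x E) w"
            have "inner2 N (?x E) (?z g) = (\<Sum>i\<in>{2..N}. g i * lk (?x E) i)"
              unfolding inner2_def split using N by (simp add: mult.commute)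
            then have "inner2 N (?x E) w = (\<Sum>i\<in>{2..N}. g i * lk (?x E) i) / norm2 N (?z g)"
              by (simp add: w_def divide_inverse)
            then have lt2: "\<tau> * norm2 N (?x E) * norm2 N (?z g) < (\<Sum>i\<in>{2..N}. g i * lk (?x E) i)"
              using lt np by (simp add: pos_less_divide_eq)
            have "\<tau> * sqrt ?M * norm2 N (?x E) \<le> \<tau> * norm2 N (?x E) * norm2 N (?z g)"
              using mult_left_mono[OF sq, of "\<tau> * norm2 N (?x E)"] \<tau> by (simp add: mult_ac)
            moreover have "norm2 N (?x E) \<noteq> 0"
            proof
              assume 0: "norm2 N (?x E) = 0"
              then have "inner2 N (?x E) w = 0"
                using inner2_Cauchy_Schwarz[of N "?x E" w] by simp
              then show False using lt 0 by simp
            qed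
            ultimately show "?\<Phi> E g" using lt2 by simp
          qed
          have [measurable]: "(\<lambda>E. lk (?x E) i) \<in> borel_measurable \<mu>" if "i \<in> {2..N}" for i
            using that by (intro lkm) auto
          show "{E \<in> space \<mu>. ?\<Phi> E g} \<in> sets \<mu>" by measurable
        qed
        ultimately show ?thesis by simp
      qed
    qed
  qed
qed

end

section \<open>Sparse vectors\<close>

text \<open>Rounding an \<open>s\<close>-sparse vector of norm at most one to the grid of mesh
  \<open>\<rho> / sqrt s\<close> leads here with \<open>M = 1 / \<rho>\<close>. The size condition
  is an \<open>l_1\<close> bound because such a bound can be counted with a product weight.\<close>

definition sparse_lattice :: "nat \<Rightarrow> nat \<Rightarrow> real \<Rightarrow> (nat \<Rightarrow> int) set" where
  "sparse_lattice N s M = {k \<in> PiE {1..N} (\<lambda>_. {- \<lfloor>M * real s\<rfloor>..\<lfloor>M * real s\<rfloor>}).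
     card {i \<in> {1..N}. k i \<noteq> 0} \<le> s \<and> (\<Sum>i=1..N. \<bar>real_of_int (k i)\<bar>) \<le> M * real s}"

lemma finite_sparse_lattice: "finite (sparse_lattice N s M)"
  by (rule finite_subset[of _ "PiE {1..N} (\<lambda>_. {- \<lfloor>M * real s\<rfloor>..\<lfloor>M * real s\<rfloor>})"])
    (auto simp: sparse_lattice_def intro!: finite_PiE)

lemma sum_lattice_weight:
  fixes q :: real
  assumes q: "0 \<le> q"
  shows "(\<Sum>j\<in>{- int m..int m}. if j = 0 then 1 else q * exp (- \<bar>real_of_int j\<bar>)) \<le> 1 + 2 * q * (1 - (1/2) ^ m)"
proof (induction m)
  case (Suc m)
  have set: "{- int (Suc m)..int (Suc m)} = insert (int (Suc m)) (insert (- int (Suc m)) {- int m..int m})"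
    by auto
  have "exp (- 1) \<le> (1 / 2 :: real)"
    using exp_ge_add_one_self[of "1::real"] by (simp add: exp_minus field_simps)
  then have "exp (- 1) ^ Suc m \<le> (1 / 2 :: real) ^ Suc m" by (intro power_mono) auto
  then have e: "exp (- real (Suc m)) \<le> (1 / 2) ^ Suc m"
    by (simp only: exp_of_nat_mult[symmetric]) simp
  have "(\<Sum>j\<in>{- int (Suc m)..int (Suc m)}. if j = 0 then 1 else q * exp (- \<bar>real_of_int j\<bar>)) =
      2 * (q * exp (- real (Suc m))) + (\<Sum>j\<in>{- int m..int m}. if j = 0 then 1 else q * exp (- \<bar>real_of_int j\<bar>))"
    unfolding set by simp
  also have "\<dots> \<le> 2 * (q * (1/2) ^ Suc m) + (1 + 2 * q * (1 - (1/2) ^ m))"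
    by (intro add_mono mult_left_mono e Suc.IH q) auto
  also have "\<dots> = 1 + 2 * q * (1 - (1/2) ^ Suc m)" by (simp add: algebra_simps)
  finally show ?case .
qed simp

text \<open>Counting by a generating function: an entry \<open>j \<noteq> 0\<close> has weight
  \<open>q * exp (- |j|)\<close> with \<open>q = s / N\<close>. Every lattice point weighs at least
  \<open>q ^ s * exp (- M s)\<close>, while the whole box weighs at most
  \<open>(1 + 2 q) ^ N \<le> exp (2 s)\<close>.\<close>

lemma card_sparse_lattice:
  assumes s: "1 \<le> s" "s \<le> N" and M: "0 \<le> M"
  shows "real (card (sparse_lattice N s M)) \<le> (real N / real s * exp (2 + M)) ^ s"
proof -
  define q where "q = real s / real N"
  have q: "0 < q" "q \<le> 1" using s by (auto simp: q_def)
  define m where "m = nat \<lfloor>M * real s\<rfloor>"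
  have m: "int m = \<lfloor>M * real s\<rfloor>" using M by (simp add: m_def)
  define \<phi> where "\<phi> j = (if j = 0 then 1 else q * exp (- \<bar>real_of_int j\<bar>))" for j :: int
  let ?P = "PiE {1..N} (\<lambda>_. {- int m..int m})"
  have lower: "q ^ s * exp (- M * real s) \<le> (\<Prod>i=1..N. \<phi> (k i))" if k: "k \<in> sparse_lattice N s M" for k
  proof -
    let ?S = "{i \<in> {1..N}. k i \<noteq> 0}"
    have "(\<Prod>i=1..N. \<phi> (k i)) = (\<Prod>i\<in>?S. \<phi> (k i))"
      by (rule prod.mono_neutral_right) (auto simp: \<phi>_def)
    also have "\<dots> = (\<Prod>i\<in>?S. q * exp (- \<bar>real_of_int (k i)\<bar>))"
      by (rule prod.cong) (auto simp: \<phi>_def)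
    also have "\<dots> = q ^ card ?S * exp (- (\<Sum>i\<in>?S. \<bar>real_of_int (k i)\<bar>))"
      by (simp add: prod.distrib exp_sum[symmetric] sum_negf)
    also have "(\<Sum>i\<in>?S. \<bar>real_of_int (k i)\<bar>) = (\<Sum>i=1..N. \<bar>real_of_int (k i)\<bar>)"
      by (rule sum.mono_neutral_left) auto
    finally have eq: "(\<Prod>i=1..N. \<phi> (k i)) = q ^ card ?S * exp (- (\<Sum>i=1..N. \<bar>real_of_int (k i)\<bar>))" .
    show ?thesis
      unfolding eq using k q
      by (intro mult_mono power_decreasing) (auto simp: sparse_lattice_def)
  qed
  have sub: "sparse_lattice N s M \<subseteq> ?P" by (auto simp: sparse_lattice_def m)
  have finP: "finite ?P" by (intro finite_PiE) auto
  have "real (card (sparse_lattice N s M)) * (q ^ s * exp (- M * real s)) \<le> (\<Sum>k\<in>sparse_lattice N s M. \<Prod>i=1..N. \<phi> (k i))"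
    using sum_bounded_below[of "sparse_lattice N s M" "q ^ s * exp (- M * real s)"] lower by simp
  also have "\<dots> \<le> (\<Sum>k\<in>?P. \<Prod>i=1..N. \<phi> (k i))"
    using q by (intro sum_mono2 finP sub prod_nonneg) (auto simp: \<phi>_def)
  also have "\<dots> = (\<Prod>i=1..N. \<Sum>j\<in>{- int m..int m}. \<phi> j)"
    by (rule prod_sum_PiE[symmetric]) auto
  also have "\<dots> \<le> (\<Prod>i=1..N. 1 + 2 * q)"
  proof (rule prod_mono, intro conjI)
    fix i assume "i \<in> {1..N}"
    show "0 \<le> (\<Sum>j\<in>{- int m..int m}. \<phi> j)" using q by (intro sum_nonneg) (auto simp: \<phi>_def)
    have "(\<Sum>j\<in>{- int m..int m}. \<phi> j) \<le> 1 + 2 * q * (1 - (1/2) ^ m)"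
      unfolding \<phi>_def using q by (intro sum_lattice_weight) auto
    also have "\<dots> \<le> 1 + 2 * q * 1" using q by (intro add_mono mult_left_mono) auto
    finally show "(\<Sum>j\<in>{- int m..int m}. \<phi> j) \<le> 1 + 2 * q" by simp
  qed
  also have "\<dots> = (1 + 2 * q) ^ N" by simp
  also have "\<dots> \<le> exp (2 * q) ^ N"
    using q exp_ge_add_one_self[of "2 * q"] by (intro power_mono) auto
  also have "\<dots> = exp (2 * real s)"
    using s by (simp add: exp_of_nat_mult[symmetric] q_def)
  finally have "real (card (sparse_lattice N s M)) * (q ^ s * exp (- M * real s)) \<le> exp (2 * real s)" .
  then have "real (card (sparse_lattice N s M)) \<le> exp (2 * real s) / (q ^ s * exp (- M * real s))"
    using q by (simp add: pos_le_divide_eq)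
  also have "\<dots> = (real N / real s) ^ s * (exp (2 * real s) * exp (M * real s))"
    using s by (simp add: q_def power_divide exp_minus field_simps)
  also have "exp (2 * real s) * exp (M * real s) = exp (2 + M) ^ s"
    by (simp add: exp_add[symmetric] exp_of_nat_mult[symmetric] algebra_simps)
  finally show ?thesis by (simp only: power_mult_distrib)
qed

definition sparse_net :: "nat \<Rightarrow> nat \<Rightarrow> real \<Rightarrow> fseq set" where
  "sparse_net N s \<rho> = (\<lambda>k. (\<rho> / sqrt (real s)) *\<^sub>R vec_of N (\<lambda>i. real_of_int (k i))) ` sparse_lattice N s (1 / \<rho>)"

lemma finite_sparse_net: "finite (sparse_net N s \<rho>)"
  by (simp add: sparse_net_def finite_sparse_lattice)

lemma sparse_net_in_Rn: "y \<in> sparse_net N s \<rho> \<Longrightarrow> y \<in> Rn N"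
  by (auto simp: sparse_net_def)

lemma card_sparse_net:
  assumes "1 \<le> s" "s \<le> N" "0 < \<rho>"
  shows "real (card (sparse_net N s \<rho>)) \<le> (real N / real s * exp (2 + 1 / \<rho>)) ^ s"
proof -
  have "card (sparse_net N s \<rho>) \<le> card (sparse_lattice N s (1 / \<rho>))"
    unfolding sparse_net_def by (rule card_image_le[OF finite_sparse_lattice])
  then show ?thesis
    using card_sparse_lattice[of s N "1 / \<rho>"] assms by simp
qed

lemma sum_sparse_abs_le:
  assumes x: "x \<in> Rn N" and c: "card (Poly_Mapping.keys x) \<le> s"
  shows "(\<Sum>i=1..N. \<bar>lk x i\<bar>) \<le> sqrt (real s) * norm2 N x"
proof -
  let ?K = "Poly_Mapping.keys x"
  have K: "?K \<subseteq> {1..N}" using x by (simp add: Rn_def)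
  have "(\<Sum>i=1..N. \<bar>lk x i\<bar>) = (\<Sum>i\<in>?K. \<bar>1\<bar> * \<bar>lk x i\<bar>)"
    using K by (simp add: sum.mono_neutral_right[of "{1..N}" ?K] in_keys_iff)
  also have "\<dots> \<le> L2_set (\<lambda>_. 1) ?K * L2_set (lk x) ?K"
    by (rule L2_set_mult_ineq)
  also have "\<dots> \<le> sqrt (real s) * norm2 N x"
  proof (rule mult_mono)
    show "L2_set (\<lambda>_. 1) ?K \<le> sqrt (real s)" using c by (simp add: L2_set_def)
    show "L2_set (lk x) ?K \<le> norm2 N x"
      unfolding norm2_def L2_set_def using K by (intro real_sqrt_le_mono sum_mono2) auto
  qed auto
  finally show ?thesis .
qed

text \<open>Coordinates are rounded towards zero on the grid of mesh \<open>\<rho> / sqrt s\<close>.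
  This direction keeps zeros and shrinks the norm, so the net point inherits the support of
  \<open>x\<close> and at most \<open>s\<close> coordinates contribute to the error.\<close>

lemma sparse_net_approx:
  assumes x: "x \<in> Rn N" "card (Poly_Mapping.keys x) \<le> s" "norm2 N x \<le> 1" and s: "1 \<le> s" and \<rho>: "0 < \<rho>"
  obtains y where "y \<in> sparse_net N s \<rho>" "Poly_Mapping.keys y \<subseteq> Poly_Mapping.keys x"
    "norm2 N (x - y) \<le> \<rho>" "norm2 N y \<le> norm2 N x"
proof -
  define t where "t = \<rho> / sqrt (real s)"
  have t: "t > 0" using s \<rho> by (simp add: t_def)
  define k0 where "k0 i = (if lk x i \<ge> 0 then \<lfloor>lk x i / t\<rfloor> else - \<lfloor>- lk x i / t\<rfloor>)" for i
  define k where "k = restrict k0 {1..N}"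
  have kb: "\<bar>real_of_int (k0 i)\<bar> \<le> \<bar>lk x i\<bar> / t" for i
  proof (cases "lk x i \<ge> 0")
    case True
    then have "0 \<le> lk x i / t" using t by simp
    then show ?thesis using True by (simp add: k0_def)
  next
    case False
    then have "0 \<le> - lk x i / t" using t by (intro divide_nonneg_pos) auto
    then have "0 \<le> \<lfloor>- lk x i / t\<rfloor>" "real_of_int \<lfloor>- lk x i / t\<rfloor> \<le> - lk x i / t" by linarith+
    then show ?thesis using False unfolding k0_def by simp
  qed
  have ke: "\<bar>lk x i - t * real_of_int (k0 i)\<bar> \<le> t" for i
  proof (cases "lk x i \<ge> 0")
    case True
    define f where "f = real_of_int \<lfloor>lk x i / t\<rfloor>"
    have "f \<le> lk x i / t" "lk x i / t < f + 1" unfolding f_def by linarith+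
    then have "t * f \<le> lk x i" "lk x i < t * f + t"
      using t by (simp_all add: field_simps)
    then show ?thesis using True by (simp add: k0_def f_def)
  next
    case False
    define f where "f = real_of_int \<lfloor>- lk x i / t\<rfloor>"
    have "f \<le> - lk x i / t" "- lk x i / t < f + 1" unfolding f_def by linarith+
    then have "t * f \<le> - lk x i" "- lk x i < t * f + t"
      using t by (simp_all add: field_simps)
    moreover have "real_of_int (k0 i) = - f" using False by (simp add: k0_def f_def)
    ultimately show ?thesis by (simp add: abs_le_iff)
  qed
  have kz: "k0 i = 0" if "lk x i = 0" for i using that by (simp add: k0_def)
  have K: "Poly_Mapping.keys x \<subseteq> {1..N}" using x by (simp add: Rn_def)
  have "(\<Sum>i=1..N. \<bar>real_of_int (k i)\<bar>) \<le> (\<Sum>i=1..N. \<bar>lk x i\<bar> / t)"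
    by (rule sum_mono) (simp add: k_def kb)
  also have "\<dots> \<le> sqrt (real s) * norm2 N x / t"
    unfolding sum_divide_distrib[symmetric] using sum_sparse_abs_le[OF x(1,2)] t by (intro divide_right_mono) auto
  also have "\<dots> \<le> sqrt (real s) * 1 / t"
    using x(3) t by (intro divide_right_mono mult_left_mono) auto
  also have "\<dots> = 1 / \<rho> * real s" using s by (simp add: t_def)
  finally have sumk: "(\<Sum>i=1..N. \<bar>real_of_int (k i)\<bar>) \<le> 1 / \<rho> * real s" .
  have rng: "k i \<in> {- \<lfloor>1 / \<rho> * real s\<rfloor>..\<lfloor>1 / \<rho> * real s\<rfloor>}" if i: "i \<in> {1..N}" for i
  proof -
    have "\<bar>real_of_int (k i)\<bar> \<le> (\<Sum>i=1..N. \<bar>real_of_int (k i)\<bar>)"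
      using i by (intro member_le_sum) auto
    then have "real_of_int \<bar>k i\<bar> \<le> 1 / \<rho> * real s" using sumk by simp
    then have "\<bar>k i\<bar> \<le> \<lfloor>1 / \<rho> * real s\<rfloor>" by (simp only: le_floor_iff)
    then show ?thesis by auto
  qed
  have supp: "{i \<in> {1..N}. k i \<noteq> 0} \<subseteq> Poly_Mapping.keys x"
    using kz by (auto simp: k_def in_keys_iff)
  have "card {i \<in> {1..N}. k i \<noteq> 0} \<le> s"
    using card_mono[OF finite_keys supp] x(2) by simp
  then have klat: "k \<in> sparse_lattice N s (1 / \<rho>)"
    unfolding sparse_lattice_def using rng sumk by (auto simp: k_def)
  define y where "y = t *\<^sub>R vec_of N (\<lambda>i. real_of_int (k i))"
  have yi: "lk y i = (if i \<in> {1..N} then t * real_of_int (k0 i) else 0)" for i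
    by (simp add: y_def k_def)
  have "y \<in> sparse_net N s \<rho>"
    unfolding sparse_net_def y_def t_def using klat by blast
  moreover have "Poly_Mapping.keys y \<subseteq> Poly_Mapping.keys x"
    using kz by (auto simp: in_keys_iff yi split: if_splits)
  moreover have "norm2 N (x - y) \<le> \<rho>"
  proof -
    have "(norm2 N (x - y))\<^sup>2 = (\<Sum>i=1..N. (lk x i - lk y i)\<^sup>2)"
      by (simp add: norm2_sq_sum lookup_minus)
    also have "\<dots> = (\<Sum>i\<in>Poly_Mapping.keys x. (lk x i - lk y i)\<^sup>2)"
      using K kz by (intro sum.mono_neutral_right) (auto simp: in_keys_iff yi)
    also have "\<dots> \<le> (\<Sum>i\<in>Poly_Mapping.keys x. t\<^sup>2)"
    proof (rule sum_mono)
      fix i assume "i \<in> Poly_Mapping.keys x"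
      then have "i \<in> {1..N}" using K by auto
      then have "\<bar>lk x i - lk y i\<bar> \<le> \<bar>t\<bar>" using ke[of i] t by (simp add: yi)
      then show "(lk x i - lk y i)\<^sup>2 \<le> t\<^sup>2" by (simp only: abs_le_square_iff)
    qed
    also have "\<dots> \<le> real s * t\<^sup>2" using x(2) by (simp add: mult_right_mono)
    also have "\<dots> = \<rho>\<^sup>2" using s by (simp add: t_def power_divide)
    finally show ?thesis using \<rho> by (intro power2_le_imp_le[of "norm2 N (x - y)" \<rho>]) auto
  qed
  moreover have "norm2 N y \<le> norm2 N x"
  proof -
    have "(norm2 N y)\<^sup>2 \<le> (norm2 N x)\<^sup>2"
      unfolding norm2_sq_sum
    proof (rule sum_mono)
      fix i assume i: "i \<in> {1..N}"
      have "t * \<bar>real_of_int (k0 i)\<bar> \<le> \<bar>lk x i\<bar>" using kb[of i] t by (simp add: field_simps)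
      then have "\<bar>lk y i\<bar> \<le> \<bar>lk x i\<bar>" using i t by (simp add: yi abs_mult)
      then show "(lk y i)\<^sup>2 \<le> (lk x i)\<^sup>2" by (simp only: abs_le_square_iff)
    qed
    then show ?thesis by (rule power2_le_imp_le) simp
  qed
  ultimately show ?thesis by (rule that)
qed

lemma keys_scaleR_subset: "Poly_Mapping.keys (c *\<^sub>R x) \<subseteq> Poly_Mapping.keys (x :: fseq)"
  by (auto simp: in_keys_iff)

text \<open>With \<open>m\<close> the supremum over sparse vectors of the unit ball, finite by
  \<open>bdd\<close>, a net point at distance \<open>1/2\<close> leaves a remainder on the same
  support, hence \<open>m \<le> c + m / 2\<close>. Only sublinearity is assumed, so that residual
  norms and linear functionals are both covered; \<open>J\<close> confines the support.\<close>

lemma sparse_net_sup: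
  fixes f :: "fseq \<Rightarrow> real"
  assumes sub: "\<And>x y. x \<in> Rn N \<Longrightarrow> y \<in> Rn N \<Longrightarrow> f (x + y) \<le> f x + f y"
    and hom: "\<And>c x. 0 \<le> c \<Longrightarrow> f (c *\<^sub>R x) = c * f x"
    and bdd: "\<And>x. x \<in> Rn N \<Longrightarrow> f x \<le> norm2 N x * C"
    and net: "\<And>y. y \<in> sparse_net N s (1/2) \<Longrightarrow> Poly_Mapping.keys y \<subseteq> J \<Longrightarrow> f y \<le> c * norm2 N y"
    and s: "1 \<le> s" and c: "0 \<le> c"
    and x: "x \<in> Rn N" "card (Poly_Mapping.keys x) \<le> s" "Poly_Mapping.keys x \<subseteq> J"
  shows "f x \<le> 2 * c * norm2 N x"
proof -
  define T where "T = {x \<in> Rn N. card (Poly_Mapping.keys x) \<le> s \<and> Poly_Mapping.keys x \<subseteq> J \<and> norm2 N x \<le> 1}"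
  define m where "m = (SUP x\<in>T. f x)"
  have T0: "0 \<in> T" by (simp add: T_def)
  have bd: "bdd_above (f ` T)"
  proof (rule bdd_aboveI2)
    fix x assume "x \<in> T"
    then have x: "x \<in> Rn N" "norm2 N x \<le> 1" by (auto simp: T_def)
    have "f x \<le> norm2 N x * \<bar>C\<bar>" using bdd[OF x(1)] mult_left_mono[OF abs_ge_self norm2_nonneg] by (rule order_trans)
    also have "\<dots> \<le> 1 * \<bar>C\<bar>" using x(2) by (rule mult_right_mono) simp
    finally show "f x \<le> \<bar>C\<bar>" by simp
  qed
  have up: "f z \<le> m" if "z \<in> T" for z
    unfolding m_def by (rule cSUP_upper[OF that bd])
  have "f 0 = 0" using hom[of 0 0] by simp
  have "m \<le> c + m / 2"
    unfolding m_def[of] 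
  proof (rule cSUP_least)
    show "T \<noteq> {}" using T0 by auto
    fix z assume "z \<in> T"
    then have z: "z \<in> Rn N" "card (Poly_Mapping.keys z) \<le> s" "Poly_Mapping.keys z \<subseteq> J" "norm2 N z \<le> 1"
      by (auto simp: T_def)
    obtain y where y: "y \<in> sparse_net N s (1/2)" "Poly_Mapping.keys y \<subseteq> Poly_Mapping.keys z"
      "norm2 N (z - y) \<le> 1/2" "norm2 N y \<le> norm2 N z"
      using sparse_net_approx[OF z(1,2,4) s, of "1/2"] by auto
    have k: "Poly_Mapping.keys (2 *\<^sub>R (z - y)) \<subseteq> Poly_Mapping.keys z"
      using y(2) by (auto simp: in_keys_iff lookup_minus subset_iff)
    have "2 *\<^sub>R (z - y) \<in> T"
      unfolding T_def using z y(3) k sparse_net_in_Rn[OF y(1)] card_mono[OF finite_keys k] by auto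
    then have "f (2 *\<^sub>R (z - y)) \<le> m" by (rule up)
    then have 1: "f (z - y) \<le> m / 2" using hom[of 2 "z - y"] by simp
    have "f y \<le> c * norm2 N y" using net y z by blast
    also have "\<dots> \<le> c * 1" using y(4) z(4) c by (intro mult_left_mono) auto
    finally have 2: "f y \<le> c" by simp
    have "f z \<le> f y + f (z - y)"
      using sub[of y "z - y"] z sparse_net_in_Rn[OF y(1)] by auto
    then show "f z \<le> c + (SUP x\<in>T. f x) / 2" using 1 2 by (simp add: m_def)
  qed
  then have m: "m \<le> 2 * c" by simp
  show ?thesis
  proof (cases "x = 0")
    case True
    then show ?thesis using \<open>f 0 = 0\<close> by simp
  next
    case False
    then have np: "norm2 N x > 0" using norm2_pos x by blast
    let ?u = "inverse (norm2 N x) *\<^sub>R x"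
    have "card (Poly_Mapping.keys ?u) \<le> s"
      using card_mono[OF finite_keys keys_scaleR_subset] x(2) by (rule order_trans)
    then have "?u \<in> T" unfolding T_def using x np keys_scaleR_subset[of "inverse (norm2 N x)" x] by auto
    then have "f ?u \<le> m" by (rule up)
    then have "f x / norm2 N x \<le> 2 * c" using hom[of "inverse (norm2 N x)" x] np m by (simp add: divide_inverse mult.commute)
    then show ?thesis using np by (simp add: pos_divide_le_eq)
  qed
qed

text \<open>The exceptional set is measurable but \<open>{x. P x}\<close> need not be, so uncountable conjunctions are allowed in \<open>P\<close>.\<close>

definition holds_except :: "'a measure \<Rightarrow> ('a \<Rightarrow> bool) \<Rightarrow> real \<Rightarrow> bool" where
  "holds_except M P b \<longleftrightarrow> (\<exists>A\<in>sets M. measure M A \<le> b \<and> (\<forall>x\<in>space M - A. P x))"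

section \<open>Calculus of exceptional sets\<close>

context prob_space
begin

lemma holds_except_conj:
  assumes "holds_except M P b" "holds_except M Q c"
  shows "holds_except M (\<lambda>x. P x \<and> Q x) (b + c)"
proof -
  obtain A B where A: "A \<in> sets M" "measure M A \<le> b" "\<forall>x\<in>space M - A. P x"
    and B: "B \<in> sets M" "measure M B \<le> c" "\<forall>x\<in>space M - B. Q x"
    using assms by (auto simp: holds_except_def)
  have "measure M (A \<union> B) \<le> b + c"
    using measure_Un_le[OF A(1) B(1)] A(2) B(2) by linarith
  then show ?thesis
    unfolding holds_except_def using A B by (intro bexI[of _ "A \<union> B"]) auto
qed

lemma holds_except_mono:
  assumes "holds_except M P b" "\<And>x. x \<in> space M \<Longrightarrow> P x \<Longrightarrow> Q x" "b \<le> c"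
  shows "holds_except M Q c"
  using assms unfolding holds_except_def by (meson DiffD1 order_trans)

lemma holds_except_all:
  assumes "finite J" "\<And>j. j \<in> J \<Longrightarrow> holds_except M (P j) (b j)"
  shows "holds_except M (\<lambda>x. \<forall>j\<in>J. P j x) (\<Sum>j\<in>J. b j)"
  using assms
proof (induction J)
  case empty
  then show ?case by (auto simp: holds_except_def intro: bexI[of _ "{}"])
next
  case (insert j J)
  then have "holds_except M (\<lambda>x. P j x \<and> (\<forall>j\<in>J. P j x)) (b j + (\<Sum>j\<in>J. b j))"
    by (intro holds_except_conj) auto
  then show ?case using insert by simp
qed

lemma holds_exceptI:
  assumes "{x \<in> space M. Q x} \<in> sets M" "measure M {x \<in> space M. Q x} \<le> b" "\<And>x. x \<in> space M \<Longrightarrow> \<not> Q x \<Longrightarrow> P x"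
  shows "holds_except M P b"
  unfolding holds_except_def using assms by (intro bexI[of _ "{x \<in> space M. Q x}"]) auto

lemma holds_except_prob:
  assumes "holds_except M P b" "{x \<in> space M. P x} \<in> sets M"
  shows "1 - b \<le> measure M {x \<in> space M. P x}"
proof -
  obtain A where A: "A \<in> sets M" "measure M A \<le> b" "\<forall>x\<in>space M - A. P x"
    using assms by (auto simp: holds_except_def)
  have "1 - b \<le> 1 - measure M A" using A by simp
  also have "\<dots> = measure M (space M - A)" using prob_compl[OF A(1)] by simp
  also have "\<dots> \<le> measure M {x \<in> space M. P x}"
    by (rule finite_measure_mono) (use A assms in auto)
  finally show ?thesis .
qed

end

section \<open>Estimates uniform over sparse vectors\<close>

context haar
begin

lemma resid_upper:
  assumes x: "x \<in> Rn N" and a: "8 * real n \<le> \<kappa>\<^sup>2 * real N" and N: "0 < N" and \<kappa>: "0 \<le> \<kappa>"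
  shows "holds_except \<mu> (\<lambda>E. norm2 N (x - orth_proj N E x) \<le> \<kappa> * norm2 N x) (2 * exp (- \<kappa>\<^sup>2 * real N / 24))"
proof (cases "x = 0")
  case True
  have "norm2 N (x - orth_proj N E x) = 0" if "E \<in> space \<mu>" for E
    using norm2_resid_scale[OF that, of 0 0] True by simp
  then show ?thesis
    using True by (intro holds_exceptI[of "\<lambda>_. False"]) auto
next
  case False
  have np: "norm2 N x > 0" using norm2_pos[OF x False] .
  define u where "u = inverse (norm2 N x) *\<^sub>R x"
  have u: "u \<in> Rn N" "norm2 N u = 1" using x np by (auto simp: u_def)
  have m: "(\<lambda>E. norm2 N (u - orth_proj N E u)) \<in> borel_measurable \<mu>"
    by (rule measurable_norm2_resid_haar[OF u(1)])
  have nu: "norm2 N (u - orth_proj N E u) = norm2 N (x - orth_proj N E x) / norm2 N x" if "E \<in> space \<mu>" for E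
    unfolding u_def norm2_resid_scale[OF that] using np by (simp add: divide_inverse mult.commute)
  show ?thesis
  proof (rule holds_exceptI[OF _ resid_upper_unit[OF u a N]])
    show "{E \<in> space \<mu>. \<kappa>\<^sup>2 < (norm2 N (u - orth_proj N E u))\<^sup>2} \<in> sets \<mu>"
      by (rule borel_measurable_iff_greater[THEN iffD1, rule_format, OF borel_measurable_power[OF m]])
    fix E assume E: "E \<in> space \<mu>" "\<not> \<kappa>\<^sup>2 < (norm2 N (u - orth_proj N E u))\<^sup>2"
    then have "norm2 N (u - orth_proj N E u) \<le> \<kappa>" using \<kappa> by (auto simp only: not_less intro: power2_le_imp_le)
    then show "norm2 N (x - orth_proj N E x) \<le> \<kappa> * norm2 N x"
      unfolding nu[OF E(1)] using np by (simp add: pos_divide_le_eq)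
  qed
qed

lemma resid_lower:
  assumes x: "x \<in> Rn N" and n: "1 \<le> n" "n \<le> N"
  shows "holds_except \<mu> (\<lambda>E. sqrt (resid_const * real n / real N) * norm2 N x \<le> norm2 N (x - orth_proj N E x)) (2 * exp (- 5 * real n))"
proof (cases "x = 0")
  case True
  then show ?thesis by (intro holds_exceptI[of "\<lambda>_. False"]) auto
next
  case False
  let ?b = "resid_const * real n / real N"
  have np: "norm2 N x > 0" using norm2_pos[OF x False] .
  define u where "u = inverse (norm2 N x) *\<^sub>R x"
  have u: "u \<in> Rn N" "norm2 N u = 1" using x np by (auto simp: u_def)
  have m: "(\<lambda>E. norm2 N (u - orth_proj N E u)) \<in> borel_measurable \<mu>"
    by (rule measurable_norm2_resid_haar[OF u(1)])
  have nu: "norm2 N (u - orth_proj N E u) = norm2 N (x - orth_proj N E x) / norm2 N x" if "E \<in> space \<mu>" for E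
    unfolding u_def norm2_resid_scale[OF that] using np by (simp add: divide_inverse mult.commute)
  show ?thesis
  proof (rule holds_exceptI[OF _ resid_lower_unit[OF u n]])
    show "{E \<in> space \<mu>. (norm2 N (u - orth_proj N E u))\<^sup>2 \<le> ?b} \<in> sets \<mu>"
      by (rule borel_measurable_iff_le[THEN iffD1, rule_format, OF borel_measurable_power[OF m]])
    fix E assume E: "E \<in> space \<mu>" "\<not> (norm2 N (u - orth_proj N E u))\<^sup>2 \<le> ?b"
    then have "sqrt ?b \<le> norm2 N (u - orth_proj N E u)" by (intro real_le_lsqrt) auto
    then show "sqrt ?b * norm2 N x \<le> norm2 N (x - orth_proj N E x)"
      unfolding nu[OF E(1)] using np by (simp add: pos_le_divide_eq)
  qed
qed

lemma resid_sublinear: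
  assumes "E \<in> space \<mu>"
  shows "norm2 N ((x + y) - orth_proj N E (x + y)) \<le> norm2 N (x - orth_proj N E x) + norm2 N (y - orth_proj N E y)"
proof -
  have E: "subspace E" "E \<subseteq> Rn N" using assms grassmannianD by (auto simp: space_haar)
  have "(x + y) - orth_proj N E (x + y) = (x - orth_proj N E x) + (y - orth_proj N E y)"
    by (simp add: orth_proj_add[OF E])
  then show ?thesis by (simp only: norm2_triangle)
qed

text \<open>Union bound over the net of radius \<open>1/2\<close> at level
  \<open>\<kappa> / 2\<close>, which doubles on passing to all sparse vectors. Hence
  \<open>32 = 4 * 8\<close>, \<open>96 = 4 * 24\<close>, and \<open>exp 4\<close> from
  \<open>2 + 1 / (1/2)\<close>.\<close>

lemma sparse_upper:
  assumes s: "1 \<le> s" "s \<le> N" and \<kappa>: "0 \<le> \<kappa>" "32 * real n \<le> \<kappa>\<^sup>2 * real N"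
  shows "holds_except \<mu> (\<lambda>E. \<forall>x\<in>Rn N. card (Poly_Mapping.keys x) \<le> s \<longrightarrow> norm2 N (x - orth_proj N E x) \<le> \<kappa> * norm2 N x)
    ((real N / real s * exp 4) ^ s * (2 * exp (- \<kappa>\<^sup>2 * real N / 96)))"
proof (rule holds_except_mono)
  show "holds_except \<mu> (\<lambda>E. \<forall>y\<in>sparse_net N s (1/2). norm2 N (y - orth_proj N E y) \<le> (\<kappa> / 2) * norm2 N y)
    (\<Sum>y\<in>sparse_net N s (1/2). 2 * exp (- (\<kappa> / 2)\<^sup>2 * real N / 24))"
    using s \<kappa> by (intro holds_except_all finite_sparse_net resid_upper sparse_net_in_Rn[of _ N s "1/2"])
      (auto simp: power_divide)
  have "(\<Sum>y\<in>sparse_net N s (1/2). 2 * exp (- (\<kappa> / 2)\<^sup>2 * real N / 24)) =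
      real (card (sparse_net N s (1/2))) * (2 * exp (- \<kappa>\<^sup>2 * real N / 96))"
    by (simp add: power_divide)
  also have "\<dots> \<le> (real N / real s * exp 4) ^ s * (2 * exp (- \<kappa>\<^sup>2 * real N / 96))"
    using card_sparse_net[OF s, of "1/2"] by (intro mult_right_mono) auto
  finally show "(\<Sum>y\<in>sparse_net N s (1/2). 2 * exp (- (\<kappa> / 2)\<^sup>2 * real N / 24)) \<le>
      (real N / real s * exp 4) ^ s * (2 * exp (- \<kappa>\<^sup>2 * real N / 96))" .
  fix E assume E: "E \<in> space \<mu>" and net: "\<forall>y\<in>sparse_net N s (1/2). norm2 N (y - orth_proj N E y) \<le> (\<kappa> / 2) * norm2 N y"
  have E': "subspace E" "E \<subseteq> Rn N" using E grassmannianD by (auto simp: space_haar)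
  show "\<forall>x\<in>Rn N. card (Poly_Mapping.keys x) \<le> s \<longrightarrow> norm2 N (x - orth_proj N E x) \<le> \<kappa> * norm2 N x"
  proof (intro ballI impI)
    fix x assume x: "x \<in> Rn N" "card (Poly_Mapping.keys x) \<le> s"
    have "norm2 N (x - orth_proj N E x) \<le> 2 * (\<kappa> / 2) * norm2 N x"
    proof (rule sparse_net_sup[where f = "\<lambda>x. norm2 N (x - orth_proj N E x)" and C = 1 and J = UNIV])
      show "norm2 N (x - orth_proj N E x) \<le> norm2 N x * 1" for x
        using norm2_resid_le[OF E'] by simp
    qed (use net x s \<kappa> resid_sublinear[OF E] norm2_resid_scale[OF E] in auto)
    then show "norm2 N (x - orth_proj N E x) \<le> \<kappa> * norm2 N x" by simp
  qed
qed

text \<open>The net point \<open>y\<close> near a unit vector \<open>u\<close> has norm at least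
  \<open>1/2\<close>, hence residual at least \<open>b / 2\<close>; the error \<open>y - u\<close>
  is sparse, so its residual is at most \<open>\<kappa> * \<rho> \<le> b / 4\<close>. The upper
  estimate is a premise inside the event, so its exceptional set is accounted for
  separately.\<close>

lemma sparse_lower:
  fixes \<kappa> \<rho> :: real
  defines "b \<equiv> sqrt (resid_const * real n / real N)"
  assumes s: "1 \<le> s" "s \<le> N" and n: "1 \<le> n" "n \<le> N" and \<rho>: "0 < \<rho>" "\<rho> \<le> 1/2" "\<kappa> * \<rho> \<le> b / 4"
  shows "holds_except \<mu> (\<lambda>E. (\<forall>x\<in>Rn N. card (Poly_Mapping.keys x) \<le> s \<longrightarrow> norm2 N (x - orth_proj N E x) \<le> \<kappa> * norm2 N x) \<longrightarrow>
      (\<forall>x\<in>Rn N. card (Poly_Mapping.keys x) \<le> s \<longrightarrow> b / 4 * norm2 N x \<le> norm2 N (x - orth_proj N E x)))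
    ((real N / real s * exp (2 + 1 / \<rho>)) ^ s * (2 * exp (- 5 * real n)))"
proof (rule holds_except_mono)
  show "holds_except \<mu> (\<lambda>E. \<forall>y\<in>sparse_net N s \<rho>. b * norm2 N y \<le> norm2 N (y - orth_proj N E y))
    (\<Sum>y\<in>sparse_net N s \<rho>. 2 * exp (- 5 * real n))"
    unfolding b_def using n by (intro holds_except_all finite_sparse_net resid_lower sparse_net_in_Rn) auto
  show "(\<Sum>y\<in>sparse_net N s \<rho>. 2 * exp (- 5 * real n)) \<le> (real N / real s * exp (2 + 1 / \<rho>)) ^ s * (2 * exp (- 5 * real n))"
    using mult_right_mono[OF card_sparse_net[OF s \<rho>(1)], of "2 * exp (- 5 * real n)"] by simp
  fix E assume E: "E \<in> space \<mu>" and net: "\<forall>y\<in>sparse_net N s \<rho>. b * norm2 N y \<le> norm2 N (y - orth_proj N E y)"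
  have b0: "0 \<le> b" by (simp add: b_def resid_const_def)
  show "(\<forall>x\<in>Rn N. card (Poly_Mapping.keys x) \<le> s \<longrightarrow> norm2 N (x - orth_proj N E x) \<le> \<kappa> * norm2 N x) \<longrightarrow>
      (\<forall>x\<in>Rn N. card (Poly_Mapping.keys x) \<le> s \<longrightarrow> b / 4 * norm2 N x \<le> norm2 N (x - orth_proj N E x))"
  proof (intro impI ballI)
    assume up: "\<forall>x\<in>Rn N. card (Poly_Mapping.keys x) \<le> s \<longrightarrow> norm2 N (x - orth_proj N E x) \<le> \<kappa> * norm2 N x"
    fix x assume x: "x \<in> Rn N" "card (Poly_Mapping.keys x) \<le> s"
    show "b / 4 * norm2 N x \<le> norm2 N (x - orth_proj N E x)"
    proof (cases "x = 0")
      case False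
      then have np: "norm2 N x > 0" using norm2_pos x by blast
      define u where "u = inverse (norm2 N x) *\<^sub>R x"
      have u: "u \<in> Rn N" "norm2 N u = 1" "card (Poly_Mapping.keys u) \<le> s"
        using x np card_mono[OF finite_keys keys_scaleR_subset, of "inverse (norm2 N x)" x] by (auto simp: u_def)
      obtain y where y: "y \<in> sparse_net N s \<rho>" "Poly_Mapping.keys y \<subseteq> Poly_Mapping.keys u"
        "norm2 N (u - y) \<le> \<rho>" "norm2 N y \<le> norm2 N u"
        using sparse_net_approx[OF u(1,3) _ s(1) \<rho>(1)] u(2) by auto
      have yR: "y \<in> Rn N" using sparse_net_in_Rn[OF y(1)] .
      have k: "Poly_Mapping.keys (y - u) \<subseteq> Poly_Mapping.keys u"
        using y(2) by (auto simp: in_keys_iff lookup_minus subset_iff)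
      have "norm2 N ((y - u) - orth_proj N E (y - u)) \<le> \<kappa> * norm2 N (y - u)"
        using u yR card_mono[OF finite_keys k] by (intro up[rule_format]) auto
      also have "\<dots> \<le> b / 4"
      proof (cases "\<kappa> \<ge> 0")
        case True
        have "\<kappa> * norm2 N (y - u) \<le> \<kappa> * \<rho>" using y(3) True by (intro mult_left_mono) (auto simp: norm2_minus_commute)
        then show ?thesis using \<rho> by simp
      next
        case False
        then have "\<kappa> * norm2 N (y - u) \<le> 0" by (simp add: mult_nonpos_nonneg)
        then show ?thesis using b0 by simp
      qed
      finally have 1: "norm2 N ((y - u) - orth_proj N E (y - u)) \<le> b / 4" .
      have "1 \<le> norm2 N y + norm2 N (u - y)" using norm2_triangle_sub[of N u y] u by simp
      then have "1 / 2 \<le> norm2 N y" using y(3) \<rho> by simp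
      then have "b * (1/2) \<le> b * norm2 N y" using b0 by (rule mult_left_mono)
      then have 2: "b / 2 \<le> norm2 N (y - orth_proj N E y)" using net y(1) by fastforce
      have "norm2 N (y - orth_proj N E y) \<le> norm2 N (u - orth_proj N E u) + norm2 N ((y - u) - orth_proj N E (y - u))"
        using resid_sublinear[OF E, of u "y - u"] by simp
      then have "b / 4 \<le> norm2 N (u - orth_proj N E u)" using 1 2 by linarith
      also have "\<dots> = norm2 N (x - orth_proj N E x) / norm2 N x"
        unfolding u_def norm2_resid_scale[OF E] using np by (simp add: divide_inverse mult.commute)
      finally show ?thesis using np by (simp add: pos_le_divide_eq)
    qed simp
  qed
qed

text \<open>The union bound for a linear functional, over net points without first coordinate.
  Rounding keeps supports, so with \<open>J = - {1}\<close> the approximation stays orthogonal to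
  \<open>e_1\<close>.\<close>

lemma sparse_marginal:
  fixes \<tau> :: real
  assumes s: "1 \<le> s" "s \<le> N" and N: "2 \<le> N" and \<tau>: "0 \<le> \<tau>"
  shows "holds_except \<mu> (\<lambda>E. \<forall>y\<in>Rn N. card (Poly_Mapping.keys y) \<le> s \<longrightarrow> lk y 1 = 0 \<longrightarrow>
      inner2 N (orth_proj N E (unit_vec 1)) y \<le> \<tau> * norm2 N (orth_proj N E (unit_vec 1)) * norm2 N y)
    ((real N / real s * exp 4) ^ s * (2 * exp (- \<tau>\<^sup>2 * real N / 96)))"
proof (rule holds_except_mono)
  let ?x = "\<lambda>E. orth_proj N E (unit_vec 1)"
  let ?D = "{y \<in> sparse_net N s (1/2). lk y 1 = 0}"
  have finD: "finite ?D" using finite_sparse_net by simp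
  have e1: "unit_vec 1 \<in> Rn N" using N by (intro unit_vec_in_Rn) auto
  note [measurable] = measurable_norm2_orth_proj_haar[OF e1] measurable_inner_orth_proj_haar[OF e1]
  have single: "holds_except \<mu> (\<lambda>E. inner2 N (?x E) y \<le> \<tau> / 2 * norm2 N (?x E) * norm2 N y) (2 * exp (- (\<tau> / 2)\<^sup>2 * real N / 24))"
    if y: "y \<in> Rn N" "lk y 1 = 0" for y
  proof (cases "y = 0")
    case True
    then show ?thesis by (intro holds_exceptI[of "\<lambda>_. False"]) auto
  next
    case False
    have np: "norm2 N y > 0" using norm2_pos[OF y(1) False] .
    define u where "u = inverse (norm2 N y) *\<^sub>R y"
    have u: "u \<in> Rn N" "norm2 N u = 1" "lk u 1 = 0" using y np by (auto simp: u_def)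
    show ?thesis
    proof (rule holds_exceptI[OF _ marginal_unit[OF N u]])
      show "{E \<in> space \<mu>. \<tau> / 2 * norm2 N (?x E) < inner2 N (?x E) u} \<in> sets \<mu>"
        by measurable
      fix E assume n: "\<not> \<tau> / 2 * norm2 N (?x E) < inner2 N (?x E) u"
      have "inner2 N (?x E) u = inner2 N (?x E) y / norm2 N y"
        by (simp add: u_def inverse_eq_divide)
      then have "inner2 N (?x E) y / norm2 N y \<le> \<tau> / 2 * norm2 N (?x E)"
        using n by linarith
      then show "inner2 N (?x E) y \<le> \<tau> / 2 * norm2 N (?x E) * norm2 N y"
        using np by (simp add: pos_divide_le_eq)
    qed (use \<tau> in auto)
  qed
  show "holds_except \<mu> (\<lambda>E. \<forall>y\<in>?D. inner2 N (?x E) y \<le> \<tau> / 2 * norm2 N (?x E) * norm2 N y)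
     (\<Sum>y\<in>?D. 2 * exp (- (\<tau> / 2)\<^sup>2 * real N / 24))"
    by (intro holds_except_all finD single) (auto intro: sparse_net_in_Rn)
  have "(\<Sum>y\<in>?D. 2 * exp (- (\<tau> / 2)\<^sup>2 * real N / 24)) = real (card ?D) * (2 * exp (- \<tau>\<^sup>2 * real N / 96))"
    by (simp add: power_divide)
  also have "\<dots> \<le> (real N / real s * exp 4) ^ s * (2 * exp (- \<tau>\<^sup>2 * real N / 96))"
  proof (rule mult_right_mono)
    have "real (card ?D) \<le> real (card (sparse_net N s (1/2)))"
      by (intro of_nat_mono card_mono finite_sparse_net) auto
    also have "\<dots> \<le> (real N / real s * exp 4) ^ s" using card_sparse_net[OF s, of "1/2"] by simp
    finally show "real (card ?D) \<le> (real N / real s * exp 4) ^ s" .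
  qed simp
  finally show "(\<Sum>y\<in>?D. 2 * exp (- (\<tau> / 2)\<^sup>2 * real N / 24)) \<le> (real N / real s * exp 4) ^ s * (2 * exp (- \<tau>\<^sup>2 * real N / 96))" .
  fix E assume E: "E \<in> space \<mu>" and net: "\<forall>y\<in>?D. inner2 N (?x E) y \<le> \<tau> / 2 * norm2 N (?x E) * norm2 N y"
  show "\<forall>y\<in>Rn N. card (Poly_Mapping.keys y) \<le> s \<longrightarrow> lk y 1 = 0 \<longrightarrow> inner2 N (?x E) y \<le> \<tau> * norm2 N (?x E) * norm2 N y"
  proof (intro ballI impI)
    fix y assume y: "y \<in> Rn N" "card (Poly_Mapping.keys y) \<le> s" "lk y 1 = 0"
    have "inner2 N (?x E) y \<le> 2 * (\<tau> / 2 * norm2 N (?x E)) * norm2 N y"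
    proof (rule sparse_net_sup[where f = "inner2 N (?x E)" and C = "norm2 N (?x E)" and J = "- {1}"])
      show "inner2 N (?x E) x \<le> norm2 N x * norm2 N (?x E)" for x
        using inner2_Cauchy_Schwarz[of N "?x E" x] by (simp add: mult.commute)
      fix z assume "z \<in> sparse_net N s (1/2)" "Poly_Mapping.keys z \<subseteq> - {1}"
      then have "z \<in> ?D" by (auto simp: in_keys_iff)
      then show "inner2 N (?x E) z \<le> \<tau> / 2 * norm2 N (?x E) * norm2 N z" using net by blast
    qed (use y s \<tau> in \<open>auto simp: inner2_add_right in_keys_iff\<close>)
    then show "inner2 N (?x E) y \<le> \<tau> * norm2 N (?x E) * norm2 N y" by simp
  qed
qed

end

section \<open>The semiaxes\<close>

lemma sigma_seq_pos: "1 \<le> j \<Longrightarrow> 0 < sigma_seq \<alpha> \<beta> j"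
  by (simp add: sigma_seq_def)

text \<open>The work is in \<open>b < 0\<close>: from
  \<open>ln (N + 1) \<le> ln (i + 1) + ln (N / i)\<close> and \<open>ln r \<le> r powr k / k\<close>
  the ratio of the logarithms is at most \<open>D * (N / i) powr k\<close>. With
  \<open>k = \<eta> / (- b)\<close>, its power \<open>- b\<close> costs exactly
  \<open>(N / i) powr \<eta>\<close>.\<close>

lemma powr_ln_quasi_mono:
  fixes \<eta> b :: real
  assumes \<eta>: "0 < \<eta>"
  shows "\<exists>C>0. \<forall>i N :: nat. 1 \<le> i \<longrightarrow> i \<le> N \<longrightarrow>
    real i powr \<eta> * ln (real i + 1) powr b \<le> C * (real N powr \<eta> * ln (real N + 1) powr b)"
proof (cases "0 \<le> b")
  case True
  show ?thesis
  proof (intro exI[of _ 1] conjI allI impI)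
    fix i N :: nat assume iN: "1 \<le> i" "i \<le> N"
    show "real i powr \<eta> * ln (real i + 1) powr b \<le> 1 * (real N powr \<eta> * ln (real N + 1) powr b)"
      using iN \<eta> True by (auto intro!: mult_mono powr_mono2)
  qed simp
next
  case False
  define k where "k = \<eta> / (- b)"
  have k: "k > 0" using divide_pos_pos[of \<eta> "- b"] \<eta> False by (simp add: k_def)
  define D where "D = 1 + 1 / (k * ln 2)"
  have D: "D \<ge> 1" using k by (simp add: D_def)
  show ?thesis
  proof (intro exI[of _ "D powr (- b)"] conjI allI impI)
    show "0 < D powr (- b)" using D by simp
    fix i N :: nat assume iN: "1 \<le> i" "i \<le> N"
    let ?r = "real N / real i"
    have r: "1 \<le> ?r" using iN by simp
    have l2: "ln 2 \<le> ln (real i + 1)" using iN by simp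
    have l2p: "0 < ln (real i + 1)" using iN by simp
    have "real N + 1 \<le> (real i + 1) * ?r"
      using iN by (simp add: field_simps)
    then have "ln (real N + 1) \<le> ln ((real i + 1) * ?r)"
      using iN by (intro ln_mono) auto
    also have "\<dots> = ln (real i + 1) + ln ?r"
      using iN by (intro ln_mult_pos) auto
    also have "ln ?r \<le> ?r powr k / k"
    proof -
      have "k * ln ?r = ln (?r powr k)" using r by (simp add: ln_powr)
      also have "\<dots> \<le> ?r powr k" using ln_le_minus_one[of "?r powr k"] iN by simp
      finally show ?thesis using k by (simp add: field_simps)
    qed
    also have "?r powr k / k \<le> ln (real i + 1) * (?r powr k / (k * ln 2))"
    proof -
      have "1 * (?r powr k / k) \<le> (ln (real i + 1) / ln 2) * (?r powr k / k)"
        using l2 k by (intro mult_right_mono) (auto simp: le_divide_eq)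
      then show ?thesis by (simp add: mult_ac)
    qed
    also have "ln (real i + 1) + ln (real i + 1) * (?r powr k / (k * ln 2)) \<le>
        ln (real i + 1) * ?r powr k + ln (real i + 1) * (?r powr k / (k * ln 2))"
      using r k l2p ge_one_powr_ge_zero[of ?r k] by (intro add_right_mono) (simp add: mult_le_cancel_left1)
    also have "\<dots> = D * (ln (real i + 1) * ?r powr k)" by (simp add: D_def algebra_simps)
    finally have "ln (real N + 1) \<le> D * (ln (real i + 1) * ?r powr k)" by simp
    then have "ln (real N + 1) powr (- b) \<le> (D * (ln (real i + 1) * ?r powr k)) powr (- b)"
      using False iN by (intro powr_mono2) auto
    also have "\<dots> = D powr (- b) * ln (real i + 1) powr (- b) * ?r powr \<eta>"
      using D l2p r False by (simp add: powr_mult powr_powr k_def)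
    finally have main: "ln (real N + 1) powr (- b) \<le> D powr (- b) * ln (real i + 1) powr (- b) * ?r powr \<eta>" .
    have lN: "0 < ln (real N + 1)" using iN by simp
    have "real i powr \<eta> * ln (real i + 1) powr b =
        real i powr \<eta> * ln (real i + 1) powr b * (ln (real N + 1) powr b * ln (real N + 1) powr (- b))"
      using lN by (simp add: powr_add[symmetric])
    also have "\<dots> \<le> real i powr \<eta> * ln (real i + 1) powr b * (ln (real N + 1) powr b *
        (D powr (- b) * ln (real i + 1) powr (- b) * ?r powr \<eta>))"
      by (intro mult_left_mono main) auto
    also have "\<dots> = D powr (- b) * (real N powr \<eta> * ln (real N + 1) powr b) *
        (ln (real i + 1) powr b * ln (real i + 1) powr (- b))"
      using iN by (simp add: powr_divide)
    also have "\<dots> = D powr (- b) * (real N powr \<eta> * ln (real N + 1) powr b)"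
      using l2p by (simp add: powr_add[symmetric])
    finally show "real i powr \<eta> * ln (real i + 1) powr b \<le> D powr (- b) * (real N powr \<eta> * ln (real N + 1) powr b)" .
  qed
qed

text \<open>For \<beta> < 0 the semiaxes may increase at small indices, so monotonicity holds up to
  a constant only.\<close>

lemma sigma_seq_quasi_decreasing:
  assumes "0 < \<alpha>"
  shows "\<exists>C>0. \<forall>i N. 1 \<le> i \<longrightarrow> i \<le> N \<longrightarrow> sigma_seq \<alpha> \<beta> N \<le> C * sigma_seq \<alpha> \<beta> i"
proof -
  obtain C where C: "C > 0" "\<And>i N :: nat. 1 \<le> i \<Longrightarrow> i \<le> N \<Longrightarrow>
    real i powr \<alpha> * ln (real i + 1) powr \<beta> \<le> C * (real N powr \<alpha> * ln (real N + 1) powr \<beta>)"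
    using powr_ln_quasi_mono[OF assms] by blast
  have inv: "sigma_seq \<alpha> \<beta> j = 1 / (real j powr \<alpha> * ln (real j + 1) powr \<beta>)" for j
    by (simp add: sigma_seq_def powr_minus divide_inverse)
  show ?thesis
  proof (intro exI[of _ C] conjI allI impI C(1))
    fix i N :: nat assume iN: "1 \<le> i" "i \<le> N"
    let ?a = "real i powr \<alpha> * ln (real i + 1) powr \<beta>" and ?b = "real N powr \<alpha> * ln (real N + 1) powr \<beta>"
    have "0 < ?a" "0 < ?b" using iN by auto
    then show "sigma_seq \<alpha> \<beta> N \<le> C * sigma_seq \<alpha> \<beta> i"
      unfolding inv using C(2)[OF iN] by (simp add: divide_le_eq le_divide_eq mult_ac)
  qed
qed

text \<open>An exponent above \<alpha> absorbs the ratio of logarithms, while the factor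
  \<open>sigma_seq \<alpha> \<beta> N\<close> keeps the exact logarithm at \<open>N\<close>.\<close>

lemma sigma_seq_growth:
  assumes "\<alpha> < a"
  shows "\<exists>C>0. \<forall>i N. 1 \<le> i \<longrightarrow> i \<le> N \<longrightarrow> sigma_seq \<alpha> \<beta> i \<le> C * sigma_seq \<alpha> \<beta> N * real N powr a * real i powr (- a)"
proof -
  obtain C where C: "C > 0" "\<And>i N :: nat. 1 \<le> i \<Longrightarrow> i \<le> N \<Longrightarrow>
    real i powr (a - \<alpha>) * ln (real i + 1) powr (- \<beta>) \<le> C * (real N powr (a - \<alpha>) * ln (real N + 1) powr (- \<beta>))"
    using powr_ln_quasi_mono[of "a - \<alpha>" "- \<beta>"] assms by auto
  show ?thesis
  proof (intro exI[of _ C] conjI allI impI C(1))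
    fix i N :: nat assume iN: "1 \<le> i" "i \<le> N"
    have "sigma_seq \<alpha> \<beta> i = real i powr (a - \<alpha>) * ln (real i + 1) powr (- \<beta>) * real i powr (- a)"
      by (simp add: sigma_seq_def powr_add[symmetric] mult_ac)
    also have "\<dots> \<le> C * (real N powr (a - \<alpha>) * ln (real N + 1) powr (- \<beta>)) * real i powr (- a)"
      by (intro mult_right_mono C(2) iN) auto
    also have "real N powr (a - \<alpha>) = real N powr (- \<alpha>) * real N powr a"
      by (simp add: powr_add[symmetric])
    finally show "sigma_seq \<alpha> \<beta> i \<le> C * sigma_seq \<alpha> \<beta> N * real N powr a * real i powr (- a)"
      by (simp add: sigma_seq_def mult_ac)
  qed
qed

text \<open>Comparison with index 1 in \<open>powr_ln_quasi_mono\<close>; the lowered exponent pays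
  for the logarithm.\<close>

lemma sigma_seq_upper:
  assumes "a < \<alpha>"
  shows "\<exists>C>0. \<forall>i. 1 \<le> i \<longrightarrow> sigma_seq \<alpha> \<beta> i \<le> C * real i powr (- a)"
proof -
  obtain C where C: "C > 0" "\<And>i N :: nat. 1 \<le> i \<Longrightarrow> i \<le> N \<Longrightarrow>
    real i powr (\<alpha> - a) * ln (real i + 1) powr \<beta> \<le> C * (real N powr (\<alpha> - a) * ln (real N + 1) powr \<beta>)"
    using powr_ln_quasi_mono[of "\<alpha> - a" \<beta>] assms by auto
  have l: "0 < ln (2::real) powr \<beta>" by simp
  show ?thesis
  proof (intro exI[of _ "C / ln 2 powr \<beta>"] conjI allI impI)
    show "0 < C / ln 2 powr \<beta>" using C l by simp
    fix i :: nat assume i: "1 \<le> i"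
    have "ln 2 powr \<beta> \<le> C * (real i powr (\<alpha> - a) * ln (real i + 1) powr \<beta>)"
      using C(2)[of 1 i] i by (simp add: one_add_one)
    then have "1 \<le> C / ln 2 powr \<beta> * (real i powr (\<alpha> - a) * ln (real i + 1) powr \<beta>)"
      using l by (simp add: le_divide_eq)
    then have "sigma_seq \<alpha> \<beta> i * 1 \<le> sigma_seq \<alpha> \<beta> i * (C / ln 2 powr \<beta> * (real i powr (\<alpha> - a) * ln (real i + 1) powr \<beta>))"
      using sigma_seq_pos[OF i, of \<alpha> \<beta>] by (intro mult_left_mono) auto
    also have "\<dots> = C / ln 2 powr \<beta> * (real i powr (- \<alpha>) * real i powr (\<alpha> - a)) * (ln (real i + 1) powr (- \<beta>) * ln (real i + 1) powr \<beta>)"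
      by (simp add: sigma_seq_def mult_ac)
    also have "\<dots> = C / ln 2 powr \<beta> * real i powr (- a)"
      using i by (simp add: powr_add[symmetric])
    finally show "sigma_seq \<alpha> \<beta> i \<le> C / ln 2 powr \<beta> * real i powr (- a)" by simp
  qed
qed

text \<open>Induction in place of an integral: the increment of \<open>t powr (1 - c)\<close> from
  \<open>t - 1\<close> to \<open>t\<close> is at least \<open>(1 - c) * t powr (- c)\<close>, by the
  weighted arithmetic-geometric mean of \<open>(t - 1) / t\<close> and 1.\<close>

lemma sum_powr_le:
  fixes c :: real
  assumes c: "0 \<le> c" "c < 1"
  shows "(\<Sum>i=1..s. real i powr (- c)) \<le> real s powr (1 - c) / (1 - c)"
proof (induction s)
  case (Suc s)
  show ?case
  proof (cases "s = 0")
    case True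
    then show ?thesis using c by (simp add: One_nat_def)
  next
    case False
    let ?t = "real (Suc s)"
    have tc: "?t powr (1 - c) = ?t * ?t powr (- c)"
      using powr_mult_base[of ?t "- c"] by simp
    have "(real s / ?t) powr (1 - c) * 1 powr c \<le> (1 - c) * (real s / ?t) + c * 1"
      using c False by (intro Youngs_inequality_0) auto
    also have "\<dots> = 1 - (1 - c) / ?t" by (simp add: field_simps)
    finally have "real s powr (1 - c) / ?t powr (1 - c) \<le> 1 - (1 - c) / ?t"
      by (simp add: powr_divide)
    then have "real s powr (1 - c) \<le> (1 - (1 - c) / ?t) * ?t powr (1 - c)"
      by (simp add: pos_divide_le_eq)
    also have "\<dots> = ?t powr (1 - c) - (1 - c) * ?t powr (- c)"
      unfolding tc by (simp add: field_simps)
    finally have "real s powr (1 - c) + (1 - c) * ?t powr (- c) \<le> ?t powr (1 - c)" by simp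
    then have "(real s powr (1 - c) + (1 - c) * ?t powr (- c)) / (1 - c) \<le> ?t powr (1 - c) / (1 - c)"
      using c by (intro divide_right_mono) auto
    then have "real s powr (1 - c) / (1 - c) + ?t powr (- c) \<le> ?t powr (1 - c) / (1 - c)"
      using c by (simp add: add_divide_distrib)
    then show ?thesis using Suc.IH by simp
  qed
qed simp

text \<open>The initial segment is essentially the worst set of its size: an index beyond
  \<open>card S\<close> contributes at most \<open>card S powr (- c)\<close>.\<close>

lemma sum_powr_set_le:
  fixes c :: real
  assumes c: "0 \<le> c" "c < 1" and S: "finite S" "S \<subseteq> {1..}"
  shows "(\<Sum>i\<in>S. real i powr (- c)) \<le> (1 + 1 / (1 - c)) * real (card S) powr (1 - c)"
proof (cases "S = {}")
  case False
  let ?s = "card S"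
  have s: "1 \<le> ?s" using S False by (simp add: Suc_leI card_gt_0_iff One_nat_def)
  have "(\<Sum>i\<in>S. real i powr (- c)) = (\<Sum>i\<in>S \<inter> {1..?s}. real i powr (- c)) + (\<Sum>i\<in>S - {1..?s}. real i powr (- c))"
    using S by (metis sum.Int_Diff)
  also have "\<dots> \<le> (\<Sum>i=1..?s. real i powr (- c)) + (\<Sum>i\<in>S - {1..?s}. real ?s powr (- c))"
  proof (rule add_mono)
    show "(\<Sum>i\<in>S \<inter> {1..?s}. real i powr (- c)) \<le> (\<Sum>i=1..?s. real i powr (- c))"
      by (rule sum_mono2) auto
    show "(\<Sum>i\<in>S - {1..?s}. real i powr (- c)) \<le> (\<Sum>i\<in>S - {1..?s}. real ?s powr (- c))"
      using S s c by (intro sum_mono powr_mono2') auto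
  qed
  also have "\<dots> \<le> real ?s powr (1 - c) / (1 - c) + real ?s * real ?s powr (- c)"
    using S by (intro add_mono sum_powr_le c) (auto intro!: mult_right_mono of_nat_mono card_mono)
  also have "real ?s * real ?s powr (- c) = real ?s powr (1 - c)"
    using s by (simp add: powr_diff powr_minus divide_inverse)
  finally show ?thesis by (simp add: algebra_simps)
qed simp

text \<open>Hoelder's inequality between the weighted \<open>l_p\<close> norm of \<open>x\<close>
  and the \<open>l_q\<close> norm of \<sigma> on \<open>S\<close>, obtained termwise from Young's
  inequality after dividing by the bound \<open>B\<close> for the latter. \<open>a * q < 1\<close>
  makes the \<open>q\<close>-th powers sum to a power of \<open>card S\<close>.\<close>

lemma p_ellipsoid_sum_le:
  fixes p q a D :: real
  assumes p: "1 < p" and pq: "1 / p + 1 / q = 1" and a: "0 \<le> a" "a * q < 1" and D: "0 < D"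
    and \<sigma>: "\<And>i. i \<in> {1..N} \<Longrightarrow> 0 < \<sigma> i \<and> \<sigma> i \<le> D * real i powr (- a)"
    and x: "x \<in> p_ellipsoid N p \<sigma>" and S: "S \<subseteq> {1..N}"
  shows "(\<Sum>i\<in>S. \<bar>lk x i\<bar>) \<le> (1 + 1 / (1 - a * q)) powr (1 / q) * D * real (card S) powr (1 / q - a)"
proof (cases "S = {}")
  case False
  have q: "q > 1"
  proof -
    have "1 / q = (p - 1) / p" using pq p by (simp add: field_simps)
    then have "q = p / (p - 1)" by (metis inverse_divide inverse_eq_divide inverse_inverse_eq)
    then show ?thesis using p by simp
  qed
  have finS: "finite S" using S by (rule finite_subset) simp
  have s: "0 < card S" using False finS by (simp add: card_gt_0_iff)
  define C where "C = 1 + 1 / (1 - a * q)"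
  have C: "C > 0" using a by (simp add: C_def add_pos_pos)
  define B where "B = C powr (1 / q) * D * real (card S) powr (1 / q - a)"
  have B: "B > 0" using C D s by (simp add: B_def)
  have Bq: "B powr q = C * D powr q * real (card S) powr (1 - a * q)"
    using C D s q by (simp add: B_def powr_mult powr_powr left_diff_distrib)
  have 1: "(\<Sum>i\<in>S. \<sigma> i powr q) \<le> B powr q"
  proof -
    have "(\<Sum>i\<in>S. \<sigma> i powr q) \<le> (\<Sum>i\<in>S. D powr q * real i powr (- (a * q)))"
    proof (rule sum_mono)
      fix i assume "i \<in> S"
      then have i: "i \<in> {1..N}" using S by auto
      have "\<sigma> i powr q \<le> (D * real i powr (- a)) powr q"
        using \<sigma>[OF i] q by (intro powr_mono2) auto
      also have "\<dots> = D powr q * real i powr (- (a * q))"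
        using D by (simp add: powr_mult powr_powr)
      finally show "\<sigma> i powr q \<le> D powr q * real i powr (- (a * q))" .
    qed
    also have "\<dots> = D powr q * (\<Sum>i\<in>S. real i powr (- (a * q)))" by (simp add: sum_distrib_left)
    also have "\<dots> \<le> D powr q * (C * real (card S) powr (1 - a * q))"
      unfolding C_def using a q finS S by (intro mult_left_mono sum_powr_set_le) auto
    finally show ?thesis by (simp add: Bq mult_ac)
  qed
  have 2: "(\<Sum>i\<in>S. (\<bar>lk x i\<bar> / \<sigma> i) powr p) \<le> 1"
  proof -
    have "(\<Sum>i\<in>S. (\<bar>lk x i\<bar> / \<sigma> i) powr p) \<le> (\<Sum>i=1..N. (\<bar>lk x i\<bar> / \<sigma> i) powr p)"
      using S by (intro sum_mono2) auto
    also have "\<dots> \<le> 1" using x by (simp add: p_ellipsoid_def)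
    finally show ?thesis .
  qed
  have "(\<Sum>i\<in>S. \<bar>lk x i\<bar>) / B = (\<Sum>i\<in>S. (\<bar>lk x i\<bar> / \<sigma> i) * (\<sigma> i / B))"
    unfolding sum_divide_distrib using \<sigma> S by (intro sum.cong) (auto simp: less_imp_neq[symmetric] subset_iff dest: less_imp_neq)
  also have "\<dots> \<le> (\<Sum>i\<in>S. (\<bar>lk x i\<bar> / \<sigma> i) powr p / p + (\<sigma> i / B) powr q / q)"
    using \<sigma> S B p q pq by (intro sum_mono Youngs_inequality) (auto simp: subset_iff less_imp_le)
  also have "\<dots> = (\<Sum>i\<in>S. (\<bar>lk x i\<bar> / \<sigma> i) powr p) / p + (\<Sum>i\<in>S. (\<sigma> i / B) powr q) / q"
    by (simp add: sum.distrib sum_divide_distrib)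
  also have "(\<Sum>i\<in>S. (\<sigma> i / B) powr q) = (\<Sum>i\<in>S. \<sigma> i powr q) / B powr q"
    unfolding sum_divide_distrib using \<sigma> S B by (intro sum.cong) (auto simp: powr_divide subset_iff less_imp_le)
  also have "(\<Sum>i\<in>S. (\<bar>lk x i\<bar> / \<sigma> i) powr p) / p + (\<Sum>i\<in>S. \<sigma> i powr q) / B powr q / q \<le> 1 / p + 1 / q"
    using 1 2 p q B by (intro add_mono divide_right_mono) auto
  finally have "(\<Sum>i\<in>S. \<bar>lk x i\<bar>) \<le> B" using B pq by (simp add: pos_divide_le_eq)
  then show ?thesis by (simp add: B_def C_def)
qed simp

section \<open>Decomposition of a vector along dyadic level sets\<close>

definition restr :: "nat \<Rightarrow> nat set \<Rightarrow> fseq \<Rightarrow> fseq" where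
  "restr N T x = vec_of N (\<lambda>i. if i \<in> T then lk x i else 0)"

lemma restr_in_Rn [simp]: "restr N T x \<in> Rn N"
  by (simp add: restr_def)

lemma lookup_restr [simp]: "lk (restr N T x) i = (if i \<in> {1..N} \<and> i \<in> T then lk x i else 0)"
  by (simp add: restr_def)

lemma card_keys_restr: "finite T \<Longrightarrow> card (Poly_Mapping.keys (restr N T x)) \<le> card T"
  by (rule card_mono) (auto simp: in_keys_iff split: if_splits)

lemma restr_all: "x \<in> Rn N \<Longrightarrow> restr N {1..N} x = x"
  by (rule Rn_eqI[of _ N]) auto

lemma norm2_le_sqrt_card:
  assumes x: "\<And>i. i \<in> {1..N} \<Longrightarrow> \<bar>lk x i\<bar> \<le> a" and a: "0 \<le> a" and K: "card (Poly_Mapping.keys x) \<le> k"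
  shows "norm2 N x \<le> sqrt (real k) * a"
proof -
  let ?K = "{1..N} \<inter> Poly_Mapping.keys x"
  have "card ?K \<le> card (Poly_Mapping.keys x)" by (rule card_mono) auto
  then have ck: "card ?K \<le> k" using K by simp
  have "(norm2 N x)\<^sup>2 = (\<Sum>i\<in>?K. (lk x i)\<^sup>2)"
    unfolding norm2_sq_sum by (rule sum.mono_neutral_right) (auto simp: in_keys_iff)
  also have "\<dots> \<le> (\<Sum>i\<in>?K. a\<^sup>2)"
    using x a by (intro sum_mono) (metis IntD1 abs_ge_zero power2_abs power_mono)
  also have "\<dots> \<le> real k * a\<^sup>2" using ck by (simp add: mult_right_mono)
  also have "\<dots> = (sqrt (real k) * a)\<^sup>2" by (simp add: power_mult_distrib)
  finally show ?thesis by (rule power2_le_imp_le) (use a in simp)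
qed

text \<open>The sum hypothesis leaves at most \<open>s j = 2 ^ j * s0\<close> coordinates above the
  level \<open>a j = A * s j powr (\<eta> - 1)\<close>. Between consecutive levels the entries are
  at most \<open>a j\<close>, so a block has norm at most \<open>sqrt (2 * s j) * a j\<close>. The
  conclusion quantifies over \<open>f\<close> because one head \<open>T\<close> has to serve for
  both the norm and the residual norm.\<close>

lemma dyadic_decomposition:
  fixes f :: "fseq \<Rightarrow> real" and A \<eta> :: real
  assumes x: "x \<in> Rn N" and A: "0 \<le> A" and \<eta>: "\<eta> < 1" and s0: "1 \<le> s0" and J: "N \<le> 2 ^ J * s0"
    and sums: "\<And>S. S \<subseteq> {1..N} \<Longrightarrow> (\<Sum>i\<in>S. \<bar>lk x i\<bar>) \<le> A * real (card S) powr \<eta>"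
  obtains T where "T \<subseteq> {1..N}" "card T \<le> s0"
    "\<And>f K. (\<And>x y. f (x + y) \<le> f x + f y) \<Longrightarrow> f 0 \<le> (0::real) \<Longrightarrow> (\<And>j. 0 \<le> K j) \<Longrightarrow>
      (\<And>j y. j < J \<Longrightarrow> y \<in> Rn N \<Longrightarrow> card (Poly_Mapping.keys y) \<le> 2 ^ Suc j * s0 \<Longrightarrow> f y \<le> K j * norm2 N y) \<Longrightarrow>
      f (x - restr N T x) \<le> (\<Sum>j<J. K j * (sqrt 2 * A * real (2 ^ j * s0) powr (\<eta> - 1 / 2)))"
proof -
  define s where "s j = 2 ^ j * s0" for j :: nat
  define a where "a j = A * real (s j) powr (\<eta> - 1)" for j
  \<comment> \<open>From the first scale reaching \<open>N\<close> on, everything is included, so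
    that the telescoping chain ends at \<open>x\<close> itself.\<close>
  define T where "T j = (if N \<le> s j then {1..N} else {i \<in> {1..N}. a j < \<bar>lk x i\<bar>})" for j
  have sp: "0 < s j" for j using s0 by (simp add: s_def)
  have a0: "0 \<le> a j" for j using A by (simp add: a_def)
  have Tsub: "T j \<subseteq> {1..N}" for j by (auto simp: T_def)
  have Tcard: "card (T j) \<le> s j" for j
  proof (cases "N \<le> s j")
    case False
    let ?t = "card (T j)"
    show ?thesis
    proof (cases "T j = {}")
      case nonempty: False
      have fin: "finite (T j)" using Tsub by (rule finite_subset) simp
      have t: "0 < ?t" using fin nonempty by (simp add: card_gt_0_iff)
      have "real ?t * a j = (\<Sum>i\<in>T j. a j)" by simp
      also have "\<dots> < (\<Sum>i\<in>T j. \<bar>lk x i\<bar>)"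
        using fin nonempty False by (intro sum_strict_mono) (auto simp: T_def)
      also have "\<dots> \<le> A * real ?t powr \<eta>" by (rule sums[OF Tsub])
      finally have lt: "real ?t * (A * real (s j) powr (\<eta> - 1)) < A * real ?t powr \<eta>" by (simp add: a_def)
      then have Ap: "0 < A" using A by (cases "A = 0") auto
      have "real ?t * real (s j) powr (\<eta> - 1) < real ?t powr \<eta>"
        using lt Ap by (simp add: mult.left_commute[of _ A])
      then have "real ?t powr (1 - \<eta>) < real (s j) powr (1 - \<eta>)"
        using t sp[of j] by (simp add: powr_diff field_simps)
      then have "real ?t < real (s j)"
        using \<eta> by (meson diff_gt_0_iff_gt not_less of_nat_0_le_iff powr_mono2 less_imp_le)
      then show ?thesis by simp
    qed simp
  qed (auto simp: T_def)
  have smono: "s j \<le> s (Suc j)" for j by (simp add: s_def)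
  have Tmono: "T j \<subseteq> T (Suc j)" for j
  proof (cases "N \<le> s (Suc j)")
    case False
    then have "\<not> N \<le> s j" using smono[of j] by simp
    moreover have "a (Suc j) \<le> a j"
      unfolding a_def using A \<eta> sp[of j] smono[of j] by (intro mult_left_mono powr_mono2') auto
    ultimately show ?thesis using False by (auto simp: T_def)
  qed (use Tsub in \<open>simp add: T_def\<close>)
  have piece: "norm2 N (restr N (T (Suc j)) x - restr N (T j) x) \<le> sqrt 2 * A * real (s j) powr (\<eta> - 1 / 2)"
    and piece_card: "card (Poly_Mapping.keys (restr N (T (Suc j)) x - restr N (T j) x)) \<le> 2 ^ Suc j * s0" for j
  proof -
    let ?d = "restr N (T (Suc j)) x - restr N (T j) x"
    have "Poly_Mapping.keys ?d \<subseteq> T (Suc j)"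
      using Tmono[of j] by (auto simp: in_keys_iff lookup_minus split: if_splits)
    then have "card (Poly_Mapping.keys ?d) \<le> card (T (Suc j))"
      using Tsub by (intro card_mono) (auto intro: finite_subset)
    then have c: "card (Poly_Mapping.keys ?d) \<le> s (Suc j)" using Tcard[of "Suc j"] by simp
    then show "card (Poly_Mapping.keys ?d) \<le> 2 ^ Suc j * s0" by (simp add: s_def)
    have "\<bar>lk ?d i\<bar> \<le> a j" if "i \<in> {1..N}" for i
      using that Tmono[of j] a0[of j] by (auto simp: lookup_minus T_def split: if_splits)
    then have "norm2 N ?d \<le> sqrt (real (s (Suc j))) * a j"
      by (rule norm2_le_sqrt_card[OF _ a0 c])
    also have "\<dots> = sqrt 2 * A * (sqrt (real (s j)) * real (s j) powr (\<eta> - 1))"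
      by (simp add: s_def a_def real_sqrt_mult)
    also have "sqrt (real (s j)) * real (s j) powr (\<eta> - 1) = real (s j) powr (\<eta> - 1 / 2)"
      using sp[of j] by (simp add: powr_half_sqrt[symmetric] powr_add[symmetric])
    finally show "norm2 N ?d \<le> sqrt 2 * A * real (s j) powr (\<eta> - 1 / 2)" .
  qed
  have TJ: "T J = {1..N}" using J by (simp add: T_def s_def)
  show ?thesis
  proof (rule that[of "T 0"])
    show "T 0 \<subseteq> {1..N}" by (rule Tsub)
    show "card (T 0) \<le> s0" using Tcard[of 0] by (simp add: s_def)
    fix f :: "fseq \<Rightarrow> real" and K :: "nat \<Rightarrow> real"
    assume f: "\<And>x y. f (x + y) \<le> f x + f y" "f 0 \<le> 0" and K0: "\<And>j. 0 \<le> K j"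
      and K: "\<And>j y. j < J \<Longrightarrow> y \<in> Rn N \<Longrightarrow> card (Poly_Mapping.keys y) \<le> 2 ^ Suc j * s0 \<Longrightarrow> f y \<le> K j * norm2 N y"
    have "f (restr N (T k) x - restr N (T 0) x) \<le> (\<Sum>j<k. K j * (sqrt 2 * A * real (2 ^ j * s0) powr (\<eta> - 1 / 2)))"
      if "k \<le> J" for k
      using that
    proof (induction k)
      case (Suc k)
      have "f (restr N (T (Suc k)) x - restr N (T 0) x) =
          f ((restr N (T k) x - restr N (T 0) x) + (restr N (T (Suc k)) x - restr N (T k) x))" by simp
      also have "\<dots> \<le> f (restr N (T k) x - restr N (T 0) x) + f (restr N (T (Suc k)) x - restr N (T k) x)"
        by (rule f)
      also have "f (restr N (T (Suc k)) x - restr N (T k) x) \<le> K k * norm2 N (restr N (T (Suc k)) x - restr N (T k) x)"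
        using Suc.prems by (intro K piece_card) auto
      also have "\<dots> \<le> K k * (sqrt 2 * A * real (2 ^ k * s0) powr (\<eta> - 1 / 2))"
        using piece[of k] K0 by (intro mult_left_mono) (auto simp: s_def)
      finally show ?case using Suc by simp
    qed (use f in simp)
    from this[of J] show "f (x - restr N (T 0) x) \<le> (\<Sum>j<J. K j * (sqrt 2 * A * real (2 ^ j * s0) powr (\<eta> - 1 / 2)))"
      by (simp add: TJ restr_all[OF x])
  qed
qed

lemma geometric_sum_decay:
  fixes c :: real
  assumes c: "0 < c" and s: "1 \<le> s"
  shows "(\<Sum>j<J. real (2 ^ j * s) powr (- c)) \<le> real s powr (- c) / (1 - 2 powr (- c))"
proof -
  let ?r = "2 powr (- c) :: real"
  have r: "0 < ?r" "?r < 1" using c powr_less_mono[of "-c" 0 2] by auto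
  have "real (2 ^ j * s) powr (- c) = real s powr (- c) * ?r ^ j" for j
    using s by (simp add: powr_mult powr_realpow[symmetric] powr_powr mult.commute)
  then have "(\<Sum>j<J. real (2 ^ j * s) powr (- c)) = real s powr (- c) * (\<Sum>j<J. ?r ^ j)"
    by (simp add: sum_distrib_left)
  also have "(\<Sum>j<J. ?r ^ j) \<le> 1 / (1 - ?r)"
    using r c by (simp add: sum_gp_strict divide_right_mono)
  finally show ?thesis by (simp add: mult_left_mono)
qed

lemma geometric_sum_growth:
  fixes c :: real
  assumes c: "0 < c" and s: "1 \<le> s"
  shows "(\<Sum>j<J. real (2 ^ j * s) powr c) \<le> real (2 ^ J * s) powr c / (2 powr c - 1)"
proof (induction J)
  case 0
  have "1 < (2::real) powr c" using c powr_less_mono[of 0 c 2] by auto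
  then show ?case by simp
next
  case (Suc J)
  have r: "1 < (2::real) powr c" using c powr_less_mono[of 0 c 2] by auto
  have "real (2 ^ Suc J * s) powr c = 2 powr c * real (2 ^ J * s) powr c"
    by (simp add: powr_mult mult.assoc)
  then have "real (2 ^ J * s) powr c / (2 powr c - 1) + real (2 ^ J * s) powr c = real (2 ^ Suc J * s) powr c / (2 powr c - 1)"
    using r c by (simp add: divide_simps) (auto simp: algebra_simps)
  then show ?case using Suc by simp
qed

lemma dyadic_index:
  fixes s N :: nat
  assumes "1 \<le> s" "s \<le> N"
  obtains J :: nat where "N \<le> 2 ^ J * s" "2 ^ J * s \<le> 2 * N"
proof -
  define J where "J = (LEAST J. N \<le> 2 ^ J * s)"
  have "N \<le> 2 ^ N * s" using assms less_exp[of N] by (metis less_imp_le mult.right_neutral mult_le_mono)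
  then have 1: "N \<le> 2 ^ J * s" unfolding J_def by (rule LeastI)
  have "2 ^ J * s \<le> 2 * N"
  proof (cases J)
    case (Suc k)
    have "\<not> N \<le> 2 ^ k * s" using not_less_Least[of k "\<lambda>J. N \<le> 2 ^ J * s"] Suc by (simp add: J_def)
    then show ?thesis using Suc by simp
  qed (use assms in simp)
  then show ?thesis using 1 that by blast
qed

text \<open>For \<open>\<eta> < 1/2\<close> the block norms decay geometrically. With
  \<open>s0 = 1\<close> the head is a single coordinate, bounded by \<open>A\<close>.\<close>

lemma tail_norm_bound:
  fixes \<eta> :: real
  assumes \<eta>: "\<eta> < 1 / 2"
  shows "\<exists>C>0. \<forall>N x A. x \<in> Rn N \<longrightarrow> 0 \<le> A \<longrightarrow> (\<forall>S\<subseteq>{1..N}. (\<Sum>i\<in>S. \<bar>lk x i\<bar>) \<le> A * real (card S) powr \<eta>) \<longrightarrow>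
    norm2 N x \<le> C * A"
proof (intro exI conjI allI impI)
  let ?c = "1 / 2 - \<eta>"
  let ?C = "1 + sqrt 2 / (1 - 2 powr (- ?c))"
  have r: "(2::real) powr (- ?c) < 1" using \<eta> powr_less_mono[of "- ?c" 0 2] by auto
  then show "0 < ?C" by (simp add: add_pos_pos)
  fix N x A assume x: "x \<in> Rn N" and A: "0 \<le> A"
    and sums: "\<forall>S\<subseteq>{1..N}. (\<Sum>i\<in>S. \<bar>lk x i\<bar>) \<le> A * real (card S) powr \<eta>"
  show "norm2 N x \<le> ?C * A"
  proof (cases "N = 0")
    case True
    then have "norm2 N x = 0" by (simp add: norm2_def L2_set_def)
    then show ?thesis using A \<open>0 < ?C\<close> by simp
  next
    case False
    obtain J where J: "N \<le> 2 ^ J * 1" using less_exp[of N] by (metis less_imp_le mult.right_neutral)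
    obtain T where T: "T \<subseteq> {1..N}" "card T \<le> 1"
      "\<And>f K. (\<And>x y. f (x + y) \<le> f x + f y) \<Longrightarrow> f 0 \<le> (0::real) \<Longrightarrow> (\<And>j. 0 \<le> K j) \<Longrightarrow>
      (\<And>j y. j < J \<Longrightarrow> y \<in> Rn N \<Longrightarrow> card (Poly_Mapping.keys y) \<le> 2 ^ Suc j * 1 \<Longrightarrow> f y \<le> K j * norm2 N y) \<Longrightarrow>
      f (x - restr N T x) \<le> (\<Sum>j<J. K j * (sqrt 2 * A * real (2 ^ j * 1) powr (\<eta> - 1 / 2)))"
      by (rule dyadic_decomposition[OF x A _ order_refl J, of \<eta>]) (use sums \<eta> in auto)
    have "norm2 N (x - restr N T x) \<le> (\<Sum>j<J. 1 * (sqrt 2 * A * real (2 ^ j * 1) powr (\<eta> - 1 / 2)))"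
      by (rule T(3)) (auto simp: norm2_triangle)
    also have "\<dots> = sqrt 2 * A * (\<Sum>j<J. real (2 ^ j * 1) powr (- ?c))"
      by (simp add: sum_distrib_left)
    also have "\<dots> \<le> sqrt 2 * A * (real 1 powr (- ?c) / (1 - 2 powr (- ?c)))"
      using \<eta> A by (intro mult_left_mono geometric_sum_decay) auto
    finally have 1: "norm2 N (x - restr N T x) \<le> sqrt 2 / (1 - 2 powr (- ?c)) * A" by simp
    have finT: "finite T" using T(1) by (rule finite_subset) simp
    have "\<bar>lk (restr N T x) i\<bar> \<le> A" if "i \<in> {1..N}" for i
      using sums[rule_format, of "{i}"] that A by auto
    then have "norm2 N (restr N T x) \<le> sqrt (real 1) * A"
      using card_keys_restr[OF finT, of N x] T(2) by (intro norm2_le_sqrt_card A) auto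
    then have "norm2 N (restr N T x) \<le> A" by simp
    then show ?thesis
      using norm2_triangle_sub[of N x "restr N T x"] 1 by (simp add: algebra_simps)
  qed
qed

section \<open>The upper bound\<close>

text \<open>Up to a constant this bounds the \<open>l_1\<close> norm on the ellipsoid: take
  \<open>S = {1..N}\<close> in \<open>ellipsoid_sum_bound\<close>.\<close>

abbreviation gelfand_width :: "real \<Rightarrow> real \<Rightarrow> real \<Rightarrow> nat \<Rightarrow> real" where
  "gelfand_width p \<alpha> \<beta> N \<equiv> real N powr (1 - 1 / p) * sigma_seq \<alpha> \<beta> N"

lemma rate_eq: "rate p \<alpha> \<beta> N n = min 1 (real n powr (- 1 / 2) * gelfand_width p \<alpha> \<beta> N)"
proof -
  have "real N powr (1 - 1 / p - \<alpha>) = real N powr (1 - 1 / p) * real N powr (- \<alpha>)"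
    by (simp add: powr_add[symmetric])
  then show ?thesis by (simp add: rate_def sigma_seq_def mult_ac)
qed

lemma conjugate_exponent:
  fixes p :: real
  assumes "1 < p"
  shows "1 / p + 1 / (p / (p - 1)) = 1" "1 / (p / (p - 1)) = 1 - 1 / p" "0 < p / (p - 1)"
  using assms by (auto simp: field_simps)

text \<open>The exponent \<open>a = 1 / q - \<delta>\<close> satisfies both
  \<open>a > \<alpha>\<close>, for the growth of the semiaxes, and \<open>a * q < 1\<close>, for the
  power sums; the exponent \<open>1 / q - a\<close> that remains is \<delta>.\<close>

lemma ellipsoid_sum_bound:
  fixes p \<alpha> \<beta> \<delta> :: real
  assumes p: "1 < p" and \<alpha>: "0 < \<alpha>" and \<delta>: "0 < \<delta>" "\<delta> < 1 - 1 / p - \<alpha>"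
  shows "\<exists>C>0. \<forall>N x S. x \<in> p_ellipsoid N p (sigma_seq \<alpha> \<beta>) \<longrightarrow> S \<subseteq> {1..N} \<longrightarrow>
    (\<Sum>i\<in>S. \<bar>lk x i\<bar>) \<le> C * gelfand_width p \<alpha> \<beta> N * real N powr (- \<delta>) * real (card S) powr \<delta>"
proof -
  define q where "q = p / (p - 1)"
  note q = conjugate_exponent[OF p, folded q_def]
  define a where "a = 1 / q - \<delta>"
  have a: "\<alpha> < a" using \<delta> by (simp add: a_def q)
  have aq: "a * q < 1" using q(3) \<delta> by (simp add: a_def algebra_simps)
  obtain D where D: "D > 0" "\<And>i N. 1 \<le> i \<Longrightarrow> i \<le> N \<Longrightarrow>
      sigma_seq \<alpha> \<beta> i \<le> D * sigma_seq \<alpha> \<beta> N * real N powr a * real i powr (- a)"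
    using sigma_seq_growth[OF a] by blast
  define C where "C = (1 + 1 / (1 - a * q)) powr (1 / q) * D"
  have "0 < 1 + 1 / (1 - a * q)" using aq by (intro add_pos_pos) auto
  then have Cp: "C > 0" using D(1) by (simp add: C_def)
  show ?thesis
  proof (intro exI[of _ C] conjI allI impI Cp)
    fix N x S assume x: "x \<in> p_ellipsoid N p (sigma_seq \<alpha> \<beta>)" and S: "S \<subseteq> {1..N}"
    show "(\<Sum>i\<in>S. \<bar>lk x i\<bar>) \<le> C * gelfand_width p \<alpha> \<beta> N * real N powr (- \<delta>) * real (card S) powr \<delta>"
    proof (cases "S = {}")
      case False
      then have N: "1 \<le> N" using S by auto
      have "(\<Sum>i\<in>S. \<bar>lk x i\<bar>) \<le> (1 + 1 / (1 - a * q)) powr (1 / q) * (D * sigma_seq \<alpha> \<beta> N * real N powr a) * real (card S) powr (1 / q - a)"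
        using p_ellipsoid_sum_le[OF p q(1) _ aq _ _ x S, of "D * sigma_seq \<alpha> \<beta> N * real N powr a"]
          D N sigma_seq_pos[of _ \<alpha> \<beta>] a \<alpha> by auto
      also have "1 / q - a = \<delta>" by (simp add: a_def)
      also have "a = (1 - 1 / p) - \<delta>" by (simp add: a_def q)
      also have "real N powr ((1 - 1 / p) - \<delta>) = real N powr (1 - 1 / p) * real N powr (- \<delta>)"
        by (simp add: powr_add[symmetric])
      finally show ?thesis by (simp add: C_def q a_def mult_ac)
    qed simp
  qed
qed

text \<open>The hypothesis \<open>1/2 - 1/p < \<alpha>\<close> admits an exponent
  \<open>a < \<alpha>\<close> with \<open>1 / q - a < 1/2\<close>, the range of
  \<open>tail_norm_bound\<close>. The bound is uniform in \<open>N\<close>.\<close>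

lemma ellipsoid_norm_bounded:
  fixes p \<alpha> \<beta> :: real
  assumes p: "1 < p" and \<alpha>: "0 < \<alpha>" "1 / 2 - 1 / p < \<alpha>" "\<alpha> < 1 - 1 / p"
  shows "\<exists>C>0. \<forall>N x. x \<in> p_ellipsoid N p (sigma_seq \<alpha> \<beta>) \<longrightarrow> norm2 N x \<le> C"
proof -
  define q where "q = p / (p - 1)"
  note q = conjugate_exponent[OF p, folded q_def]
  \<comment> \<open>Midpoint between \<alpha> and the lower limit; the maximum with 0 keeps
    \<open>a\<close> nonnegative when \<open>p < 2\<close>.\<close>
  define a where "a = (\<alpha> + max 0 (1 / 2 - 1 / p)) / 2"
  have a: "0 \<le> a" "a < \<alpha>" "1 / 2 - 1 / p < a" using \<alpha> by (auto simp: a_def max_def)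
  have "a < 1 / q" using a \<alpha> q(2) by linarith
  then have aq: "a * q < 1" using q(3) by (simp only: pos_less_divide_eq)
  obtain D where D: "D > 0" "\<And>i. 1 \<le> i \<Longrightarrow> sigma_seq \<alpha> \<beta> i \<le> D * real i powr (- a)"
    using sigma_seq_upper[OF a(2)] by blast
  define C where "C = (1 + 1 / (1 - a * q)) powr (1 / q) * D"
  have "0 < 1 + 1 / (1 - a * q)" using aq by (intro add_pos_pos) auto
  then have Cp: "C > 0" using D(1) by (simp add: C_def)
  have "1 / q - a < 1 / 2" using a by (simp add: q)
  then obtain C' where C': "C' > 0" "\<And>N x A. x \<in> Rn N \<Longrightarrow> 0 \<le> A \<Longrightarrow>
      (\<forall>S\<subseteq>{1..N}. (\<Sum>i\<in>S. \<bar>lk x i\<bar>) \<le> A * real (card S) powr (1 / q - a)) \<Longrightarrow> norm2 N x \<le> C' * A"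
    using tail_norm_bound[of "1 / q - a"] by blast
  show ?thesis
  proof (intro exI[of _ "C' * C"] conjI allI impI)
    show "0 < C' * C" using C' Cp by simp
    fix N x assume x: "x \<in> p_ellipsoid N p (sigma_seq \<alpha> \<beta>)"
    show "norm2 N x \<le> C' * C"
    proof (rule C'(2))
      show "x \<in> Rn N" using x by (simp add: p_ellipsoid_def)
      show "\<forall>S\<subseteq>{1..N}. (\<Sum>i\<in>S. \<bar>lk x i\<bar>) \<le> C * real (card S) powr (1 / q - a)"
        using p_ellipsoid_sum_le[OF p q(1) a(1) aq D(1) _ x] D(2) sigma_seq_pos[of _ \<alpha> \<beta>] by (auto simp: C_def)
    qed (use Cp in simp)
  qed
qed

lemma section_radius_bounded:
  fixes p \<alpha> \<beta> :: real
  assumes p: "1 < p" and \<alpha>: "0 < \<alpha>" "1 / 2 - 1 / p < \<alpha>" "\<alpha> < 1 - 1 / p"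
  shows "\<exists>C>0. \<forall>N n E. E \<in> grassmannian N n \<longrightarrow> section_radius N (p_ellipsoid N p (sigma_seq \<alpha> \<beta>)) E \<le> C"
proof -
  obtain C where C: "C > 0" "\<And>N x. x \<in> p_ellipsoid N p (sigma_seq \<alpha> \<beta>) \<Longrightarrow> norm2 N x \<le> C"
    using ellipsoid_norm_bounded[OF assms] by blast
  show ?thesis
    using C by (intro exI[of _ C]) (auto intro!: section_radius_least subspace_0 dest: grassmannianD(1))
qed

text \<open>For the regime in which \<open>n\<close> is too small against
  \<open>N powr \<delta>\<close> to allow any sparsity level: it bounds the rate below by a
  constant.\<close>

lemma gelfand_width_lower:
  fixes p \<alpha> \<beta> \<delta> :: real
  assumes p: "1 < p" and \<alpha>: "0 < \<alpha>" and \<delta>: "0 < \<delta>" "\<delta> < 1 - 1 / p - \<alpha>"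
  shows "\<exists>c>0. \<forall>N\<ge>1. c * real N powr \<delta> \<le> gelfand_width p \<alpha> \<beta> N"
proof -
  have a: "\<alpha> < 1 - 1 / p - \<delta>" using \<delta> by simp
  obtain D where D: "D > 0" "\<And>i N. 1 \<le> i \<Longrightarrow> i \<le> N \<Longrightarrow>
      sigma_seq \<alpha> \<beta> i \<le> D * sigma_seq \<alpha> \<beta> N * real N powr (1 - 1 / p - \<delta>) * real i powr (- (1 - 1 / p - \<delta>))"
    using sigma_seq_growth[OF a] by blast
  have s1: "0 < sigma_seq \<alpha> \<beta> 1" by (rule sigma_seq_pos) simp
  show ?thesis
  proof (intro exI[of _ "sigma_seq \<alpha> \<beta> 1 / D"] conjI allI impI)
    show "0 < sigma_seq \<alpha> \<beta> 1 / D" using s1 D by simp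
    fix N :: nat assume N: "1 \<le> N"
    have "sigma_seq \<alpha> \<beta> 1 \<le> D * sigma_seq \<alpha> \<beta> N * real N powr (1 - 1 / p - \<delta>)"
      using D(2)[of 1 N] N by simp
    also have "real N powr (1 - 1 / p - \<delta>) = real N powr (1 - 1 / p) * real N powr (- \<delta>)"
      by (simp add: powr_add[symmetric])
    finally have "sigma_seq \<alpha> \<beta> 1 * real N powr \<delta> \<le> D * sigma_seq \<alpha> \<beta> N * (real N powr (1 - 1 / p) * real N powr (- \<delta>)) * real N powr \<delta>"
      by (rule mult_right_mono) simp
    also have "\<dots> = D * gelfand_width p \<alpha> \<beta> N * (real N powr (- \<delta>) * real N powr \<delta>)"
      by (simp add: mult_ac)
    also have "real N powr (- \<delta>) * real N powr \<delta> = 1" using N by (simp add: powr_add[symmetric])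
    finally show "sigma_seq \<alpha> \<beta> 1 / D * real N powr \<delta> \<le> gelfand_width p \<alpha> \<beta> N"
      using D(1) by (simp add: field_simps)
  qed
qed

section \<open>Entropy of the nets over dyadic scales\<close>

lemma ln_le_powr_div:
  fixes x \<delta> :: real
  assumes "1 \<le> x" "0 < \<delta>"
  shows "ln x \<le> x powr \<delta> / \<delta>"
proof -
  have "\<delta> * ln x = ln (x powr \<delta>)" using assms by (simp add: ln_powr)
  also have "\<dots> \<le> x powr \<delta> - 1" by (rule ln_le_minus_one) (use assms in simp)
  finally show ?thesis using assms by (simp add: field_simps)
qed

text \<open>The entropy \<open>s * ln (N / s)\<close> is traded for
  \<open>s powr (1 - \<delta>) * N powr \<delta> / \<delta>\<close>, a pure power whose sums over
  dyadic scales are geometric.\<close>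

lemma net_count_le:
  fixes \<delta> M :: real
  assumes s: "1 \<le> s" "s \<le> N" and \<delta>: "0 < \<delta>" and M: "0 \<le> M"
  shows "(real N / real s * exp M) ^ s \<le> exp ((1 / \<delta> + M) * (real s powr (1 - \<delta>) * real N powr \<delta>))"
proof -
  let ?L = "real s powr (1 - \<delta>) * real N powr \<delta>"
  have L: "?L = real s * (real N / real s) powr \<delta>"
    using s by (simp add: powr_divide powr_diff)
  have r: "1 \<le> real N / real s" using s by simp
  have "ln (real N / real s) \<le> (real N / real s) powr \<delta> / \<delta>" by (rule ln_le_powr_div[OF r \<delta>])
  moreover have "M * 1 \<le> M * (real N / real s) powr \<delta>"
    using M r \<delta> by (intro mult_left_mono ge_one_powr_ge_zero) auto
  ultimately have "real s * (ln (real N / real s) + M) \<le> real s * ((real N / real s) powr \<delta> / \<delta> + M * (real N / real s) powr \<delta>)"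
    by (intro mult_left_mono add_mono) auto
  also have "\<dots> = (1 / \<delta> + M) * ?L" unfolding L by (simp add: algebra_simps)
  finally have "exp (real s * (ln (real N / real s) + M)) \<le> exp ((1 / \<delta> + M) * ?L)" by simp
  moreover have "exp (real s * (ln (real N / real s) + M)) = (real N / real s * exp M) ^ s"
  proof -
    have "exp (ln (real N / real s) + M) = real N / real s * exp M"
      using r by (simp add: exp_add)
    then show ?thesis by (simp add: exp_of_nat_mult)
  qed
  ultimately show ?thesis by simp
qed

text \<open>
  On sparse vectors the residual has norm at most \<open>sqrt (1056 * n / N)\<close> times that of the vector,
  so replacing a vector by a net point at this distance costs a quarter of the lower bound.
\<close>

definition net_radius :: real where "net_radius = sqrt (resid_const / 1056) / 4"

lemma net_radius: "0 < net_radius" "net_radius \<le> 1 / 2"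
proof -
  show "0 < net_radius" by (simp add: net_radius_def resid_const_def)
  have "exp (- 11) \<le> (1::real)" by simp
  then have "resid_const / 1056 \<le> 1" unfolding resid_const_def by linarith
  then have "sqrt (resid_const / 1056) \<le> 1" by (simp only: real_sqrt_le_1_iff)
  then show "net_radius \<le> 1 / 2" unfolding net_radius_def by linarith
qed

lemma sum_exp_le:
  "(\<Sum>j<J. 2 * exp (- ((5 + real j) * real n))) \<le> exp (- 3 * real n)" if "1 \<le> n"
proof -
  have e: "exp (- 1) \<le> (1 / 2 :: real)"
    using exp_ge_add_one_self[of "1::real"] by (simp add: exp_minus field_simps)
  have "(\<Sum>j<J. 2 * exp (- ((5 + real j) * real n))) \<le> (\<Sum>j<J. 2 * exp (- 5 * real n) * (1 / 2) ^ j)"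
  proof (rule sum_mono)
    fix j
    have "- ((5 + real j) * real n) \<le> - 5 * real n + real j * (- 1)"
      using mult_left_mono[of 1 "real n" "real j"] that by (simp add: algebra_simps)
    then have "exp (- ((5 + real j) * real n)) \<le> exp (- 5 * real n) * exp (- 1) ^ j"
      unfolding exp_of_nat_mult[symmetric] exp_add[symmetric] by simp
    also have "\<dots> \<le> exp (- 5 * real n) * (1 / 2) ^ j"
      using e by (intro mult_left_mono power_mono) auto
    finally show "2 * exp (- ((5 + real j) * real n)) \<le> 2 * exp (- 5 * real n) * (1 / 2) ^ j" by simp
  qed
  also have "\<dots> = 2 * exp (- 5 * real n) * (\<Sum>j<J. (1 / 2) ^ j)" by (simp add: sum_distrib_left)
  also have "\<dots> \<le> 2 * exp (- 5 * real n) * 2"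
    by (intro mult_left_mono) (simp_all add: sum_gp_strict)
  also have "\<dots> \<le> exp (2 * real n) * exp (- 5 * real n)"
  proof -
    have "4 \<le> exp (2 * real n)"
    proof -
      have "(2::real) \<le> exp 1" using exp_ge_add_one_self[of "1::real"] by simp
      also have "\<dots> \<le> exp (real n)" using that by simp
      finally have "2 * 2 \<le> exp (real n) * exp (real n)" by (intro mult_mono) auto
      then show ?thesis by (simp add: exp_add[symmetric])
    qed
    then show ?thesis by simp
  qed
  also have "\<dots> = exp (- 3 * real n)" unfolding exp_add[symmetric] by simp
  finally show ?thesis .
qed

text \<open>The level at scale \<open>2 ^ j * s0\<close> is dictated by the entropy
  \<open>?L j\<close>. Since \<open>B / 96 = 11 / k0\<close> and the net costs at most
  \<open>1 / k0\<close>, the exponent keeps a margin \<open>10 / k0 * ?L j\<close>, and growth of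
  \<open>?L j\<close> in \<open>j\<close> makes the failures summable.\<close>

lemma (in haar) dyadic_upper_event:
  fixes \<delta> k0 :: real
  defines "B \<equiv> 1056 / k0"
  assumes \<delta>: "0 < \<delta>" "\<delta> < 1 / 2" and n: "1 \<le> n" "n < N" and s0: "1 \<le> s0" "s0 \<le> N"
    and k0: "0 < k0" "k0 * (1 / \<delta> + 4) \<le> 1"
    and low: "k0 * real n / 2 \<le> real s0 powr (1 - \<delta>) * real N powr \<delta>"
  shows "holds_except \<mu> (\<lambda>E. \<forall>j<J. \<forall>x\<in>Rn N. card (Poly_Mapping.keys x) \<le> 2 ^ j * s0 \<longrightarrow>
      norm2 N (x - orth_proj N E x) \<le> sqrt (B * (real (2 ^ j * s0) powr (1 - \<delta>) * real N powr \<delta>) / real N) * norm2 N x)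
    (exp (- 3 * real n))"
proof -
  let ?L = "\<lambda>j. real (2 ^ j * s0) powr (1 - \<delta>) * real N powr \<delta>"
  let ?P = "\<lambda>j E. \<forall>x\<in>Rn N. card (Poly_Mapping.keys x) \<le> 2 ^ j * s0 \<longrightarrow>
      norm2 N (x - orth_proj N E x) \<le> sqrt (B * ?L j / real N) * norm2 N x"
  have N: "0 < N" using n by simp
  have "k0 * 4 \<le> k0 * (1 / \<delta> + 4)" using k0 \<delta> by (intro mult_left_mono) auto
  then have "k0 * 4 \<le> 1" using k0(2) by (rule order_trans)
  then have k01: "k0 \<le> 1 / 4" by simp
  have B: "1 \<le> B" "0 < B" using k0 k01 by (simp_all add: B_def field_simps)
  \<comment> \<open>\<open>\<delta> < 1/2\<close> gives
    \<open>2 powr ((1 - \<delta>) * j) \<ge> exp (j * ln 2 / 2)\<close>, and this is at least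
    \<open>1 + j / 3\<close>.\<close>
  have Lbig: "(1 + real j / 3) * (k0 * real n / 2) \<le> ?L j" for j
  proof -
    have "1 + real j / 3 \<le> 1 + real j * (ln 2 / 2)"
      using ln2_ge_two_thirds by (simp add: mult_left_mono[of "1/3" "ln 2 / 2" "real j", simplified])
    also have "\<dots> \<le> exp (real j * (ln 2 / 2))" by (rule exp_ge_add_one_self)
    also have "\<dots> \<le> exp (real j * ((1 - \<delta>) * ln 2))"
    proof -
      have "(1 / 2) * ln (2::real) \<le> (1 - \<delta>) * ln 2" using \<delta> by (intro mult_right_mono) auto
      then have "real j * (ln 2 / 2) \<le> real j * ((1 - \<delta>) * ln 2)" by (intro mult_left_mono) auto
      then show ?thesis by simp
    qed
    also have "\<dots> = (2 ^ j) powr (1 - \<delta>)"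
      by (simp add: powr_def ln_realpow mult_ac)
    finally have "(1 + real j / 3) * (k0 * real n / 2) \<le> (2 ^ j) powr (1 - \<delta>) * (real s0 powr (1 - \<delta>) * real N powr \<delta>)"
      using low k0 by (intro mult_mono) auto
    also have "\<dots> = ?L j" by (simp add: powr_mult mult_ac)
    finally show ?thesis .
  qed
  have single: "holds_except \<mu> (?P j) (2 * exp (- ((5 + real j) * real n)))" for j
  proof (cases "2 ^ j * s0 \<le> N")
    case True
    let ?s = "2 ^ j * s0"
    have "1 * 1 \<le> ?s" using s0 by (intro mult_le_mono) auto
    then have s: "1 \<le> ?s" by simp
    have L0: "0 \<le> ?L j" by simp
    have L1: "k0 * real n / 2 \<le> ?L j"
    proof -
      have "1 * (k0 * real n / 2) \<le> (1 + real j / 3) * (k0 * real n / 2)"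
        using k0 by (intro mult_right_mono) auto
      then show ?thesis using Lbig[of j] by linarith
    qed
    have ksq: "(sqrt (B * ?L j / real N))\<^sup>2 * real N = B * ?L j" using B L0 N by simp
    have "32 * real n \<le> B * (k0 * real n / 2)" using k0 by (simp add: B_def)
    also have "\<dots> \<le> B * ?L j" using B L1 by (intro mult_left_mono) auto
    finally have c32: "32 * real n \<le> (sqrt (B * ?L j / real N))\<^sup>2 * real N" unfolding ksq .
    show ?thesis
    proof (rule holds_except_mono[OF sparse_upper[OF s True _ c32]])
      have "(real N / real ?s * exp 4) ^ ?s * (2 * exp (- (sqrt (B * ?L j / real N))\<^sup>2 * real N / 96)) \<le>
          exp ((1 / \<delta> + 4) * ?L j) * (2 * exp (- (B * ?L j) / 96))"
        using net_count_le[OF s True \<delta>(1), of 4] ksq by (intro mult_mono) auto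
      also have "\<dots> = 2 * exp ((1 / \<delta> + 4 - B / 96) * ?L j)"
        by (simp add: exp_add[symmetric] algebra_simps)
      also have "\<dots> \<le> 2 * exp (- ((5 + real j) * real n))"
      proof -
        have "1 / \<delta> + 4 \<le> 1 / k0" using k0 by (simp add: field_simps)
        then have "1 / \<delta> + 4 - B / 96 \<le> - (10 / k0)" by (simp add: B_def)
        then have "(1 / \<delta> + 4 - B / 96) * ?L j \<le> - (10 / k0) * ?L j" using L0 by (rule mult_right_mono)
        also have "\<dots> \<le> - (10 / k0) * ((1 + real j / 3) * (k0 * real n / 2))"
          using Lbig[of j] k0 by (intro mult_left_mono_neg) auto
        also have "\<dots> = - ((5 + 5 * real j / 3) * real n)" using k0 by (simp add: field_simps)
        also have "\<dots> \<le> - ((5 + real j) * real n)" by (simp add: mult_right_mono)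
        finally show ?thesis by simp
      qed
      finally show "(real N / real ?s * exp 4) ^ ?s * (2 * exp (- (sqrt (B * ?L j / real N))\<^sup>2 * real N / 96)) \<le>
        2 * exp (- ((5 + real j) * real n))" .
    qed (use B in auto)
  next
    \<comment> \<open>At scales beyond \<open>N\<close> the level is at least one, and a residual
      never exceeds the norm of its vector.\<close>
    case False
    have triv: "?P j E" if "E \<in> space \<mu>" for E
    proof (intro ballI impI)
      fix x assume x: "x \<in> Rn N"
      have E: "subspace E" "E \<subseteq> Rn N" using that grassmannianD by (auto simp: space_haar)
      have "real N \<le> real (2 ^ j * s0)" using False by (simp only: of_nat_le_iff)
      then have "real N powr (1 - \<delta>) * real N powr \<delta> \<le> ?L j"
        using \<delta> by (intro mult_right_mono powr_mono2) auto
      then have "real N \<le> ?L j" using N by (simp add: powr_add[symmetric])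
      then have "1 * real N \<le> B * ?L j" using B by (intro mult_mono) auto
      then have "1 \<le> sqrt (B * ?L j / real N)" using N by simp
      then have "1 * norm2 N x \<le> sqrt (B * ?L j / real N) * norm2 N x" by (intro mult_right_mono) auto
      then show "norm2 N (x - orth_proj N E x) \<le> sqrt (B * ?L j / real N) * norm2 N x"
        using norm2_resid_le[OF E, of x] by linarith
    qed
    show ?thesis by (rule holds_exceptI[of "\<lambda>_. False"]) (use triv in auto)
  qed
  have "holds_except \<mu> (\<lambda>E. \<forall>j\<in>{..<J}. ?P j E) (\<Sum>j<J. 2 * exp (- ((5 + real j) * real n)))"
    by (intro holds_except_all single) simp
  then show ?thesis
    by (rule holds_except_mono) (use sum_exp_le[OF n(1)] in auto)
qed

text \<open>The deterministic half of the upper bound. In the norm of the tail the first block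
  dominates, since \<open>\<delta> < 1/2\<close>; in its residual the last one does, of size about
  \<open>N\<close>, where the powers of \<open>N\<close> combine to \<open>N powr (- 1/2)\<close>.
  Dividing by \<open>b * sqrt (n / N)\<close> yields the same order \<open>n powr (- 1/2)\<close>
  for the head.\<close>

lemma decomposition_radius_bound:
  fixes \<delta> k0 A B b :: real
  assumes \<delta>: "0 < \<delta>" "\<delta> < 1 / 2" and n: "1 \<le> n" and s0: "1 \<le> s0" "s0 \<le> N" and B: "0 < B" and b: "0 < b"
    and low: "k0 * real n / 2 \<le> real s0 powr (1 - \<delta>) * real N powr \<delta>" and k0: "0 < k0"
    and J: "N \<le> 2 ^ J * s0" "2 ^ J * s0 \<le> 2 * N"
    and E: "subspace E" "E \<subseteq> Rn N"
    and up: "\<forall>j<Suc J. \<forall>x\<in>Rn N. card (Poly_Mapping.keys x) \<le> 2 ^ j * s0 \<longrightarrow>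
      norm2 N (x - orth_proj N E x) \<le> sqrt (B * (real (2 ^ j * s0) powr (1 - \<delta>) * real N powr \<delta>) / real N) * norm2 N x"
    and lower: "\<forall>x\<in>Rn N. card (Poly_Mapping.keys x) \<le> s0 \<longrightarrow> b * sqrt (real n / real N) * norm2 N x \<le> norm2 N (x - orth_proj N E x)"
    and A: "0 \<le> A" and x: "x \<in> E"
    and sums: "\<And>S. S \<subseteq> {1..N} \<Longrightarrow> (\<Sum>i\<in>S. \<bar>lk x i\<bar>) \<le> A * real N powr (- \<delta>) * real (card S) powr \<delta>"
  shows "norm2 N x \<le> (2 * sqrt B * 2 powr (\<delta> / 2) / (2 powr (\<delta> / 2) - 1) / b +
      sqrt 2 / (1 - 2 powr (- (1 / 2 - \<delta>))) * sqrt (2 / k0)) * A * real n powr (- 1 / 2)"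
proof -
  have xR: "x \<in> Rn N" using x E by auto
  have N: "0 < N" using s0 by simp
  let ?A = "A * real N powr (- \<delta>)"
  let ?s = "\<lambda>j. real (2 ^ j * s0)"
  have sp: "0 < ?s j" for j using s0 by simp
  obtain T where T: "T \<subseteq> {1..N}" "card T \<le> s0"
    "\<And>f K. (\<And>x y. f (x + y) \<le> f x + f y) \<Longrightarrow> f 0 \<le> (0::real) \<Longrightarrow> (\<And>j. 0 \<le> K j) \<Longrightarrow>
      (\<And>j y. j < J \<Longrightarrow> y \<in> Rn N \<Longrightarrow> card (Poly_Mapping.keys y) \<le> 2 ^ Suc j * s0 \<Longrightarrow> f y \<le> K j * norm2 N y) \<Longrightarrow>
      f (x - restr N T x) \<le> (\<Sum>j<J. K j * (sqrt 2 * ?A * ?s j powr (\<delta> - 1 / 2)))"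
    by (rule dyadic_decomposition[OF xR _ _ s0(1) J(1), of ?A \<delta>]) (use A \<delta> sums in auto)
  let ?y = "restr N T x" and ?z = "x - restr N T x"
  have r2: "(2::real) powr (- (1 / 2 - \<delta>)) < 1" using \<delta> powr_less_mono[of "- (1 / 2 - \<delta>)" 0 2] by auto
  \<comment> \<open>Square root of \<open>low\<close>, in which a factor
    \<open>s0 powr (\<delta> / 2)\<close> is enlarged to \<open>N powr (\<delta> / 2)\<close>. The
    right side is the reciprocal of the size of the first tail block.\<close>
  have s0N: "sqrt (k0 / 2) * real n powr (1 / 2) \<le> real s0 powr (1 / 2 - \<delta>) * real N powr \<delta>"
  proof -
    have "sqrt (k0 / 2) * real n powr (1 / 2) = sqrt (k0 * real n / 2)"
      by (simp add: powr_half_sqrt real_sqrt_mult[symmetric])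
    also have "\<dots> \<le> sqrt (real s0 powr (1 - \<delta>) * real N powr \<delta>)" using low by simp
    also have "\<dots> = real s0 powr ((1 - \<delta>) / 2) * real N powr (\<delta> / 2)"
      by (simp add: powr_half_sqrt[symmetric] powr_mult powr_powr)
    also have "real s0 powr ((1 - \<delta>) / 2) = real s0 powr (1 / 2 - \<delta>) * real s0 powr (\<delta> / 2)"
      unfolding powr_add[symmetric] by (rule arg_cong[of _ _ "(powr) (real s0)"]) (simp add: field_simps)
    also have "real s0 powr (1 / 2 - \<delta>) * real s0 powr (\<delta> / 2) * real N powr (\<delta> / 2) =
        real s0 powr (1 / 2 - \<delta>) * (real s0 powr (\<delta> / 2) * real N powr (\<delta> / 2))" by (rule mult.assoc)
    also have "\<dots> \<le> real s0 powr (1 / 2 - \<delta>) * (real N powr (\<delta> / 2) * real N powr (\<delta> / 2))"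
      using s0 \<delta> by (intro mult_left_mono mult_right_mono powr_mono2) auto
    also have "real N powr (\<delta> / 2) * real N powr (\<delta> / 2) = real N powr \<delta>"
      by (simp add: powr_add[symmetric])
    finally show ?thesis .
  qed
  have z: "norm2 N ?z \<le> sqrt 2 / (1 - 2 powr (- (1 / 2 - \<delta>))) * sqrt (2 / k0) * A * real n powr (- 1 / 2)"
  proof -
    have "norm2 N ?z \<le> (\<Sum>j<J. 1 * (sqrt 2 * ?A * ?s j powr (\<delta> - 1 / 2)))"
      by (rule T(3)) (auto simp: norm2_triangle)
    also have "\<dots> = sqrt 2 * ?A * (\<Sum>j<J. ?s j powr (- (1 / 2 - \<delta>)))"
      by (simp add: sum_distrib_left)
    also have "\<dots> \<le> sqrt 2 * ?A * (real s0 powr (- (1 / 2 - \<delta>)) / (1 - 2 powr (- (1 / 2 - \<delta>))))"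
      using \<delta> A s0 by (intro mult_left_mono geometric_sum_decay) auto
    also have "\<dots> = sqrt 2 / (1 - 2 powr (- (1 / 2 - \<delta>))) * A * (1 / (real s0 powr (1 / 2 - \<delta>) * real N powr \<delta>))"
      using powr_minus_divide[of "real s0" "1 / 2 - \<delta>"] powr_minus_divide[of "real N" \<delta>]
      by (simp add: mult_ac)
    also have "\<dots> \<le> sqrt 2 / (1 - 2 powr (- (1 / 2 - \<delta>))) * A * (1 / (sqrt (k0 / 2) * real n powr (1 / 2)))"
      using s0N r2 A k0 n s0 N by (intro mult_left_mono divide_left_mono mult_pos_pos) auto
    also have "1 / (sqrt (k0 / 2) * real n powr (1 / 2)) = sqrt (2 / k0) * real n powr (- 1 / 2)"
      using k0 powr_minus_divide[of "real n" "1 / 2"] by (simp add: real_sqrt_divide)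
    finally show ?thesis by (simp add: mult_ac)
  qed
  have Qz: "norm2 N (?z - orth_proj N E ?z) \<le> 2 * sqrt B * 2 powr (\<delta> / 2) / (2 powr (\<delta> / 2) - 1) * A * real N powr (- 1 / 2)"
  proof -
    let ?K = "\<lambda>j. sqrt (B * (?s (Suc j) powr (1 - \<delta>) * real N powr \<delta>) / real N)"
    have "norm2 N (?z - orth_proj N E ?z) \<le> (\<Sum>j<J. ?K j * (sqrt 2 * ?A * ?s j powr (\<delta> - 1 / 2)))"
    proof (rule T(3)[of "\<lambda>x. norm2 N (x - orth_proj N E x)"])
      fix x y
      have "(x + y) - orth_proj N E (x + y) = (x - orth_proj N E x) + (y - orth_proj N E y)"
        by (simp add: orth_proj_add[OF E])
      then show "norm2 N ((x + y) - orth_proj N E (x + y)) \<le> norm2 N (x - orth_proj N E x) + norm2 N (y - orth_proj N E y)"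
        by (simp only: norm2_triangle)
    next
      show "norm2 N (0 - orth_proj N E 0) \<le> 0"
        by (simp add: linear_0[OF linear_orth_proj[OF E]])
    next
      fix j y assume "j < J" "y \<in> Rn N" "card (Poly_Mapping.keys y) \<le> 2 ^ Suc j * s0"
      then show "norm2 N (y - orth_proj N E y) \<le> ?K j * norm2 N y"
        using up by blast
    qed (use B in auto)
    \<comment> \<open>At block size \<open>s\<close> the residual factor is of order
      \<open>(s / N) powr ((1 - \<delta>) / 2)\<close> and the norm of order
      \<open>A * N powr (- \<delta>) * s powr (\<delta> - 1/2)\<close>; the product grows like
      \<open>s powr (\<delta> / 2)\<close>.\<close>
    also have "\<dots> \<le> (\<Sum>j<J. 2 * sqrt B * A * real N powr (- \<delta> / 2 - 1 / 2) * ?s j powr (\<delta> / 2))"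
    proof (rule sum_mono)
      fix j
      have "?s (Suc j) powr (1 - \<delta>) = 2 powr (1 - \<delta>) * ?s j powr (1 - \<delta>)"
        by (simp add: powr_mult mult.assoc)
      also have "\<dots> \<le> 2 powr 1 * ?s j powr (1 - \<delta>)"
        using \<delta> by (intro mult_right_mono powr_mono) auto
      finally have s1: "?s (Suc j) powr (1 - \<delta>) \<le> 2 * ?s j powr (1 - \<delta>)" by simp
      have "?K j \<le> sqrt (B * (2 * ?s j powr (1 - \<delta>) * real N powr \<delta>) / real N)"
        using s1 B by (intro real_sqrt_le_mono divide_right_mono mult_left_mono mult_right_mono) auto
      also have "\<dots> = sqrt 2 * sqrt B * (?s j powr (1 - \<delta>) * real N powr (\<delta> - 1)) powr (1 / 2)"
        using N B sp[of j] by (simp add: powr_half_sqrt real_sqrt_mult real_sqrt_divide powr_diff)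
      also have "(?s j powr (1 - \<delta>) * real N powr (\<delta> - 1)) powr (1 / 2) = ?s j powr ((1 - \<delta>) / 2) * real N powr ((\<delta> - 1) / 2)"
        by (simp add: powr_mult powr_powr)
      finally have K: "?K j \<le> sqrt 2 * sqrt B * (?s j powr ((1 - \<delta>) / 2) * real N powr ((\<delta> - 1) / 2))" .
      have "?K j * (sqrt 2 * ?A * ?s j powr (\<delta> - 1 / 2)) \<le>
          sqrt 2 * sqrt B * (?s j powr ((1 - \<delta>) / 2) * real N powr ((\<delta> - 1) / 2)) * (sqrt 2 * ?A * ?s j powr (\<delta> - 1 / 2))"
        using A by (intro mult_right_mono K) auto
      also have "\<dots> = (sqrt 2 * sqrt 2) * sqrt B * A * (real N powr ((\<delta> - 1) / 2) * real N powr (- \<delta>)) *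
          (?s j powr ((1 - \<delta>) / 2) * ?s j powr (\<delta> - 1 / 2))"
        by (simp only: mult_ac)
      also have "real N powr ((\<delta> - 1) / 2) * real N powr (- \<delta>) = real N powr (- \<delta> / 2 - 1 / 2)"
        unfolding powr_add[symmetric] by (rule arg_cong[of _ _ "(powr) (real N)"]) (simp add: field_simps)
      also have "?s j powr ((1 - \<delta>) / 2) * ?s j powr (\<delta> - 1 / 2) = ?s j powr (\<delta> / 2)"
        unfolding powr_add[symmetric] by (rule arg_cong[of _ _ "(powr) (?s j)"]) (simp add: field_simps)
      finally show "?K j * (sqrt 2 * ?A * ?s j powr (\<delta> - 1 / 2)) \<le> 2 * sqrt B * A * real N powr (- \<delta> / 2 - 1 / 2) * ?s j powr (\<delta> / 2)"
        by simp
    qed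
    also have "\<dots> = 2 * sqrt B * A * real N powr (- \<delta> / 2 - 1 / 2) * (\<Sum>j<J. ?s j powr (\<delta> / 2))"
      by (simp only: sum_distrib_left)
    also have "\<dots> \<le> 2 * sqrt B * A * real N powr (- \<delta> / 2 - 1 / 2) * (?s J powr (\<delta> / 2) / (2 powr (\<delta> / 2) - 1))"
      using \<delta> A B s0 by (intro mult_left_mono geometric_sum_growth) auto
    also have "\<dots> \<le> 2 * sqrt B * A * real N powr (- \<delta> / 2 - 1 / 2) * ((2 * real N) powr (\<delta> / 2) / (2 powr (\<delta> / 2) - 1))"
    proof -
      have "?s J \<le> 2 * real N" using J(2) by (metis of_nat_le_iff of_nat_mult of_nat_numeral)
      then show ?thesis
        using \<delta> A B by (intro mult_left_mono divide_right_mono powr_mono2) (auto intro!: ge_one_powr_ge_zero)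
    qed
    also have "\<dots> = 2 * sqrt B * 2 powr (\<delta> / 2) / (2 powr (\<delta> / 2) - 1) * A * (real N powr (- \<delta> / 2 - 1 / 2) * real N powr (\<delta> / 2))"
      by (simp add: powr_mult)
    also have "real N powr (- \<delta> / 2 - 1 / 2) * real N powr (\<delta> / 2) = real N powr (- 1 / 2)"
      by (simp only: powr_add[symmetric]) simp
    finally show ?thesis .
  qed
  have y: "norm2 N ?y \<le> 2 * sqrt B * 2 powr (\<delta> / 2) / (2 powr (\<delta> / 2) - 1) / b * A * real n powr (- 1 / 2)"
  proof -
    let ?M = "2 * sqrt B * 2 powr (\<delta> / 2) / (2 powr (\<delta> / 2) - 1) * A"
    have finT: "finite T" using T(1) by (rule finite_subset) simp
    have "orth_proj N E x = x" by (rule orth_proj_id[OF E x])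
    then have "orth_proj N E ?z = x - orth_proj N E ?y"
      using orth_proj_diff[OF E, of x ?y] by simp
    then have "?y - orth_proj N E ?y = orth_proj N E ?z - ?z"
      by simp
    then have "norm2 N (?y - orth_proj N E ?y) = norm2 N (?z - orth_proj N E ?z)"
      by (simp only: norm2_minus_commute)
    moreover have "b * sqrt (real n / real N) * norm2 N ?y \<le> norm2 N (?y - orth_proj N E ?y)"
      using lower card_keys_restr[OF finT, of N x] T(2) by simp
    ultimately have "b * sqrt (real n / real N) * norm2 N ?y \<le> ?M * real N powr (- 1 / 2)"
      using Qz by simp
    also have "sqrt (real n / real N) = real n powr (1 / 2) * real N powr (- 1 / 2)"
      using powr_minus_divide[of "real N" "1 / 2"] by (simp add: powr_half_sqrt real_sqrt_divide)
    finally have "(b * (real n powr (1 / 2)) * norm2 N ?y) * real N powr (- 1 / 2) \<le> ?M * real N powr (- 1 / 2)"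
      by (simp add: mult_ac)
    then have "b * (real n powr (1 / 2)) * norm2 N ?y \<le> ?M"
      by (rule mult_right_le_imp_le) (use N in simp)
    then have "norm2 N ?y \<le> ?M / (b * real n powr (1 / 2))"
    proof -
      have "0 < b * real n powr (1 / 2)" using b n by simp
      then show ?thesis
        using \<open>b * (real n powr (1 / 2)) * norm2 N ?y \<le> ?M\<close>
        by (simp only: pos_le_divide_eq mult.commute[of "norm2 N ?y"])
    qed
    also have "?M / (b * real n powr (1 / 2)) = ?M / b * real n powr (- 1 / 2)"
      using powr_minus_divide[of "real n" "1 / 2"] by simp
    finally show ?thesis by simp
  qed
  show ?thesis
    using norm2_triangle_sub[of N x ?y] y z by (simp add: distrib_right)
qed

text \<open>\<open>t\<close> solves \<open>t powr (1 - \<delta>) * N powr \<delta> = k0 * n\<close>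
  exactly. \<open>big\<close> ensures \<open>t \<ge> 1\<close>, so the integer part loses at most a
  factor 2.\<close>

lemma net_scale_exists:
  fixes \<delta> k0 :: real
  assumes \<delta>: "0 < \<delta>" "\<delta> < 1" and n: "n \<le> N" and k0: "0 < k0" "k0 \<le> 1" and big: "real N powr \<delta> \<le> k0 * real n"
    and N: "1 \<le> N"
  obtains s0 :: nat where "1 \<le> s0" "s0 \<le> N" "k0 * real n / 2 \<le> real s0 powr (1 - \<delta>) * real N powr \<delta>"
    "real s0 powr (1 - \<delta>) * real N powr \<delta> \<le> k0 * real n"
proof -
  define t where "t = (k0 * real n * real N powr (- \<delta>)) powr (1 / (1 - \<delta>))"
  have Np: "0 < real N powr \<delta>" using N by simp
  have base: "1 \<le> k0 * real n * real N powr (- \<delta>)"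
    using big Np by (simp add: powr_minus field_simps)
  have t1: "1 \<le> t" unfolding t_def using base \<delta> by (intro ge_one_powr_ge_zero) auto
  have tp: "t powr (1 - \<delta>) * real N powr \<delta> = k0 * real n"
  proof -
    have "t powr (1 - \<delta>) = k0 * real n * real N powr (- \<delta>)"
      unfolding t_def using \<delta> base by (simp add: powr_powr)
    then show ?thesis using N by (simp add: powr_add[symmetric])
  qed
  define s0 where "s0 = nat \<lfloor>t\<rfloor>"
  have f1: "1 \<le> \<lfloor>t\<rfloor>" using t1 by simp
  then have rs: "real s0 = real_of_int \<lfloor>t\<rfloor>" by (simp add: s0_def)
  have s1: "1 \<le> s0" using f1 by (simp add: s0_def nat_le_iff le_nat_iff)
  have "1 \<le> real_of_int \<lfloor>t\<rfloor>" using f1 by simp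
  then have s0t: "real s0 \<le> t" "t \<le> 2 * real s0" unfolding rs by linarith+
  have "real s0 powr (1 - \<delta>) \<le> t powr (1 - \<delta>)" using s0t \<delta> by (intro powr_mono2) auto
  then have up: "real s0 powr (1 - \<delta>) * real N powr \<delta> \<le> k0 * real n"
    unfolding tp[symmetric] using Np by (intro mult_right_mono) auto
  have "t powr (1 - \<delta>) \<le> (2 * real s0) powr (1 - \<delta>)" using s0t t1 \<delta> by (intro powr_mono2) auto
  also have "\<dots> = 2 powr (1 - \<delta>) * real s0 powr (1 - \<delta>)" by (simp add: powr_mult)
  also have "\<dots> \<le> 2 powr 1 * real s0 powr (1 - \<delta>)" using \<delta> by (intro mult_right_mono powr_mono) auto
  finally have "t powr (1 - \<delta>) * real N powr \<delta> \<le> 2 * real s0 powr (1 - \<delta>) * real N powr \<delta>"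
    using Np by (intro mult_right_mono) auto
  then have low: "k0 * real n / 2 \<le> real s0 powr (1 - \<delta>) * real N powr \<delta>" unfolding tp by simp
  have "s0 \<le> N"
  proof (rule ccontr)
    assume "\<not> s0 \<le> N"
    then have "real N powr (1 - \<delta>) < real s0 powr (1 - \<delta>)" using \<delta> by (intro powr_less_mono2) auto
    then have "real N powr (1 - \<delta>) * real N powr \<delta> < real s0 powr (1 - \<delta>) * real N powr \<delta>"
      using Np by (intro mult_strict_right_mono) auto
    then have "real N < k0 * real n" using up N by (simp add: powr_add[symmetric])
    also have "\<dots> \<le> 1 * real N" using k0 n by (intro mult_mono) auto
    finally show False by simp
  qed
  then show ?thesis using that s1 low up by blast
qed

theorem section_radius_upper_bound:
  fixes p \<alpha> \<beta> :: real
  assumes p: "1 < p" and \<alpha>: "0 < \<alpha>" "1 / 2 - 1 / p < \<alpha>" "\<alpha> < 1 - 1 / p"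
  shows "\<exists>C>0. \<forall>N n \<mu>. 1 \<le> n \<longrightarrow> n < N \<longrightarrow> normalized_haar N n \<mu> \<longrightarrow>
    holds_except \<mu> (\<lambda>E. section_radius N (p_ellipsoid N p (sigma_seq \<alpha> \<beta>)) E \<le> C * rate p \<alpha> \<beta> N n) (exp (- 2 * real n))"
proof -
  \<comment> \<open>Half of the gap in \<open>\<alpha> < 1 - 1/p\<close>: strictly inside it, as the
    semiaxis estimates demand, and below \<open>1/2\<close>.\<close>
  define \<delta> where "\<delta> = (1 - 1 / p - \<alpha>) / 2"
  have \<delta>: "0 < \<delta>" "\<delta> < 1 / 2" "\<delta> < 1 - 1 / p - \<alpha>" using \<alpha> by (auto simp: \<delta>_def)
  \<comment> \<open>Small enough for the entropy of both nets in use, of radius \<open>1/2\<close>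
    (summand 4) and of radius \<open>net_radius\<close>.\<close>
  define k0 where "k0 = 1 / (1 / \<delta> + 4 + 1 / net_radius)"
  have dsum: "0 < 1 / \<delta>" "0 < 1 / net_radius" using \<delta> net_radius by auto
  have k0: "0 < k0" "k0 * (1 / \<delta> + 4) \<le> 1" "k0 \<le> 1" "k0 * (1 / \<delta> + (2 + 1 / net_radius)) \<le> 1"
    using dsum unfolding k0_def by (auto simp: divide_le_eq add_pos_pos)
  define B where "B = 1056 / k0"
  have B: "B > 0" using k0 by (simp add: B_def)
  define b where "b = sqrt resid_const / 4"
  have rc: "resid_const > 0" by (simp add: resid_const_def)
  have b: "b > 0" using rc by (simp add: b_def)
  obtain C0 where C0: "C0 > 0" "\<And>N x S. x \<in> p_ellipsoid N p (sigma_seq \<alpha> \<beta>) \<Longrightarrow> S \<subseteq> {1..N} \<Longrightarrow>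
    (\<Sum>i\<in>S. \<bar>lk x i\<bar>) \<le> C0 * gelfand_width p \<alpha> \<beta> N * real N powr (- \<delta>) * real (card S) powr \<delta>"
    using ellipsoid_sum_bound[OF p \<alpha>(1) \<delta>(1,3)] by blast
  obtain R where R: "R > 0" "\<And>N n E. E \<in> grassmannian N n \<Longrightarrow> section_radius N (p_ellipsoid N p (sigma_seq \<alpha> \<beta>)) E \<le> R"
    using section_radius_bounded[OF assms] by blast
  obtain c where c: "c > 0" "\<And>N. 1 \<le> N \<Longrightarrow> c * real N powr \<delta> \<le> gelfand_width p \<alpha> \<beta> N"
    using gelfand_width_lower[OF p \<alpha>(1) \<delta>(1,3)] by blast
  define D where "D = (2 * sqrt B * 2 powr (\<delta> / 2) / (2 powr (\<delta> / 2) - 1) / b +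
      sqrt 2 / (1 - 2 powr (- (1 / 2 - \<delta>))) * sqrt (2 / k0)) * C0"
  define C where "C = max R (max D (R / (c * sqrt k0)))"
  have Cp: "C > 0" using R by (simp add: C_def)
  show ?thesis
  proof (intro exI[of _ C] conjI allI impI Cp)
    fix N n \<mu> assume n: "1 \<le> n" "n < N" and "normalized_haar N n \<mu>"
    then interpret haar N n \<mu> by unfold_locales
    let ?w = "gelfand_width p \<alpha> \<beta> N"
    let ?K = "p_ellipsoid N p (sigma_seq \<alpha> \<beta>)"
    have N: "1 \<le> N" using n by simp
    have w: "0 < ?w" using N sigma_seq_pos[of N \<alpha> \<beta>] by simp
    have np: "0 < real n powr (- 1 / 2)" using n by simp
    show "holds_except \<mu> (\<lambda>E. section_radius N ?K E \<le> C * rate p \<alpha> \<beta> N n) (exp (- 2 * real n))"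
    proof (cases "real N powr \<delta> \<le> k0 * real n")
      \<comment> \<open>No sparsity level fits the entropy budget. The rate is then at least a
        positive constant or equal to 1, and the uniform bound \<open>R\<close> on the radius
        suffices.\<close>
      case False
      have "real n powr (- 1 / 2) * ?w \<ge> (real N powr \<delta> / k0) powr (- 1 / 2) * (c * real N powr \<delta>)"
      proof (rule mult_mono)
        show "(real N powr \<delta> / k0) powr (- 1 / 2) \<le> real n powr (- 1 / 2)"
          using False k0 n by (intro powr_mono2') (auto simp: field_simps)
      qed (use c N in auto)
      also have "(real N powr \<delta> / k0) powr (- 1 / 2) * (c * real N powr \<delta>) = c * sqrt k0 * ((real N powr \<delta>) powr (- 1 / 2) * real N powr \<delta>)"
      proof -
        have "k0 powr (- 1 / 2) = 1 / sqrt k0" using powr_minus_divide[of k0 "1 / 2"] k0 by (simp add: powr_half_sqrt)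
        then show ?thesis using k0 by (simp add: powr_divide)
      qed
      also have "(real N powr \<delta>) powr (- 1 / 2) * real N powr \<delta> = real N powr (\<delta> / 2)"
        by (simp add: powr_powr powr_add[symmetric])
      finally have "c * sqrt k0 * real N powr (\<delta> / 2) \<le> real n powr (- 1 / 2) * ?w" .
      moreover have "c * sqrt k0 * 1 \<le> c * sqrt k0 * real N powr (\<delta> / 2)"
        using c k0 N \<delta> by (intro mult_left_mono ge_one_powr_ge_zero) auto
      ultimately have big: "c * sqrt k0 \<le> real n powr (- 1 / 2) * ?w" by linarith
      have "R \<le> C * rate p \<alpha> \<beta> N n"
      proof (cases "1 \<le> real n powr (- 1 / 2) * ?w")
        case True
        then have "rate p \<alpha> \<beta> N n = 1" by (simp add: rate_eq)
        then show ?thesis by (simp add: C_def)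
      next
        case F: False
        have "R = R / (c * sqrt k0) * (c * sqrt k0)" using c k0 by simp
        also have "\<dots> \<le> C * (real n powr (- 1 / 2) * ?w)"
        proof (rule mult_mono[OF _ big])
          show "R / (c * sqrt k0) \<le> C" by (simp add: C_def)
        qed (use Cp c k0 in auto)
        finally show ?thesis using F by (simp add: rate_eq)
      qed
      then have "section_radius N ?K E \<le> C * rate p \<alpha> \<beta> N n" if "E \<in> space \<mu>" for E
        using R(2)[of E N n] that by (auto simp: space_haar intro: order_trans)
      then show ?thesis by (intro holds_exceptI[of "\<lambda>_. False"]) auto
    next
      case True
      obtain s0 where s0: "1 \<le> s0" "s0 \<le> N" "k0 * real n / 2 \<le> real s0 powr (1 - \<delta>) * real N powr \<delta>"
        "real s0 powr (1 - \<delta>) * real N powr \<delta> \<le> k0 * real n"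
        using net_scale_exists[OF \<delta>(1) _ less_imp_le[OF n(2)] k0(1,3) True N] \<delta>(2) by auto
      obtain J where J: "N \<le> 2 ^ J * s0" "2 ^ J * s0 \<le> 2 * N" using dyadic_index[OF s0(1,2)] .
      let ?up = "\<lambda>j E. \<forall>x\<in>Rn N. card (Poly_Mapping.keys x) \<le> 2 ^ j * s0 \<longrightarrow>
        norm2 N (x - orth_proj N E x) \<le> sqrt (B * (real (2 ^ j * s0) powr (1 - \<delta>) * real N powr \<delta>) / real N) * norm2 N x"
      have U: "holds_except \<mu> (\<lambda>E. \<forall>j<Suc J. ?up j E) (exp (- 3 * real n))"
        unfolding B_def by (rule dyadic_upper_event[OF \<delta>(1,2) n s0(1,2) k0(1,2) s0(3)])
      let ?\<kappa> = "sqrt (B * (real s0 powr (1 - \<delta>) * real N powr \<delta>) / real N)"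
      let ?b = "sqrt (resid_const * real n / real N)"
      \<comment> \<open>Upper and lower residual factors are both of order
        \<open>sqrt (n / N)\<close>, so an absolute net radius works.\<close>
      have \<kappa>\<rho>: "?\<kappa> * net_radius \<le> ?b / 4"
      proof -
        have "B * (real s0 powr (1 - \<delta>) * real N powr \<delta>) \<le> B * (k0 * real n)"
          using s0(4) B by (intro mult_left_mono) auto
        also have "\<dots> = 1056 * real n" using k0 by (simp add: B_def)
        finally have "?\<kappa> \<le> sqrt (1056 * real n / real N)"
          by (intro real_sqrt_le_mono divide_right_mono) auto
        then have "?\<kappa> * net_radius \<le> sqrt (1056 * real n / real N) * net_radius"
          using net_radius by (intro mult_right_mono) auto
        also have "\<dots> = sqrt (1056 * real n / real N * (resid_const / 1056)) / 4"
          unfolding net_radius_def by (simp add: real_sqrt_mult[symmetric])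
        also have "1056 * real n / real N * (resid_const / 1056) = resid_const * real n / real N" by simp
        finally show ?thesis .
      qed
      have L: "holds_except \<mu> (\<lambda>E. (\<forall>x\<in>Rn N. card (Poly_Mapping.keys x) \<le> s0 \<longrightarrow> norm2 N (x - orth_proj N E x) \<le> ?\<kappa> * norm2 N x) \<longrightarrow>
        (\<forall>x\<in>Rn N. card (Poly_Mapping.keys x) \<le> s0 \<longrightarrow> ?b / 4 * norm2 N x \<le> norm2 N (x - orth_proj N E x))) (2 * exp (- 4 * real n))"
      proof (rule holds_except_mono[OF sparse_lower[OF s0(1,2) n(1) less_imp_le[OF n(2)] net_radius \<kappa>\<rho>]])
        have "(real N / real s0 * exp (2 + 1 / net_radius)) ^ s0 \<le> exp ((1 / \<delta> + (2 + 1 / net_radius)) * (real s0 powr (1 - \<delta>) * real N powr \<delta>))"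
          using dsum by (intro net_count_le s0 \<delta>) auto
        also have "\<dots> \<le> exp ((1 / \<delta> + (2 + 1 / net_radius)) * (k0 * real n))"
          using s0(4) dsum by (simp add: mult_left_mono)
        also have "\<dots> \<le> exp (real n)"
          using mult_right_mono[OF k0(4), of "real n"] by (simp add: mult_ac)
        finally have "(real N / real s0 * exp (2 + 1 / net_radius)) ^ s0 * (2 * exp (- 5 * real n)) \<le> exp (real n) * (2 * exp (- 5 * real n))"
          by (rule mult_right_mono) simp
        also have "\<dots> = 2 * exp (- 4 * real n)" by (simp add: exp_add[symmetric] mult.left_commute)
        finally show "(real N / real s0 * exp (2 + 1 / net_radius)) ^ s0 * (2 * exp (- 5 * real n)) \<le> 2 * exp (- 4 * real n)" .
      qed
      show ?thesis
      proof (rule holds_except_mono[OF holds_except_conj[OF U L]])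
        have "exp (- 1) \<le> (1 / 2 :: real)"
          using exp_ge_add_one_self[of "1::real"] by (simp add: exp_minus field_simps)
        moreover have "exp (- real n) \<le> exp (- 1)" using n by simp
        ultimately have h: "exp (- real n) \<le> (1 / 2 :: real)" by linarith
        have "exp (- 3 * real n) + 2 * exp (- 4 * real n) = exp (- 2 * real n) * (exp (- real n) + 2 * exp (- real n) * exp (- real n))"
          by (simp add: distrib_left exp_add[symmetric] mult.left_commute)
        also have "\<dots> \<le> exp (- 2 * real n) * 1"
        proof (rule mult_left_mono)
          have "2 * exp (- real n) * exp (- real n) \<le> 2 * (1/2) * (1/2 :: real)"
            using h by (intro mult_mono) auto
          then show "exp (- real n) + 2 * exp (- real n) * exp (- real n) \<le> 1" using h by simp
        qed simp
        finally show "exp (- 3 * real n) + 2 * exp (- 4 * real n) \<le> exp (- 2 * real n)" by simp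
        fix E assume Es: "E \<in> space \<mu>" and ev: "(\<forall>j<Suc J. ?up j E) \<and>
          ((\<forall>x\<in>Rn N. card (Poly_Mapping.keys x) \<le> s0 \<longrightarrow> norm2 N (x - orth_proj N E x) \<le> ?\<kappa> * norm2 N x) \<longrightarrow>
          (\<forall>x\<in>Rn N. card (Poly_Mapping.keys x) \<le> s0 \<longrightarrow> ?b / 4 * norm2 N x \<le> norm2 N (x - orth_proj N E x)))"
        have E: "subspace E" "E \<subseteq> Rn N" using Es grassmannianD by (auto simp: space_haar)
        have "?up 0 E" using ev by blast
        then have "\<forall>x\<in>Rn N. card (Poly_Mapping.keys x) \<le> s0 \<longrightarrow> norm2 N (x - orth_proj N E x) \<le> ?\<kappa> * norm2 N x" by simp
        then have low: "\<forall>x\<in>Rn N. card (Poly_Mapping.keys x) \<le> s0 \<longrightarrow> ?b / 4 * norm2 N x \<le> norm2 N (x - orth_proj N E x)"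
          using ev by blast
        have bb: "?b / 4 = b * sqrt (real n / real N)"
          by (simp add: b_def real_sqrt_mult[symmetric])
        have "norm2 N x \<le> D * ?w * real n powr (- 1 / 2)" if x: "x \<in> E" "x \<in> ?K" for x
        proof -
          have "norm2 N x \<le> (2 * sqrt B * 2 powr (\<delta> / 2) / (2 powr (\<delta> / 2) - 1) / b +
            sqrt 2 / (1 - 2 powr (- (1 / 2 - \<delta>))) * sqrt (2 / k0)) * (C0 * ?w) * real n powr (- 1 / 2)"
          proof (rule decomposition_radius_bound[OF \<delta>(1,2) n(1) s0(1,2) B b s0(3) k0(1) J E _ _ _ x(1)])
            show "\<forall>j<Suc J. ?up j E" using ev by blast
            show "\<forall>x\<in>Rn N. card (Poly_Mapping.keys x) \<le> s0 \<longrightarrow> b * sqrt (real n / real N) * norm2 N x \<le> norm2 N (x - orth_proj N E x)"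
              using low unfolding bb .
          qed (use C0 w x in auto)
          then show ?thesis by (simp add: D_def mult_ac)
        qed
        then have "section_radius N ?K E \<le> D * ?w * real n powr (- 1 / 2)"
          using subspace_0[OF E(1)] by (intro section_radius_least) auto
        also have "\<dots> \<le> C * (real n powr (- 1 / 2) * ?w)"
        proof -
          have "D * (real n powr (- 1 / 2) * ?w) \<le> C * (real n powr (- 1 / 2) * ?w)"
            using w np by (intro mult_right_mono) (auto simp: C_def)
          then show ?thesis by (simp add: mult_ac)
        qed
        finally have 1: "section_radius N ?K E \<le> C * (real n powr (- 1 / 2) * ?w)" .
        have 2: "section_radius N ?K E \<le> C * 1"
          using R(2)[of E N n] Es by (auto simp: space_haar C_def)
        show "section_radius N ?K E \<le> C * rate p \<alpha> \<beta> N n"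
          using 1 2 by (auto simp: rate_eq min_def)
      qed
    qed
  qed
qed

section \<open>Lower bounds\<close>

lemma section_radius_nonneg:
  assumes "1 < p" "\<And>i. i \<in> {1..N} \<Longrightarrow> 0 < \<sigma> i" "subspace E"
  shows "0 \<le> section_radius N (p_ellipsoid N p \<sigma>) E"
  using section_radius_upper[of p N \<sigma> 0 E] assms subspace_0[of E] by auto

lemma section_radius_ge:
  assumes p: "1 < p" and \<sigma>: "\<And>i. i \<in> {1..N} \<Longrightarrow> 0 < \<sigma> i" and E: "subspace E" "E \<subseteq> Rn N"
    and x: "x \<in> E" and G: "0 < G" and sum: "(\<Sum>i=1..N. (\<bar>lk x i\<bar> / \<sigma> i) powr p) \<le> G powr p"
  shows "norm2 N x \<le> G * section_radius N (p_ellipsoid N p \<sigma>) E"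
proof -
  let ?y = "inverse G *\<^sub>R x"
  have "(\<Sum>i=1..N. (\<bar>lk ?y i\<bar> / \<sigma> i) powr p) = (\<Sum>i=1..N. (\<bar>lk x i\<bar> / \<sigma> i) powr p / G powr p)"
  proof (rule sum.cong[OF refl])
    fix i assume i: "i \<in> {1..N}"
    have "\<bar>lk ?y i\<bar> / \<sigma> i = (\<bar>lk x i\<bar> / \<sigma> i) / G" using G by (simp add: abs_mult field_simps)
    then show "(\<bar>lk ?y i\<bar> / \<sigma> i) powr p = (\<bar>lk x i\<bar> / \<sigma> i) powr p / G powr p"
      using G \<sigma>[OF i] by (simp only: powr_divide)
  qed
  also have "\<dots> \<le> 1" unfolding sum_divide_distrib[symmetric] using sum G by simp
  finally have "?y \<in> p_ellipsoid N p \<sigma>" using x E by (auto simp: p_ellipsoid_def)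
  moreover have "?y \<in> E" using x E(1) by (rule subspace_scale[rotated])
  ultimately have "norm2 N ?y \<le> section_radius N (p_ellipsoid N p \<sigma>) E"
    using p \<sigma> by (intro section_radius_upper) auto
  then show ?thesis using G by (simp add: field_simps)
qed

text \<open>The first coordinate is weighed by the fixed semiaxis
  \<open>sigma_seq \<alpha> \<beta> 1\<close>. All others are compared with the last semiaxis, the
  smallest up to a constant, which is affordable for vectors that are flat there.\<close>

lemma section_radius_ge_flat:
  fixes p \<alpha> \<beta> :: real
  assumes p: "1 < p" and \<alpha>: "0 < \<alpha>"
  shows "\<exists>C>0. \<forall>N E x H. 1 \<le> N \<longrightarrow> subspace E \<longrightarrow> E \<subseteq> Rn N \<longrightarrow> x \<in> E \<longrightarrow> 0 < H \<longrightarrow>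
    (\<Sum>i\<in>{2..N}. \<bar>lk x i\<bar> powr p) \<le> H powr p \<longrightarrow>
    norm2 N x \<le> C * (\<bar>lk x 1\<bar> + H / sigma_seq \<alpha> \<beta> N) * section_radius N (p_ellipsoid N p (sigma_seq \<alpha> \<beta>)) E"
proof -
  obtain C1 where C1: "C1 > 0" "\<And>i N. 1 \<le> i \<Longrightarrow> i \<le> N \<Longrightarrow> sigma_seq \<alpha> \<beta> N \<le> C1 * sigma_seq \<alpha> \<beta> i"
    using sigma_seq_quasi_decreasing[OF \<alpha>] by blast
  have s1: "0 < sigma_seq \<alpha> \<beta> 1" by (rule sigma_seq_pos) simp
  define C where "C = 2 * max (1 / sigma_seq \<alpha> \<beta> 1) C1"
  have Cp: "C > 0" using C1 by (simp add: C_def)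
  show ?thesis
  proof (intro exI[of _ C] conjI allI impI Cp)
    fix N E x H
    assume N: "1 \<le> N" and E: "subspace E" "E \<subseteq> Rn N" and x: "x \<in> E" and H: "(0::real) < H"
      and sum: "(\<Sum>i\<in>{2..N}. \<bar>lk x i\<bar> powr p) \<le> H powr p"
    let ?\<sigma> = "sigma_seq \<alpha> \<beta>"
    have \<sigma>: "0 < ?\<sigma> i" if "i \<in> {1..N}" for i using that by (intro sigma_seq_pos) auto
    have \<sigma>N: "0 < ?\<sigma> N" using N by (intro sigma_seq_pos)
    let ?g = "\<bar>lk x 1\<bar> + H / ?\<sigma> N"
    have g: "0 < ?g" using H \<sigma>N by (simp add: add_nonneg_pos)
    let ?m = "max (1 / ?\<sigma> 1) C1"
    have m: "0 < ?m" using C1 by simp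
    have first: "(\<bar>lk x 1\<bar> / ?\<sigma> 1) powr p \<le> (?m * ?g) powr p"
    proof (rule powr_mono2)
      have "1 / ?\<sigma> 1 * \<bar>lk x 1\<bar> \<le> ?m * ?g" using H \<sigma>N m by (intro mult_mono) auto
      then show "\<bar>lk x 1\<bar> / ?\<sigma> 1 \<le> ?m * ?g" by simp
    qed (use p s1 in auto)
    have "(\<Sum>i\<in>{2..N}. (\<bar>lk x i\<bar> / ?\<sigma> i) powr p) \<le> (\<Sum>i\<in>{2..N}. (C1 / ?\<sigma> N) powr p * \<bar>lk x i\<bar> powr p)"
    proof (rule sum_mono)
      fix i assume i: "i \<in> {2..N}"
      then have i1: "1 \<le> i" "i \<le> N" by auto
      have "1 / ?\<sigma> i \<le> C1 / ?\<sigma> N"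
        using C1(2)[OF i1] \<sigma>N sigma_seq_pos[OF i1(1), of \<alpha> \<beta>] by (simp add: field_simps)
      then have "\<bar>lk x i\<bar> * (1 / ?\<sigma> i) \<le> \<bar>lk x i\<bar> * (C1 / ?\<sigma> N)" by (rule mult_left_mono) simp
      then have "(\<bar>lk x i\<bar> / ?\<sigma> i) powr p \<le> (C1 / ?\<sigma> N * \<bar>lk x i\<bar>) powr p"
        using p sigma_seq_pos[OF i1(1), of \<alpha> \<beta>] by (intro powr_mono2) (auto simp: mult_ac)
      then show "(\<bar>lk x i\<bar> / ?\<sigma> i) powr p \<le> (C1 / ?\<sigma> N) powr p * \<bar>lk x i\<bar> powr p"
        by (simp only: powr_mult)
    qed
    also have "\<dots> = (C1 / ?\<sigma> N) powr p * (\<Sum>i\<in>{2..N}. \<bar>lk x i\<bar> powr p)" by (simp add: sum_distrib_left)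
    also have "\<dots> \<le> (C1 / ?\<sigma> N) powr p * H powr p" using sum by (rule mult_left_mono) simp
    also have "\<dots> = (C1 * (H / ?\<sigma> N)) powr p" using C1 \<sigma>N H by (simp add: powr_mult[symmetric])
    also have "\<dots> \<le> (?m * ?g) powr p"
    proof (rule powr_mono2)
      show "C1 * (H / ?\<sigma> N) \<le> ?m * ?g" using H \<sigma>N m by (intro mult_mono) auto
    qed (use p C1 H \<sigma>N in auto)
    finally have rest: "(\<Sum>i\<in>{2..N}. (\<bar>lk x i\<bar> / ?\<sigma> i) powr p) \<le> (?m * ?g) powr p" .
    have "(\<Sum>i=1..N. (\<bar>lk x i\<bar> / ?\<sigma> i) powr p) = (\<bar>lk x 1\<bar> / ?\<sigma> 1) powr p + (\<Sum>i\<in>{2..N}. (\<bar>lk x i\<bar> / ?\<sigma> i) powr p)"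
      using N by (simp add: sum.atLeast_Suc_atMost numeral_2_eq_2 One_nat_def)
    also have "\<dots> \<le> 2 powr 1 * (?m * ?g) powr p" using first rest by simp
    also have "\<dots> \<le> 2 powr p * (?m * ?g) powr p" using p by (intro mult_right_mono powr_mono) auto
    also have "\<dots> = (C * ?g) powr p" using m g by (simp add: C_def powr_mult)
    finally show "norm2 N x \<le> C * ?g * section_radius N (p_ellipsoid N p ?\<sigma>) E"
      using Cp g by (intro section_radius_ge[OF p \<sigma> E x]) auto
  qed
qed

lemma resid_inner_symmetric:
  assumes E: "subspace E" "E \<subseteq> Rn N"
  shows "inner2 N (x - orth_proj N E x) y = inner2 N x (y - orth_proj N E y)"
  by (simp add: inner2_diff_left inner2_diff_right orth_proj_symmetric[OF E])

text \<open>
  If \<open>I - P\<^sub>E\<close> is a contraction with factor \<open>1/2\<close> on sparse vectors, then every vector of \<open>E\<^sup>\<bottom>\<close> is the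
  image of a flat vector: subtract the large coordinates, whose image has at most half the norm, and iterate.
\<close>

lemma flat_preimage:
  assumes E: "subspace E" "E \<subseteq> Rn N" and t: "1 \<le> t"
    and contr: "\<forall>x\<in>Rn N. card (Poly_Mapping.keys x) \<le> Suc t \<longrightarrow> norm2 N (x - orth_proj N E x) \<le> 1 / 2 * norm2 N x"
    and v: "v \<in> Rn N" "orth_proj N E v = 0"
  obtains z where "z \<in> Rn N" "lk z 1 = 0" "\<And>i. \<bar>lk z i\<bar> \<le> 2 * norm2 N v / sqrt (real t)" "z - orth_proj N E z = v"
proof -
  \<comment> \<open>Index 1 is always removed, so the first coordinate of every \<open>d k\<close>,
    hence of \<open>z\<close>, vanishes; it accounts for \<open>Suc t\<close> in
    \<open>contr\<close>.\<close>
  define S where "S u = insert 1 {i \<in> {1..N}. norm2 N u / sqrt (real t) < \<bar>lk u i\<bar>}" for u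
  define Q where "Q x = x - orth_proj N E x" for x
  define step where "step u = Q (restr N (S u) u)" for u
  define u where "u k = (step ^^ k) v" for k
  define d where "d k = u k - restr N (S (u k)) (u k)" for k
  have tp: "0 < sqrt (real t)" using t by simp
  have QR: "Q x \<in> Rn N" if "x \<in> Rn N" for x
    using that orth_proj_in_Rn[OF E, of x] by (auto simp: Q_def)
  have PQ: "orth_proj N E (Q x) = 0" for x
    by (simp add: Q_def orth_proj_diff[OF E] orth_proj_id[OF E orth_proj_in[OF E]])
  have Qdiff: "Q (x - y) = Q x - Q y" for x y by (simp add: Q_def orth_proj_diff[OF E])
  have finS: "finite (S w)" for w by (simp add: S_def)
  \<comment> \<open>Chebyshev: more than \<open>t\<close> entries above
    \<open>norm2 N w / sqrt t\<close> would exceed the norm of \<open>w\<close>.\<close>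
  have cardS: "card (S w) \<le> Suc t" for w
  proof -
    let ?B = "{i \<in> {1..N}. norm2 N w / sqrt (real t) < \<bar>lk w i\<bar>}"
    have "card ?B \<le> t"
    proof (rule ccontr)
      assume "\<not> card ?B \<le> t"
      then have cB: "t < card ?B" by simp
      then have ne: "?B \<noteq> {}" by (metis card.empty not_less_zero)
      have "real t * (norm2 N w / sqrt (real t))\<^sup>2 \<le> real (card ?B) * (norm2 N w / sqrt (real t))\<^sup>2"
        using cB by (intro mult_right_mono) auto
      also have "\<dots> = (\<Sum>i\<in>?B. (norm2 N w / sqrt (real t))\<^sup>2)" by simp
      also have "\<dots> < (\<Sum>i\<in>?B. (lk w i)\<^sup>2)"
      proof (rule sum_strict_mono)
        fix i assume "i \<in> ?B"
        then have "norm2 N w / sqrt (real t) < \<bar>lk w i\<bar>" by simp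
        then have "(norm2 N w / sqrt (real t))\<^sup>2 < \<bar>lk w i\<bar>\<^sup>2"
          using tp by (intro power_strict_mono) auto
        then show "(norm2 N w / sqrt (real t))\<^sup>2 < (lk w i)\<^sup>2" by simp
      qed (use ne in auto)
      also have "\<dots> \<le> (norm2 N w)\<^sup>2" unfolding norm2_sq_sum by (intro sum_mono2) auto
      finally show False using t by (simp add: power_divide)
    qed
    then show ?thesis unfolding S_def by (intro order_trans[OF card_insert_le_m1]) auto
  qed
  have u0: "u 0 = v" by (simp add: u_def)
  have uSuc: "u (Suc k) = Q (restr N (S (u k)) (u k))" for k by (simp add: u_def step_def)
  have uR: "u k \<in> Rn N" for k by (cases k) (auto simp: u0 uSuc v intro!: QR)
  have uQ: "Q (u k) = u k" for k
  proof (cases k)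
    case 0
    then show ?thesis using v(2) by (simp add: u0 Q_def)
  next
    case (Suc j)
    then show ?thesis unfolding Suc uSuc using PQ[of "restr N (S (u j)) (u j)"] by (simp add: Q_def[of "Q _"])
  qed
  have u_half: "norm2 N (u (Suc k)) \<le> 1 / 2 * norm2 N (u k)" for k
  proof -
    have "norm2 N (u (Suc k)) \<le> 1 / 2 * norm2 N (restr N (S (u k)) (u k))"
      unfolding uSuc Q_def using order_trans[OF card_keys_restr[OF finS] cardS]
      by (intro contr[rule_format]) auto
    also have "norm2 N (restr N (S (u k)) (u k)) \<le> norm2 N (u k)"
    proof (rule power2_le_imp_le)
      show "(norm2 N (restr N (S (u k)) (u k)))\<^sup>2 \<le> (norm2 N (u k))\<^sup>2"
        unfolding norm2_sq_sum by (intro sum_mono) auto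
    qed simp
    finally show ?thesis by simp
  qed
  have u_pow: "norm2 N (u k) \<le> (1 / 2) ^ k * norm2 N v" for k
  proof (induction k)
    case (Suc k)
    show ?case using u_half[of k] Suc by simp
  qed (simp add: u0)
  have Qd: "Q (d k) = u k - u (Suc k)" for k unfolding d_def Qdiff uQ uSuc ..
  have d1: "lk (d k) 1 = 0" for k
    using Rn_lookup_outside[OF uR, of 1 k] by (auto simp: d_def S_def lookup_minus)
  have dle: "\<bar>lk (d k) i\<bar> \<le> (1 / 2) ^ k * (norm2 N v / sqrt (real t))" for k i
  proof -
    have "\<bar>lk (d k) i\<bar> \<le> norm2 N (u k) / sqrt (real t)"
      using Rn_lookup_outside[OF uR, of i k] tp by (auto simp: d_def S_def lookup_minus)
    also have "\<dots> \<le> (1 / 2) ^ k * norm2 N v / sqrt (real t)"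
      using tp by (intro divide_right_mono u_pow) auto
    finally show ?thesis by simp
  qed
  have geo: "(\<lambda>k. (1 / 2) ^ k * (norm2 N v / sqrt (real t))) sums (2 * (norm2 N v / sqrt (real t)))"
    using sums_mult2[OF geometric_sums[of "1 / 2 :: real"], of "norm2 N v / sqrt (real t)"] by simp
  have summ: "summable (\<lambda>k. \<bar>lk (d k) i\<bar>)" for i
    by (rule summable_comparison_test[OF _ sums_summable[OF geo]]) (use dle in auto)
  define z where "z = vec_of N (\<lambda>i. suminf (\<lambda>k. lk (d k) i))"
  have zsums: "(\<lambda>k. lk (d k) i) sums lk z i" if "i \<in> {1..N}" for i
    using summable_sums[OF summable_rabs_cancel[OF summ[of i]]] that by (simp add: z_def)
  have zle: "\<bar>lk z i\<bar> \<le> 2 * norm2 N v / sqrt (real t)" for i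
  proof (cases "i \<in> {1..N}")
    case True
    have "\<bar>suminf (\<lambda>k. lk (d k) i)\<bar> \<le> suminf (\<lambda>k. \<bar>lk (d k) i\<bar>)" by (rule summable_rabs[OF summ])
    also have "\<dots> \<le> suminf (\<lambda>k. (1 / 2) ^ k * (norm2 N v / sqrt (real t)))"
      by (rule suminf_le[OF dle summ sums_summable[OF geo]])
    also have "\<dots> = 2 * (norm2 N v / sqrt (real t))" using geo by (rule sums_unique[symmetric])
    finally show ?thesis using True by (simp add: z_def)
  next
    case False
    have "lk z i = 0" unfolding z_def lookup_vec_of using False by (rule if_not_P)
    then show ?thesis by simp
  qed
  have z1: "lk z 1 = 0" using d1 by (simp add: z_def)
  have zR: "z \<in> Rn N" by (simp add: z_def)
  have "Q z = v"
  proof (rule Rn_eqI[OF QR[OF zR] v(1)])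
    fix i assume i: "i \<in> {1..N}"
    have coord: "lk (Q x) i = (\<Sum>j=1..N. lk x j * lk (Q (unit_vec i)) j)" for x
      using resid_inner_symmetric[OF E, of x "unit_vec i"] i by (simp add: Q_def inner2_def[of N x])
    have "(\<lambda>k. \<Sum>j=1..N. lk (d k) j * lk (Q (unit_vec i)) j) sums (\<Sum>j=1..N. lk z j * lk (Q (unit_vec i)) j)"
      by (intro sums_sum sums_mult2 zsums)
    then have 1: "(\<lambda>k. lk (u k) i - lk (u (Suc k)) i) sums lk (Q z) i"
      unfolding coord[symmetric] Qd lookup_minus .
    have "(\<lambda>k. lk (u k) i) \<longlonglongrightarrow> 0"
    proof (rule tendsto_0_le[where K = 1])
      show "(\<lambda>k. (1 / 2) ^ k * norm2 N v) \<longlonglongrightarrow> 0"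
        by (rule tendsto_mult_left_zero) (rule LIMSEQ_power_zero, simp)
      have "\<bar>lk (u k) i\<bar> \<le> (1 / 2) ^ k * norm2 N v" for k
        using abs_lookup_le_norm2[OF i, of "u k"] u_pow[of k] by linarith
      then show "eventually (\<lambda>k. norm (lk (u k) i) \<le> norm ((1 / 2) ^ k * norm2 N v) * 1) sequentially"
        by (simp add: abs_mult)
    qed
    then have "(\<lambda>k. lk (u k) i - lk (u (Suc k)) i) sums (lk (u 0) i - 0)"
      by (rule telescope_sums')
    then show "lk (Q z) i = lk v i" using sums_unique2[OF 1] u0 by simp
  qed
  then show ?thesis using that[OF zR z1 zle] by (simp add: Q_def)
qed

text \<open>Off the first coordinate, which is 1, the test vector has entries of order
  \<open>sqrt n / N\<close>, so \<open>H / sigma_seq \<alpha> \<beta> N\<close> is of order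
  \<open>sqrt n / gelfand_width\<close>. The estimate is then brought to the form of the rate by
  \<open>rate * (1 + sqrt n / gelfand_width) \<le> 2\<close>.\<close>

lemma flat_lower_bound:
  fixes p \<alpha> \<beta> a :: real
  assumes p: "1 < p" and \<alpha>: "0 < \<alpha>" and a: "0 < a"
  shows "\<exists>C>0. \<forall>N n t E. 1 \<le> n \<longrightarrow> 1 \<le> t \<longrightarrow> real N \<le> a * real t \<longrightarrow> E \<in> grassmannian N n \<longrightarrow> 1 \<le> N \<longrightarrow>
    (\<forall>x\<in>Rn N. card (Poly_Mapping.keys x) \<le> Suc t \<longrightarrow> norm2 N (x - orth_proj N E x) \<le> 1 / 2 * norm2 N x) \<longrightarrow>
    norm2 N (unit_vec 1 - orth_proj N E (unit_vec 1)) \<le> a * sqrt (real n / real N) \<longrightarrow>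
    rate p \<alpha> \<beta> N n \<le> C * section_radius N (p_ellipsoid N p (sigma_seq \<alpha> \<beta>)) E"
proof -
  obtain C where C: "C > 0" "\<And>N E x H. 1 \<le> N \<Longrightarrow> subspace E \<Longrightarrow> E \<subseteq> Rn N \<Longrightarrow> x \<in> E \<Longrightarrow> 0 < H \<Longrightarrow>
    (\<Sum>i\<in>{2..N}. \<bar>lk x i\<bar> powr p) \<le> H powr p \<Longrightarrow>
    norm2 N x \<le> C * (\<bar>lk x 1\<bar> + H / sigma_seq \<alpha> \<beta> N) * section_radius N (p_ellipsoid N p (sigma_seq \<alpha> \<beta>)) E"
    using section_radius_ge_flat[OF p \<alpha>] by blast
  define D where "D = 1 + 2 * a * sqrt a"
  have D: "1 \<le> D" using a by (simp add: D_def)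
  show ?thesis
  proof (intro exI[of _ "C * (2 * D)"] conjI allI impI)
    show "0 < C * (2 * D)" using C D by simp
    fix N n t E
    assume n: "1 \<le> n" and t: "1 \<le> t" and Nt: "real N \<le> a * real t" and EG: "E \<in> grassmannian N n" and N: "1 \<le> N"
      and contr: "\<forall>x\<in>Rn N. card (Poly_Mapping.keys x) \<le> Suc t \<longrightarrow> norm2 N (x - orth_proj N E x) \<le> 1 / 2 * norm2 N x"
      and small: "norm2 N (unit_vec 1 - orth_proj N E (unit_vec 1)) \<le> a * sqrt (real n / real N)"
    let ?R = "section_radius N (p_ellipsoid N p (sigma_seq \<alpha> \<beta>)) E"
    let ?e = "unit_vec 1"
    let ?w = "gelfand_width p \<alpha> \<beta> N"
    note E = grassmannianD(1,2)[OF EG]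
    have e: "?e \<in> Rn N" using N by (intro unit_vec_in_Rn) auto
    define v where "v = ?e - orth_proj N E ?e"
    have v: "v \<in> Rn N" "orth_proj N E v = 0"
      using e orth_proj_in_Rn[OF E, of ?e]
      by (auto simp: v_def orth_proj_diff[OF E] orth_proj_id[OF E orth_proj_in[OF E]])
    obtain z where z: "z \<in> Rn N" "lk z 1 = 0" "\<And>i. \<bar>lk z i\<bar> \<le> 2 * norm2 N v / sqrt (real t)" "z - orth_proj N E z = v"
      using flat_preimage[OF E t contr v] by blast
    define x where "x = ?e - z"
    have "orth_proj N E x = x"
    proof -
      have "x - orth_proj N E x = (?e - orth_proj N E ?e) - (z - orth_proj N E z)"
        by (simp add: x_def orth_proj_diff[OF E])
      also have "\<dots> = 0" unfolding z(4) v_def by simp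
      finally show ?thesis by simp
    qed
    then have xE: "x \<in> E" using orth_proj_in[OF E, of x] by simp
    have x1: "lk x 1 = 1" using z(2) by (simp add: x_def lookup_minus)
    have nx: "1 \<le> norm2 N x" using abs_lookup_le_norm2[of 1 N x] N x1 by simp
    define \<zeta> where "\<zeta> = 2 * a * sqrt (real n / real N) / sqrt (real t)"
    have \<zeta>: "0 < \<zeta>" using a n N t by (simp add: \<zeta>_def)
    have xi: "\<bar>lk x i\<bar> \<le> \<zeta>" if "i \<in> {2..N}" for i
    proof -
      have "\<bar>lk x i\<bar> = \<bar>lk z i\<bar>" using that by (simp add: x_def lookup_minus)
      also have "\<dots> \<le> 2 * norm2 N v / sqrt (real t)" by (rule z(3))
      also have "\<dots> \<le> 2 * (a * sqrt (real n / real N)) / sqrt (real t)"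
        using small by (intro divide_right_mono mult_left_mono) (auto simp: v_def)
      finally show ?thesis by (simp add: \<zeta>_def)
    qed
    define H where "H = real N powr (1 / p) * \<zeta>"
    have H: "0 < H" using \<zeta> N by (simp add: H_def)
    have "(\<Sum>i\<in>{2..N}. \<bar>lk x i\<bar> powr p) \<le> (\<Sum>i\<in>{2..N}. \<zeta> powr p)"
      using xi p by (intro sum_mono powr_mono2) auto
    also have "\<dots> \<le> real N * \<zeta> powr p" using N by (auto intro!: mult_right_mono)
    also have "\<dots> = H powr p" using p N \<zeta> by (simp add: H_def powr_mult powr_powr)
    finally have "norm2 N x \<le> C * (\<bar>lk x 1\<bar> + H / sigma_seq \<alpha> \<beta> N) * ?R"
      by (rule C(2)[OF N E xE H])
    then have 1: "1 \<le> C * (1 + H / sigma_seq \<alpha> \<beta> N) * ?R" using nx x1 by simp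
    have \<sigma>N: "0 < sigma_seq \<alpha> \<beta> N" using N by (rule sigma_seq_pos)
    have w: "0 < ?w" using N \<sigma>N by simp
    have R0: "0 \<le> ?R" using p E by (intro section_radius_nonneg sigma_seq_pos) auto
    have Hw: "H / sigma_seq \<alpha> \<beta> N \<le> 2 * a * sqrt a * (sqrt (real n) / ?w)"
    proof -
      have "sqrt (real N) \<le> sqrt a * sqrt (real t)" using Nt by (simp add: real_sqrt_mult[symmetric])
      then have "1 / sqrt (real t) \<le> sqrt a / sqrt (real N)" using t N by (simp add: field_simps)
      then have "2 * a * sqrt (real n / real N) * (1 / sqrt (real t)) \<le> 2 * a * sqrt (real n / real N) * (sqrt a / sqrt (real N))"
        using a by (intro mult_left_mono) auto
      also have "\<dots> = 2 * a * sqrt a * (sqrt (real n) / real N)" using N by (simp add: real_sqrt_divide)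
      finally have "H / sigma_seq \<alpha> \<beta> N \<le> real N powr (1 / p) * (2 * a * sqrt a * (sqrt (real n) / real N)) / sigma_seq \<alpha> \<beta> N"
        unfolding H_def \<zeta>_def using \<sigma>N by (intro divide_right_mono mult_left_mono) auto
      also have "\<dots> = 2 * a * sqrt a * (sqrt (real n) * (real N powr (1 / p) / real N) / sigma_seq \<alpha> \<beta> N)" by (simp add: mult_ac)
      also have "real N powr (1 / p) / real N = 1 / real N powr (1 - 1 / p)"
        using N by (simp add: powr_diff)
      finally show ?thesis by (simp add: mult_ac)
    qed
    have "C * (1 + H / sigma_seq \<alpha> \<beta> N) * ?R \<le> C * (D * (1 + sqrt (real n) / ?w)) * ?R"
    proof -
      let ?q = "sqrt (real n) / ?w"
      have "0 \<le> ?q" "0 \<le> 2 * a * sqrt a" using w a by auto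
      moreover have "D * (1 + ?q) = 1 + 2 * a * sqrt a + ?q + 2 * a * sqrt a * ?q"
        unfolding D_def by (simp only: distrib_left distrib_right mult_1_left mult_1_right add.assoc)
      ultimately have "1 + H / sigma_seq \<alpha> \<beta> N \<le> D * (1 + sqrt (real n) / ?w)"
        using Hw by linarith
      then show ?thesis using C R0 by (intro mult_right_mono mult_left_mono) auto
    qed
    with 1 have 2: "1 \<le> C * (D * (1 + sqrt (real n) / ?w)) * ?R" by linarith
    let ?r = "rate p \<alpha> \<beta> N n"
    have sn: "real n powr (- 1 / 2) = 1 / sqrt (real n)"
      using powr_minus_divide[of "real n" "1 / 2"] by (simp add: powr_half_sqrt)
    have r: "0 \<le> ?r" "?r \<le> 1" using w by (auto simp: rate_eq)
    have "?r \<le> 1 / sqrt (real n) * ?w" unfolding rate_eq sn by (rule min.cobounded2)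
    then have r3: "?r \<le> ?w / sqrt (real n)" by simp
    have "?r * (sqrt (real n) / ?w) \<le> ?w / sqrt (real n) * (sqrt (real n) / ?w)"
      using w by (intro mult_right_mono r3) auto
    also have "\<dots> = 1" using \<sigma>N N n by simp
    finally have r2: "?r * (1 + sqrt (real n) / ?w) \<le> 2" using r(2) by (simp add: distrib_left)
    have "?r * 1 \<le> ?r * (C * (D * (1 + sqrt (real n) / ?w)) * ?R)"
      using 2 r(1) by (intro mult_left_mono)
    also have "\<dots> = C * D * ?R * (?r * (1 + sqrt (real n) / ?w))" by (simp only: mult_ac)
    also have "\<dots> \<le> C * D * ?R * 2" using r2 C D R0 by (intro mult_left_mono) auto
    finally show "?r \<le> C * (2 * D) * ?R" by (simp add: mult_ac)
  qed
qed

text \<open>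
  The square of \<open>4608\<close>. With at most \<open>N / 4608\<^sup>2\<close> nonzero coordinates the net has at most
  \<open>exp (N / 768)\<close> points, less than the inverse \<open>exp (N / 384)\<close> of the single-vector failure probability.
\<close>

definition sparsity_divisor :: nat where "sparsity_divisor = 21233664"

text \<open>Here \<open>t + 1 = N div sparsity_divisor\<close>. The union bound leaves
  \<open>exp (n - N / 768)\<close>, and \<open>N\<close> is far above \<open>2304 * n\<close>. The
  level for \<open>e_1\<close> uses the same factor \<open>2 * sparsity_divisor\<close> as the bound
  on \<open>N / t\<close>, since \<open>flat_lower_bound\<close> has one constant for both.\<close>

lemma (in haar) flat_events:
  assumes n: "1 \<le> n" and Nn: "4 * sparsity_divisor * n \<le> N"
  shows "\<exists>t. 1 \<le> t \<and> real N \<le> 2 * real sparsity_divisor * real t \<and>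
    holds_except \<mu> (\<lambda>E. (\<forall>x\<in>Rn N. card (Poly_Mapping.keys x) \<le> Suc t \<longrightarrow> norm2 N (x - orth_proj N E x) \<le> 1 / 2 * norm2 N x) \<and>
      norm2 N (unit_vec 1 - orth_proj N E (unit_vec 1)) \<le> 2 * real sparsity_divisor * sqrt (real n / real N))
    (2 * exp (- 2 * real n))"
proof -
  let ?M = sparsity_divisor
  have M: "?M = 21233664" by (simp add: sparsity_divisor_def)
  define s where "s = N div ?M"
  have N4: "4 * ?M \<le> N" using Nn n by (simp add: M)
  have s4: "4 \<le> s" using N4 by (simp add: s_def M)
  have sN: "s * ?M \<le> N" by (simp add: s_def)
  have Ns: "N < (s + 1) * ?M" unfolding s_def M by (simp add: dividend_less_div_times)
  define t where "t = s - 1"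
  have st: "s = Suc t" using s4 by (simp add: t_def)
  have t: "1 \<le> t" using s4 by (simp add: t_def)
  have "N \<le> 2 * ?M * t" using Ns s4 by (simp add: st M)
  then have Nt: "real N \<le> 2 * real ?M * real t" by (metis of_nat_le_iff of_nat_mult of_nat_numeral)
  have Np: "0 < N" using N4 by (simp add: M)
  have two: "2 \<le> exp (real n)"
  proof -
    have "(2::real) \<le> exp 1" using exp_ge_add_one_self[of "1::real"] by simp
    also have "\<dots> \<le> exp (real n)" using n by simp
    finally show ?thesis .
  qed
  have big: "real ?M * 4 * real n \<le> real N"
  proof -
    have "real (4 * ?M * n) \<le> real N" using Nn by (simp only: of_nat_le_iff)
    then show ?thesis by simp
  qed
  have s1: "1 \<le> s" "s \<le> N" using s4 sN by (auto simp: M)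
  have A: "holds_except \<mu> (\<lambda>E. \<forall>x\<in>Rn N. card (Poly_Mapping.keys x) \<le> s \<longrightarrow> norm2 N (x - orth_proj N E x) \<le> 1 / 2 * norm2 N x)
    (exp (- 2 * real n))"
  proof (rule holds_except_mono[OF sparse_upper[OF s1, of "1 / 2"]])
    show "32 * real n \<le> (1 / 2)\<^sup>2 * real N" using big by (simp add: M power_divide)
    have cnt: "(real N / real s * exp 4) ^ s \<le> exp (real N / 768)"
    proof -
      have "(real N / real s * exp 4) ^ s \<le> exp ((1 / (1 / 2) + 4) * (real s powr (1 - 1 / 2) * real N powr (1 / 2)))"
        by (rule net_count_le[OF s1]) auto
      also have "real s powr (1 - 1 / 2) * real N powr (1 / 2) = sqrt (real s * real N)"
        by (simp add: powr_half_sqrt real_sqrt_mult)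
      also have "sqrt (real s * real N) \<le> real N / 4608"
      proof (rule real_le_lsqrt)
        have "real (s * ?M) \<le> real N" using sN by (simp only: of_nat_le_iff)
        then have "real s \<le> real N / 21233664" by (simp add: M)
        then have "real s * real N \<le> real N / 21233664 * real N" by (rule mult_right_mono) simp
        then show "real s * real N \<le> (real N / 4608)\<^sup>2" by (simp add: power2_eq_square)
      qed auto
      finally show ?thesis by simp
    qed
    have "(real N / real s * exp 4) ^ s * (2 * exp (- (1 / 2)\<^sup>2 * real N / 96)) \<le> exp (real N / 768) * (exp (real n) * exp (- (real N / 384)))"
      using cnt two by (intro mult_mono) (auto simp: power_divide)
    also have "\<dots> = exp (real n - real N / 768)" by (simp add: exp_add[symmetric])
    also have "\<dots> \<le> exp (- 2 * real n)" using big by (simp add: M)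
    finally show "(real N / real s * exp 4) ^ s * (2 * exp (- (1 / 2)\<^sup>2 * real N / 96)) \<le> exp (- 2 * real n)" .
  qed auto
  have e: "unit_vec 1 \<in> Rn N" using Np by (intro unit_vec_in_Rn) auto
  let ?\<kappa> = "2 * real ?M * sqrt (real n / real N)"
  have \<kappa>N: "?\<kappa>\<^sup>2 * real N = 4 * (real ?M)\<^sup>2 * real n" using Np by (simp add: power_mult_distrib)
  have "holds_except \<mu> (\<lambda>E. norm2 N (unit_vec 1 - orth_proj N E (unit_vec 1)) \<le> ?\<kappa> * norm2 N (unit_vec 1)) (2 * exp (- ?\<kappa>\<^sup>2 * real N / 24))"
  proof (rule resid_upper[OF e _ Np])
    show "8 * real n \<le> ?\<kappa>\<^sup>2 * real N" unfolding \<kappa>N by (simp add: M)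
  qed simp
  then have B: "holds_except \<mu> (\<lambda>E. norm2 N (unit_vec 1 - orth_proj N E (unit_vec 1)) \<le> ?\<kappa>) (exp (- 2 * real n))"
  proof (rule holds_except_mono)
    have eq: "- ?\<kappa>\<^sup>2 * real N / 24 = - (4 * (real ?M)\<^sup>2 * real n) / 24" using \<kappa>N by simp
    have "2 * exp (- ?\<kappa>\<^sup>2 * real N / 24) \<le> exp (real n) * exp (- (4 * (real ?M)\<^sup>2 * real n) / 24)"
      unfolding eq using two by (intro mult_right_mono) auto
    also have "\<dots> \<le> exp (- 2 * real n)" unfolding exp_add[symmetric] by (simp add: M)
    finally show "2 * exp (- ?\<kappa>\<^sup>2 * real N / 24) \<le> exp (- 2 * real n)" .
  qed (use Np in \<open>simp add: Suc_leI One_nat_def\<close>)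
  show ?thesis
    using t Nt holds_except_mono[OF holds_except_conj[OF A B]] unfolding st by (intro exI[of _ t]) auto
qed

theorem section_radius_lower_bound:
  fixes p \<alpha> \<beta> :: real
  assumes p: "1 < p" and \<alpha>: "0 < \<alpha>"
  shows "\<exists>C>0. \<forall>N n \<mu>. 1 \<le> n \<longrightarrow> 4 * real sparsity_divisor * real n \<le> real N \<longrightarrow> normalized_haar N n \<mu> \<longrightarrow>
    holds_except \<mu> (\<lambda>E. rate p \<alpha> \<beta> N n \<le> C * section_radius N (p_ellipsoid N p (sigma_seq \<alpha> \<beta>)) E) (2 * exp (- 2 * real n))"
proof -
  have M: "0 < 2 * real sparsity_divisor" by (simp add: sparsity_divisor_def)
  obtain C where C: "C > 0" "\<And>N n t E. 1 \<le> n \<Longrightarrow> 1 \<le> t \<Longrightarrow> real N \<le> 2 * real sparsity_divisor * real t \<Longrightarrow> E \<in> grassmannian N n \<Longrightarrow> 1 \<le> N \<Longrightarrow>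
    (\<forall>x\<in>Rn N. card (Poly_Mapping.keys x) \<le> Suc t \<longrightarrow> norm2 N (x - orth_proj N E x) \<le> 1 / 2 * norm2 N x) \<Longrightarrow>
    norm2 N (unit_vec 1 - orth_proj N E (unit_vec 1)) \<le> 2 * real sparsity_divisor * sqrt (real n / real N) \<Longrightarrow>
    rate p \<alpha> \<beta> N n \<le> C * section_radius N (p_ellipsoid N p (sigma_seq \<alpha> \<beta>)) E"
    using flat_lower_bound[OF p \<alpha> M] by blast
  show ?thesis
  proof (intro exI[of _ C] conjI allI impI C(1))
    fix N n \<mu> assume n: "1 \<le> n" and Nn: "4 * real sparsity_divisor * real n \<le> real N" and "normalized_haar N n \<mu>"
    then interpret haar N n \<mu> by unfold_locales
    have "real (4 * sparsity_divisor * n) \<le> real N" using Nn by simp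
    then have Nn': "4 * sparsity_divisor * n \<le> N" by (simp only: of_nat_le_iff)
    have N: "1 \<le> N" using Nn' n by (simp add: sparsity_divisor_def)
    obtain t where t: "1 \<le> t" "real N \<le> 2 * real sparsity_divisor * real t"
      "holds_except \<mu> (\<lambda>E. (\<forall>x\<in>Rn N. card (Poly_Mapping.keys x) \<le> Suc t \<longrightarrow> norm2 N (x - orth_proj N E x) \<le> 1 / 2 * norm2 N x) \<and>
      norm2 N (unit_vec 1 - orth_proj N E (unit_vec 1)) \<le> 2 * real sparsity_divisor * sqrt (real n / real N))
      (2 * exp (- 2 * real n))"
      using flat_events[OF n Nn'] by blast
    show "holds_except \<mu> (\<lambda>E. rate p \<alpha> \<beta> N n \<le> C * section_radius N (p_ellipsoid N p (sigma_seq \<alpha> \<beta>)) E) (2 * exp (- 2 * real n))"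
      using t(3) by (rule holds_except_mono) (use C(2)[OF n t(1,2) _ N] in \<open>auto simp: space_haar\<close>)
  qed
qed

text \<open>
  The level set of \<open>\<bar>x\<^sub>i\<bar>\<close> at height \<open>\<tau>\<^sub>j * norm2 x / sqrt (2 ^ j)\<close> has fewer than \<open>2 ^ j\<close> elements:
  otherwise the restriction \<open>y\<close> of \<open>x\<close> to \<open>2 ^ j\<close> of them violates the bound on \<open>inner2 x y\<close>.
\<close>

lemma sum_powr_le_dyadic:
  fixes x :: fseq and p :: real
  assumes p: "0 < p" and x: "x \<in> Rn N" and J: "N \<le> 2 ^ J" and \<tau>: "\<And>j. j < J \<Longrightarrow> 0 \<le> \<tau> j"
    and marg: "\<And>j y. j < J \<Longrightarrow> y \<in> Rn N \<Longrightarrow> card (Poly_Mapping.keys y) \<le> 2 ^ j \<Longrightarrow> lk y 1 = 0 \<Longrightarrow>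
      inner2 N x y \<le> \<tau> j * norm2 N x * norm2 N y"
  shows "(\<Sum>i\<in>{2..N}. \<bar>lk x i\<bar> powr p) \<le> (\<Sum>j<J. 2 ^ Suc j * (\<tau> j * norm2 N x / sqrt (2 ^ j)) powr p)"
proof -
  define a where "a j = \<tau> j * norm2 N x / sqrt (2 ^ j)" for j
  define T where "T j = (if j = J then {2..N} else {i \<in> {2..N}. a j < \<bar>lk x i\<bar>})" for j
  have Tsub: "T j \<subseteq> {2..N}" for j by (auto simp: T_def)
  have finT: "finite (T j)" for j using Tsub by (rule finite_subset) simp
  have small: "card (T j) < 2 ^ j" if j: "j < J" for j
  proof (rule ccontr)
    assume "\<not> card (T j) < 2 ^ j"
    then obtain S where S: "S \<subseteq> T j" "card S = 2 ^ j" by (metis not_less obtain_subset_with_card_n)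
    have finS: "finite S" using S(1) finT by (rule finite_subset)
    have S2: "S \<subseteq> {2..N}" using S(1) Tsub by blast
    have aj: "0 \<le> a j" using \<tau>[OF j] by (simp add: a_def)
    let ?y = "restr N S x"
    have ny: "(norm2 N ?y)\<^sup>2 = (\<Sum>i\<in>S. (lk x i)\<^sup>2)"
      unfolding norm2_sq_sum using S2 by (intro sum.mono_neutral_cong_right) auto
    have ip: "inner2 N x ?y = (norm2 N ?y)\<^sup>2"
      unfolding norm2_sq by (auto simp: inner2_def intro!: sum.cong)
    have "inner2 N x ?y \<le> \<tau> j * norm2 N x * norm2 N ?y"
      using S2 order_trans[OF card_keys_restr[OF finS] eq_refl[OF S(2)]] by (intro marg j) auto
    then have "norm2 N ?y * norm2 N ?y \<le> (\<tau> j * norm2 N x) * norm2 N ?y"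
      unfolding ip by (simp add: power2_eq_square)
    then have le: "norm2 N ?y \<le> \<tau> j * norm2 N x"
      using \<tau>[OF j] norm2_nonneg[of N ?y] norm2_nonneg[of N x]
      by (metis mult_le_cancel_right mult_nonneg_nonneg order_antisym_conv not_less)
    have "(\<tau> j * norm2 N x)\<^sup>2 = (\<Sum>i\<in>S. (a j)\<^sup>2)"
      using S(2) by (simp add: a_def power_divide)
    also have "\<dots> < (\<Sum>i\<in>S. (lk x i)\<^sup>2)"
    proof (rule sum_strict_mono)
      show "S \<noteq> {}" using S(2) by auto
      fix i assume "i \<in> S"
      then have "a j < \<bar>lk x i\<bar>" using S(1) j by (auto simp: T_def)
      then have "(a j)\<^sup>2 < \<bar>lk x i\<bar>\<^sup>2" using aj by (intro power_strict_mono) auto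
      then show "(a j)\<^sup>2 < (lk x i)\<^sup>2" by simp
    qed (rule finS)
    also have "\<dots> = (norm2 N ?y)\<^sup>2" by (rule ny[symmetric])
    also have "\<dots> \<le> (\<tau> j * norm2 N x)\<^sup>2" using le by (intro power_mono) auto
    finally show False by simp
  qed
  have cT: "card (T j) \<le> 2 ^ j" if "j \<le> J" for j
  proof (cases "j = J")
    case True
    have "card {2..N} \<le> N" by simp
    then show ?thesis using True J by (simp add: T_def)
  qed (use small[of j] that in auto)
  have "(\<Sum>i\<in>T k. \<bar>lk x i\<bar> powr p) \<le> (\<Sum>j<k. 2 ^ Suc j * a j powr p)" if "k \<le> J" for k
    using that
  proof (induction k)
    case 0
    have "T 0 = {}"
    proof (cases "J = 0")
      case True
      then have "N \<le> 1" using J by simp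
      then show ?thesis using Tsub[of 0] by auto
    next
      case False
      then show ?thesis using small[of 0] finT[of 0] by simp
    qed
    then show ?case by simp
  next
    case (Suc k)
    have "(\<Sum>i\<in>T (Suc k). \<bar>lk x i\<bar> powr p) = (\<Sum>i\<in>T (Suc k) \<inter> T k. \<bar>lk x i\<bar> powr p) + (\<Sum>i\<in>T (Suc k) - T k. \<bar>lk x i\<bar> powr p)"
      using finT by (metis sum.Int_Diff)
    also have "(\<Sum>i\<in>T (Suc k) \<inter> T k. \<bar>lk x i\<bar> powr p) \<le> (\<Sum>i\<in>T k. \<bar>lk x i\<bar> powr p)"
      by (intro sum_mono2 finT) auto
    also have "(\<Sum>i\<in>T (Suc k) - T k. \<bar>lk x i\<bar> powr p) \<le> (\<Sum>i\<in>T (Suc k) - T k. a k powr p)"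
    proof (rule sum_mono)
      fix i assume i: "i \<in> T (Suc k) - T k"
      have "i \<in> {2..N}" using i Tsub by blast
      moreover have "T k = {i \<in> {2..N}. a k < \<bar>lk x i\<bar>}" using Suc.prems by (simp add: T_def)
      ultimately have "\<bar>lk x i\<bar> \<le> a k" using i by simp
      then show "\<bar>lk x i\<bar> powr p \<le> a k powr p" using p by (intro powr_mono2) auto
    qed
    also have "\<dots> \<le> 2 ^ Suc k * a k powr p"
    proof -
      have "card (T (Suc k) - T k) \<le> card (T (Suc k))" by (intro card_mono finT) auto
      also have "\<dots> \<le> 2 ^ Suc k" by (rule cT[OF Suc.prems])
      finally have "real (card (T (Suc k) - T k)) \<le> real (2 ^ Suc k)" by (simp only: of_nat_le_iff)
      then show ?thesis by (simp add: mult_right_mono)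
    qed
    finally show ?case using Suc by simp
  qed
  from this[of J] show ?thesis by (simp add: T_def a_def)
qed

section \<open>Marginals of the projected first coordinate vector, p > 2\<close>

lemma powr_add_le:
  fixes u v r :: real
  assumes "0 \<le> u" "0 \<le> v" "0 \<le> r"
  shows "(u + v) powr r \<le> 2 powr r * (u powr r + v powr r)"
proof -
  have "(u + v) powr r \<le> (2 * max u v) powr r" using assms by (intro powr_mono2) auto
  also have "\<dots> = 2 powr r * max u v powr r" by (rule powr_mult)
  also have "max u v powr r \<le> u powr r + v powr r" by (auto simp: max_def)
  finally show ?thesis by (simp add: mult_left_mono)
qed

text \<open>At scale \<open>m = 2 ^ j\<close> the entropy term contributes
  \<open>N powr (1/2) * m powr (1/2)\<close>, dominated by the last scale, and the deviation term
  \<open>N powr (2/p)\<close> contributes \<open>N * m powr (1 - p/2)\<close>, dominated by the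
  first because \<open>p > 2\<close>. Both sums are of order \<open>N\<close>, with the common
  factor \<open>N powr (- p/2)\<close>.\<close>

lemma marginal_levels_sum:
  fixes p B :: real
  assumes p: "2 < p" and B: "0 < B"
  shows "\<exists>C>0. \<forall>N J. 1 \<le> N \<longrightarrow> 2 ^ J \<le> 2 * N \<longrightarrow>
    (\<Sum>j<J. 2 ^ Suc j * (sqrt (B * (real (2 ^ j) powr (1 - 1 / p) * real N powr (1 / p) + real N powr (2 / p)) / real N) / sqrt (2 ^ j)) powr p)
      \<le> (C * real N powr (1 / p - 1 / 2)) powr p"
proof -
  define c1 where "c1 = 2 powr (1 / 2) / (2 powr (1 / 2) - 1 :: real)"
  define e where "e = p / 2 - 1"
  have e: "0 < e" using p by (simp add: e_def)
  define c2 where "c2 = 1 / (1 - 2 powr (- e))"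
  have c1: "0 < c1"
  proof -
    have "1 < (2::real) powr (1 / 2)" using powr_less_mono[of 0 "1 / 2" 2] by simp
    then show ?thesis by (simp add: c1_def)
  qed
  have c2: "0 < c2"
  proof -
    have "(2::real) powr (- e) < 1" using e powr_less_mono[of "- e" 0 2] by auto
    then show ?thesis by (simp add: c2_def)
  qed
  define D where "D = 2 * (2 * B) powr (p / 2) * (c1 + c2)"
  have D: "0 < D" using B c1 c2 by (simp add: D_def)
  show ?thesis
  proof (intro exI[of _ "D powr (1 / p)"] conjI allI impI)
    show "0 < D powr (1 / p)" using D by simp
    fix N J :: nat assume N: "1 \<le> N" and J: "2 ^ J \<le> 2 * N"
    let ?m = "\<lambda>j. real (2 ^ j * 1)"
    have term_le: "2 ^ Suc j * (sqrt (B * (real (2 ^ j) powr (1 - 1 / p) * real N powr (1 / p) + real N powr (2 / p)) / real N) / sqrt (2 ^ j)) powr p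
        \<le> 2 * ((2 * B) powr (p / 2) * real N powr (- p / 2)) * (real N powr (1 / 2) * ?m j powr (1 / 2) + real N * ?m j powr (- e))" for j
    proof -
      define m where "m = real (2 ^ j)"
      have m: "0 < m" by (simp add: m_def)
      let ?u = "m powr (- (1 / p)) * real N powr (1 / p)" and ?v = "real N powr (2 / p) * m powr (- 1)"
      have q: "m powr (1 - 1 / p) / m = m powr (- (1 / p))"
        using m powr_diff[of m "1 - 1 / p" 1] by simp
      have "sqrt (B * (m powr (1 - 1 / p) * real N powr (1 / p) + real N powr (2 / p)) / real N) / sqrt m =
          sqrt (B / real N * (?u + ?v))"
        unfolding real_sqrt_divide[symmetric] q[symmetric] using m by (simp add: field_simps powr_minus)
      also have "\<dots> = (B / real N * (?u + ?v)) powr (1 / 2)"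
        using B m by (simp add: powr_half_sqrt)
      finally have "(sqrt (B * (m powr (1 - 1 / p) * real N powr (1 / p) + real N powr (2 / p)) / real N) / sqrt m) powr p =
          (B / real N * (?u + ?v)) powr (p / 2)"
        by (simp add: powr_powr)
      also have "\<dots> = (B / real N) powr (p / 2) * (?u + ?v) powr (p / 2)" by (rule powr_mult)
      also have "\<dots> \<le> (B / real N) powr (p / 2) * (2 powr (p / 2) * (?u powr (p / 2) + ?v powr (p / 2)))"
        using p by (intro mult_left_mono powr_add_le) auto
      also have "?u powr (p / 2) = m powr (- (1 / 2)) * real N powr (1 / 2)"
        using p by (simp add: powr_mult powr_powr)
      also have "?v powr (p / 2) = real N * m powr (- (p / 2))"
      proof -
        have "?v powr (p / 2) = real N powr (2 / p * (p / 2)) * m powr (- 1 * (p / 2))"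
          by (simp only: powr_mult powr_powr)
        then show ?thesis using p N by simp
      qed
      also have "(B / real N) powr (p / 2) = B powr (p / 2) * real N powr (- p / 2)"
        using powr_minus_divide[of "real N" "p / 2"] B by (simp add: powr_divide)
      finally have main: "(sqrt (B * (m powr (1 - 1 / p) * real N powr (1 / p) + real N powr (2 / p)) / real N) / sqrt m) powr p
          \<le> (2 * B) powr (p / 2) * real N powr (- p / 2) * (m powr (- (1 / 2)) * real N powr (1 / 2) + real N * m powr (- (p / 2)))"
        by (simp add: powr_mult mult_ac)
      have mm: "m * m powr (- (1 / 2)) = m powr (1 / 2)" "m * m powr (- (p / 2)) = m powr (- e)"
        using m powr_mult_base[of m "- (1 / 2)"] powr_mult_base[of m "- (p / 2)"] by (simp_all add: e_def)
      have "2 * m * (sqrt (B * (m powr (1 - 1 / p) * real N powr (1 / p) + real N powr (2 / p)) / real N) / sqrt m) powr p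
          \<le> 2 * m * ((2 * B) powr (p / 2) * real N powr (- p / 2) * (m powr (- (1 / 2)) * real N powr (1 / 2) + real N * m powr (- (p / 2))))"
        using m by (intro mult_left_mono main) auto
      also have "\<dots> = 2 * ((2 * B) powr (p / 2) * real N powr (- p / 2)) * (real N powr (1 / 2) * (m * m powr (- (1 / 2))) + real N * (m * m powr (- (p / 2))))"
        by (simp add: algebra_simps)
      finally show ?thesis unfolding mm by (simp add: m_def)
    qed
    have "(\<Sum>j<J. 2 ^ Suc j * (sqrt (B * (real (2 ^ j) powr (1 - 1 / p) * real N powr (1 / p) + real N powr (2 / p)) / real N) / sqrt (2 ^ j)) powr p)
      \<le> (\<Sum>j<J. 2 * ((2 * B) powr (p / 2) * real N powr (- p / 2)) * (real N powr (1 / 2) * ?m j powr (1 / 2) + real N * ?m j powr (- e)))"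
      by (intro sum_mono term_le)
    also have "\<dots> = 2 * ((2 * B) powr (p / 2) * real N powr (- p / 2)) * (real N powr (1 / 2) * (\<Sum>j<J. ?m j powr (1 / 2)) + real N * (\<Sum>j<J. ?m j powr (- e)))"
      by (simp only: sum_distrib_left sum.distrib distrib_left)
    also have "\<dots> \<le> 2 * ((2 * B) powr (p / 2) * real N powr (- p / 2)) * (c1 * real N + c2 * real N)"
    proof (intro mult_left_mono add_mono)
      have "(\<Sum>j<J. ?m j powr (1 / 2)) \<le> ?m J powr (1 / 2) / (2 powr (1 / 2) - 1)"
        by (rule geometric_sum_growth) auto
      also have "\<dots> \<le> (2 * real N) powr (1 / 2) / (2 powr (1 / 2) - 1)"
      proof -
        have "real (2 ^ J) \<le> real (2 * N)" using J by (simp only: of_nat_le_iff)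
        then have "?m J \<le> 2 * real N" by simp
        then show ?thesis by (intro divide_right_mono powr_mono2) (auto intro!: ge_one_powr_ge_zero)
      qed
      also have "\<dots> = c1 * real N powr (1 / 2)" by (simp add: c1_def powr_mult)
      finally have "real N powr (1 / 2) * (\<Sum>j<J. ?m j powr (1 / 2)) \<le> real N powr (1 / 2) * (c1 * real N powr (1 / 2))"
        by (rule mult_left_mono) simp
      also have "\<dots> = c1 * (real N powr (1 / 2) * real N powr (1 / 2))" by (simp only: mult_ac)
      also have "real N powr (1 / 2) * real N powr (1 / 2) = real N" by (simp add: powr_half_sqrt)
      finally show "real N powr (1 / 2) * (\<Sum>j<J. ?m j powr (1 / 2)) \<le> c1 * real N" .
      have "(\<Sum>j<J. ?m j powr (- e)) \<le> real 1 powr (- e) / (1 - 2 powr (- e))"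
        using e by (intro geometric_sum_decay) auto
      then have "(\<Sum>j<J. ?m j powr (- e)) \<le> c2" by (simp add: c2_def)
      then have "real N * (\<Sum>j<J. ?m j powr (- e)) \<le> real N * c2" by (rule mult_left_mono) simp
      then show "real N * (\<Sum>j<J. ?m j powr (- e)) \<le> c2 * real N" by (simp only: mult.commute)
    qed (use B in auto)
    also have "\<dots> = D * (real N * real N powr (- p / 2))" by (simp add: D_def algebra_simps)
    also have "real N * real N powr (- p / 2) = real N powr (1 - p / 2)"
      using powr_mult_base[of "real N" "- p / 2"] by simp
    also have "D * real N powr (1 - p / 2) = (D powr (1 / p) * real N powr (1 / p - 1 / 2)) powr p"
      using D p by (simp add: powr_mult powr_powr left_diff_distrib)
    finally show "(\<Sum>j<J. 2 ^ Suc j * (sqrt (B * (real (2 ^ j) powr (1 - 1 / p) * real N powr (1 / p) + real N powr (2 / p)) / real N) / sqrt (2 ^ j)) powr p)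
      \<le> (D powr (1 / p) * real N powr (1 / p - 1 / 2)) powr p" .
  qed
qed

text \<open>\<open>net_count_le\<close> with \<open>\<delta> = 1/p\<close> gives net entropy
  \<open>(p + 4) * ?L j\<close>. The factor \<open>2 * p + 6\<close> in \<open>B\<close> beats it
  and leaves \<open>p * N powr (2/p)\<close> for the probability and \<open>5 + j\<close> for the
  summation over scales.\<close>

lemma (in haar) marginal_events:
  fixes p :: real
  defines "B \<equiv> 96 * (2 * p + 6)"
  assumes p: "2 < p" and n: "n < N" and N: "2 \<le> N" and J: "2 ^ J < 2 * N"
  shows "holds_except \<mu> (\<lambda>E. (\<forall>j<J. \<forall>y\<in>Rn N. card (Poly_Mapping.keys y) \<le> 2 ^ j \<longrightarrow> lk y 1 = 0 \<longrightarrow>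
      inner2 N (orth_proj N E (unit_vec 1)) y \<le>
        sqrt (B * (real (2 ^ j) powr (1 - 1 / p) * real N powr (1 / p) + real N powr (2 / p)) / real N) *
          norm2 N (orth_proj N E (unit_vec 1)) * norm2 N y) \<and> 0 < norm2 N (orth_proj N E (unit_vec 1)))
    (exp (- p * real N powr (2 / p)))"
proof -
  let ?L = "\<lambda>j. real (2 ^ j) powr (1 - 1 / p) * real N powr (1 / p)"
  let ?X = "real N powr (2 / p)"
  let ?\<tau> = "\<lambda>j. sqrt (B * (?L j + ?X) / real N)"
  let ?P = "\<lambda>j E. \<forall>y\<in>Rn N. card (Poly_Mapping.keys y) \<le> 2 ^ j \<longrightarrow> lk y 1 = 0 \<longrightarrow>
      inner2 N (orth_proj N E (unit_vec 1)) y \<le> ?\<tau> j * norm2 N (orth_proj N E (unit_vec 1)) * norm2 N y"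
  have B: "0 < B" using p by (simp add: B_def)
  have X: "1 \<le> ?X" using N p by (intro ge_one_powr_ge_zero) auto
  have single: "holds_except \<mu> (?P j) (exp (- p * ?X) * (2 * exp (- ((5 + real j) * real 1))))" if j: "j < J" for j
  proof (rule holds_except_mono[OF sparse_marginal[OF _ _ N]])
    show s1: "1 \<le> (2 ^ j :: nat)" by simp
    have "2 ^ Suc j \<le> (2 ^ J :: nat)" using j by (intro power_increasing) auto
    then have "2 * 2 ^ j < 2 * N" using J by simp
    then show s2: "2 ^ j \<le> N" by simp
    have L: "real j \<le> ?L j"
    proof -
      have "real j \<le> real (2 ^ j)" using less_exp[of j] by (simp only: of_nat_le_iff less_imp_le)
      also have "\<dots> = real (2 ^ j) powr (1 - 1 / p) * real (2 ^ j) powr (1 / p)" by (simp add: powr_add[symmetric])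
      also have "\<dots> \<le> ?L j"
      proof -
        have "real (2 ^ j) \<le> real N" using s2 by (simp only: of_nat_le_iff)
        then show ?thesis using p by (intro mult_left_mono powr_mono2) auto
      qed
      finally show ?thesis .
    qed
    have \<tau>: "(?\<tau> j)\<^sup>2 * real N = B * (?L j + ?X)" using B N by (simp add: add_nonneg_nonneg)
    have "(real N / real (2 ^ j) * exp 4) ^ (2 ^ j) * (2 * exp (- (?\<tau> j)\<^sup>2 * real N / 96)) \<le>
        exp ((1 / (1 / p) + 4) * ?L j) * (2 * exp (- (B * (?L j + ?X)) / 96))"
      using net_count_le[OF s1 s2, of "1 / p" 4] p \<tau> by (intro mult_mono) auto
    also have "\<dots> = 2 * exp ((p + 4) * ?L j - (2 * p + 6) * (?L j + ?X))"
    proof -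
      have eq: "- (B * (?L j + ?X)) / 96 = - ((2 * p + 6) * (?L j + ?X))" "1 / (1 / p) = p"
        by (simp_all add: B_def)
      have ex: "exp (a - z) = exp a * exp (- z)" for a z :: real
        using exp_add[of a "- z"] by simp
      show ?thesis unfolding eq ex by (simp only: mult_ac)
    qed
    also have "\<dots> \<le> 2 * exp (- p * ?X - (5 + real j))"
    proof -
      have "(p + 4) * ?L j - (2 * p + 6) * (?L j + ?X) = - p * ?X - p * ?X - 6 * ?X - (p + 1) * ?L j - ?L j"
        by (simp add: algebra_simps)
      moreover have "0 \<le> p * ?X" "0 \<le> (p + 1) * ?L j" using p by auto
      ultimately show ?thesis using X L by simp
    qed
    also have "\<dots> = exp (- p * ?X) * (2 * exp (- ((5 + real j) * real 1)))"
      by (simp add: exp_add[symmetric])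
    finally show "(real N / real (2 ^ j) * exp 4) ^ (2 ^ j) * (2 * exp (- (?\<tau> j)\<^sup>2 * real N / 96)) \<le>
      exp (- p * ?X) * (2 * exp (- ((5 + real j) * real 1)))" .
  qed (use B X in auto)
  have "holds_except \<mu> (\<lambda>E. \<forall>j\<in>{..<J}. ?P j E) (\<Sum>j<J. exp (- p * ?X) * (2 * exp (- ((5 + real j) * real 1))))"
    by (intro holds_except_all single) auto
  then have A: "holds_except \<mu> (\<lambda>E. \<forall>j\<in>{..<J}. ?P j E) (exp (- p * ?X))"
  proof (rule holds_except_mono)
    have "(\<Sum>j<J. exp (- p * ?X) * (2 * exp (- ((5 + real j) * real 1)))) = exp (- p * ?X) * (\<Sum>j<J. 2 * exp (- ((5 + real j) * real 1)))"
      by (simp only: sum_distrib_left)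
    also have "\<dots> \<le> exp (- p * ?X) * exp (- 3 * real 1)"
      by (intro mult_left_mono sum_exp_le) auto
    also have "\<dots> \<le> exp (- p * ?X) * 1" by (intro mult_left_mono) auto
    finally show "(\<Sum>j<J. exp (- p * ?X) * (2 * exp (- ((5 + real j) * real 1)))) \<le> exp (- p * ?X)" by simp
  qed auto
  have e: "unit_vec 1 \<in> Rn N" "norm2 N (unit_vec 1) = 1" using N by (auto intro: unit_vec_in_Rn)
  \<comment> \<open>Positivity of the norm, by which the later estimates are divided, costs no
    probability.\<close>
  have Z: "holds_except \<mu> (\<lambda>E. 0 < norm2 N (orth_proj N E (unit_vec 1))) 0"
  proof (rule holds_exceptI)
    show "{E \<in> space \<mu>. 1 \<le> norm2 N (unit_vec 1 - orth_proj N E (unit_vec 1))} \<in> sets \<mu>"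
      by (rule borel_measurable_iff_ge[THEN iffD1, rule_format, OF measurable_norm2_resid_haar[OF e(1)]])
    show "measure \<mu> {E \<in> space \<mu>. 1 \<le> norm2 N (unit_vec 1 - orth_proj N E (unit_vec 1))} \<le> 0"
      using proj_nonzero_unit[OF e n] by simp
    fix E assume "E \<in> space \<mu>" and lt: "\<not> 1 \<le> norm2 N (unit_vec 1 - orth_proj N E (unit_vec 1))"
    then have E: "subspace E" "E \<subseteq> Rn N" using grassmannianD by (auto simp: space_haar)
    have "(norm2 N (unit_vec 1 - orth_proj N E (unit_vec 1)))\<^sup>2 < 1\<^sup>2"
      using lt by (intro power_strict_mono) auto
    moreover have "1\<^sup>2 = (norm2 N (orth_proj N E (unit_vec 1)))\<^sup>2 + (norm2 N (unit_vec 1 - orth_proj N E (unit_vec 1)))\<^sup>2"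
      using orth_proj_pythagoras[OF E, of "unit_vec 1"] unfolding e(2) .
    ultimately have "0 < (norm2 N (orth_proj N E (unit_vec 1)))\<^sup>2" by linarith
    then show "0 < norm2 N (orth_proj N E (unit_vec 1))" by (metis less_le norm2_nonneg zero_less_power2)
  qed
  show ?thesis
    by (rule holds_except_mono[OF holds_except_conj[OF A Z]]) auto
qed

text \<open>The estimates are homogeneous in the norm of the projected vector, which cancels; hence
  validity for all \<open>n < N\<close>. Only the rate at \<open>n = N\<close> is reached, which has
  the right order once \<open>n\<close> is comparable to \<open>N\<close>.\<close>

theorem section_radius_lower_bound_large_p:
  fixes p \<alpha> \<beta> :: real
  assumes p: "2 < p" and \<alpha>: "0 < \<alpha>"
  shows "\<exists>C>0. \<forall>N n \<mu>. n < N \<longrightarrow> 2 \<le> N \<longrightarrow> normalized_haar N n \<mu> \<longrightarrow>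
    holds_except \<mu> (\<lambda>E. rate p \<alpha> \<beta> N N \<le> C * section_radius N (p_ellipsoid N p (sigma_seq \<alpha> \<beta>)) E)
      (exp (- p * real N powr (2 / p)))"
proof -
  have p1: "1 < p" using p by simp
  define B where "B = 96 * (2 * p + 6)"
  have B: "0 < B" using p by (simp add: B_def)
  obtain C where C: "C > 0" "\<And>N E x H. 1 \<le> N \<Longrightarrow> subspace E \<Longrightarrow> E \<subseteq> Rn N \<Longrightarrow> x \<in> E \<Longrightarrow> 0 < H \<Longrightarrow>
    (\<Sum>i\<in>{2..N}. \<bar>lk x i\<bar> powr p) \<le> H powr p \<Longrightarrow>
    norm2 N x \<le> C * (\<bar>lk x 1\<bar> + H / sigma_seq \<alpha> \<beta> N) * section_radius N (p_ellipsoid N p (sigma_seq \<alpha> \<beta>)) E"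
    using section_radius_ge_flat[OF p1 \<alpha>] by blast
  obtain D where D: "D > 0" "\<And>N J. 1 \<le> N \<Longrightarrow> 2 ^ J \<le> 2 * N \<Longrightarrow>
    (\<Sum>j<J. 2 ^ Suc j * (sqrt (B * (real (2 ^ j) powr (1 - 1 / p) * real N powr (1 / p) + real N powr (2 / p)) / real N) / sqrt (2 ^ j)) powr p)
      \<le> (D * real N powr (1 / p - 1 / 2)) powr p"
    using marginal_levels_sum[OF p B] by blast
  show ?thesis
  proof (intro exI[of _ "C * (2 * (1 + D))"] conjI allI impI)
    show "0 < C * (2 * (1 + D))" using C D by (simp add: add_pos_pos)
    fix N n \<mu> assume n: "n < N" and N: "2 \<le> N" and "normalized_haar N n \<mu>"
    then interpret haar N n \<mu> by unfold_locales
    let ?R = "section_radius N (p_ellipsoid N p (sigma_seq \<alpha> \<beta>))"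
    let ?w = "gelfand_width p \<alpha> \<beta> N"
    have N1: "1 \<le> N" using N by simp
    define J where "J = (LEAST J. N \<le> 2 ^ J)"
    have J1: "N \<le> 2 ^ J" unfolding J_def by (rule LeastI[of _ N]) (simp add: less_imp_le)
    have J2: "2 ^ J < 2 * N"
    proof (cases J)
      case 0
      then show ?thesis using N by simp
    next
      case (Suc k)
      have "\<not> N \<le> 2 ^ k" using not_less_Least[of k "\<lambda>J. N \<le> 2 ^ J"] Suc by (simp add: J_def)
      then show ?thesis using Suc by simp
    qed
    show "holds_except \<mu> (\<lambda>E. rate p \<alpha> \<beta> N N \<le> C * (2 * (1 + D)) * ?R E) (exp (- p * real N powr (2 / p)))"
    proof (rule holds_except_mono[OF marginal_events[OF p n N J2] _ order_refl])
      let ?\<tau> = "\<lambda>j. sqrt (96 * (2 * p + 6) * (real (2 ^ j) powr (1 - 1 / p) * real N powr (1 / p) + real N powr (2 / p)) / real N)"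
      fix E assume Es: "E \<in> space \<mu>" and ev: "(\<forall>j<J. \<forall>y\<in>Rn N. card (Poly_Mapping.keys y) \<le> 2 ^ j \<longrightarrow> lk y 1 = 0 \<longrightarrow>
        inner2 N (orth_proj N E (unit_vec 1)) y \<le> ?\<tau> j * norm2 N (orth_proj N E (unit_vec 1)) * norm2 N y) \<and>
        0 < norm2 N (orth_proj N E (unit_vec 1))"
      have E: "subspace E" "E \<subseteq> Rn N" using Es grassmannianD by (auto simp: space_haar)
      define x where "x = orth_proj N E (unit_vec 1)"
      have x: "x \<in> E" "x \<in> Rn N" using orth_proj_in[OF E] orth_proj_in_Rn[OF E] by (auto simp: x_def)
      have nx: "0 < norm2 N x" using ev by (simp add: x_def)
      have "(\<Sum>i\<in>{2..N}. \<bar>lk x i\<bar> powr p) \<le> (\<Sum>j<J. 2 ^ Suc j * (?\<tau> j * norm2 N x / sqrt (2 ^ j)) powr p)"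
        by (rule sum_powr_le_dyadic[OF _ x(2) J1]) (use p ev in \<open>auto simp: x_def\<close>)
      also have "\<dots> = (\<Sum>j<J. norm2 N x powr p * (2 ^ Suc j * (?\<tau> j / sqrt (2 ^ j)) powr p))"
      proof (rule sum.cong[OF refl])
        fix j
        have "?\<tau> j * norm2 N x / sqrt (2 ^ j) = norm2 N x * (?\<tau> j / sqrt (2 ^ j))" by simp
        then show "2 ^ Suc j * (?\<tau> j * norm2 N x / sqrt (2 ^ j)) powr p = norm2 N x powr p * (2 ^ Suc j * (?\<tau> j / sqrt (2 ^ j)) powr p)"
          by (simp only: powr_mult mult.left_commute)
      qed
      also have "\<dots> = norm2 N x powr p * (\<Sum>j<J. 2 ^ Suc j * (?\<tau> j / sqrt (2 ^ j)) powr p)"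
        by (simp only: sum_distrib_left)
      also have "\<dots> \<le> norm2 N x powr p * (D * real N powr (1 / p - 1 / 2)) powr p"
        using D(2)[OF N1 less_imp_le[OF J2]] unfolding B_def by (rule mult_left_mono) simp
      also have "\<dots> = (norm2 N x * (D * real N powr (1 / p - 1 / 2))) powr p" by (rule powr_mult[symmetric])
      finally have sum: "(\<Sum>i\<in>{2..N}. \<bar>lk x i\<bar> powr p) \<le> (norm2 N x * (D * real N powr (1 / p - 1 / 2))) powr p" .
      let ?H = "norm2 N x * (D * real N powr (1 / p - 1 / 2))"
      have H: "0 < ?H" using nx D N by simp
      have \<sigma>N: "0 < sigma_seq \<alpha> \<beta> N" using N1 by (rule sigma_seq_pos)
      have w: "0 < ?w" using N \<sigma>N by simp
      have R0: "0 \<le> ?R E" using p E by (intro section_radius_nonneg sigma_seq_pos) auto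
      let ?q = "sqrt (real N) / ?w"
      have Hq: "?H / sigma_seq \<alpha> \<beta> N = norm2 N x * (D * ?q)"
      proof -
        have "real N powr (1 / p - 1 / 2) = sqrt (real N) / real N powr (1 - 1 / p)"
        proof -
          have "sqrt (real N) / real N powr (1 - 1 / p) = real N powr (1 / 2 - (1 - 1 / p))"
            by (simp only: powr_diff powr_half_sqrt of_nat_0_le_iff)
          then show ?thesis by simp
        qed
        then show ?thesis by simp
      qed
      have "norm2 N x \<le> C * (\<bar>lk x 1\<bar> + ?H / sigma_seq \<alpha> \<beta> N) * ?R E"
        by (rule C(2)[OF N1 E x(1) H sum])
      also have "\<dots> \<le> C * (norm2 N x * ((1 + D) * (1 + ?q))) * ?R E"
      proof (intro mult_right_mono mult_left_mono R0)
        have "0 \<le> ?q" using w by simp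
        moreover have "(1 + D) * (1 + ?q) = 1 + D + ?q + D * ?q"
          by (simp only: distrib_left distrib_right mult_1_left mult_1_right add.assoc)
        ultimately have "1 + D * ?q \<le> (1 + D) * (1 + ?q)" using D(1) by linarith
        then have "norm2 N x * (1 + D * ?q) \<le> norm2 N x * ((1 + D) * (1 + ?q))" by (rule mult_left_mono) simp
        moreover have "\<bar>lk x 1\<bar> \<le> norm2 N x" using N by (intro abs_lookup_le_norm2) auto
        ultimately show "\<bar>lk x 1\<bar> + ?H / sigma_seq \<alpha> \<beta> N \<le> norm2 N x * ((1 + D) * (1 + ?q))"
          unfolding Hq by (simp add: distrib_left)
      qed (use C in simp)
      finally have "norm2 N x * 1 \<le> norm2 N x * (C * (1 + D) * (1 + ?q) * ?R E)" by (simp add: mult_ac)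
      then have one: "1 \<le> C * (1 + D) * (1 + ?q) * ?R E" using nx by (simp only: mult_le_cancel_left_pos)
      let ?r = "rate p \<alpha> \<beta> N N"
      have sn: "real N powr (- 1 / 2) = 1 / sqrt (real N)"
        using powr_minus_divide[of "real N" "1 / 2"] by (simp add: powr_half_sqrt)
      have r: "0 \<le> ?r" "?r \<le> 1" using w by (auto simp: rate_eq)
      have "?r \<le> 1 / sqrt (real N) * ?w" unfolding rate_eq sn by (rule min.cobounded2)
      then have r3: "?r \<le> ?w / sqrt (real N)" by simp
      have "?r * ?q \<le> ?w / sqrt (real N) * ?q"
        using w by (intro mult_right_mono r3) auto
      also have "\<dots> = 1" using \<sigma>N N by simp
      finally have r2: "?r * (1 + ?q) \<le> 2" using r(2) by (simp add: distrib_left)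
      have "?r * 1 \<le> ?r * (C * (1 + D) * (1 + ?q) * ?R E)"
        using one r(1) by (rule mult_left_mono)
      also have "\<dots> = C * (1 + D) * ?R E * (?r * (1 + ?q))" by (simp only: mult_ac)
      also have "\<dots> \<le> C * (1 + D) * ?R E * 2" using r2 C D R0 by (intro mult_left_mono) auto
      finally show "?r \<le> C * (2 * (1 + D)) * ?R E" by (simp only: mult_1_right mult_ac)
    qed
  qed
qed

text \<open>\<open>N - n\<close> basis vectors of \<open>E\<close> and \<open>n + 1\<close>
  coordinate vectors cannot be independent; the coordinate part of a linear relation is, up to sign,
  also its part in \<open>E\<close>.\<close>

lemma grassmannian_meets_coordinates:
  assumes E: "E \<in> grassmannian N n" and n: "n < N"
  obtains x where "x \<in> E" "x \<noteq> 0" "\<And>i. i \<notin> {1..Suc n} \<Longrightarrow> lk x i = 0"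
proof -
  let ?A = "unit_vec ` {1..Suc n}"
  note E' = grassmannianD(1,2)[OF E]
  obtain B F where B: "orthonormal N (B \<union> F)" "span B = E" "card B + n = N"
    using grassmannian_bases[OF E] by metis
  have oB: "orthonormal N B" using orthonormal_subset[OF B(1)] by auto
  have finB: "finite B" by (rule orthonormalD[OF oB])
  have AN: "{1..Suc n} \<subseteq> {1..N}" using n by auto
  have oA: "orthonormal N ?A" by (rule orthonormal_unit_vecs[OF AN])
  have suppA: "lk x i = 0" if "x \<in> span ?A" "i \<notin> {1..Suc n}" for x i
  proof -
    have "subspace {x :: fseq. lk x i = 0}"
      by (auto simp: subspace_def lookup_add)
    then have "span ?A \<subseteq> {x. lk x i = 0}"
      by (rule span_minimal[rotated]) (use that(2) in auto)
    then show ?thesis using that(1) by blast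
  qed
  show ?thesis
  proof (cases "B \<inter> ?A = {}")
    \<comment> \<open>A common element would be counted once in the union, but it is itself a vector
      of the required kind.\<close>
    case False
    then obtain b where b: "b \<in> B" "b \<in> ?A" by blast
    then have "b \<noteq> 0" using orthonormalD(3)[OF oB b(1) b(1)] by auto
    then show ?thesis
      using that[of b] b B(2) suppA[of b] span_base[of b B] span_base[of b ?A] by auto
  next
    case True
    have "card (B \<union> ?A) = card B + card ?A"
      using finB True by (intro card_Un_disjoint) auto
    also have "\<dots> = Suc N" using B(3) by (simp only: card_unit_vecs) simp
    finally have big: "card (B \<union> ?A) = Suc N" .
    have "B \<union> ?A \<subseteq> span (unit_vec ` {1..N})"
      unfolding span_unit_vecs using orthonormalD(2)[OF oB] orthonormalD(2)[OF oA] by blast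
    then have "dependent (B \<union> ?A)"
      using independent_span_bound[of "unit_vec ` {1..N}" "B \<union> ?A"] big by (auto simp: card_unit_vecs)
    then obtain u where u: "\<exists>v\<in>B \<union> ?A. u v \<noteq> 0" "(\<Sum>v\<in>B \<union> ?A. u v *\<^sub>R v) = 0"
      using dependent_finite[of "B \<union> ?A"] finB by auto
    define x where "x = (\<Sum>v\<in>?A. u v *\<^sub>R v)"
    have "(\<Sum>v\<in>B. u v *\<^sub>R v) + x = 0"
      using u(2) finB True unfolding x_def by (subst (asm) sum.union_disjoint) auto
    then have xB: "(\<Sum>v\<in>B. u v *\<^sub>R v) = - x" by (simp add: eq_neg_iff_add_eq_0)
    have "(\<Sum>v\<in>B. u v *\<^sub>R v) \<in> E"
      unfolding B(2)[symmetric] by (intro span_sum span_scale span_base)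
    then have xE: "x \<in> E" unfolding xB using subspace_neg[OF E'(1), of "- x"] by simp
    have xA: "x \<in> span ?A" unfolding x_def by (intro span_sum span_scale span_base)
    have "x \<noteq> 0"
    proof
      assume x0: "x = 0"
      have "u v = 0" if "v \<in> ?A" for v
        using orthonormal_inner2_sum[OF oA that, of u] x0 unfolding x_def by simp
      moreover have "u v = 0" if "v \<in> B" for v
        using orthonormal_inner2_sum[OF oB that, of u] x0 unfolding xB by simp
      ultimately show False using u(1) by blast
    qed
    then show ?thesis using that[OF xE] suppA[OF xA] by blast
  qed
qed

text \<open>Comparison of \<open>l_p\<close> and \<open>l_2\<close> norms on \<open>card I\<close>
  coordinates, termwise from Young's inequality for \<open>y powr (p/2)\<close>, where
  \<open>y\<close> is the square scaled to have mean at most one.\<close>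

lemma power_mean_le:
  fixes p :: real and x :: "nat \<Rightarrow> real"
  assumes p: "0 < p" "p \<le> 2" and I: "finite I" "I \<noteq> {}" and s: "0 < s" "(\<Sum>i\<in>I. (x i)\<^sup>2) \<le> s\<^sup>2"
  shows "(\<Sum>i\<in>I. \<bar>x i\<bar> powr p) \<le> (real (card I) powr (1 / p - 1 / 2) * s) powr p"
proof -
  let ?k = "real (card I)"
  have k: "0 < ?k" using I by (simp add: card_gt_0_iff)
  have bound: "\<bar>x i\<bar> powr p \<le> (s / sqrt ?k) powr p * (p / 2 * ((x i)\<^sup>2 * ?k / s\<^sup>2) + (1 - p / 2))" for i
  proof (cases "x i = 0")
    case True
    then show ?thesis using p s by simp
  next
    case False
    define y where "y = (x i)\<^sup>2 * ?k / s\<^sup>2"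
    have y: "0 < y" using False k s by (simp add: y_def)
    have "y powr (p / 2) * 1 powr (1 - p / 2) \<le> p / 2 * y + (1 - p / 2) * 1"
      using p y by (intro Youngs_inequality_0) auto
    then have Y: "y powr (p / 2) \<le> p / 2 * y + (1 - p / 2)" by simp
    have "\<bar>x i\<bar> = s / sqrt ?k * y powr (1 / 2)"
      using k s y by (simp add: powr_half_sqrt y_def real_sqrt_divide real_sqrt_mult)
    then have "\<bar>x i\<bar> powr p = (s / sqrt ?k) powr p * y powr (p / 2)"
      by (simp only: powr_mult powr_powr) simp
    also have "\<dots> \<le> (s / sqrt ?k) powr p * (p / 2 * y + (1 - p / 2))"
      by (rule mult_left_mono[OF Y]) simp
    finally show ?thesis by (simp only: y_def)
  qed
  have "(\<Sum>i\<in>I. \<bar>x i\<bar> powr p) \<le> (\<Sum>i\<in>I. (s / sqrt ?k) powr p * (p / 2 * ((x i)\<^sup>2 * ?k / s\<^sup>2) + (1 - p / 2)))"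
    by (intro sum_mono bound)
  also have "\<dots> = (s / sqrt ?k) powr p * (p / 2 * ((\<Sum>i\<in>I. (x i)\<^sup>2) * ?k / s\<^sup>2) + ?k * (1 - p / 2))"
    by (simp only: sum_distrib_left[symmetric] sum.distrib sum_distrib_right[symmetric] sum_divide_distrib[symmetric] sum_constant)
  also have "\<dots> \<le> (s / sqrt ?k) powr p * (p / 2 * ?k + ?k * (1 - p / 2))"
  proof (intro mult_left_mono add_right_mono)
    have "(\<Sum>i\<in>I. (x i)\<^sup>2) * ?k \<le> s\<^sup>2 * ?k" using s k by (intro mult_right_mono) auto
    then show "(\<Sum>i\<in>I. (x i)\<^sup>2) * ?k / s\<^sup>2 \<le> ?k" using s by (simp add: pos_divide_le_eq mult.commute)
  qed (use p in auto)
  also have "p / 2 * ?k + ?k * (1 - p / 2) = ?k powr (1 / p * p)"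
    using p k by (simp add: algebra_simps)
  also have "(s / sqrt ?k) powr p * ?k powr (1 / p * p) = (s * (?k powr (1 / p) / sqrt ?k)) powr p"
    by (simp only: powr_powr[symmetric] powr_mult[symmetric]) simp
  also have "?k powr (1 / p) / sqrt ?k = ?k powr (1 / p - 1 / 2)"
    by (simp only: powr_diff powr_half_sqrt of_nat_0_le_iff)
  finally show ?thesis by (simp only: mult.commute)
qed

theorem section_radius_lower_deterministic:
  fixes p \<alpha> \<beta> :: real
  assumes p: "1 < p" "p \<le> 2" and \<alpha>: "0 < \<alpha>"
  shows "\<exists>C>0. \<forall>N n E. 1 \<le> n \<longrightarrow> n < N \<longrightarrow> E \<in> grassmannian N n \<longrightarrow>
    real n powr (1 / 2 - 1 / p) * sigma_seq \<alpha> \<beta> n \<le> C * section_radius N (p_ellipsoid N p (sigma_seq \<alpha> \<beta>)) E"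
proof -
  obtain C1 where C1: "C1 > 0" "\<And>i N. 1 \<le> i \<Longrightarrow> i \<le> N \<Longrightarrow> sigma_seq \<alpha> \<beta> N \<le> C1 * sigma_seq \<alpha> \<beta> i"
    using sigma_seq_quasi_decreasing[OF \<alpha>] by blast
  \<comment> \<open>Applied to the neighbours \<open>n\<close> and \<open>n + 1\<close>, in order to
    replace the semiaxis at \<open>n + 1\<close> by the one at \<open>n\<close>;
    \<open>\<alpha> + 1\<close> is one admissible exponent above \<alpha>.\<close>
  obtain C2 where C2: "C2 > 0" "\<And>i N. 1 \<le> i \<Longrightarrow> i \<le> N \<Longrightarrow>
      sigma_seq \<alpha> \<beta> i \<le> C2 * sigma_seq \<alpha> \<beta> N * real N powr (\<alpha> + 1) * real i powr (- (\<alpha> + 1))"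
    using sigma_seq_growth[of \<alpha> "\<alpha> + 1" \<beta>, OF less_add_one] by blast
  define D where "D = C2 * 2 powr (\<alpha> + 1)"
  define G where "G = 2 powr (1 / p - 1 / 2)"
  have D: "0 < D" using C2 by (simp add: D_def)
  have G: "0 < G" by (simp add: G_def)
  show ?thesis
  proof (intro exI[of _ "G * D * C1"] conjI allI impI)
    show "0 < G * D * C1" using C1 D G by simp
    fix N n E assume n: "1 \<le> n" "n < N" and EG: "E \<in> grassmannian N n"
    let ?R = "section_radius N (p_ellipsoid N p (sigma_seq \<alpha> \<beta>)) E"
    let ?\<sigma> = "sigma_seq \<alpha> \<beta>"
    let ?k = "real (Suc n)"
    note E = grassmannianD(1,2)[OF EG]
    obtain x where x: "x \<in> E" "x \<noteq> 0" "\<And>i. i \<notin> {1..Suc n} \<Longrightarrow> lk x i = 0"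
      using grassmannian_meets_coordinates[OF EG n(2)] by blast
    have nx: "0 < norm2 N x" using norm2_pos[OF _ x(2)] x(1) E by auto
    have sub: "{1..Suc n} \<subseteq> {1..N}" using n by auto
    have sq: "(\<Sum>i\<in>{1..Suc n}. (lk x i)\<^sup>2) \<le> (norm2 N x)\<^sup>2"
      unfolding norm2_sq_sum using sub by (intro sum_mono2) auto
    have \<sigma>n: "0 < ?\<sigma> (Suc n)" "0 < ?\<sigma> n" using n by (auto intro!: sigma_seq_pos)
    let ?G = "C1 / ?\<sigma> (Suc n) * (?k powr (1 / p - 1 / 2) * norm2 N x)"
    have Gp: "0 < ?G" using C1 \<sigma>n nx by simp
    have "(\<Sum>i=1..N. (\<bar>lk x i\<bar> / ?\<sigma> i) powr p) = (\<Sum>i\<in>{1..Suc n}. (\<bar>lk x i\<bar> / ?\<sigma> i) powr p)"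
      using sub x(3) by (intro sum.mono_neutral_right) auto
    also have "\<dots> \<le> (\<Sum>i\<in>{1..Suc n}. (C1 / ?\<sigma> (Suc n)) powr p * \<bar>lk x i\<bar> powr p)"
    proof (rule sum_mono)
      fix i assume "i \<in> {1..Suc n}"
      then have i: "1 \<le> i" "i \<le> Suc n" by auto
      have "1 / ?\<sigma> i \<le> C1 / ?\<sigma> (Suc n)"
        using C1(2)[OF i] \<sigma>n sigma_seq_pos[OF i(1), of \<alpha> \<beta>] by (simp add: field_simps)
      then have "\<bar>lk x i\<bar> * (1 / ?\<sigma> i) \<le> \<bar>lk x i\<bar> * (C1 / ?\<sigma> (Suc n))" by (rule mult_left_mono) simp
      then have "(\<bar>lk x i\<bar> / ?\<sigma> i) powr p \<le> (C1 / ?\<sigma> (Suc n) * \<bar>lk x i\<bar>) powr p"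
        using p sigma_seq_pos[OF i(1), of \<alpha> \<beta>] by (intro powr_mono2) (auto simp: mult_ac)
      then show "(\<bar>lk x i\<bar> / ?\<sigma> i) powr p \<le> (C1 / ?\<sigma> (Suc n)) powr p * \<bar>lk x i\<bar> powr p"
        by (simp only: powr_mult)
    qed
    also have "\<dots> = (C1 / ?\<sigma> (Suc n)) powr p * (\<Sum>i\<in>{1..Suc n}. \<bar>lk x i\<bar> powr p)"
      by (simp only: sum_distrib_left)
    also have "\<dots> \<le> (C1 / ?\<sigma> (Suc n)) powr p * (real (card {1..Suc n}) powr (1 / p - 1 / 2) * norm2 N x) powr p"
      using p nx sq by (intro mult_left_mono power_mean_le) auto
    also have "\<dots> = (C1 / ?\<sigma> (Suc n) * (real (card {1..Suc n}) powr (1 / p - 1 / 2) * norm2 N x)) powr p"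
      by (rule powr_mult[symmetric])
    also have "real (card {1..Suc n}) = ?k" by simp
    finally have "norm2 N x \<le> ?G * ?R"
      using p Gp by (intro section_radius_ge[OF p(1) _ E x(1)] sigma_seq_pos) auto
    then have "norm2 N x * 1 \<le> norm2 N x * (C1 / ?\<sigma> (Suc n) * ?k powr (1 / p - 1 / 2) * ?R)" by (simp add: mult_ac)
    then have one: "1 \<le> C1 / ?\<sigma> (Suc n) * ?k powr (1 / p - 1 / 2) * ?R" using nx by (simp only: mult_le_cancel_left_pos)
    have "?\<sigma> n \<le> C2 * ?\<sigma> (Suc n) * ?k powr (\<alpha> + 1) * real n powr (- (\<alpha> + 1))"
      using n by (intro C2) auto
    also have "?k powr (\<alpha> + 1) \<le> (2 * real n) powr (\<alpha> + 1)" using n \<alpha> by (intro powr_mono2) auto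
    also have "C2 * ?\<sigma> (Suc n) * (2 * real n) powr (\<alpha> + 1) * real n powr (- (\<alpha> + 1)) =
        D * ?\<sigma> (Suc n) * (real n powr (\<alpha> + 1) * real n powr (- (\<alpha> + 1)))"
      by (simp add: D_def powr_mult)
    also have "real n powr (\<alpha> + 1) * real n powr (- (\<alpha> + 1)) = 1"
      using n by (simp add: powr_add[symmetric])
    finally have s1: "?\<sigma> n \<le> D * ?\<sigma> (Suc n)" using C2 \<sigma>n by (simp add: mult_left_mono mult_right_mono)
    have k1: "?k powr (1 / p - 1 / 2) \<le> G * real n powr (1 / p - 1 / 2)"
    proof -
      have "?k powr (1 / p - 1 / 2) \<le> (2 * real n) powr (1 / p - 1 / 2)"
        using n p by (intro powr_mono2) (auto simp: field_simps)
      then show ?thesis by (simp add: G_def powr_mult)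
    qed
    have R0: "0 \<le> ?R" using p E by (intro section_radius_nonneg sigma_seq_pos) auto
    have "real n powr (1 / 2 - 1 / p) * ?\<sigma> n * 1 \<le> real n powr (1 / 2 - 1 / p) * ?\<sigma> n * (C1 / ?\<sigma> (Suc n) * ?k powr (1 / p - 1 / 2) * ?R)"
      using one \<sigma>n by (intro mult_left_mono) auto
    also have "\<dots> = (?\<sigma> n / ?\<sigma> (Suc n)) * (real n powr (1 / 2 - 1 / p) * ?k powr (1 / p - 1 / 2)) * (C1 * ?R)"
      by (simp add: mult_ac)
    also have "\<dots> \<le> D * G * (C1 * ?R)"
    proof (intro mult_right_mono mult_mono)
      show "?\<sigma> n / ?\<sigma> (Suc n) \<le> D" using s1 \<sigma>n by (simp add: pos_divide_le_eq)
      have "real n powr (1 / 2 - 1 / p) * ?k powr (1 / p - 1 / 2) \<le> real n powr (1 / 2 - 1 / p) * (G * real n powr (1 / p - 1 / 2))"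
        by (rule mult_left_mono[OF k1]) simp
      also have "\<dots> = G * (real n powr (1 / 2 - 1 / p) * real n powr (1 / p - 1 / 2))" by (simp only: mult_ac)
      also have "real n powr (1 / 2 - 1 / p) * real n powr (1 / p - 1 / 2) = 1"
        using n by (simp add: powr_add[symmetric])
      finally show "real n powr (1 / 2 - 1 / p) * ?k powr (1 / p - 1 / 2) \<le> G" by simp
    qed (use D \<sigma>n C1 R0 in auto)
    finally show "real n powr (1 / 2 - 1 / p) * ?\<sigma> n \<le> G * D * C1 * ?R" by (simp add: mult_ac)
  qed
qed

text \<open>Turns \<open>n \<le> c * gelfand_width\<^sup>2\<close> into \<open>n\<close> at most a
  small multiple of \<open>N\<close>, where the flat test vector is available.\<close>

lemma gelfand_width_upper:
  fixes p \<alpha> \<beta> :: real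
  assumes p: "1 < p" and \<alpha>: "0 < \<alpha>" "1 / 2 - 1 / p < \<alpha>"
  shows "\<exists>C>0. \<forall>N\<ge>1. gelfand_width p \<alpha> \<beta> N \<le> C * real N powr (1 / 2)"
proof -
  define a where "a = max 0 (1 / 2 - 1 / p)"
  have a: "a < \<alpha>" "1 / 2 - 1 / p \<le> a" using \<alpha> by (auto simp: a_def)
  obtain C where C: "C > 0" "\<And>i. 1 \<le> i \<Longrightarrow> sigma_seq \<alpha> \<beta> i \<le> C * real i powr (- a)"
    using sigma_seq_upper[OF a(1)] by blast
  show ?thesis
  proof (intro exI[of _ C] conjI allI impI C(1))
    fix N :: nat assume N: "1 \<le> N"
    have "gelfand_width p \<alpha> \<beta> N \<le> real N powr (1 - 1 / p) * (C * real N powr (- a))"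
      by (intro mult_left_mono C N) auto
    also have "\<dots> = C * (real N powr (1 - 1 / p) * real N powr (- a))" by (simp only: mult_ac)
    also have "real N powr (1 - 1 / p) * real N powr (- a) = real N powr (1 - 1 / p - a)"
      by (simp add: powr_add[symmetric])
    also have "C * real N powr (1 - 1 / p - a) \<le> C * real N powr (1 / 2)"
      using a N C by (intro mult_left_mono powr_mono) auto
    finally show "gelfand_width p \<alpha> \<beta> N \<le> C * real N powr (1 / 2)" .
  qed
qed

text \<open>Up to \<open>4 * sparsity_divisor * n \<le> N\<close> the flat test vector applies.
  Beyond it, replacing \<open>n\<close> by \<open>N\<close> in the rate costs a constant factor
  only, so the bound at \<open>n = N\<close> suffices.\<close>

theorem section_radius_lower_bound_all:
  fixes p \<alpha> \<beta> :: real
  assumes p: "2 \<le> p" and \<alpha>: "0 < \<alpha>"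
  shows "\<exists>C>0. \<forall>N n \<mu>. 1 \<le> n \<longrightarrow> n < N \<longrightarrow> normalized_haar N n \<mu> \<longrightarrow>
    holds_except \<mu> (\<lambda>E. rate p \<alpha> \<beta> N n \<le> C * section_radius N (p_ellipsoid N p (sigma_seq \<alpha> \<beta>)) E)
      (max (2 * exp (- 2 * real n)) (exp (- p * real n powr (2 / p))))"
proof -
  have p1: "1 < p" using p by simp
  let ?M = "4 * real sparsity_divisor"
  have M: "1 \<le> ?M" by (simp add: sparsity_divisor_def)
  obtain C1 where C1: "C1 > 0" "\<And>N n \<mu>. 1 \<le> n \<Longrightarrow> ?M * real n \<le> real N \<Longrightarrow> normalized_haar N n \<mu> \<Longrightarrow>
    holds_except \<mu> (\<lambda>E. rate p \<alpha> \<beta> N n \<le> C1 * section_radius N (p_ellipsoid N p (sigma_seq \<alpha> \<beta>)) E) (2 * exp (- 2 * real n))"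
    using section_radius_lower_bound[OF p1 \<alpha>] by blast
  obtain C2 where C2: "C2 > 0" "\<And>N n \<mu>. 1 \<le> n \<Longrightarrow> n < N \<Longrightarrow> normalized_haar N n \<mu> \<Longrightarrow>
    holds_except \<mu> (\<lambda>E. rate p \<alpha> \<beta> N N \<le> C2 * section_radius N (p_ellipsoid N p (sigma_seq \<alpha> \<beta>)) E) (exp (- p * real n powr (2 / p)))"
  proof (cases "p = 2")
    case False
    then have p2: "2 < p" using p by simp
    obtain C where C: "C > 0" "\<And>N n \<mu>. n < N \<Longrightarrow> 2 \<le> N \<Longrightarrow> normalized_haar N n \<mu> \<Longrightarrow>
      holds_except \<mu> (\<lambda>E. rate p \<alpha> \<beta> N N \<le> C * section_radius N (p_ellipsoid N p (sigma_seq \<alpha> \<beta>)) E) (exp (- p * real N powr (2 / p)))"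
      using section_radius_lower_bound_large_p[OF p2 \<alpha>] by blast
    show ?thesis
    proof (rule that[OF C(1)])
      fix N n \<mu> assume n: "1 \<le> n" "n < N" and h: "normalized_haar N n \<mu>"
      interpret haar N n \<mu> using h by unfold_locales
      have N2: "2 \<le> N" using n by simp
      show "holds_except \<mu> (\<lambda>E. rate p \<alpha> \<beta> N N \<le> C * section_radius N (p_ellipsoid N p (sigma_seq \<alpha> \<beta>)) E) (exp (- p * real n powr (2 / p)))"
      proof (rule holds_except_mono[OF C(2)[OF n(2) N2 h]])
        have "real n powr (2 / p) \<le> real N powr (2 / p)" using n p by (intro powr_mono2) auto
        then have "p * real n powr (2 / p) \<le> p * real N powr (2 / p)" using p by (intro mult_left_mono) auto
        then show "exp (- p * real N powr (2 / p)) \<le> exp (- p * real n powr (2 / p))" by simp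
      qed auto
    qed
  next
    \<comment> \<open>At \<open>p = 2\<close> the deviation part of
      \<open>marginal_levels_sum\<close> would grow with the number of scales. Instead the
      deterministic bound gives the semiaxis at \<open>n\<close>, which dominates the one at
      \<open>N\<close> and with it \<open>rate p \<alpha> \<beta> N N\<close>.\<close>
    case True
    obtain C where C: "C > 0" "\<And>N n E. 1 \<le> n \<Longrightarrow> n < N \<Longrightarrow> E \<in> grassmannian N n \<Longrightarrow>
      real n powr (1 / 2 - 1 / p) * sigma_seq \<alpha> \<beta> n \<le> C * section_radius N (p_ellipsoid N p (sigma_seq \<alpha> \<beta>)) E"
      using section_radius_lower_deterministic[OF p1 _ \<alpha>] True by blast
    obtain D where D: "D > 0" "\<And>i N. 1 \<le> i \<Longrightarrow> i \<le> N \<Longrightarrow> sigma_seq \<alpha> \<beta> N \<le> D * sigma_seq \<alpha> \<beta> i"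
      using sigma_seq_quasi_decreasing[OF \<alpha>] by blast
    show ?thesis
    proof (rule that[of "D * C"])
      show "0 < D * C" using C D by simp
      fix N n \<mu> assume n: "1 \<le> n" "n < N" and h: "normalized_haar N n \<mu>"
      interpret haar N n \<mu> using h by unfold_locales
      have "rate p \<alpha> \<beta> N N \<le> D * C * section_radius N (p_ellipsoid N p (sigma_seq \<alpha> \<beta>)) E" if "E \<in> space \<mu>" for E
      proof -
        have "rate p \<alpha> \<beta> N N \<le> real N powr (- 1 / 2) * gelfand_width p \<alpha> \<beta> N"
          unfolding rate_eq by (rule min.cobounded2)
        also have "\<dots> = real N powr (- 1 / 2) * real N powr (1 / 2) * sigma_seq \<alpha> \<beta> N"
          unfolding True by simp
        also have "real N powr (- 1 / 2) * real N powr (1 / 2) = 1"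
          using n by (simp only: powr_add[symmetric]) simp
        also have "1 * sigma_seq \<alpha> \<beta> N \<le> D * sigma_seq \<alpha> \<beta> n" using D(2)[of n N] n by simp
        also have "\<dots> \<le> D * (C * section_radius N (p_ellipsoid N p (sigma_seq \<alpha> \<beta>)) E)"
          using C(2)[OF n, of E] that n D(1) unfolding True by (intro mult_left_mono) (auto simp: space_haar)
        finally show ?thesis by (simp only: mult.assoc)
      qed
      then show "holds_except \<mu> (\<lambda>E. rate p \<alpha> \<beta> N N \<le> D * C * section_radius N (p_ellipsoid N p (sigma_seq \<alpha> \<beta>)) E) (exp (- p * real n powr (2 / p)))"
        by (intro holds_exceptI[of "\<lambda>_. False"]) auto
    qed
  qed
  show ?thesis
  proof (intro exI[of _ "max C1 (sqrt ?M * C2)"] conjI allI impI)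
    show "0 < max C1 (sqrt ?M * C2)" using C1 by simp
    fix N n \<mu> assume n: "1 \<le> n" "n < N" and h: "normalized_haar N n \<mu>"
    interpret haar N n \<mu> using h by unfold_locales
    let ?R = "section_radius N (p_ellipsoid N p (sigma_seq \<alpha> \<beta>))"
    have R0: "0 \<le> ?R E" if "E \<in> space \<mu>" for E
      using that p1 grassmannianD(1) by (intro section_radius_nonneg sigma_seq_pos) (auto simp: space_haar)
    show "holds_except \<mu> (\<lambda>E. rate p \<alpha> \<beta> N n \<le> max C1 (sqrt ?M * C2) * ?R E)
      (max (2 * exp (- 2 * real n)) (exp (- p * real n powr (2 / p))))"
    proof (cases "?M * real n \<le> real N")
      case True
      show ?thesis
      proof (rule holds_except_mono[OF C1(2)[OF n(1) True h]])
        fix E assume "E \<in> space \<mu>" "rate p \<alpha> \<beta> N n \<le> C1 * ?R E"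
        then show "rate p \<alpha> \<beta> N n \<le> max C1 (sqrt ?M * C2) * ?R E"
          using mult_right_mono[OF max.cobounded1 R0, of E C1 "sqrt ?M * C2"] by linarith
      qed simp
    next
      case False
      show ?thesis
      proof (rule holds_except_mono[OF C2(2)[OF n h]])
        fix E assume E: "E \<in> space \<mu>" and le: "rate p \<alpha> \<beta> N N \<le> C2 * ?R E"
        have w: "0 < gelfand_width p \<alpha> \<beta> N" using n sigma_seq_pos[of N \<alpha> \<beta>] by simp
        have sn: "real k powr (- 1 / 2) = 1 / sqrt (real k)" for k
          using powr_minus_divide[of "real k" "1 / 2"] by (simp add: powr_half_sqrt)
        have "sqrt (real N) \<le> sqrt ?M * sqrt (real n)"
          unfolding real_sqrt_mult[symmetric] using False by simp
        then have "1 / sqrt (real n) \<le> sqrt ?M * (1 / sqrt (real N))"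
          using n by (simp add: field_simps)
        then have "1 / sqrt (real n) * gelfand_width p \<alpha> \<beta> N \<le> sqrt ?M * (1 / sqrt (real N)) * gelfand_width p \<alpha> \<beta> N"
          using w by (intro mult_right_mono) auto
        then have a: "real n powr (- 1 / 2) * gelfand_width p \<alpha> \<beta> N \<le> sqrt ?M * (real N powr (- 1 / 2) * gelfand_width p \<alpha> \<beta> N)"
          unfolding sn by (simp only: mult.assoc)
        have b: "1 \<le> sqrt ?M" using M by simp
        have "rate p \<alpha> \<beta> N n \<le> sqrt ?M * rate p \<alpha> \<beta> N N"
        proof (cases "1 \<le> real N powr (- 1 / 2) * gelfand_width p \<alpha> \<beta> N")
          case True
          then have r1: "rate p \<alpha> \<beta> N N = 1" unfolding rate_eq by (rule min_absorb1)
          have "rate p \<alpha> \<beta> N n \<le> 1" unfolding rate_eq by (rule min.cobounded1)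
          then show ?thesis unfolding r1 using b by linarith
        next
          case False
          then have r1: "rate p \<alpha> \<beta> N N = real N powr (- 1 / 2) * gelfand_width p \<alpha> \<beta> N"
            unfolding rate_eq by (intro min_absorb2) linarith
          have "rate p \<alpha> \<beta> N n \<le> real n powr (- 1 / 2) * gelfand_width p \<alpha> \<beta> N" unfolding rate_eq by (rule min.cobounded2)
          then show ?thesis unfolding r1 using a by linarith
        qed
        also have "\<dots> \<le> sqrt ?M * (C2 * ?R E)" using le b by (intro mult_left_mono) auto
        also have "\<dots> = sqrt ?M * C2 * ?R E" by (simp only: mult.assoc)
        also have "\<dots> \<le> max C1 (sqrt ?M * C2) * ?R E" by (rule mult_right_mono[OF max.cobounded2 R0[OF E]])
        finally show "rate p \<alpha> \<beta> N n \<le> max C1 (sqrt ?M * C2) * ?R E" .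
      qed simp
    qed
  qed
qed

section \<open>Assembly of the probability estimates\<close>

lemma (in haar) approx_measurable:
  assumes "1 < p"
  shows "{E \<in> space \<mu>. approx_by C (section_radius N (p_ellipsoid N p (sigma_seq \<alpha> \<beta>)) E) r} \<in> sets \<mu>"
    "{E \<in> space \<mu>. a \<le> C * section_radius N (p_ellipsoid N p (sigma_seq \<alpha> \<beta>)) E \<and>
      section_radius N (p_ellipsoid N p (sigma_seq \<alpha> \<beta>)) E \<le> r} \<in> sets \<mu>"
proof -
  have "section_radius N (p_ellipsoid N p (sigma_seq \<alpha> \<beta>)) \<in> borel_measurable (grassmann_borel N n)"
    using assms by (intro measurable_section_radius sigma_seq_pos) auto
  then have [measurable]: "section_radius N (p_ellipsoid N p (sigma_seq \<alpha> \<beta>)) \<in> borel_measurable \<mu>"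
    by (simp cong: measurable_cong_sets add: sets_haar)
  show "{E \<in> space \<mu>. approx_by C (section_radius N (p_ellipsoid N p (sigma_seq \<alpha> \<beta>)) E) r} \<in> sets \<mu>"
    unfolding approx_by_def by measurable
  show "{E \<in> space \<mu>. a \<le> C * section_radius N (p_ellipsoid N p (sigma_seq \<alpha> \<beta>)) E \<and>
      section_radius N (p_ellipsoid N p (sigma_seq \<alpha> \<beta>)) E \<le> r} \<in> sets \<mu>"
    by measurable
qed

lemma (in haar) approx_prob:
  assumes p: "1 < p" and C: "0 \<le> C1" "0 \<le> C2" "0 \<le> r"
    and up: "holds_except \<mu> (\<lambda>E. section_radius N (p_ellipsoid N p (sigma_seq \<alpha> \<beta>)) E \<le> C1 * r) b"
    and lo: "holds_except \<mu> (\<lambda>E. r \<le> C2 * section_radius N (p_ellipsoid N p (sigma_seq \<alpha> \<beta>)) E) c"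
    and d: "b + c \<le> d"
  shows "1 - d \<le> measure \<mu> {E \<in> space \<mu>. approx_by (max C1 C2) (section_radius N (p_ellipsoid N p (sigma_seq \<alpha> \<beta>)) E) r}"
proof (rule holds_except_prob[OF _ approx_measurable(1)[OF p]])
  show "holds_except \<mu> (\<lambda>E. approx_by (max C1 C2) (section_radius N (p_ellipsoid N p (sigma_seq \<alpha> \<beta>)) E) r) d"
  proof (rule holds_except_mono[OF holds_except_conj[OF up lo] _ d])
    let ?R = "section_radius N (p_ellipsoid N p (sigma_seq \<alpha> \<beta>))"
    fix E assume E: "E \<in> space \<mu>" and h: "?R E \<le> C1 * r \<and> r \<le> C2 * ?R E"
    have "0 \<le> ?R E"
      using E p grassmannianD(1) by (intro section_radius_nonneg sigma_seq_pos) (auto simp: space_haar)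
    then have "C2 * ?R E \<le> max C1 C2 * ?R E" "C1 * r \<le> max C1 C2 * r"
      using C by (auto intro: mult_right_mono)
    then show "approx_by (max C1 C2) (?R E) r" unfolding approx_by_def using h by linarith
  qed
qed

lemma rate_nonneg: "0 \<le> rate p \<alpha> \<beta> N n"
  by (simp add: rate_def)

text \<open>Lowering the rate from 2 to \<open>1/2\<close> absorbs the number of exceptional events;
  \<open>(3/2) ^ 3 > 3\<close> is enough.\<close>

lemma exp_budget:
  assumes "1 \<le> n"
  shows "3 * exp (- 2 * real n) \<le> exp (- (1 / 2) * real n)"
proof -
  have "(3 / 2) ^ 3 \<le> exp (1 / 2 :: real) ^ 3"
    using exp_ge_add_one_self[of "1 / 2 :: real"] by (intro power_mono) auto
  also have "\<dots> = exp (3 / 2)" using exp_of_nat_mult[of 3 "1 / 2 :: real"] by simp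
  also have "\<dots> \<le> exp (3 / 2 * real n)" using assms by simp
  finally have "3 * exp (- 2 * real n) \<le> exp (3 / 2 * real n) * exp (- 2 * real n)"
    by (intro mult_right_mono) (auto simp: power3_eq_cube)
  also have "\<dots> = exp (- (1 / 2) * real n)" unfolding exp_add[symmetric] by (simp add: algebra_simps)
  finally show ?thesis .
qed

lemma proposition_large_p:
  fixes p \<alpha> \<beta> :: real
  assumes p: "2 \<le> p" and \<alpha>: "0 < \<alpha>" "1 / 2 - 1 / p < \<alpha>" "\<alpha> < 1 - 1 / p"
  shows "\<exists>C>0. \<forall>N n \<mu>. 1 \<le> n \<longrightarrow> n < N \<longrightarrow> normalized_haar N n \<mu> \<longrightarrow>
    measure \<mu> {E \<in> space \<mu>. approx_by C (section_radius N (p_ellipsoid N p (sigma_seq \<alpha> \<beta>)) E) (rate p \<alpha> \<beta> N n)}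
      \<ge> 1 - exp (- (1 / 2) * real n) - 2 * exp (- (1 / 2) * p * real n powr (2 / p))"
proof -
  have p1: "1 < p" using p by simp
  obtain C1 where C1: "C1 > 0" "\<And>N n \<mu>. 1 \<le> n \<Longrightarrow> n < N \<Longrightarrow> normalized_haar N n \<mu> \<Longrightarrow>
    holds_except \<mu> (\<lambda>E. section_radius N (p_ellipsoid N p (sigma_seq \<alpha> \<beta>)) E \<le> C1 * rate p \<alpha> \<beta> N n) (exp (- 2 * real n))"
    using section_radius_upper_bound[OF p1 \<alpha>] by blast
  obtain C2 where C2: "C2 > 0" "\<And>N n \<mu>. 1 \<le> n \<Longrightarrow> n < N \<Longrightarrow> normalized_haar N n \<mu> \<Longrightarrow>
    holds_except \<mu> (\<lambda>E. rate p \<alpha> \<beta> N n \<le> C2 * section_radius N (p_ellipsoid N p (sigma_seq \<alpha> \<beta>)) E)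
      (max (2 * exp (- 2 * real n)) (exp (- p * real n powr (2 / p))))"
    using section_radius_lower_bound_all[OF p \<alpha>(1)] by blast
  show ?thesis
  proof (intro exI[of _ "max C1 C2"] conjI allI impI)
    show "0 < max C1 C2" using C1 by simp
    fix N n \<mu> assume n: "1 \<le> n" "n < N" and h: "normalized_haar N n \<mu>"
    interpret haar N n \<mu> using h by unfold_locales
    have "p * real n powr (2 / p) * (1 / 2) \<le> p * real n powr (2 / p) * 1" using p by (intro mult_left_mono) auto
    then have e: "exp (- p * real n powr (2 / p)) \<le> exp (- (1 / 2) * p * real n powr (2 / p))" by simp
    have pos: "0 < exp (- 2 * real n)" "0 < exp (- (1 / 2) * p * real n powr (2 / p))" by simp_all
    have "exp (- 2 * real n) + max (2 * exp (- 2 * real n)) (exp (- p * real n powr (2 / p))) \<le>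
      exp (- (1 / 2) * real n) + 2 * exp (- (1 / 2) * p * real n powr (2 / p))"
      using exp_budget[OF n(1)] e pos by linarith
    then show "measure \<mu> {E \<in> space \<mu>. approx_by (max C1 C2) (section_radius N (p_ellipsoid N p (sigma_seq \<alpha> \<beta>)) E) (rate p \<alpha> \<beta> N n)}
      \<ge> 1 - exp (- (1 / 2) * real n) - 2 * exp (- (1 / 2) * p * real n powr (2 / p))"
      using approx_prob[OF p1 _ _ rate_nonneg C1(2)[OF n h] C2(2)[OF n h]] C1(1) C2(1) by (simp add: diff_diff_eq)
  qed
qed

text \<open>Only the upper bound is random; the lower bound holds for every subspace of the
  Grassmannian.\<close>

lemma proposition_small_p_all:
  fixes p \<alpha> \<beta> :: real
  assumes p: "1 < p" "p < 2" and \<alpha>: "0 < \<alpha>" "1 / 2 - 1 / p < \<alpha>" "\<alpha> < 1 - 1 / p"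
  shows "\<exists>C>0. \<forall>N n \<mu>. 1 \<le> n \<longrightarrow> n < N \<longrightarrow> normalized_haar N n \<mu> \<longrightarrow>
    measure \<mu> {E \<in> space \<mu>.
        real n powr (1 / 2 - 1 / p - \<alpha>) * ln (real n + 1) powr (- \<beta>) \<le> C * section_radius N (p_ellipsoid N p (sigma_seq \<alpha> \<beta>)) E \<and>
        section_radius N (p_ellipsoid N p (sigma_seq \<alpha> \<beta>)) E \<le> C * rate p \<alpha> \<beta> N n}
      \<ge> 1 - 3 * exp (- (1 / 2) * real n)"
proof -
  obtain C1 where C1: "C1 > 0" "\<And>N n \<mu>. 1 \<le> n \<Longrightarrow> n < N \<Longrightarrow> normalized_haar N n \<mu> \<Longrightarrow>
    holds_except \<mu> (\<lambda>E. section_radius N (p_ellipsoid N p (sigma_seq \<alpha> \<beta>)) E \<le> C1 * rate p \<alpha> \<beta> N n) (exp (- 2 * real n))"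
    using section_radius_upper_bound[OF p(1) \<alpha>] by blast
  obtain C2 where C2: "C2 > 0" "\<And>N n E. 1 \<le> n \<Longrightarrow> n < N \<Longrightarrow> E \<in> grassmannian N n \<Longrightarrow>
    real n powr (1 / 2 - 1 / p) * sigma_seq \<alpha> \<beta> n \<le> C2 * section_radius N (p_ellipsoid N p (sigma_seq \<alpha> \<beta>)) E"
    using section_radius_lower_deterministic[OF p(1) less_imp_le[OF p(2)] \<alpha>(1)] by blast
  show ?thesis
  proof (intro exI[of _ "max C1 C2"] conjI allI impI)
    show "0 < max C1 C2" using C1 by simp
    fix N n \<mu> assume n: "1 \<le> n" "n < N" and h: "normalized_haar N n \<mu>"
    interpret haar N n \<mu> using h by unfold_locales
    let ?R = "section_radius N (p_ellipsoid N p (sigma_seq \<alpha> \<beta>))"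
    have eq: "real n powr (1 / 2 - 1 / p - \<alpha>) * ln (real n + 1) powr (- \<beta>) = real n powr (1 / 2 - 1 / p) * sigma_seq \<alpha> \<beta> n"
    proof -
      have "real n powr (1 / 2 - 1 / p - \<alpha>) = real n powr (1 / 2 - 1 / p) * real n powr (- \<alpha>)"
        by (simp only: powr_add[symmetric]) simp
      then show ?thesis by (simp add: sigma_seq_def)
    qed
    show "measure \<mu> {E \<in> space \<mu>.
        real n powr (1 / 2 - 1 / p - \<alpha>) * ln (real n + 1) powr (- \<beta>) \<le> max C1 C2 * ?R E \<and> ?R E \<le> max C1 C2 * rate p \<alpha> \<beta> N n}
      \<ge> 1 - 3 * exp (- (1 / 2) * real n)"
    proof (rule holds_except_prob[OF holds_except_mono[OF C1(2)[OF n h]] approx_measurable(2)[OF p(1)]])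
      fix E assume E: "E \<in> space \<mu>" and up: "?R E \<le> C1 * rate p \<alpha> \<beta> N n"
      have R0: "0 \<le> ?R E"
        using E p grassmannianD(1) by (intro section_radius_nonneg sigma_seq_pos) (auto simp: space_haar)
      have "real n powr (1 / 2 - 1 / p) * sigma_seq \<alpha> \<beta> n \<le> C2 * ?R E"
        using C2(2)[OF n] E by (simp add: space_haar)
      moreover have "C2 * ?R E \<le> max C1 C2 * ?R E" "C1 * rate p \<alpha> \<beta> N n \<le> max C1 C2 * rate p \<alpha> \<beta> N n"
        using R0 rate_nonneg by (auto intro: mult_right_mono)
      ultimately show "real n powr (1 / 2 - 1 / p - \<alpha>) * ln (real n + 1) powr (- \<beta>) \<le> max C1 C2 * ?R E \<and> ?R E \<le> max C1 C2 * rate p \<alpha> \<beta> N n"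
        unfolding eq using up by linarith
    next
      have "0 < exp (- (1 / 2) * real n)" "0 < exp (- 2 * real n)" by simp_all
      then show "exp (- 2 * real n) \<le> 3 * exp (- (1 / 2) * real n)"
        using exp_budget[OF n(1)] by linarith
    qed
  qed
qed

lemma proposition_small_n:
  fixes p \<alpha> \<beta> :: real
  assumes p: "1 < p" and \<alpha>: "0 < \<alpha>" "1 / 2 - 1 / p < \<alpha>" "\<alpha> < 1 - 1 / p"
  shows "\<exists>C>0. \<forall>N n \<mu>. 1 \<le> n \<longrightarrow> n < N \<longrightarrow> 4 * real sparsity_divisor * real n \<le> real N \<longrightarrow> normalized_haar N n \<mu> \<longrightarrow>
    measure \<mu> {E \<in> space \<mu>. approx_by C (section_radius N (p_ellipsoid N p (sigma_seq \<alpha> \<beta>)) E) (rate p \<alpha> \<beta> N n)}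
      \<ge> 1 - 3 * exp (- (1 / 2) * real n)"
proof -
  obtain C1 where C1: "C1 > 0" "\<And>N n \<mu>. 1 \<le> n \<Longrightarrow> n < N \<Longrightarrow> normalized_haar N n \<mu> \<Longrightarrow>
    holds_except \<mu> (\<lambda>E. section_radius N (p_ellipsoid N p (sigma_seq \<alpha> \<beta>)) E \<le> C1 * rate p \<alpha> \<beta> N n) (exp (- 2 * real n))"
    using section_radius_upper_bound[OF p \<alpha>] by blast
  obtain C2 where C2: "C2 > 0" "\<And>N n \<mu>. 1 \<le> n \<Longrightarrow> 4 * real sparsity_divisor * real n \<le> real N \<Longrightarrow> normalized_haar N n \<mu> \<Longrightarrow>
    holds_except \<mu> (\<lambda>E. rate p \<alpha> \<beta> N n \<le> C2 * section_radius N (p_ellipsoid N p (sigma_seq \<alpha> \<beta>)) E) (2 * exp (- 2 * real n))"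
    using section_radius_lower_bound[OF p \<alpha>(1)] by blast
  show ?thesis
  proof (intro exI[of _ "max C1 C2"] conjI allI impI)
    show "0 < max C1 C2" using C1 by simp
    fix N n \<mu> assume n: "1 \<le> n" "n < N" and Nn: "4 * real sparsity_divisor * real n \<le> real N" and h: "normalized_haar N n \<mu>"
    interpret haar N n \<mu> using h by unfold_locales
    have "0 < exp (- (1 / 2) * real n)" by simp
    then have "exp (- 2 * real n) + 2 * exp (- 2 * real n) \<le> 3 * exp (- (1 / 2) * real n)"
      using exp_budget[OF n(1)] by linarith
    then show "measure \<mu> {E \<in> space \<mu>. approx_by (max C1 C2) (section_radius N (p_ellipsoid N p (sigma_seq \<alpha> \<beta>)) E) (rate p \<alpha> \<beta> N n)}
      \<ge> 1 - 3 * exp (- (1 / 2) * real n)"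
      using approx_prob[OF p _ _ rate_nonneg C1(2)[OF n h] C2(2)[OF n(1) Nn h]] C1(1) C2(1) by simp
  qed
qed

text \<open>The upper bound \<open>R\<close> holds for every subspace, so the whole failure
  probability is that of the flat lower bound, at its original rate 2.\<close>

lemma proposition_constant_radius:
  fixes p \<alpha> \<beta> :: real
  assumes p: "1 < p" and \<alpha>: "0 < \<alpha>" "1 / 2 - 1 / p < \<alpha>" "\<alpha> < 1 - 1 / p"
  shows "\<exists>c>0. \<exists>C>0. \<forall>N n \<mu>. 1 \<le> n \<longrightarrow> n < N \<longrightarrow>
    real n \<le> c * real N powr (2 * (1 - 1 / p - \<alpha>)) * ln (real N + 1) powr (- 2 * \<beta>) \<longrightarrow> normalized_haar N n \<mu> \<longrightarrow>
    measure \<mu> {E \<in> space \<mu>. approx_by C (section_radius N (p_ellipsoid N p (sigma_seq \<alpha> \<beta>)) E) 1} \<ge> 1 - 2 * exp (- 2 * real n)"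
proof -
  let ?M = "4 * real sparsity_divisor"
  have M: "1 \<le> ?M" by (simp add: sparsity_divisor_def)
  obtain R where R: "R > 0" "\<And>N n E. E \<in> grassmannian N n \<Longrightarrow> section_radius N (p_ellipsoid N p (sigma_seq \<alpha> \<beta>)) E \<le> R"
    using section_radius_bounded[OF p \<alpha>] by blast
  obtain C2 where C2: "C2 > 0" "\<And>N n \<mu>. 1 \<le> n \<Longrightarrow> ?M * real n \<le> real N \<Longrightarrow> normalized_haar N n \<mu> \<Longrightarrow>
    holds_except \<mu> (\<lambda>E. rate p \<alpha> \<beta> N n \<le> C2 * section_radius N (p_ellipsoid N p (sigma_seq \<alpha> \<beta>)) E) (2 * exp (- 2 * real n))"
    using section_radius_lower_bound[OF p \<alpha>(1)] by blast
  obtain D where D: "D > 0" "\<And>N. 1 \<le> N \<Longrightarrow> gelfand_width p \<alpha> \<beta> N \<le> D * real N powr (1 / 2)"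
    using gelfand_width_upper[OF p \<alpha>(1,2)] by blast
  \<comment> \<open>\<open>c \<le> 1\<close> makes the rate equal to 1; the second entry, through
    \<open>gelfand_width_upper\<close>, makes \<open>n\<close> a small multiple of
    \<open>N\<close>.\<close>
  define c where "c = min 1 (1 / (?M * D\<^sup>2))"
  have c: "0 < c" "c \<le> 1" "c * (?M * D\<^sup>2) \<le> 1"
  proof -
    have MD: "0 < ?M * D\<^sup>2" using M D by simp
    then show "0 < c" unfolding c_def min_less_iff_conj zero_less_divide_1_iff by simp
    show "c \<le> 1" by (simp add: c_def)
    have "c \<le> 1 / (?M * D\<^sup>2)" by (simp only: c_def min.cobounded2)
    then show "c * (?M * D\<^sup>2) \<le> 1" by (simp only: pos_le_divide_eq[OF MD])
  qed
  show ?thesis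
  proof (rule exI[of _ c], rule conjI[OF c(1)], rule exI[of _ "max R C2"], intro conjI allI impI)
    show "0 < max R C2" using R by simp
    fix N n \<mu> assume n: "1 \<le> n" "n < N"
      and small: "real n \<le> c * real N powr (2 * (1 - 1 / p - \<alpha>)) * ln (real N + 1) powr (- 2 * \<beta>)"
      and h: "normalized_haar N n \<mu>"
    interpret haar N n \<mu> using h by unfold_locales
    have N: "1 \<le> N" using n by simp
    let ?w = "gelfand_width p \<alpha> \<beta> N"
    have w: "0 < ?w" using N sigma_seq_pos[OF N, of \<alpha> \<beta>] by simp
    have w2: "real N powr (2 * (1 - 1 / p - \<alpha>)) * ln (real N + 1) powr (- 2 * \<beta>) = ?w\<^sup>2"
    proof -
      have weq: "?w = real N powr (1 - 1 / p - \<alpha>) * ln (real N + 1) powr (- \<beta>)"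
      proof -
        have "real N powr (1 - 1 / p - \<alpha>) = real N powr (1 - 1 / p) * real N powr (- \<alpha>)"
          by (simp add: powr_add[symmetric])
        then show ?thesis by (simp add: sigma_seq_def)
      qed
      have "real N powr (2 * (1 - 1 / p - \<alpha>)) = (real N powr (1 - 1 / p - \<alpha>))\<^sup>2"
        by (simp only: power2_eq_square powr_add[symmetric] mult_2)
      moreover have "ln (real N + 1) powr (- 2 * \<beta>) = (ln (real N + 1) powr (- \<beta>))\<^sup>2"
        by (simp only: power2_eq_square powr_add[symmetric]) simp
      ultimately show ?thesis unfolding weq by (simp only: power_mult_distrib)
    qed
    have nw: "real n \<le> c * ?w\<^sup>2" using small unfolding w2[symmetric] by (simp only: mult.assoc)
    have "?w\<^sup>2 \<le> (D * real N powr (1 / 2))\<^sup>2" using D(2)[OF N] w by (intro power_mono) auto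
    also have "\<dots> = D\<^sup>2 * real N" by (simp add: power_mult_distrib powr_half_sqrt)
    finally have "c * ?w\<^sup>2 \<le> c * (D\<^sup>2 * real N)" using c by (intro mult_left_mono) auto
    then have "?M * real n \<le> ?M * (c * (D\<^sup>2 * real N))" using nw M by (intro mult_left_mono) auto
    also have "\<dots> = c * (?M * D\<^sup>2) * real N" by (simp only: mult_ac)
    also have "\<dots> \<le> 1 * real N" using c by (intro mult_right_mono) auto
    finally have Mn: "?M * real n \<le> real N" by simp
    have "c * ?w\<^sup>2 \<le> 1 * ?w\<^sup>2" using c by (intro mult_right_mono) auto
    then have "real n \<le> ?w\<^sup>2" using nw by linarith
    then have "sqrt (real n) \<le> ?w" using w by (intro real_le_lsqrt) auto
    then have "1 \<le> 1 / sqrt (real n) * ?w" using n by (simp add: field_simps)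
    moreover have "real n powr (- 1 / 2) = 1 / sqrt (real n)"
      using powr_minus_divide[of "real n" "1 / 2"] by (simp add: powr_half_sqrt)
    ultimately have r1: "rate p \<alpha> \<beta> N n = 1" unfolding rate_eq by (intro min_absorb1) simp
    have up: "holds_except \<mu> (\<lambda>E. section_radius N (p_ellipsoid N p (sigma_seq \<alpha> \<beta>)) E \<le> R * 1) 0"
      using R(2) by (intro holds_exceptI[of "\<lambda>_. False"]) (auto simp: space_haar)
    show "measure \<mu> {E \<in> space \<mu>. approx_by (max R C2) (section_radius N (p_ellipsoid N p (sigma_seq \<alpha> \<beta>)) E) 1} \<ge> 1 - 2 * exp (- 2 * real n)"
      using approx_prob[OF p _ _ _ up C2(2)[OF n(1) Mn h, unfolded r1]] R(1) C2(1) by simp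
  qed
qed

theorem proposition6p7:
  shows "\<exists>\<gamma>>0. \<forall>(p::real) (p'::real) (\<alpha>::real) (\<beta>::real).
    1 < p \<longrightarrow> 1 / p + 1 / p' = 1 \<longrightarrow> 0 < \<alpha> \<longrightarrow> 1 / 2 - 1 / p < \<alpha> \<longrightarrow> \<alpha> < 1 - 1 / p \<longrightarrow>
    (let R = (\<lambda>N. section_radius N (p_ellipsoid N p (sigma_seq \<alpha> \<beta>))) in
      (2 \<le> p \<longrightarrow>
        (\<exists>C>0. \<forall>N n \<mu>. 1 \<le> n \<longrightarrow> n < N \<longrightarrow> normalized_haar N n \<mu> \<longrightarrow>
          measure \<mu> {E \<in> space \<mu>. approx_by C (R N E) (rate p \<alpha> \<beta> N n)}
            \<ge> 1 - exp (- \<gamma> * real n) - 2 * exp (- \<gamma> * p * real n powr (2 / p)))) \<and>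
      (p < 2 \<longrightarrow>
        (\<exists>C>0. \<forall>N n \<mu>. 1 \<le> n \<longrightarrow> n < N \<longrightarrow> normalized_haar N n \<mu> \<longrightarrow>
          measure \<mu> {E \<in> space \<mu>.
              real n powr (1 / 2 - 1 / p - \<alpha>) * ln (real n + 1) powr (- \<beta>) \<le> C * R N E \<and>
              R N E \<le> C * rate p \<alpha> \<beta> N n}
            \<ge> 1 - 3 * exp (- \<gamma> * real n)) \<and>
        (\<exists>c>0. \<exists>C>0. \<forall>N n \<mu>. 1 \<le> n \<longrightarrow> n < N \<longrightarrow> real n \<le> c * real N powr (2 / p') \<longrightarrow>
          normalized_haar N n \<mu> \<longrightarrow>
          measure \<mu> {E \<in> space \<mu>. approx_by C (R N E) (rate p \<alpha> \<beta> N n)}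
            \<ge> 1 - 3 * exp (- \<gamma> * real n))) \<and>
      (\<exists>c>0. \<exists>C>0. \<forall>N n \<mu>. 1 \<le> n \<longrightarrow> n < N \<longrightarrow>
        real n \<le> c * real N powr (2 * (1 - 1 / p - \<alpha>)) * ln (real N + 1) powr (- 2 * \<beta>) \<longrightarrow>
        normalized_haar N n \<mu> \<longrightarrow>
        measure \<mu> {E \<in> space \<mu>. approx_by C (R N E) 1}
          \<ge> 1 - 2 * exp (- 2 * real n)))"
proof (rule exI[of _ "1 / 2"], intro conjI allI impI)
  \<comment> \<open>The value of \<gamma>, as left by \<open>exp_budget\<close>.\<close>
  show "0 < (1 / 2 :: real)" by simp
  fix p p' \<alpha> \<beta> :: real
  assume p: "1 < p" and pp: "1 / p + 1 / p' = 1" and \<alpha>: "0 < \<alpha>" "1 / 2 - 1 / p < \<alpha>" "\<alpha> < 1 - 1 / p"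
  have small: "\<exists>c>0. \<exists>C>0. \<forall>N n \<mu>. 1 \<le> n \<longrightarrow> n < N \<longrightarrow> real n \<le> c * real N powr (2 / p') \<longrightarrow>
      normalized_haar N n \<mu> \<longrightarrow>
      measure \<mu> {E \<in> space \<mu>. approx_by C (section_radius N (p_ellipsoid N p (sigma_seq \<alpha> \<beta>)) E) (rate p \<alpha> \<beta> N n)}
        \<ge> 1 - 3 * exp (- (1 / 2) * real n)" if p2: "p < 2"
  proof -
    let ?M = "4 * real sparsity_divisor"
    have M: "0 < ?M" by (simp add: sparsity_divisor_def)
    obtain C where C: "C > 0" "\<And>N n \<mu>. 1 \<le> n \<Longrightarrow> n < N \<Longrightarrow> ?M * real n \<le> real N \<Longrightarrow> normalized_haar N n \<mu> \<Longrightarrow>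
      measure \<mu> {E \<in> space \<mu>. approx_by C (section_radius N (p_ellipsoid N p (sigma_seq \<alpha> \<beta>)) E) (rate p \<alpha> \<beta> N n)}
        \<ge> 1 - 3 * exp (- (1 / 2) * real n)"
      using proposition_small_n[OF p \<alpha>] by blast
    \<comment> \<open>For \<open>p < 2\<close> one has \<open>2 / p' \<le> 1\<close>, so the
      prescribed range lies within \<open>n \<le> c * N\<close>, where
      \<open>proposition_small_n\<close> applies.\<close>
    have "1 / 2 \<le> 1 / p" using p p2 by (simp add: field_simps)
    then have "1 / p' \<le> 1 / 2" using pp by linarith
    then have pe: "2 / p' \<le> 1" by simp
    show ?thesis
    proof (rule exI[of _ "1 / ?M"], rule conjI, use M in simp, rule exI[of _ C], intro conjI allI impI)
      show "0 < C" by (rule C(1))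
      fix N n \<mu> assume n: "1 \<le> n" "n < N" and le: "real n \<le> 1 / ?M * real N powr (2 / p')"
        and h: "normalized_haar N n \<mu>"
      have "real N powr (2 / p') \<le> real N powr 1" using n pe by (intro powr_mono) auto
      then have "1 / ?M * real N powr (2 / p') \<le> 1 / ?M * real N" using M by (intro mult_left_mono) auto
      then have "real n \<le> real N / ?M" using le by simp
      then have Mn: "?M * real n \<le> real N" using M by (simp only: pos_le_divide_eq mult.commute)
      show "measure \<mu> {E \<in> space \<mu>. approx_by C (section_radius N (p_ellipsoid N p (sigma_seq \<alpha> \<beta>)) E) (rate p \<alpha> \<beta> N n)}
          \<ge> 1 - 3 * exp (- (1 / 2) * real n)" by (rule C(2)[OF n Mn h])
    qed
  qed
  show "let R = (\<lambda>N. section_radius N (p_ellipsoid N p (sigma_seq \<alpha> \<beta>))) in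
      (2 \<le> p \<longrightarrow>
        (\<exists>C>0. \<forall>N n \<mu>. 1 \<le> n \<longrightarrow> n < N \<longrightarrow> normalized_haar N n \<mu> \<longrightarrow>
          measure \<mu> {E \<in> space \<mu>. approx_by C (R N E) (rate p \<alpha> \<beta> N n)}
            \<ge> 1 - exp (- (1 / 2) * real n) - 2 * exp (- (1 / 2) * p * real n powr (2 / p)))) \<and>
      (p < 2 \<longrightarrow>
        (\<exists>C>0. \<forall>N n \<mu>. 1 \<le> n \<longrightarrow> n < N \<longrightarrow> normalized_haar N n \<mu> \<longrightarrow>
          measure \<mu> {E \<in> space \<mu>.
              real n powr (1 / 2 - 1 / p - \<alpha>) * ln (real n + 1) powr (- \<beta>) \<le> C * R N E \<and>
              R N E \<le> C * rate p \<alpha> \<beta> N n}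
            \<ge> 1 - 3 * exp (- (1 / 2) * real n)) \<and>
        (\<exists>c>0. \<exists>C>0. \<forall>N n \<mu>. 1 \<le> n \<longrightarrow> n < N \<longrightarrow> real n \<le> c * real N powr (2 / p') \<longrightarrow>
          normalized_haar N n \<mu> \<longrightarrow>
          measure \<mu> {E \<in> space \<mu>. approx_by C (R N E) (rate p \<alpha> \<beta> N n)}
            \<ge> 1 - 3 * exp (- (1 / 2) * real n))) \<and>
      (\<exists>c>0. \<exists>C>0. \<forall>N n \<mu>. 1 \<le> n \<longrightarrow> n < N \<longrightarrow>
        real n \<le> c * real N powr (2 * (1 - 1 / p - \<alpha>)) * ln (real N + 1) powr (- 2 * \<beta>) \<longrightarrow>
        normalized_haar N n \<mu> \<longrightarrow>
        measure \<mu> {E \<in> space \<mu>. approx_by C (R N E) 1}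
          \<ge> 1 - 2 * exp (- 2 * real n))"
    unfolding Let_def
    by (intro conjI impI proposition_large_p proposition_small_p_all proposition_constant_radius small p \<alpha>)
qed

end
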